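(* Let $\mathcal{C}$ be either the category $\mathcal{LRF}$ of labeled rooted forests or the category $\mathcal{LFG}$ of labeled Feynman graphs. Then, as $\mathfrak{n}_{\mathcal{C}}$-modules, $$\mathrm{H}_{ins}\simeq\mathrm{H}_{top\text{-}ins}\qquad\text{and}\qquad \mathrm{H}^*_{elim}\simeq\mathrm{H}^*_{top\text{-}elim}.$$
   Context: **Category $\mathcal{LRF}$.** Fix an infinite label set $S$. A labeled rooted tree is a finite tree $T$ with a distinguished root and an injection $V(T)\hookrightarrow S$; a labeled rooted forest is a finite set of labeled rooted trees with pairwise disjoint label sets. An admissible cut of a tree $T$ is a subset of $E(T)$ containing at most one edge on any path from a leaf to the root; removing the cut edges gives a forest $P_C(T)$ (the components not containing the root) and a tree $R_C(T)$ (the component containing the root). The empty cut $C_{null}$ (with $P=\emptyset$, $R=T$) and the formal full cut $C_{full}$ (with $P=T$, $R=\emptyset$) are admissible. A cut $C$ of a forest $F$ is a choice of cut of each tree, with $P_C(F)$, $R_C(F)$ the unions of the corresponding parts. Isomorphisms of forests are bijections of trees and of their vertices preserving roots and incidences (labels are ignored). Objects are labeled rooted forests and the empty forest $\emptyset$ (zero object); $\mathrm{Hom}(F_1,F_2)$ is the set of triples $(C_1,C_2,f)$ with $C_i$ an admissible cut of $F_i$ and $f:R_{C_1}(F_1)\cong P_{C_2}(F_2)$. A subobject of $F$ is $N=P_C(F)$ for an admissible cut $C$, with quotient $F/N=R_C(F)$; different cuts give different subobjects. **Category $\mathcal{LFG}$ ($\phi^3$ theory).** A graph has half-edges $H$ and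 vertices $V$; each half-edge is adjacent to exactly one vertex and at most one other half-edge. Half-edges not adjacent to another half-edge are external edges; pairs of adjacent half-edges are internal edges. A Feynman graph is a (possibly disconnected) graph in which each vertex has exactly three half-edges, and each connected component has 2 or 3 external edges and at least one loop. A labeled Feynman graph has its half-edges labeled bijectively by a set. Isomorphisms are bijections of vertices and half-edges preserving incidences (labels are ignored). A subgraph $\gamma\subset\Gamma$ is a Feynman graph with $V(\gamma)\subset V(\Gamma)$, $H(\gamma)\subset H(\Gamma)$, containing all half-edges at its vertices, with incidences inherited from $\Gamma$. For $\gamma$ connected, $\Gamma/\gamma$ is obtained as follows: if $\gamma$ has 3 external edges, replace $\gamma$ by a single new trivalent vertex to which the external half-edges of $\gamma$ are attached; if $\gamma$ has 2 external edges, delete all vertices and half-edges of $\gamma$ and join the half-edges to which its two external half-edges were joined. For general $\gamma$ take successive quotients by components. The quotient of a connected component by itself is empty; in particular $\Gamma/\Gamma=\emptyset$. Objects are labeled Feynman graphs and the empty graph $\emptyset$ (zero object); $\mathrm{Hom}(\Gamma_1,\Gamma_2)$ is the set of triples $(\gamma_1,\gamma_2,f)$ with $\gamma_i\subset\Gamma_i$ subgraphs (possibly $\emptyset$ or $\Gamma_i$) and $f:\Gamma_1/\gamma_1\cong\gamma_2$. Subobjects of $\Gamma$ are its subgraphs $\gamma$ (including $\emptyset$, $\Gamma$), with quotient $\Gamma/\gamma$. **Known facts on $\mathcal{C}$.** $\oplus$ denotes disjoint union. For $A\subset B$ there is an inclusion-preserving bijection between subobjects $S$ of $B$ containing $A$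 and subobjects $\overline S$ of $B/A$, with $(B/A)/\overline S\cong B/S$. An object is decomposable if it is of the form $A\oplus B$ with $A,B\ne\emptyset$, and indecomposable otherwise. **Hall algebra.** $\mathrm{Iso}(\mathcal{C})$ is the set of isomorphism classes. $\mathrm{H}_{\mathcal{C}}$ is the $\mathbb{Q}$-vector space of finitely supported functions $\mathrm{Iso}(\mathcal{C})\to\mathbb{Q}$, with basis of delta functions $\delta_A$, product $(f\times g)(M)=\sum_{N\subset M}f(N)g(M/N)$ (sum over subobjects of a representative of $M$) and coproduct $\Delta(f)(M,N)=f(M\oplus N)$. It is a cocommutative Hopf algebra, isomorphic to $U(\mathfrak{n}_{\mathcal{C}})$, where $\mathfrak{n}_{\mathcal{C}}$ is its Lie algebra of primitive elements, with basis the $X_A:=\delta_A$ for $A$ nonempty indecomposable. $\mathrm{H}^*_{\mathcal{C}}$ is the restricted dual, with basis $\{\phi_A\}$ dual to $\{\delta_A\}$. **Representations.** A right action of $\mathfrak{n}_{\mathcal{C}}$ is regarded as a left module structure via $X\cdot m:=-\,m\cdot X$ for $X\in\mathfrak{n}_{\mathcal{C}}$. For $X_A\in\mathfrak{n}_{\mathcal{C}}$ and $B\in\mathrm{Iso}(\mathcal{C})$ (with $N$ running over subobjects of a representative of $B$): - $\mathrm{H}_{ins}$ is $\mathrm{H}_{\mathcal{C}}$ with the left action $X_A\cdot\delta_B=\delta_A\times\delta_B$; - $\mathrm{H}_{top\text{-}ins}$ is $\mathrm{H}_{\mathcal{C}}$ with the right action $\delta_B\cdot X_A=\delta_B\times\delta_A$;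 - $\mathrm{H}^*_{elim}$ is $\mathrm{H}^*_{\mathcal{C}}$ with the left action $X_A\cdot\phi_B=-\sum_{N\subset B,\,N\simeq A}\phi_{B/N}$ (the dual of $\mathrm{H}_{ins}$); - $\mathrm{H}^*_{top\text{-}elim}$ is $\mathrm{H}^*_{\mathcal{C}}$ with the right action $\phi_B\cdot X_A=-\sum_{N\subset B,\,B/N\simeq A}\phi_N$ (the dual of $\mathrm{H}_{top\text{-}ins}$).
   Formalization: In LFG a subgraph may cut internal edges of Γ between its own vertices, and γ is a subobject only if each 2-legged component of γ is a whole component of Γ or has both legs joined to half-edges of Γ; otherwise Γ/γ is undefined or loop-free and the stated bijection of subobjects fails. *)

theory Defs
  imports Complex_Main "HOL-Library.FuncSet"
begin

section \<open>Hall algebras\<close>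

text \<open>
  The part of a category on which its Hall algebra and the modules below depend.  The set
  \<open>Subs B\<close> indexes the subobjects of \<open>B\<close> without repetition; the subobject with index \<open>N\<close> is
  \<open>sub B N\<close>, with quotient \<open>quot B N\<close>.  \<open>disj_union A B M\<close> says that \<open>M\<close> is the disjoint union
  of \<open>A\<close> and \<open>B\<close>, which must have disjoint sets of labels.
\<close>

record ('o, 'n) hall_data =
  Obj :: "'o set"
  iso :: "'o \<Rightarrow> 'o \<Rightarrow> bool"
  null :: "'o"
  disj_union :: "'o \<Rightarrow> 'o \<Rightarrow> 'o \<Rightarrow> bool"
  Subs :: "'o \<Rightarrow> 'n set"
  sub :: "'o \<Rightarrow> 'n \<Rightarrow> 'o"
  quot :: "'o \<Rightarrow> 'n \<Rightarrow> 'o"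

definition iso_class :: "('o, 'n) hall_data \<Rightarrow> 'o \<Rightarrow> 'o set" where
  "iso_class C A = {B \<in> Obj C. iso C A B}"

definition Iso :: "('o, 'n) hall_data \<Rightarrow> 'o set set" where
  "Iso C = iso_class C ` Obj C"

definition representative :: "'o set \<Rightarrow> 'o" where
  "representative M = (SOME A. A \<in> M)"

text \<open>
  The labels of the two summands can be made disjoint by passing to isomorphic objects,
  the label set being infinite.
\<close>

definition class_sum :: "('o, 'n) hall_data \<Rightarrow> 'o set \<Rightarrow> 'o set \<Rightarrow> 'o set" where
  "class_sum C M N = {L \<in> Obj C. \<exists>A\<in>M. \<exists>B\<in>N. \<exists>L'. disj_union C A B L' \<and> iso C L' L}"

definition supp :: "('o, 'n) hall_data \<Rightarrow> ('o set \<Rightarrow> rat) \<Rightarrow> 'o set set" where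
  "supp C f = {A \<in> Iso C. f A \<noteq> 0}"

definition Hall :: "('o, 'n) hall_data \<Rightarrow> ('o set \<Rightarrow> rat) set" where
  "Hall C = {f. finite {A. f A \<noteq> 0} \<and> {A. f A \<noteq> 0} \<subseteq> Iso C}"

definition delta :: "'o set \<Rightarrow> 'o set \<Rightarrow> rat" where
  "delta A = (\<lambda>B. if B = A then 1 else 0)"

definition hall_mult ::
    "('o, 'n) hall_data \<Rightarrow> ('o set \<Rightarrow> rat) \<Rightarrow> ('o set \<Rightarrow> rat) \<Rightarrow> 'o set \<Rightarrow> rat" where
  "hall_mult C f g = (\<lambda>M. if M \<in> Iso C
     then \<Sum>N \<in> Subs C (representative M).
            f (iso_class C (sub C (representative M) N)) *
            g (iso_class C (quot C (representative M) N))
     else 0)"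

definition hall_comult ::
    "('o, 'n) hall_data \<Rightarrow> ('o set \<Rightarrow> rat) \<Rightarrow> 'o set \<Rightarrow> 'o set \<Rightarrow> rat" where
  "hall_comult C f = (\<lambda>M N. f (class_sum C M N))"

text \<open>
  The Lie algebra of primitive elements, \<open>\<Delta> f = f \<otimes> 1 + 1 \<otimes> f\<close>, where the unit \<open>1\<close> is the delta
  function at the class of the zero object.
\<close>

definition prim :: "('o, 'n) hall_data \<Rightarrow> ('o set \<Rightarrow> rat) set" where
  "prim C = {f \<in> Hall C. \<forall>M \<in> Iso C. \<forall>N \<in> Iso C.
     hall_comult C f M N =
       f M * delta (iso_class C (null C)) N + delta (iso_class C (null C)) M * f N}"

definition dual_basis :: "('o, 'n) hall_data \<Rightarrow> 'o set \<Rightarrow> ('o set \<Rightarrow> rat) \<Rightarrow> rat" where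
  "dual_basis C A = (\<lambda>f. if f \<in> Hall C then f A else 0)"

definition Hall_dual :: "('o, 'n) hall_data \<Rightarrow> (('o set \<Rightarrow> rat) \<Rightarrow> rat) set" where
  "Hall_dual C = {(\<lambda>f. \<Sum>A\<in>S. c A * dual_basis C A f) | S c. finite S \<and> S \<subseteq> Iso C}"

text \<open>
  The coefficient of a functional \<open>\<phi>\<close> at \<open>dual_basis C A\<close> is \<open>\<phi> (delta A)\<close>.
\<close>

definition dual_supp :: "('o, 'n) hall_data \<Rightarrow> (('o set \<Rightarrow> rat) \<Rightarrow> rat) \<Rightarrow> 'o set set" where
  "dual_supp C \<phi> = {A \<in> Iso C. \<phi> (delta A) \<noteq> 0}"


section \<open>Insertion and elimination modules\<close>

text \<open>
  Each action is the bilinear extension of its values on the basis elements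
  \<open>X\<^sub>A = delta A\<close> and \<open>delta B\<close> (or \<open>dual_basis C B\<close>).  The right actions \<open>m \<cdot> X\<close> are turned into
  left actions by \<open>X \<cdot> m = - (m \<cdot> X)\<close>.
\<close>

definition ins ::
    "('o, 'n) hall_data \<Rightarrow> ('o set \<Rightarrow> rat) \<Rightarrow> ('o set \<Rightarrow> rat) \<Rightarrow> 'o set \<Rightarrow> rat" where
  "ins C X m = (\<lambda>M. \<Sum>A \<in> supp C X. \<Sum>B \<in> supp C m.
     X A * m B * hall_mult C (delta A) (delta B) M)"

definition top_ins_right ::
    "('o, 'n) hall_data \<Rightarrow> ('o set \<Rightarrow> rat) \<Rightarrow> ('o set \<Rightarrow> rat) \<Rightarrow> 'o set \<Rightarrow> rat" where
  "top_ins_right C m X = (\<lambda>M. \<Sum>A \<in> supp C X. \<Sum>B \<in> supp C m.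
     m B * X A * hall_mult C (delta B) (delta A) M)"

definition top_ins ::
    "('o, 'n) hall_data \<Rightarrow> ('o set \<Rightarrow> rat) \<Rightarrow> ('o set \<Rightarrow> rat) \<Rightarrow> 'o set \<Rightarrow> rat" where
  "top_ins C X m = (\<lambda>M. - top_ins_right C m X M)"

definition elim_basis ::
    "('o, 'n) hall_data \<Rightarrow> 'o set \<Rightarrow> 'o set \<Rightarrow> ('o set \<Rightarrow> rat) \<Rightarrow> rat" where
  "elim_basis C A B = (\<lambda>f. - (\<Sum>N \<in> {N \<in> Subs C (representative B).
       iso_class C (sub C (representative B) N) = A}.
     dual_basis C (iso_class C (quot C (representative B) N)) f))"

definition elim ::
    "('o, 'n) hall_data \<Rightarrow> ('o set \<Rightarrow> rat) \<Rightarrow> (('o set \<Rightarrow> rat) \<Rightarrow> rat) \<Rightarrow> ('o set \<Rightarrow> rat) \<Rightarrow> rat" where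
  "elim C X \<phi> = (\<lambda>f. \<Sum>A \<in> supp C X. \<Sum>B \<in> dual_supp C \<phi>.
     X A * \<phi> (delta B) * elim_basis C A B f)"

definition top_elim_right_basis ::
    "('o, 'n) hall_data \<Rightarrow> 'o set \<Rightarrow> 'o set \<Rightarrow> ('o set \<Rightarrow> rat) \<Rightarrow> rat" where
  "top_elim_right_basis C B A = (\<lambda>f. - (\<Sum>N \<in> {N \<in> Subs C (representative B).
       iso_class C (quot C (representative B) N) = A}.
     dual_basis C (iso_class C (sub C (representative B) N)) f))"

definition top_elim_right ::
    "('o, 'n) hall_data \<Rightarrow> (('o set \<Rightarrow> rat) \<Rightarrow> rat) \<Rightarrow> ('o set \<Rightarrow> rat) \<Rightarrow> ('o set \<Rightarrow> rat) \<Rightarrow> rat" where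
  "top_elim_right C \<phi> X = (\<lambda>f. \<Sum>A \<in> supp C X. \<Sum>B \<in> dual_supp C \<phi>.
     \<phi> (delta B) * X A * top_elim_right_basis C B A f)"

definition top_elim ::
    "('o, 'n) hall_data \<Rightarrow> ('o set \<Rightarrow> rat) \<Rightarrow> (('o set \<Rightarrow> rat) \<Rightarrow> rat) \<Rightarrow> ('o set \<Rightarrow> rat) \<Rightarrow> rat" where
  "top_elim C X \<phi> = (\<lambda>f. - top_elim_right C \<phi> X f)"

text \<open>
  Isomorphism of modules over a Lie algebra \<open>L\<close>, for \<open>V\<close> and \<open>W\<close> rational vector spaces of
  functions with pointwise operations.
\<close>

definition modules_isomorphic ::
    "'l set \<Rightarrow> ('x \<Rightarrow> rat) set \<Rightarrow> ('l \<Rightarrow> ('x \<Rightarrow> rat) \<Rightarrow> 'x \<Rightarrow> rat) \<Rightarrow>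
     ('y \<Rightarrow> rat) set \<Rightarrow> ('l \<Rightarrow> ('y \<Rightarrow> rat) \<Rightarrow> 'y \<Rightarrow> rat) \<Rightarrow> bool" where
  "modules_isomorphic L V act W act' \<longleftrightarrow> (\<exists>\<Phi>. bij_betw \<Phi> V W \<and>
     (\<forall>f\<in>V. \<forall>g\<in>V. \<Phi> (\<lambda>x. f x + g x) = (\<lambda>y. \<Phi> f y + \<Phi> g y)) \<and>
     (\<forall>c. \<forall>f\<in>V. \<Phi> (\<lambda>x. c * f x) = (\<lambda>y. c * \<Phi> f y)) \<and>
     (\<forall>X\<in>L. \<forall>m\<in>V. \<Phi> (act X m) = act' X (\<Phi> m)))"


section \<open>Labeled rooted forests\<close>

text \<open>
  The vertices of a tree are identified with their labels.  Edges are directed away from the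
  root, as pairs (parent, child).
\<close>

record 's rtree =
  tverts :: "'s set"
  troot :: 's
  tedges :: "('s \<times> 's) set"

definition rooted_tree :: "'s rtree \<Rightarrow> bool" where
  "rooted_tree T \<longleftrightarrow> finite (tverts T) \<and> troot T \<in> tverts T \<and>
     tedges T \<subseteq> tverts T \<times> tverts T \<and>
     (\<forall>u. (u, troot T) \<notin> tedges T) \<and>
     (\<forall>v \<in> tverts T - {troot T}. \<exists>!u. (u, v) \<in> tedges T) \<and>
     (\<forall>v \<in> tverts T. (troot T, v) \<in> (tedges T)\<^sup>*)"

definition rooted_forest :: "'s rtree set \<Rightarrow> bool" where
  "rooted_forest F \<longleftrightarrow> finite F \<and> (\<forall>T\<in>F. rooted_tree T) \<and>
     (\<forall>T\<in>F. \<forall>T'\<in>F. T \<noteq> T' \<longrightarrow> tverts T \<inter> tverts T' = {})"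

definition tree_iso :: "'s rtree \<Rightarrow> 's rtree \<Rightarrow> bool" where
  "tree_iso T T' \<longleftrightarrow> (\<exists>f. bij_betw f (tverts T) (tverts T') \<and> f (troot T) = troot T' \<and>
     (\<forall>u \<in> tverts T. \<forall>v \<in> tverts T. (u, v) \<in> tedges T \<longleftrightarrow> (f u, f v) \<in> tedges T'))"

definition forest_iso :: "'s rtree set \<Rightarrow> 's rtree set \<Rightarrow> bool" where
  "forest_iso F G \<longleftrightarrow> (\<exists>p. bij_betw p F G \<and> (\<forall>T\<in>F. tree_iso T (p T)))"

definition forest_disj_union :: "'s rtree set \<Rightarrow> 's rtree set \<Rightarrow> 's rtree set \<Rightarrow> bool" where
  "forest_disj_union F G M \<longleftrightarrow>
     (\<Union>T\<in>F. tverts T) \<inter> (\<Union>T\<in>G. tverts T) = {} \<and> M = F \<union> G"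

definition leaves :: "'s rtree \<Rightarrow> 's set" where
  "leaves T = {v \<in> tverts T. \<forall>w. (v, w) \<notin> tedges T}"

definition path_to_root :: "'s rtree \<Rightarrow> 's \<Rightarrow> ('s \<times> 's) set" where
  "path_to_root T l = {(u, v) \<in> tedges T. (v, l) \<in> (tedges T)\<^sup>*}"

datatype 's tree_cut = Edge_Cut "('s \<times> 's) set" | Full_Cut

definition admissible_cuts :: "'s rtree \<Rightarrow> 's tree_cut set" where
  "admissible_cuts T = insert Full_Cut
     {Edge_Cut K | K. K \<subseteq> tedges T \<and> (\<forall>l \<in> leaves T. card (K \<inter> path_to_root T l) \<le> 1)}"

text \<open>
  For \<open>v\<close> the root of \<open>T\<close> or the lower end of an edge in \<open>K\<close>, this is the connected component of
  \<open>v\<close> after the edges in \<open>K\<close> are removed, with \<open>v\<close> as root.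
\<close>

definition cut_component :: "'s rtree \<Rightarrow> ('s \<times> 's) set \<Rightarrow> 's \<Rightarrow> 's rtree" where
  "cut_component T K v =
     \<lparr>tverts = {w. (v, w) \<in> (tedges T - K)\<^sup>*}, troot = v,
      tedges = {(a, b) \<in> tedges T - K. (v, a) \<in> (tedges T - K)\<^sup>*}\<rparr>"

fun tree_P :: "'s rtree \<Rightarrow> 's tree_cut \<Rightarrow> 's rtree set" where
  "tree_P T (Edge_Cut K) = (\<lambda>(u, v). cut_component T K v) ` K"
| "tree_P T Full_Cut = {T}"

fun tree_R :: "'s rtree \<Rightarrow> 's tree_cut \<Rightarrow> 's rtree set" where
  "tree_R T (Edge_Cut K) = {cut_component T K (troot T)}"
| "tree_R T Full_Cut = {}"

type_synonym 's lrf_data = "('s rtree set, 's rtree \<Rightarrow> 's tree_cut) hall_data"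

definition LRF :: "'s lrf_data" where
  "LRF = \<lparr>Obj = {F. rooted_forest F}, iso = forest_iso, null = {},
     disj_union = forest_disj_union,
     Subs = (\<lambda>F. Pi\<^sub>E F admissible_cuts),
     sub = (\<lambda>F K. \<Union>T\<in>F. tree_P T (K T)),
     quot = (\<lambda>F K. \<Union>T\<in>F. tree_R T (K T))\<rparr>"


section \<open>Labeled Feynman graphs\<close>

text \<open>
  Half-edges are identified with their labels.  \<open>inc\<close> is the adjacency of half-edges to vertices,
  \<open>adj\<close> the symmetric adjacency between half-edges.
\<close>

record ('v, 'h) hgraph =
  verts :: "'v set"
  halves :: "'h set"
  inc :: "('h \<times> 'v) set"
  adj :: "('h \<times> 'h) set"

definition hgraph :: "('v, 'h) hgraph \<Rightarrow> bool" where
  "hgraph G \<longleftrightarrow> finite (verts G) \<and> finite (halves G) \<and>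
     inc G \<subseteq> halves G \<times> verts G \<and> (\<forall>h \<in> halves G. \<exists>!v. (h, v) \<in> inc G) \<and>
     adj G \<subseteq> halves G \<times> halves G \<and> sym (adj G) \<and> irrefl (adj G) \<and> single_valued (adj G)"

definition external :: "('v, 'h) hgraph \<Rightarrow> 'h set" where
  "external G = {h \<in> halves G. \<forall>h'. (h, h') \<notin> adj G}"

definition internal :: "('v, 'h) hgraph \<Rightarrow> 'h set set" where
  "internal G = {{h, h'} | h h'. (h, h') \<in> adj G}"

definition joined :: "('v, 'h) hgraph \<Rightarrow> ('v \<times> 'v) set" where
  "joined G = {(v, w). \<exists>h h'. (h, v) \<in> inc G \<and> (h, h') \<in> adj G \<and> (h', w) \<in> inc G}"

definition restrict_hgraph :: "('v, 'h) hgraph \<Rightarrow> 'v set \<Rightarrow> 'h set \<Rightarrow> ('v, 'h) hgraph" where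
  "restrict_hgraph G W H =
     \<lparr>verts = W, halves = H, inc = inc G \<inter> (H \<times> W), adj = adj G \<inter> (H \<times> H)\<rparr>"

definition component_of :: "('v, 'h) hgraph \<Rightarrow> 'v \<Rightarrow> ('v, 'h) hgraph" where
  "component_of G v = (let W = {w \<in> verts G. (v, w) \<in> (joined G)\<^sup>*}
     in restrict_hgraph G W {h. \<exists>w\<in>W. (h, w) \<in> inc G})"

definition components :: "('v, 'h) hgraph \<Rightarrow> ('v, 'h) hgraph set" where
  "components G = component_of G ` verts G"

text \<open>The number of loops of a connected graph, i.e. its first Betti number.\<close>

definition loop_number :: "('v, 'h) hgraph \<Rightarrow> int" where
  "loop_number K = int (card (internal K)) - int (card (verts K)) + 1"

text \<open>The empty graph satisfies this definition; it is the zero object.\<close>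

definition feynman :: "('v, 'h) hgraph \<Rightarrow> bool" where
  "feynman G \<longleftrightarrow> hgraph G \<and> (\<forall>v \<in> verts G. card {h. (h, v) \<in> inc G} = 3) \<and>
     (\<forall>K \<in> components G. card (external K) \<in> {2, 3} \<and> loop_number K \<ge> 1)"

definition feynman_iso :: "('v, 'h) hgraph \<Rightarrow> ('v, 'h) hgraph \<Rightarrow> bool" where
  "feynman_iso G G' \<longleftrightarrow> (\<exists>f g. bij_betw f (verts G) (verts G') \<and>
     bij_betw g (halves G) (halves G') \<and>
     (\<forall>h \<in> halves G. \<forall>v \<in> verts G. (h, v) \<in> inc G \<longleftrightarrow> (g h, f v) \<in> inc G') \<and>
     (\<forall>h \<in> halves G. \<forall>h' \<in> halves G. (h, h') \<in> adj G \<longleftrightarrow> (g h, g h') \<in> adj G'))"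

definition hgraph_disj_union ::
    "('v, 'h) hgraph \<Rightarrow> ('v, 'h) hgraph \<Rightarrow> ('v, 'h) hgraph \<Rightarrow> bool" where
  "hgraph_disj_union G G' M \<longleftrightarrow>
     verts G \<inter> verts G' = {} \<and> halves G \<inter> halves G' = {} \<and>
     M = \<lparr>verts = verts G \<union> verts G', halves = halves G \<union> halves G',
          inc = inc G \<union> inc G', adj = adj G \<union> adj G'\<rparr>"

text \<open>
  The incidences of a subgraph are among those of the ambient graph, but an internal edge of the
  ambient graph between two vertices of the subgraph may be cut into two external edges of the
  subgraph: as for the Connes--Kreimer coproduct, distinct components of a subgraph may be joined
  by an edge of the ambient graph.
\<close>

definition subgraph :: "('v, 'h) hgraph \<Rightarrow> ('v, 'h) hgraph \<Rightarrow> bool" where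
  "subgraph S G \<longleftrightarrow> feynman S \<and> verts S \<subseteq> verts G \<and> halves S \<subseteq> halves G \<and>
     inc S \<subseteq> inc G \<and> adj S \<subseteq> adj G \<and>
     (\<forall>h v. (h, v) \<in> inc G \<and> v \<in> verts S \<longrightarrow> (h, v) \<in> inc S)"

text \<open>
  Removing a component with two external edges, other than a whole component of \<open>G\<close>, means
  joining the two half-edges of \<open>G\<close> to which these are joined.  The quotient is defined only if
  both exist.
\<close>

definition quotient_defined :: "('v, 'h) hgraph \<Rightarrow> ('v, 'h) hgraph \<Rightarrow> bool" where
  "quotient_defined G S \<longleftrightarrow> (\<forall>K \<in> components S. card (external K) = 2 \<longrightarrow>
     K \<in> components G \<or> external K \<inter> external G = {})"

text \<open>
  The quotient by a connected \<open>K\<close>.  When \<open>K\<close> is contracted, the new vertex takes over the name of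
  one of the vertices of \<open>K\<close>, all of which are removed.
\<close>

definition quotient_conn :: "('v, 'h) hgraph \<Rightarrow> ('v, 'h) hgraph \<Rightarrow> ('v, 'h) hgraph" where
  "quotient_conn K G =
    (let W = verts G - verts K; H = halves G - halves K in
     if K \<in> components G then restrict_hgraph G W H
     else if card (external K) = 3 then
       (let n = (SOME v. v \<in> verts K); H' = H \<union> external K in
        \<lparr>verts = insert n W, halves = H',
         inc = inc G \<inter> (H \<times> W) \<union> external K \<times> {n},
         adj = adj G \<inter> (H' \<times> H')\<rparr>)
     else
       \<lparr>verts = W, halves = H, inc = inc G \<inter> (H \<times> W),
        adj = adj G \<inter> (H \<times> H) \<union>
          {(a, b) \<in> H \<times> H. \<exists>x y. external K = {x, y} \<and> x \<noteq> y \<and>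
             (a, x) \<in> adj G \<and> (b, y) \<in> adj G}\<rparr>)"

text \<open>Successive quotients by the components; their order does not matter.\<close>

definition hgraph_quotient :: "('v, 'h) hgraph \<Rightarrow> ('v, 'h) hgraph \<Rightarrow> ('v, 'h) hgraph" where
  "hgraph_quotient G S =
     fold quotient_conn (SOME Ks. distinct Ks \<and> set Ks = components S) G"

type_synonym ('v, 'h) lfg_data = "(('v, 'h) hgraph, ('v, 'h) hgraph) hall_data"

definition LFG :: "('v, 'h) lfg_data" where
  "LFG = \<lparr>Obj = {G. feynman G}, iso = feynman_iso,
     null = \<lparr>verts = {}, halves = {}, inc = {}, adj = {}\<rparr>,
     disj_union = hgraph_disj_union,
     Subs = (\<lambda>G. {S. subgraph S G \<and> quotient_defined G S}),
     sub = (\<lambda>G S. S),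
     quot = hgraph_quotient\<rparr>"

end

theory Submission
  imports Defs
begin

text \<open>
  Disjoint union and the subobject coproduct \<open>B \<mapsto> \<Sum>N\<subseteq>B. N \<otimes> B/N\<close> make the span of the isomorphism
  classes into a graded commutative Hopf algebra.  The Hall product is the convolution of functionals
  on it, and the primitive elements are the functionals that vanish on products.  The transpose of its
  antipode is an involution of the Hall algebra that reverses products and is \<open>-1\<close> on primitive
  elements, hence carries left multiplication by \<open>X\<close> to the negative of right multiplication by
  \<open>X\<close>.  The transpose of this involution intertwines the two dual modules.

  The coproduct is coassociative because flags of subobjects \<open>A \<subseteq> B\<close> correspond to subobjects of
  quotients.  For forests this is visible on down-closed sets of vertices.  Contracting a Feynman
  graph removes vertices, so graphs are embedded in a larger class of graphs, with vertices of
  valence two or three, in which a quotient merely forgets half-edges and merges vertices: there the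
  flags of subobjects match on the nose, and the Feynman quotient is recovered by smoothing the
  bivalent vertices.
\<close>

section \<open>The antipode of a commutative incidence bialgebra\<close>

text \<open>What is needed is one bijection that works for all primitive \<open>X\<close> at once.
  Commutativity of \<open>\<oplus>\<close> makes the antipode an involution, so no inverse has to be
  constructed; its sign on primitives is exactly the sign that turns a right action into a left one.
  The delicate point is finiteness, since functions must keep finite support. Hence two measures.
  \<open>sz\<close> drops strictly for proper subobjects and nontrivial quotients and drives all
  recursions. \<open>w\<close> does not increase in total when an object is merged from sub and
  quotient, is additive on sums, and bounds finitely many classes; it confines the support of the
  transposed antipode. For graphs these must be different numbers. A subgraph may keep every
  half-edge and only cut edges, so half-edges cannot serve as \<open>sz\<close>; smoothing after the
  removal of a two-leg component loses adjacencies that neither subgraph nor quotient accounts for,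
  so adjacencies cannot serve as \<open>w\<close>. The second obstacle is that smoothing destroys
  strict equality of iterated quotients. It is therefore postponed: flags are compared before
  smoothing, and smoothing is shown not to alter the family of subobjects.\<close>

locale incidence_bialgebra =
  fixes I :: "'i set" and z :: 'i and p :: "'i \<Rightarrow> 'i \<Rightarrow> 'i" (infixl "\<oplus>" 65)
    and J :: "'i \<Rightarrow> 'n set" and l r :: "'i \<Rightarrow> 'n \<Rightarrow> 'i"
    and sz w :: "'i \<Rightarrow> nat"
  assumes finite_J: "B \<in> I \<Longrightarrow> finite (J B)"
    and l_in: "B \<in> I \<Longrightarrow> n \<in> J B \<Longrightarrow> l B n \<in> I"
    and r_in: "B \<in> I \<Longrightarrow> n \<in> J B \<Longrightarrow> r B n \<in> I"
    and z_in: "z \<in> I"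
    and p_in: "A \<in> I \<Longrightarrow> B \<in> I \<Longrightarrow> A \<oplus> B \<in> I"
    and p_comm: "A \<in> I \<Longrightarrow> B \<in> I \<Longrightarrow> A \<oplus> B = B \<oplus> A"
    and p_assoc: "A \<in> I \<Longrightarrow> B \<in> I \<Longrightarrow> D \<in> I \<Longrightarrow> (A \<oplus> B) \<oplus> D = A \<oplus> (B \<oplus> D)"
    and p_zero: "A \<in> I \<Longrightarrow> A \<oplus> z = A"
    and p_eq_zero: "A \<in> I \<Longrightarrow> B \<in> I \<Longrightarrow> A \<oplus> B = z \<Longrightarrow> A = z"
    and coassoc: "B \<in> I \<Longrightarrow>
      (\<Sum>n\<in>J B. \<Sum>k\<in>J (l B n). F (l (l B n) k) (r (l B n) k) (r B n)) =
      (\<Sum>n\<in>J B. \<Sum>k\<in>J (r B n). (F (l B n) (l (r B n) k) (r (r B n) k) :: rat))"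
    and counit_l: "B \<in> I \<Longrightarrow> (\<Sum>n\<in>J B. if l B n = z then G (r B n) else 0) = (G B :: rat)"
    and counit_r: "B \<in> I \<Longrightarrow> (\<Sum>n\<in>J B. if r B n = z then G (l B n) else 0) = (G B :: rat)"
    and comult_sum: "A \<in> I \<Longrightarrow> B \<in> I \<Longrightarrow>
      (\<Sum>n\<in>J (A \<oplus> B). K (l (A \<oplus> B) n) (r (A \<oplus> B) n)) =
      (\<Sum>n\<in>J A. \<Sum>k\<in>J B. (K (l A n \<oplus> l B k) (r A n \<oplus> r B k) :: rat))"
    and sz_zero: "sz z = 0"
    and sz_l: "B \<in> I \<Longrightarrow> n \<in> J B \<Longrightarrow> r B n \<noteq> z \<Longrightarrow> sz (l B n) < sz B"
    and sz_r: "B \<in> I \<Longrightarrow> n \<in> J B \<Longrightarrow> l B n \<noteq> z \<Longrightarrow> sz (r B n) < sz B"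
    and w_sub: "B \<in> I \<Longrightarrow> n \<in> J B \<Longrightarrow> w B \<le> w (l B n) + w (r B n)"
    and w_sum: "A \<in> I \<Longrightarrow> B \<in> I \<Longrightarrow> w (A \<oplus> B) = w A + w B"
    and w_finite: "finite {B \<in> I. w B \<le> k}"
begin

definition eps :: "'i \<Rightarrow> rat" where "eps B = (if B = z then 1 else 0)"

text \<open>Product dual to the coproduct given by \<open>l\<close> and \<open>r\<close>; in the
  Hall instance it agrees with the Hall product on \<open>Iso C\<close>.\<close>

definition conv :: "('i \<Rightarrow> rat) \<Rightarrow> ('i \<Rightarrow> rat) \<Rightarrow> 'i \<Rightarrow> rat" where
  "conv f g B = (\<Sum>n\<in>J B. f (l B n) * g (r B n))"

lemma p_zero_left: "A \<in> I \<Longrightarrow> z \<oplus> A = A"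
  using p_comm p_zero z_in by metis

lemma p_eq_zero_iff: "A \<in> I \<Longrightarrow> B \<in> I \<Longrightarrow> A \<oplus> B = z \<longleftrightarrow> A = z \<and> B = z"
  using p_eq_zero p_comm p_zero z_in by metis

lemma sum_counit_unique:
  assumes "finite S" "(\<Sum>n\<in>S. if P n then 1 else 0) = (1 :: rat)"
  shows "\<exists>!n. n \<in> S \<and> P n"
proof -
  have "(\<Sum>n\<in>S. if P n then 1 else 0 :: rat) = of_nat (card {n \<in> S. P n})"
    using assms(1) by (simp add: sum.inter_filter[symmetric])
  hence "card {n \<in> S. P n} = 1" using assms(2) by simp
  then obtain m where "{n \<in> S. P n} = {m}" by (auto simp: card_1_singleton_iff)
  thus ?thesis by (metis (mono_tags, lifting) mem_Collect_eq singletonD singletonI)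
qed

text \<open>The right counit law for the constant function 1 shows that exactly one index has zero
  right part; the same law for the indicator of \<open>B\<close> shows that some such index has left
  part \<open>B\<close>.\<close>

lemma zero_l:
  assumes B: "B \<in> I" and n: "n \<in> J B" and "r B n = z"
  shows "l B n = B"
proof -
  have "\<exists>!n. n \<in> J B \<and> r B n = z"
    using counit_r[OF B, of "\<lambda>_. 1"] by (intro sum_counit_unique finite_J B)
  hence "{n \<in> J B. r B n = z} = {n}" using n assms(3) by auto
  hence eq: "k = n" if "k \<in> J B" "r B k = z" for k using that by blast
  have "(1::rat) = (\<Sum>k\<in>J B. if r B k = z then (if l B k = B then 1 else 0) else 0)"
    using counit_r[OF B, of "\<lambda>x. if x = B then 1 else 0"] by simp
  then obtain k where "k \<in> J B" "r B k = z" "l B k = B"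
    by (smt (verit, best) sum.neutral zero_neq_one)
  thus ?thesis using eq by blast
qed

lemma zero_zero: "B \<in> I \<Longrightarrow> n \<in> J B \<Longrightarrow> l B n = z \<Longrightarrow> r B n = z \<Longrightarrow> B = z"
  using zero_l by metis

lemma eps_sum: "A \<in> I \<Longrightarrow> B \<in> I \<Longrightarrow> eps (A \<oplus> B) = eps A * eps B"
  by (auto simp: eps_def p_eq_zero_iff)

lemma r_zero: "n \<in> J z \<Longrightarrow> r z n = z"
  using sz_l[OF z_in] sz_zero by fastforce

lemma l_zero: "n \<in> J z \<Longrightarrow> l z n = z"
  using sz_r[OF z_in] sz_zero by fastforce

text \<open>The zero class is group-like: since \<open>sz z = 0\<close> nothing can be smaller, so
  both parts of every index are \<open>z\<close>, and the counit law leaves a single index.\<close>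

lemma sum_J_zero: "(\<Sum>n\<in>J z. K (l z n) (r z n)) = (K z z :: rat)"
  using counit_l[OF z_in, of "K z"] by (simp add: r_zero l_zero cong: sum.cong)

lemma conv_eps_left: "B \<in> I \<Longrightarrow> conv eps g B = g B"
proof -
  assume B: "B \<in> I"
  have "conv eps g B = (\<Sum>n\<in>J B. if l B n = z then g (r B n) else 0)"
    unfolding conv_def eps_def by (intro sum.cong) auto
  thus ?thesis using counit_l[OF B] by simp
qed

text \<open>
  The transpose of the antipode of the commutative bialgebra with basis \<^term>\<open>I\<close>, product
  \<^term>\<open>(\<oplus>)\<close> and coproduct \<open>B \<mapsto> \<Sum>n. l B n \<otimes> r B n\<close>, a linear combination of basis elements
  being regarded as a functional on \<^typ>\<open>'i \<Rightarrow> rat\<close>.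
\<close>

function antipode :: "('i \<Rightarrow> rat) \<Rightarrow> 'i \<Rightarrow> rat" where
  "antipode f B = (if B \<notin> I then 0 else if B = z then f z else
     - (\<Sum>n\<in>{n \<in> J B. r B n \<noteq> z}. antipode (\<lambda>a. f (a \<oplus> r B n)) (l B n)))"
  by pat_completeness auto
termination by (relation "measure (\<lambda>(f, B). sz B)") (auto simp: sz_l)

declare antipode.simps [simp del]

lemma antipode_outside: "B \<notin> I \<Longrightarrow> antipode f B = 0"
  by (simp add: antipode.simps)

lemma antipode_zero: "antipode f z = f z"
  using z_in by (simp add: antipode.simps)

lemma antipode_rec:
  assumes "B \<in> I" "B \<noteq> z"
  shows "antipode f B = - (\<Sum>n\<in>{n \<in> J B. r B n \<noteq> z}. antipode (\<lambda>a. f (a \<oplus> r B n)) (l B n))"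
  using assms by (subst antipode.simps) simp

lemma antipode_induct [consumes 1, case_names zero step]:
  assumes "B \<in> I" and "P z"
    and "\<And>B. B \<in> I \<Longrightarrow> B \<noteq> z \<Longrightarrow> (\<And>n. n \<in> J B \<Longrightarrow> r B n \<noteq> z \<Longrightarrow> P (l B n)) \<Longrightarrow> P B"
  shows "P B"
  using assms(1)
proof (induction "sz B" arbitrary: B rule: less_induct)
  case less
  show ?case
  proof (cases "B = z")
    case False
    show ?thesis
      by (rule assms(3)[OF less(2) False]) (use less sz_l l_in in blast)
  qed (use assms(2) in simp)
qed

text \<open>\<open>antipode f B\<close> is \<open>f\<close> evaluated on S(B), S being the antipode
  on basis elements. Two finiteness facts are recorded: S(B) is a finite combination, which is what
  the dual modules need, and its terms have weight at least \<open>w B\<close>, which is what finite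
  support needs. The bound survives the recursion because each step adds \<open>r B n\<close> to a
  term of S(\<open>l B n\<close>), and \<open>w\<close> is additive on sums and subadditive on
  extensions.\<close>

lemma antipode_matrix:
  assumes "B \<in> I"
  shows "\<exists>S c. finite S \<and> S \<subseteq> {a \<in> I. w B \<le> w a} \<and> (\<forall>f. antipode f B = (\<Sum>a\<in>S. c a * f a))"
  using assms
proof (induction rule: antipode_induct)
  case zero
  show ?case
    by (intro exI[of _ "{z}"] exI[of _ "\<lambda>_. 1"]) (auto simp: antipode_zero z_in)
next
  case (step B)
  let ?N = "{n \<in> J B. r B n \<noteq> z}"
  have fN: "finite ?N" using finite_J step(1) by auto
  have "\<forall>n\<in>?N. \<exists>S c. finite S \<and> S \<subseteq> {a \<in> I. w (l B n) \<le> w a} \<and>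
      (\<forall>f. antipode f (l B n) = (\<Sum>a\<in>S. c a * f a))"
    using step(3) by simp
  from bchoice[OF this] obtain S where
    "\<forall>n\<in>?N. \<exists>c. finite (S n) \<and> S n \<subseteq> {a \<in> I. w (l B n) \<le> w a} \<and>
      (\<forall>f. antipode f (l B n) = (\<Sum>a\<in>S n. c a * f a))" ..
  from bchoice[OF this] obtain c where S: "\<And>n. n \<in> ?N \<Longrightarrow> finite (S n)"
      "\<And>n. n \<in> ?N \<Longrightarrow> S n \<subseteq> {a \<in> I. w (l B n) \<le> w a}"
      "\<And>n f. n \<in> ?N \<Longrightarrow> antipode f (l B n) = (\<Sum>a\<in>S n. c n a * f a)"
    by blast
  let ?T = "\<Union>n\<in>?N. (\<lambda>a. a \<oplus> r B n) ` S n"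
  \<comment> \<open>Different pairs \<open>n\<close>, \<open>a\<close> can produce the same class
    \<open>a \<oplus> r B n\<close>, so the coefficients are collected over the fibres of this
    map.\<close>
  let ?c = "\<lambda>b. - (\<Sum>n\<in>?N. \<Sum>a\<in>S n. if a \<oplus> r B n = b then c n a else 0)"
  have fT: "finite ?T" using fN S by auto
  have T: "?T \<subseteq> {a \<in> I. w B \<le> w a}"
  proof
    fix b assume "b \<in> ?T"
    then obtain n a where n: "n \<in> ?N" and a: "a \<in> S n" and b: "b = a \<oplus> r B n" by auto
    have aI: "a \<in> I" "w (l B n) \<le> w a" using S(2) n a by auto
    have "w B \<le> w (l B n) + w (r B n)" using w_sub step(1) n by auto
    thus "b \<in> {a \<in> I. w B \<le> w a}"
      using aI b r_in[of B n] step(1) n p_in w_sum by auto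
  qed
  have "antipode f B = (\<Sum>b\<in>?T. ?c b * f b)" for f
  proof -
    have "(\<Sum>b\<in>?T. ?c b * f b) =
        (\<Sum>b\<in>?T. - (\<Sum>n\<in>?N. \<Sum>a\<in>S n. if a \<oplus> r B n = b then c n a * f b else 0))"
      by (intro sum.cong) (auto simp: sum_distrib_right if_distrib intro!: sum.cong)
    also have "\<dots> = - (\<Sum>b\<in>?T. \<Sum>n\<in>?N. \<Sum>a\<in>S n. if a \<oplus> r B n = b then c n a * f b else 0)"
      by (simp add: sum_negf)
    also have "(\<Sum>b\<in>?T. \<Sum>n\<in>?N. \<Sum>a\<in>S n. if a \<oplus> r B n = b then c n a * f b else 0) =
        (\<Sum>n\<in>?N. \<Sum>b\<in>?T. \<Sum>a\<in>S n. if a \<oplus> r B n = b then c n a * f b else 0)"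
      by (rule sum.swap)
    also have "\<dots> = (\<Sum>n\<in>?N. \<Sum>a\<in>S n. \<Sum>b\<in>?T. if a \<oplus> r B n = b then c n a * f b else 0)"
      by (rule sum.cong[OF refl], rule sum.swap)
    also have "\<dots> = (\<Sum>n\<in>?N. \<Sum>a\<in>S n. c n a * f (a \<oplus> r B n))"
    proof (intro sum.cong refl)
      fix n a assume n: "n \<in> ?N" and a: "a \<in> S n"
      have "a \<oplus> r B n \<in> ?T" using n a by blast
      thus "(\<Sum>b\<in>?T. if a \<oplus> r B n = b then c n a * f b else 0) = c n a * f (a \<oplus> r B n)"
        using fT by (simp add: sum.delta')
    qed
    also have "\<dots> = (\<Sum>n\<in>?N. antipode (\<lambda>a. f (a \<oplus> r B n)) (l B n))"
      by (intro sum.cong refl) (use S(3) in simp)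
    finally show ?thesis using antipode_rec[OF step(1,2)] by simp
  qed
  thus ?case by (intro exI[of _ ?T] exI[of _ ?c]) (use fT T in simp)
qed

lemma antipode_matrixE:
  assumes "B \<in> I"
  obtains S c where "finite S" "S \<subseteq> I" "\<And>a. a \<in> S \<Longrightarrow> w B \<le> w a"
    "\<And>f. antipode f B = (\<Sum>a\<in>S. c a * f a)"
proof -
  from antipode_matrix[OF assms] show ?thesis
  proof (elim exE conjE)
    fix S c assume S: "finite S" "S \<subseteq> {a \<in> I. w B \<le> w a}" "\<forall>f. antipode f B = (\<Sum>a\<in>S. c a * f a)"
    show ?thesis by (rule that[of S c]) (use S in auto)
  qed
qed

text \<open>The laws of \<open>\<oplus>\<close> hold only on \<open>I\<close>, so rewriting inside a
  functional argument always goes through this rule.\<close>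

lemma antipode_cong:
  assumes "\<And>a. a \<in> I \<Longrightarrow> f a = g a" shows "antipode f B = antipode g B"
proof (cases "B \<in> I")
  case True
  then obtain S c where "finite S" "S \<subseteq> I" "\<And>a. a \<in> S \<Longrightarrow> w B \<le> w a"
      "\<And>f. antipode f B = (\<Sum>a\<in>S. c a * f a)"
    by (rule antipode_matrixE) (rule that)
  thus ?thesis using assms by (auto intro!: sum.cong)
qed (simp add: antipode_outside)

lemma antipode_add: "antipode (\<lambda>a. f a + g a) B = antipode f B + antipode g B"
proof (cases "B \<in> I")
  case True
  then obtain S c where "finite S" "S \<subseteq> I" "\<And>a. a \<in> S \<Longrightarrow> w B \<le> w a"
      "\<And>f. antipode f B = (\<Sum>a\<in>S. c a * f a)"
    by (rule antipode_matrixE) (rule that)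
  thus ?thesis by (simp add: algebra_simps sum.distrib)
qed (simp add: antipode_outside)

lemma antipode_scale: "antipode (\<lambda>a. k * f a) B = k * antipode f B"
proof (cases "B \<in> I")
  case True
  then obtain S c where "finite S" "S \<subseteq> I" "\<And>a. a \<in> S \<Longrightarrow> w B \<le> w a"
      "\<And>f. antipode f B = (\<Sum>a\<in>S. c a * f a)"
    by (rule antipode_matrixE) (rule that)
  thus ?thesis by (simp add: sum_distrib_left algebra_simps)
qed (simp add: antipode_outside)

lemma antipode_sum: "antipode (\<lambda>a. \<Sum>i\<in>S. f i a) B = (\<Sum>i\<in>S. antipode (f i) B)"
proof (cases "finite S")
  case True
  thus ?thesis
  proof induction
    case empty
    show ?case using antipode_scale[of 0 "\<lambda>_. 0" B] by simp
  qed (simp add: antipode_add)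
qed (use antipode_scale[of 0 "\<lambda>_. 0" B] in simp)

lemma antipode_minus: "antipode (\<lambda>a. - f a) B = - antipode f B"
  using antipode_scale[of "- 1" f B] by simp

text \<open>Isolates the term \<open>B \<otimes> z\<close> of the coproduct, the only one whose left
  part is not smaller than \<open>B\<close> and hence out of reach of induction on
  \<open>sz\<close>.\<close>

lemma sum_J_split:
  assumes "B \<in> I"
  shows "(\<Sum>n\<in>J B. K (l B n) (r B n)) = (K B z :: rat) +
    (\<Sum>n\<in>{n \<in> J B. r B n \<noteq> z}. K (l B n) (r B n))"
proof -
  have "(\<Sum>n\<in>J B. K (l B n) (r B n)) =
     (\<Sum>n\<in>J B. (if r B n = z then K (l B n) z else 0) + (if r B n \<noteq> z then K (l B n) (r B n) else 0))"
    by (intro sum.cong) auto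
  also have "\<dots> = K B z + (\<Sum>n\<in>J B. if r B n \<noteq> z then K (l B n) (r B n) else 0)"
    by (simp only: sum.distrib counit_r[OF assms, of "\<lambda>x. K x z"])
  also have "(\<Sum>n\<in>J B. if r B n \<noteq> z then K (l B n) (r B n) else 0) =
      (\<Sum>n\<in>{n \<in> J B. r B n \<noteq> z}. K (l B n) (r B n))"
    using finite_J[OF assms] by (simp add: sum.inter_filter)
  finally show ?thesis .
qed

text \<open>The identity S * id = unit; the recursion defining \<open>antipode\<close> is this
  equation solved for the term with zero right part.\<close>

lemma antipode_left:
  assumes "B \<in> I"
  shows "(\<Sum>n\<in>J B. antipode (\<lambda>a. f (a \<oplus> r B n)) (l B n)) = eps B * f z"
proof (cases "B = z")
  case True
  show ?thesis
    unfolding True using sum_J_zero[of "\<lambda>x y. antipode (\<lambda>a. f (a \<oplus> y)) x"]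
    by (simp add: antipode_zero eps_def p_zero z_in)
next
  case False
  have "antipode (\<lambda>a. f (a \<oplus> z)) B = antipode f B"
    by (rule antipode_cong) (simp add: p_zero)
  thus ?thesis
    using sum_J_split[OF assms, of "\<lambda>x y. antipode (\<lambda>a. f (a \<oplus> y)) x"] antipode_rec[OF assms False, of f]
    using False by (simp add: eps_def)
qed

text \<open>Uniqueness of convolution inverses: S = (S * id) * S = S * (id * S), and by induction id
  * S is already the unit on all proper right parts, which forces it to vanish at \<open>B\<close>
  as well.\<close>

lemma antipode_right:
  assumes "B \<in> I"
  shows "(\<Sum>n\<in>J B. antipode (\<lambda>b. f (l B n \<oplus> b)) (r B n)) = eps B * f z"
  using assms
proof (induction "sz B" arbitrary: B f rule: less_induct)
  case (less B)
  note B = less.prems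
  \<comment> \<open>\<open>e\<close> is the convolution id * S followed by the functional; it has to
    vanish for \<open>B \<noteq> z\<close>.\<close>
  define e where "e f D = (\<Sum>n\<in>J D. antipode (\<lambda>b. f (l D n \<oplus> b)) (r D n))" for f :: "'i \<Rightarrow> rat" and D
  have IH: "e g D = eps D * g z" if "D \<in> I" "sz D < sz B" for g D
    unfolding e_def using less.hyps[OF that(2,1)] .
  show ?case
  proof (cases "B = z")
    case True
    show ?thesis
      unfolding True using sum_J_zero[of "\<lambda>x y. antipode (\<lambda>b. f (x \<oplus> b)) y"]
      by (simp add: antipode_zero eps_def p_zero z_in)
  next
    case False
    define T where "T x y c = antipode (\<lambda>a. antipode (\<lambda>b. f (a \<oplus> (y \<oplus> b))) c) x" for x y c
    \<comment> \<open>The counit law is read backwards, so that the unit can be replaced by S * id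
      through \<open>antipode_left\<close> and then be regrouped by \<open>coassoc\<close>.\<close>
    have "antipode f B = (\<Sum>n\<in>J B. if l B n = z then antipode f (r B n) else 0)"
      using counit_l[OF B, of "antipode f"] by simp
    also have "\<dots> = (\<Sum>n\<in>J B. \<Sum>k\<in>J (l B n). T (l (l B n) k) (r (l B n) k) (r B n))"
    proof (intro sum.cong refl)
      fix n assume n: "n \<in> J B"
      note lI = l_in[OF B n] and rI = r_in[OF B n]
      have "(\<Sum>k\<in>J (l B n). T (l (l B n) k) (r (l B n) k) (r B n)) =
          (\<Sum>k\<in>J (l B n). antipode (\<lambda>a. antipode (\<lambda>b. f ((a \<oplus> r (l B n) k) \<oplus> b)) (r B n)) (l (l B n) k))"
        unfolding T_def
        by (intro sum.cong refl antipode_cong) (simp add: p_assoc r_in lI)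
      also have "\<dots> = eps (l B n) * antipode (\<lambda>b. f (z \<oplus> b)) (r B n)"
        by (rule antipode_left[OF lI, of "\<lambda>a. antipode (\<lambda>b. f (a \<oplus> b)) (r B n)"])
      also have "antipode (\<lambda>b. f (z \<oplus> b)) (r B n) = antipode f (r B n)"
        by (rule antipode_cong) (simp add: p_zero_left)
      finally show "(if l B n = z then antipode f (r B n) else 0) =
          (\<Sum>k\<in>J (l B n). T (l (l B n) k) (r (l B n) k) (r B n))"
        by (simp add: eps_def)
    qed
    also have "\<dots> = (\<Sum>n\<in>J B. \<Sum>k\<in>J (r B n). T (l B n) (l (r B n) k) (r (r B n) k))"
      by (rule coassoc[OF B])
    also have "\<dots> = (\<Sum>n\<in>J B. antipode (\<lambda>a. e (\<lambda>y. f (a \<oplus> y)) (r B n)) (l B n))"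
      unfolding T_def e_def by (simp add: antipode_sum)
    also have "\<dots> = (\<Sum>n\<in>J B. (if l B n = z then e f (r B n) else 0) +
        (if r B n = z then antipode f (l B n) else 0))"
    proof (intro sum.cong refl)
      fix n assume n: "n \<in> J B"
      note lI = l_in[OF B n] and rI = r_in[OF B n]
      show "antipode (\<lambda>a. e (\<lambda>y. f (a \<oplus> y)) (r B n)) (l B n) =
        (if l B n = z then e f (r B n) else 0) + (if r B n = z then antipode f (l B n) else 0)"
      proof (cases "l B n = z")
        case True
        have "e (\<lambda>y. f (z \<oplus> y)) (r B n) = e f (r B n)"
          unfolding e_def
          by (intro sum.cong refl antipode_cong) (simp add: p_zero_left l_in p_in rI)
        \<comment> \<open>With both parts zero \<open>B\<close> would be zero, so the two summands
          of the claim are never active for the same index.\<close>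
        moreover have "r B n \<noteq> z"
        proof
          assume "r B n = z"
          thus False using False True n B zero_zero by blast
        qed
        ultimately show ?thesis using True by (simp add: antipode_zero)
      next
        case nz: False
        have "antipode (\<lambda>a. e (\<lambda>y. f (a \<oplus> y)) (r B n)) (l B n) =
            antipode (\<lambda>a. eps (r B n) * f (a \<oplus> z)) (l B n)"
          using IH[OF rI sz_r[OF B n nz]] by simp
        also have "\<dots> = eps (r B n) * antipode (\<lambda>a. f (a \<oplus> z)) (l B n)"
          by (rule antipode_scale)
        also have "antipode (\<lambda>a. f (a \<oplus> z)) (l B n) = antipode f (l B n)"
          by (rule antipode_cong) (simp add: p_zero)
        finally show ?thesis using nz by (simp add: eps_def)
      qed
    qed
    also have "\<dots> = e f B + antipode f B"
      using counit_l[OF B, of "e f"] counit_r[OF B, of "antipode f"] by (simp add: sum.distrib)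
    finally have "e f B = 0" by simp
    thus ?thesis using False by (simp add: e_def eps_def)
  qed
qed

text \<open>S is multiplicative. Both sides are left convolution inverses of the map (A, B) to
  \<open>A \<oplus> B\<close>; in the sum over pairs of indices their difference \<open>d\<close>
  vanishes by induction except where both right parts are zero, and that term is \<open>d\<close> at
  (A, B) itself. Commutativity enters when the right parts are collected.\<close>

lemma antipode_sum_class:
  assumes "A \<in> I" "B \<in> I"
  shows "antipode f (A \<oplus> B) = antipode (\<lambda>a. antipode (\<lambda>b. f (a \<oplus> b)) B) A"
  using assms
proof (induction "sz A + sz B" arbitrary: A B f rule: less_induct)
  case (less A B)
  note A = less.prems(1) and B = less.prems(2)
  define T where "T f A B = antipode (\<lambda>a. antipode (\<lambda>b. f (a \<oplus> b)) B) A" for f A B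
  define d where "d f A B = antipode f (A \<oplus> B) - T f A B" for f A B
  have T: "(\<Sum>n\<in>J A. \<Sum>k\<in>J B. T (\<lambda>x. f (x \<oplus> (r A n \<oplus> r B k))) (l A n) (l B k)) =
      eps A * (eps B * f z)"
  proof -
    have "(\<Sum>n\<in>J A. \<Sum>k\<in>J B. T (\<lambda>x. f (x \<oplus> (r A n \<oplus> r B k))) (l A n) (l B k)) =
       (\<Sum>n\<in>J A. \<Sum>k\<in>J B. antipode (\<lambda>a. antipode (\<lambda>b. f ((a \<oplus> r A n) \<oplus> (b \<oplus> r B k))) (l B k)) (l A n))"
    proof (unfold T_def, intro sum.cong refl antipode_cong)
      fix n k a b assume "n \<in> J A" "k \<in> J B" and ab: "a \<in> I" "b \<in> I"
      hence rr: "r A n \<in> I" "r B k \<in> I" using r_in A B by auto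
      show "f (a \<oplus> b \<oplus> (r A n \<oplus> r B k)) = f ((a \<oplus> r A n) \<oplus> (b \<oplus> r B k))"
        using ab rr p_assoc p_comm p_in by metis
    qed
    also have "\<dots> = (\<Sum>n\<in>J A. antipode (\<lambda>a. \<Sum>k\<in>J B. antipode (\<lambda>b. f ((a \<oplus> r A n) \<oplus> (b \<oplus> r B k))) (l B k)) (l A n))"
      by (simp add: antipode_sum)
    also have "\<dots> = (\<Sum>n\<in>J A. antipode (\<lambda>a. eps B * f ((a \<oplus> r A n) \<oplus> z)) (l A n))"
      using antipode_left[OF B, of "\<lambda>b. f (_ \<oplus> b)"] by simp
    also have "\<dots> = eps A * (eps B * f (z \<oplus> z))"
      by (rule antipode_left[OF A, of "\<lambda>a. eps B * f (a \<oplus> z)"])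
    finally show ?thesis by (simp add: p_zero z_in)
  qed
  have "(\<Sum>n\<in>J (A \<oplus> B). antipode (\<lambda>x. f (x \<oplus> r (A \<oplus> B) n)) (l (A \<oplus> B) n)) = eps A * (eps B * f z)"
    using antipode_left[OF p_in[OF A B], of f] eps_sum[OF A B] by simp
  also have "(\<Sum>n\<in>J (A \<oplus> B). antipode (\<lambda>x. f (x \<oplus> r (A \<oplus> B) n)) (l (A \<oplus> B) n)) =
      (\<Sum>n\<in>J A. \<Sum>k\<in>J B. antipode (\<lambda>x. f (x \<oplus> (r A n \<oplus> r B k))) (l A n \<oplus> l B k))"
    by (rule comult_sum[OF A B, of "\<lambda>u v. antipode (\<lambda>x. f (x \<oplus> v)) u"])
  finally have "(\<Sum>n\<in>J A. \<Sum>k\<in>J B. d (\<lambda>x. f (x \<oplus> (r A n \<oplus> r B k))) (l A n) (l B k)) = 0"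
    using T by (simp add: d_def sum_subtractf)
  moreover have "(\<Sum>n\<in>J A. \<Sum>k\<in>J B. d (\<lambda>x. f (x \<oplus> (r A n \<oplus> r B k))) (l A n) (l B k)) =
      (\<Sum>n\<in>J A. if r A n = z then (\<Sum>k\<in>J B. if r B k = z then d f (l A n) (l B k) else 0) else 0)"
  proof (rule sum.cong[OF refl])
    fix n assume n: "n \<in> J A"
    note lA = l_in[OF A n]
    have szA: "sz (l A n) \<le> sz A"
    proof (cases "r A n = z")
      case True
      thus ?thesis using zero_l[OF A n] by simp
    qed (use sz_l[OF A n] in simp)
    have step: "d (\<lambda>x. f (x \<oplus> (r A n \<oplus> r B k))) (l A n) (l B k) =
        (if r A n = z \<and> r B k = z then d f (l A n) (l B k) else 0)" if k: "k \<in> J B" for k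
    proof -
      note lB = l_in[OF B k]
      have szB: "sz (l B k) \<le> sz B"
      proof (cases "r B k = z")
        case True
        thus ?thesis using zero_l[OF B k] by simp
      qed (use sz_l[OF B k] in simp)
      show ?thesis
      proof (cases "r A n = z \<and> r B k = z")
        case True
        have "d (\<lambda>x. f (x \<oplus> z)) (l A n) (l B k) = d f (l A n) (l B k)"
          unfolding d_def T_def
          by (intro arg_cong2[of _ _ _ _ minus] antipode_cong) (auto simp: p_zero p_in)
        thus ?thesis using True by (simp add: p_zero z_in)
      next
        case False
        hence "sz (l A n) + sz (l B k) < sz A + sz B"
          using szA szB sz_l[OF A n] sz_l[OF B k] by fastforce
        from less.hyps[OF this lA lB] show ?thesis using False by (auto simp: d_def T_def)
      qed
    qed
    show "(\<Sum>k\<in>J B. d (\<lambda>x. f (x \<oplus> (r A n \<oplus> r B k))) (l A n) (l B k)) =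
      (if r A n = z then (\<Sum>k\<in>J B. if r B k = z then d f (l A n) (l B k) else 0) else 0)"
      using step by (simp cong: sum.cong)
  qed
  moreover have "\<dots> = d f A B"
    unfolding counit_r[OF B] by (rule counit_r[OF A])
  ultimately show ?case by (simp add: d_def T_def)
qed

text \<open>Applying S to S * id = unit and using multiplicativity gives S^2 * S = unit. By
  induction S^2 may be replaced by the identity in every term but that of
  \<open>B \<otimes> z\<close>; comparison with id * S = unit leaves S^2(B) = B.\<close>

lemma antipode_antipode:
  assumes "B \<in> I"
  shows "antipode (antipode f) B = f B"
  using assms
proof (induction "sz B" arbitrary: B f rule: less_induct)
  case (less B)
  note B = less.prems
  have "(\<Sum>n\<in>J B. antipode (\<lambda>a. antipode f (a \<oplus> r B n)) (l B n)) =
      antipode (antipode f) B +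
      (\<Sum>n\<in>{n \<in> J B. r B n \<noteq> z}. antipode (\<lambda>a. antipode f (a \<oplus> r B n)) (l B n))"
    using sum_J_split[OF B, of "\<lambda>x y. antipode (\<lambda>a. antipode f (a \<oplus> y)) x"]
      antipode_cong[of "\<lambda>a. antipode f (a \<oplus> z)" "antipode f" B] by (simp add: p_zero)
  also have "(\<Sum>n\<in>{n \<in> J B. r B n \<noteq> z}. antipode (\<lambda>a. antipode f (a \<oplus> r B n)) (l B n)) =
      (\<Sum>n\<in>{n \<in> J B. r B n \<noteq> z}. antipode (\<lambda>b. f (l B n \<oplus> b)) (r B n))"
  proof (intro sum.cong refl)
    fix n assume n: "n \<in> {n \<in> J B. r B n \<noteq> z}"
    hence lI: "l B n \<in> I" and rI: "r B n \<in> I" and lt: "sz (l B n) < sz B"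
      using l_in r_in sz_l B by auto
    have "antipode (\<lambda>a. antipode f (a \<oplus> r B n)) (l B n) =
        antipode (\<lambda>a. antipode (\<lambda>x. antipode (\<lambda>y. f (x \<oplus> y)) (r B n)) a) (l B n)"
      by (rule antipode_cong) (simp add: antipode_sum_class rI)
    also have "\<dots> = antipode (\<lambda>y. f (l B n \<oplus> y)) (r B n)"
      by (rule less.hyps[OF lt lI])
    finally show "antipode (\<lambda>a. antipode f (a \<oplus> r B n)) (l B n) =
        antipode (\<lambda>b. f (l B n \<oplus> b)) (r B n)" .
  qed
  finally have "eps B * antipode f z = antipode (antipode f) B +
      (\<Sum>n\<in>{n \<in> J B. r B n \<noteq> z}. antipode (\<lambda>b. f (l B n \<oplus> b)) (r B n))"
    using antipode_left[OF B, of "antipode f"] by simp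
  moreover have "eps B * f z = f B +
      (\<Sum>n\<in>{n \<in> J B. r B n \<noteq> z}. antipode (\<lambda>b. f (l B n \<oplus> b)) (r B n))"
    using antipode_right[OF B, of f] sum_J_split[OF B, of "\<lambda>x y. antipode (\<lambda>b. f (x \<oplus> b)) y"]
    by (simp add: antipode_zero p_zero B)
  ultimately show ?case by (simp add: antipode_zero)
qed

text \<open>Infinitesimal characters of the bialgebra, the transposed reading of the condition that
  defines \<open>prim\<close>.\<close>

definition primitive :: "('i \<Rightarrow> rat) \<Rightarrow> bool" where
  "primitive X \<longleftrightarrow> (\<forall>A\<in>I. \<forall>B\<in>I. X (A \<oplus> B) = X A * eps B + eps A * X B)"

lemma primitive_zero: "primitive X \<Longrightarrow> X z = 0"
  using p_zero[OF z_in] z_in by (force simp: primitive_def eps_def)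

text \<open>Left convolution with an infinitesimal character is a derivation for
  \<open>\<oplus>\<close>: on a subobject of a sum, \<open>X\<close> is nonzero only if one of the
  two parts is zero, and then the corresponding summand passes unchanged into the quotient.\<close>

lemma conv_primitive_sum:
  assumes X: "primitive X" and A: "A \<in> I" and B: "B \<in> I"
  shows "conv X m (A \<oplus> B) = conv X (\<lambda>a. m (a \<oplus> B)) A + conv X (\<lambda>b. m (A \<oplus> b)) B"
proof -
  have "conv X m (A \<oplus> B) = (\<Sum>n\<in>J A. \<Sum>k\<in>J B. X (l A n \<oplus> l B k) * m (r A n \<oplus> r B k))"
    unfolding conv_def by (rule comult_sum[OF A B, of "\<lambda>x y. X x * m y"])
  also have "\<dots> = (\<Sum>n\<in>J A. \<Sum>k\<in>J B. X (l A n) * (eps (l B k) * m (r A n \<oplus> r B k)) +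
      eps (l A n) * (X (l B k) * m (r A n \<oplus> r B k)))"
  proof (intro sum.cong refl)
    fix n k assume "n \<in> J A" "k \<in> J B"
    hence "X (l A n \<oplus> l B k) = X (l A n) * eps (l B k) + eps (l A n) * X (l B k)"
      using X l_in A B by (simp add: primitive_def)
    thus "X (l A n \<oplus> l B k) * m (r A n \<oplus> r B k) = X (l A n) * (eps (l B k) * m (r A n \<oplus> r B k)) +
      eps (l A n) * (X (l B k) * m (r A n \<oplus> r B k))" by (simp add: algebra_simps)
  qed
  also have "\<dots> = (\<Sum>n\<in>J A. X (l A n) * conv eps (\<lambda>b. m (r A n \<oplus> b)) B) +
      conv eps (\<lambda>a. conv X (\<lambda>b. m (a \<oplus> b)) B) A"
    by (simp add: sum.distrib sum_distrib_left conv_def)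
  also have "\<dots> = conv X (\<lambda>a. m (a \<oplus> B)) A + conv X (\<lambda>b. m (A \<oplus> b)) B"
    by (simp add: conv_eps_left A B) (simp add: conv_def)
  finally show ?thesis .
qed

text \<open>Evaluate S * id = unit on \<open>conv X m\<close>; the total is zero because
  \<open>X z = 0\<close>. The derivation rule splits each term in two. The second halves are
  regrouped by \<open>coassoc\<close>, after which the induction hypothesis cancels them against the
  first halves wherever the right part is nonzero. What remains is the term of
  \<open>B \<otimes> z\<close>, which is the claim.\<close>

lemma antipode_conv_primitive:
  assumes X: "primitive X" and "B \<in> I"
  shows "antipode (conv X m) B = - conv (antipode m) X B"
  using assms(2)
proof (induction "sz B" arbitrary: B m rule: less_induct)
  case (less B)
  note B = less.prems
  \<comment> \<open>Common shape of both families of terms: \<open>antipode\<close> of the translate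
    of \<open>m\<close> by \<open>c\<close>, taken at \<open>a\<close>, times \<open>X\<close> at
    the middle factor \<open>b\<close>. Being a function of three classes, it is open to
    \<open>coassoc\<close>.\<close>
  define F where "F a b c = antipode (\<lambda>x. m (x \<oplus> c)) a * X b" for a b c
  let ?N = "{n \<in> J B. r B n \<noteq> z}"
  have inner: "antipode (\<lambda>a. conv X m (a \<oplus> r B n)) (l B n) =
     antipode (conv X (\<lambda>x. m (x \<oplus> r B n))) (l B n) +
       (\<Sum>k\<in>J (r B n). F (l B n) (l (r B n) k) (r (r B n) k))" if n: "n \<in> J B" for n
  proof -
    note rI = r_in[OF B n]
    have "antipode (\<lambda>a. conv X m (a \<oplus> r B n)) (l B n) =
        antipode (\<lambda>a. conv X (\<lambda>x. m (x \<oplus> r B n)) a + conv X (\<lambda>b. m (a \<oplus> b)) (r B n)) (l B n)"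
      by (rule antipode_cong) (rule conv_primitive_sum[OF X _ rI])
    also have "\<dots> = antipode (conv X (\<lambda>x. m (x \<oplus> r B n))) (l B n) +
       antipode (\<lambda>a. conv X (\<lambda>b. m (a \<oplus> b)) (r B n)) (l B n)" by (rule antipode_add)
    also have "antipode (\<lambda>a. conv X (\<lambda>b. m (a \<oplus> b)) (r B n)) (l B n) =
       (\<Sum>k\<in>J (r B n). F (l B n) (l (r B n) k) (r (r B n) k))"
      unfolding conv_def F_def by (simp add: antipode_sum antipode_scale mult.commute)
    finally show ?thesis .
  qed
  have left: "antipode (conv X (\<lambda>x. m (x \<oplus> r B n))) (l B n) =
      - (\<Sum>k\<in>J (l B n). F (l (l B n) k) (r (l B n) k) (r B n))" if n: "n \<in> ?N" for n
    using less.hyps[of "l B n" "\<lambda>x. m (x \<oplus> r B n)"] sz_l[OF B] l_in[OF B] n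
    by (simp add: conv_def F_def)
  define G where "G x y = antipode (conv X (\<lambda>u. m (u \<oplus> y))) x +
     (\<Sum>k\<in>J x. F (l x k) (r x k) y)" for x y
  have "eps B * conv X m z = (\<Sum>n\<in>J B. antipode (\<lambda>a. conv X m (a \<oplus> r B n)) (l B n))"
    using antipode_left[OF B] by simp
  also have "\<dots> = (\<Sum>n\<in>J B. antipode (conv X (\<lambda>x. m (x \<oplus> r B n))) (l B n)) +
      (\<Sum>n\<in>J B. \<Sum>k\<in>J (r B n). F (l B n) (l (r B n) k) (r (r B n) k))"
    by (simp add: inner sum.distrib)
  also have "\<dots> = (\<Sum>n\<in>J B. G (l B n) (r B n))"
    using coassoc[OF B, of F] by (simp add: G_def sum.distrib)
  also have "\<dots> = G B z + (\<Sum>n\<in>?N. G (l B n) (r B n))"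
    by (rule sum_J_split[OF B])
  also have "(\<Sum>n\<in>?N. G (l B n) (r B n)) = 0"
    using left by (simp add: G_def)
  also have "G B z = antipode (conv X m) B + conv (antipode m) X B"
  proof -
    have "antipode (\<lambda>x. m (x \<oplus> z)) a = antipode m a" for a
      by (rule antipode_cong) (simp add: p_zero)
    moreover have "antipode (conv X (\<lambda>u. m (u \<oplus> z))) B = antipode (conv X m) B"
      by (rule antipode_cong) (auto simp: conv_def p_zero r_in intro!: sum.cong)
    ultimately show ?thesis by (simp add: G_def F_def conv_def)
  qed
  finally show ?case
    using sum_J_zero[of "\<lambda>x y. X x * m y"] primitive_zero[OF X] by (simp add: conv_def)
qed

text \<open>Mirror image of \<open>antipode_conv_primitive\<close>, obtained by conjugating it with
  the involution.\<close>

lemma antipode_conv_primitive_right: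
  assumes X: "primitive X" and B: "B \<in> I"
  shows "antipode (conv m X) B = - conv X (antipode m) B"
proof -
  have "antipode (conv m X) B = antipode (\<lambda>b. - antipode (conv X (antipode m)) b) B"
  proof (rule antipode_cong)
    fix a assume a: "a \<in> I"
    have "conv (antipode (antipode m)) X a = conv m X a"
      unfolding conv_def by (intro sum.cong) (auto simp: antipode_antipode l_in a)
    thus "conv m X a = - antipode (conv X (antipode m)) a"
      using antipode_conv_primitive[OF X a, of "antipode m"] by simp
  qed
  thus ?thesis by (simp add: antipode_minus antipode_antipode[OF B])
qed

text \<open>A nonzero value at \<open>B\<close> needs some \<open>a\<close> in the support of
  \<open>f\<close> with \<open>w B \<le> w a\<close>. The sum of all weights in the support serves
  as a crude uniform bound in place of a maximum.\<close>

lemma antipode_finite_support: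
  assumes "finite {a. f a \<noteq> 0}" "{a. f a \<noteq> 0} \<subseteq> I"
  shows "finite {a. antipode f a \<noteq> 0}"
proof -
  let ?S = "{a. f a \<noteq> 0}"
  have "{B. antipode f B \<noteq> 0} \<subseteq> {B \<in> I. w B \<le> (\<Sum>a\<in>?S. w a)}"
  proof safe
    fix B assume nz: "antipode f B \<noteq> 0"
    thus B: "B \<in> I" using antipode_outside by blast
    obtain S c where S: "finite S" "S \<subseteq> I" "\<And>a. a \<in> S \<Longrightarrow> w B \<le> w a"
        "\<And>f. antipode f B = (\<Sum>a\<in>S. c a * f a)"
      using B by (rule antipode_matrixE) (rule that)
    from nz have "(\<Sum>a\<in>S. c a * f a) \<noteq> 0" by (simp add: S(4))
    then obtain a where a: "a \<in> S" "c a * f a \<noteq> 0"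
      by (rule sum.not_neutral_contains_not_neutral)
    hence "w B \<le> w a" using S(3) by auto
    also have "\<dots> \<le> (\<Sum>a\<in>?S. w a)" using a assms(1) by (intro member_le_sum) auto
    finally show "w B \<le> (\<Sum>a\<in>?S. w a)" .
  qed
  thus ?thesis using w_finite finite_subset by blast
qed

end

section \<open>Finitely supported functions and their restricted dual\<close>

lemma sum_supp_delta:
  assumes "f \<in> Hall C"
  shows "(\<Sum>A\<in>supp C f. f A * delta A x) = f x"
proof -
  have supp: "supp C f = {A. f A \<noteq> 0}" using assms by (auto simp: Hall_def supp_def)
  hence fin: "finite (supp C f)" using assms by (simp add: Hall_def)
  have "(\<Sum>A\<in>supp C f. f A * delta A x) = (\<Sum>A\<in>supp C f. if x = A then f x else 0)"
    by (intro sum.cong) (auto simp: delta_def)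
  also have "\<dots> = f x" using fin supp by simp
  finally show ?thesis .
qed

lemma delta_in_Hall: "A \<in> Iso C \<Longrightarrow> delta A \<in> Hall C"
  by (auto simp: Hall_def delta_def)

text \<open>\<open>dual_basis\<close> is zero outside \<open>Hall C\<close>, so an element of the
  dual is a finite linear functional on \<open>Hall C\<close> extended by zero.\<close>

lemma Hall_dual_iff:
  "\<phi> \<in> Hall_dual C \<longleftrightarrow> (\<exists>S c. finite S \<and> S \<subseteq> Iso C \<and>
     \<phi> = (\<lambda>f. if f \<in> Hall C then (\<Sum>A\<in>S. c A * f A) else 0))"
proof -
  have "(\<lambda>f. \<Sum>A\<in>S. c A * dual_basis C A f) = (\<lambda>f. if f \<in> Hall C then (\<Sum>A\<in>S. c A * f A) else 0)" for S c
    by (auto simp: dual_basis_def)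
  thus ?thesis unfolding Hall_dual_def by auto
qed

lemma Hall_dualE:
  assumes "\<phi> \<in> Hall_dual C"
  obtains S c where "finite S" "S \<subseteq> Iso C"
    "\<phi> = (\<lambda>f. if f \<in> Hall C then (\<Sum>A\<in>S. c A * f A) else 0)"
  using assms unfolding Hall_dual_iff by (elim exE conjE) (rule that)

lemma finite_dual_supp:
  assumes "\<phi> \<in> Hall_dual C"
  shows "finite (dual_supp C \<phi>)"
proof -
  obtain S c where S: "finite S" "S \<subseteq> Iso C"
    and \<phi>: "\<phi> = (\<lambda>f. if f \<in> Hall C then (\<Sum>A\<in>S. c A * f A) else 0)"
    using assms by (rule Hall_dualE)
  have "\<phi> (delta B) = 0" if "B \<notin> S" for B
    using that by (auto simp: \<phi> delta_def intro!: sum.neutral)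
  hence "dual_supp C \<phi> \<subseteq> S" by (auto simp: dual_supp_def)
  thus ?thesis using S(1) finite_subset by blast
qed

text \<open>Makes the presentation of a functional canonical: the coefficients are its values at
  delta functions, whatever \<open>S\<close> and \<open>c\<close> it was built from.\<close>

lemma Hall_dual_expand:
  assumes "\<phi> \<in> Hall_dual C"
  shows "\<phi> f = (if f \<in> Hall C then (\<Sum>B\<in>dual_supp C \<phi>. \<phi> (delta B) * f B) else 0)"
proof -
  obtain S c where S: "finite S" "S \<subseteq> Iso C"
    and \<phi>: "\<phi> = (\<lambda>f. if f \<in> Hall C then (\<Sum>A\<in>S. c A * f A) else 0)"
    using assms by (rule Hall_dualE)
  have val: "\<phi> (delta B) = (if B \<in> S then c B else 0)" if "B \<in> Iso C" for B
  proof -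
    have "(\<Sum>A\<in>S. c A * delta B A) = (\<Sum>A\<in>S. if A = B then c A else 0)"
      by (intro sum.cong) (auto simp: delta_def)
    thus ?thesis using S(1) delta_in_Hall[OF that] by (simp add: \<phi>)
  qed
  have "(\<Sum>B\<in>dual_supp C \<phi>. \<phi> (delta B) * f B) = (\<Sum>B\<in>dual_supp C \<phi>. c B * f B)"
    by (intro sum.cong refl) (auto simp: dual_supp_def val)
  also have "\<dots> = (\<Sum>B\<in>S. c B * f B)"
    using S by (intro sum.mono_neutral_left) (auto simp: dual_supp_def val split: if_splits)
  finally show ?thesis by (simp add: \<phi>)
qed

section \<open>The antipode as an isomorphism of Hall modules\<close>

locale hall_bialgebra =
  incidence_bialgebra "Iso C" "iso_class C (null C)" "class_sum C"
    "\<lambda>B. Subs C (representative B)"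
    "\<lambda>B N. iso_class C (sub C (representative B) N)"
    "\<lambda>B N. iso_class C (quot C (representative B) N)" sz w
  for C :: "('o, 'n) hall_data" and sz w
begin

lemma prim_primitive: "X \<in> prim C \<Longrightarrow> primitive X"
  unfolding prim_def primitive_def hall_comult_def eps_def delta_def by auto

text \<open>The actions are defined by bilinear extension from delta functions; here the double
  expansion is collapsed to a single convolution.\<close>

lemma hall_mult_sum:
  assumes "f \<in> Hall C" "g \<in> Hall C"
  shows "(\<Sum>A\<in>supp C f. \<Sum>B\<in>supp C g. f A * g B * hall_mult C (delta A) (delta B) M) =
    (if M \<in> Iso C then conv f g M else 0)"
proof (cases "M \<in> Iso C")
  case True
  let ?l = "\<lambda>N. iso_class C (sub C (representative M) N)"
  let ?r = "\<lambda>N. iso_class C (quot C (representative M) N)"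
  have "(\<Sum>A\<in>supp C f. \<Sum>B\<in>supp C g. f A * g B * hall_mult C (delta A) (delta B) M) =
     (\<Sum>A\<in>supp C f. \<Sum>B\<in>supp C g. \<Sum>N\<in>Subs C (representative M).
        (f A * delta A (?l N)) * (g B * delta B (?r N)))"
    using True by (simp add: hall_mult_def sum_distrib_left algebra_simps)
  also have "\<dots> = (\<Sum>A\<in>supp C f. \<Sum>N\<in>Subs C (representative M). \<Sum>B\<in>supp C g.
        (f A * delta A (?l N)) * (g B * delta B (?r N)))"
    by (intro sum.cong refl sum.swap)
  also have "\<dots> = (\<Sum>N\<in>Subs C (representative M). \<Sum>A\<in>supp C f. \<Sum>B\<in>supp C g.
        (f A * delta A (?l N)) * (g B * delta B (?r N)))"
    by (rule sum.swap)
  also have "\<dots> = (\<Sum>N\<in>Subs C (representative M). f (?l N) * g (?r N))"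
    by (simp add: sum_product[symmetric] sum_supp_delta assms)
  finally show ?thesis using True by (simp add: conv_def)
qed (simp add: hall_mult_def)

lemma antipode_Hall: "f \<in> Hall C \<Longrightarrow> antipode f \<in> Hall C"
  using antipode_finite_support[of f] antipode_outside[of _ f] by (auto simp: Hall_def)

lemma antipode_antipode_Hall: "f \<in> Hall C \<Longrightarrow> antipode (antipode f) = f"
proof
  fix A assume f: "f \<in> Hall C"
  show "antipode (antipode f) A = f A"
  proof (cases "A \<in> Iso C")
    case False
    thus ?thesis using f by (auto simp: antipode_outside Hall_def)
  qed (rule antipode_antipode)
qed

text \<open>The isomorphism is \<open>antipode\<close> itself, which is its own inverse; the minus
  sign of \<open>antipode_conv_primitive\<close> is the one in the definition of
  \<open>top_ins\<close>.\<close>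

theorem ins_iso_top_ins: "modules_isomorphic (prim C) (Hall C) (ins C) (Hall C) (top_ins C)"
  unfolding modules_isomorphic_def
proof (intro exI[of _ antipode] conjI ballI allI)
  show "bij_betw antipode (Hall C) (Hall C)"
    by (rule bij_betwI[where g = antipode]) (auto simp: antipode_Hall antipode_antipode_Hall)
  show "antipode (\<lambda>x. f x + g x) = (\<lambda>y. antipode f y + antipode g y)" for f g
    by (rule ext) (rule antipode_add)
  show "antipode (\<lambda>x. c * f x) = (\<lambda>y. c * antipode f y)" for c f
    by (rule ext) (rule antipode_scale)
  fix X m assume X: "X \<in> prim C" and m: "m \<in> Hall C"
  hence XH: "X \<in> Hall C" by (simp add: prim_def)
  show "antipode (ins C X m) = top_ins C X (antipode m)"
  proof
    fix M
    have "antipode (ins C X m) M = antipode (conv X m) M"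
      by (rule antipode_cong) (simp add: ins_def hall_mult_sum[OF XH m])
    also have "\<dots> = - (if M \<in> Iso C then conv (antipode m) X M else 0)"
      by (simp add: antipode_outside antipode_conv_primitive prim_primitive[OF X])
    also have "\<dots> = top_ins C X (antipode m) M"
      using hall_mult_sum[OF antipode_Hall[OF m] XH, of M]
      by (simp add: top_ins_def top_ins_right_def sum.swap[of _ "supp C X"])
    finally show "antipode (ins C X m) M = top_ins C X (antipode m) M" .
  qed
qed

text \<open>For each class \<open>A\<close> the inner sum runs over the indices in the fibre of
  \<open>h\<close>; weighting by \<open>f A\<close> and summing over all \<open>A\<close>
  reassembles the full index set.\<close>

lemma sum_fibres:
  assumes "f \<in> Hall C" and "finite K"
  shows "(\<Sum>A\<in>supp C f. f A * (\<Sum>N\<in>{N \<in> K. h N = A}. g N)) = (\<Sum>N\<in>K. f (h N) * g N)"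
proof -
  have "(\<Sum>A\<in>supp C f. f A * (\<Sum>N\<in>{N \<in> K. h N = A}. g N)) =
      (\<Sum>A\<in>supp C f. \<Sum>N\<in>K. f A * delta A (h N) * g N)"
    unfolding sum.inter_filter[OF assms(2)] sum_distrib_left
    by (intro sum.cong refl) (simp add: delta_def)
  also have "\<dots> = (\<Sum>N\<in>K. (\<Sum>A\<in>supp C f. f A * delta A (h N)) * g N)"
    by (subst sum.swap) (simp add: sum_distrib_right)
  finally show ?thesis by (simp add: sum_supp_delta[OF assms(1)])
qed

text \<open>The value is minus \<phi> of \<open>conv X f\<close>, spelled out through the
  coefficients of \<phi>: a functional in the dual vanishes outside \<open>Hall C\<close>, and
  \<open>conv X f\<close> is not shown to lie there.\<close>

lemma elim_eq:
  assumes X: "X \<in> Hall C"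
  shows "elim C X \<phi> f =
    (if f \<in> Hall C then - (\<Sum>B\<in>dual_supp C \<phi>. \<phi> (delta B) * conv X f B) else 0)"
proof -
  have "elim C X \<phi> f =
      (\<Sum>B\<in>dual_supp C \<phi>. - (\<phi> (delta B) * (\<Sum>A\<in>supp C X. X A * - elim_basis C A B f)))"
    unfolding elim_def by (subst sum.swap) (simp add: sum_distrib_left algebra_simps sum_negf)
  also have "\<dots> = (\<Sum>B\<in>dual_supp C \<phi>. - (\<phi> (delta B) * (if f \<in> Hall C then conv X f B else 0)))"
  proof (intro sum.cong refl)
    fix B assume "B \<in> dual_supp C \<phi>"
    hence fin: "finite (Subs C (representative B))" using finite_J by (simp add: dual_supp_def)
    show "- (\<phi> (delta B) * (\<Sum>A\<in>supp C X. X A * - elim_basis C A B f)) =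
        - (\<phi> (delta B) * (if f \<in> Hall C then conv X f B else 0))"
      by (simp only: elim_basis_def minus_minus sum_fibres[OF X fin])
        (simp add: conv_def dual_basis_def)
  qed
  finally show ?thesis by (simp add: sum_negf)
qed

text \<open>No sign is left here: the sign of the dual action and the sign of the passage from right
  to left modules cancel.\<close>

lemma top_elim_eq:
  assumes X: "X \<in> Hall C"
  shows "top_elim C X \<phi> f =
    (if f \<in> Hall C then (\<Sum>B\<in>dual_supp C \<phi>. \<phi> (delta B) * conv f X B) else 0)"
proof -
  have "top_elim C X \<phi> f =
      (\<Sum>B\<in>dual_supp C \<phi>. \<phi> (delta B) * (\<Sum>A\<in>supp C X. X A * - top_elim_right_basis C B A f))"
    unfolding top_elim_def top_elim_right_def
    by (subst sum.swap) (simp add: sum_distrib_left algebra_simps sum_negf)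
  also have "\<dots> = (\<Sum>B\<in>dual_supp C \<phi>. \<phi> (delta B) * (if f \<in> Hall C then conv f X B else 0))"
  proof (intro sum.cong refl)
    fix B assume "B \<in> dual_supp C \<phi>"
    hence fin: "finite (Subs C (representative B))" using finite_J by (simp add: dual_supp_def)
    show "\<phi> (delta B) * (\<Sum>A\<in>supp C X. X A * - top_elim_right_basis C B A f) =
        \<phi> (delta B) * (if f \<in> Hall C then conv f X B else 0)"
      by (simp only: top_elim_right_basis_def minus_minus sum_fibres[OF X fin])
        (simp add: conv_def dual_basis_def mult.commute)
  qed
  finally show ?thesis by simp
qed

text \<open>Transpose of \<open>antipode\<close>, set to zero outside \<open>Hall C\<close> to match
  the convention built into \<open>dual_basis\<close>.\<close>

definition antipode_dual :: "(('o set \<Rightarrow> rat) \<Rightarrow> rat) \<Rightarrow> ('o set \<Rightarrow> rat) \<Rightarrow> rat" where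
  "antipode_dual \<phi> f = (if f \<in> Hall C then \<phi> (antipode f) else 0)"

text \<open>Each S(A) is a finite combination of classes, so finitely many coefficients of \<phi>
  yield finitely many coefficients of the transpose.\<close>

lemma antipode_dual_in:
  assumes "\<phi> \<in> Hall_dual C"
  shows "antipode_dual \<phi> \<in> Hall_dual C"
proof -
  obtain S c where S: "finite S" "S \<subseteq> Iso C"
    and \<phi>: "\<phi> = (\<lambda>f. if f \<in> Hall C then (\<Sum>A\<in>S. c A * f A) else 0)"
    using assms by (rule Hall_dualE)
  have "\<forall>A\<in>S. \<exists>T e. finite T \<and> T \<subseteq> Iso C \<and> (\<forall>f. antipode f A = (\<Sum>a\<in>T. e a * f a))"
  proof
    fix A assume "A \<in> S"
    hence "A \<in> Iso C" using S by blast
    then obtain T e where "finite T" "T \<subseteq> Iso C" "\<And>a. a \<in> T \<Longrightarrow> w A \<le> w a"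
        "\<And>f. antipode f A = (\<Sum>a\<in>T. e a * f a)"
      by (rule antipode_matrixE) (rule that)
    thus "\<exists>T e. finite T \<and> T \<subseteq> Iso C \<and> (\<forall>f. antipode f A = (\<Sum>a\<in>T. e a * f a))"
      by (intro exI[of _ T] exI[of _ e]) simp
  qed
  from bchoice[OF this] obtain T where
    "\<forall>A\<in>S. \<exists>e. finite (T A) \<and> T A \<subseteq> Iso C \<and> (\<forall>f. antipode f A = (\<Sum>a\<in>T A. e a * f a))" ..
  from bchoice[OF this] obtain e where
    T: "\<And>A. A \<in> S \<Longrightarrow> finite (T A)" "\<And>A. A \<in> S \<Longrightarrow> T A \<subseteq> Iso C"
       "\<And>A f. A \<in> S \<Longrightarrow> antipode f A = (\<Sum>a\<in>T A. e A a * f a)" by blast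
  define U where "U = (\<Union>A\<in>S. T A)"
  define d where "d a = (\<Sum>A\<in>S. c A * (if a \<in> T A then e A a else 0))" for a
  have fU: "finite U" "U \<subseteq> Iso C" using S T by (auto simp: U_def)
  have "(\<Sum>A\<in>S. c A * antipode f A) = (\<Sum>a\<in>U. d a * f a)" for f
  proof -
    have "(\<Sum>A\<in>S. c A * antipode f A) = (\<Sum>A\<in>S. c A * (\<Sum>a\<in>U. (if a \<in> T A then e A a else 0) * f a))"
    proof (intro sum.cong refl arg_cong2[of _ _ _ _ times])
      fix A assume A: "A \<in> S"
      show "antipode f A = (\<Sum>a\<in>U. (if a \<in> T A then e A a else 0) * f a)"
        unfolding T(3)[OF A] using fU A by (intro sum.mono_neutral_cong_left) (auto simp: U_def)
    qed
    also have "\<dots> = (\<Sum>a\<in>U. d a * f a)"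
      unfolding d_def sum_distrib_left sum_distrib_right by (subst sum.swap) (simp add: algebra_simps)
    finally show ?thesis .
  qed
  hence "antipode_dual \<phi> = (\<lambda>f. if f \<in> Hall C then (\<Sum>a\<in>U. d a * f a) else 0)"
    by (auto simp: antipode_dual_def \<phi> antipode_Hall)
  thus ?thesis unfolding Hall_dual_iff by (intro exI[of _ U] exI[of _ d]) (simp add: fU)
qed

lemma antipode_dual_dual:
  assumes "\<phi> \<in> Hall_dual C"
  shows "antipode_dual (antipode_dual \<phi>) = \<phi>"
proof
  fix f
  have "\<phi> f = 0" if "f \<notin> Hall C" using assms that by (auto simp: Hall_dual_iff)
  thus "antipode_dual (antipode_dual \<phi>) f = \<phi> f"
    by (auto simp: antipode_dual_def antipode_Hall antipode_antipode_Hall)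
qed

text \<open>Here \<open>h\<close> is an arbitrary function, since it will be a convolution whose
  support is not controlled; for \<open>h\<close> in \<open>Hall C\<close> the statement would be
  immediate from the definition.\<close>

lemma antipode_dual_transpose:
  assumes \<phi>: "\<phi> \<in> Hall_dual C"
  shows "(\<Sum>B\<in>dual_supp C \<phi>. \<phi> (delta B) * antipode h B) =
    (\<Sum>B\<in>dual_supp C (antipode_dual \<phi>). antipode_dual \<phi> (delta B) * h B)"
proof -
  have "\<forall>B\<in>dual_supp C \<phi>. \<exists>T. finite T \<and> T \<subseteq> Iso C \<and>
      (\<forall>f g. (\<forall>a\<in>T. f a = g a) \<longrightarrow> antipode f B = antipode g B)"
  proof
    fix B assume "B \<in> dual_supp C \<phi>"
    hence "B \<in> Iso C" by (simp add: dual_supp_def)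
    then obtain T c where T: "finite T" "T \<subseteq> Iso C" "\<And>a. a \<in> T \<Longrightarrow> w B \<le> w a"
        "\<And>f. antipode f B = (\<Sum>a\<in>T. c a * f a)"
      by (rule antipode_matrixE) (rule that)
    have "antipode f B = antipode g B" if "\<forall>a\<in>T. f a = g a" for f g
      using that by (simp add: T(4) cong: sum.cong)
    thus "\<exists>T. finite T \<and> T \<subseteq> Iso C \<and>
      (\<forall>f g. (\<forall>a\<in>T. f a = g a) \<longrightarrow> antipode f B = antipode g B)"
      using T(1,2) by blast
  qed
  from bchoice[OF this] obtain T where T': "\<forall>B\<in>dual_supp C \<phi>. finite (T B) \<and> T B \<subseteq> Iso C \<and>
      (\<forall>f g. (\<forall>a\<in>T B. f a = g a) \<longrightarrow> antipode f B = antipode g B)" ..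
  have T: "finite (T B)" "T B \<subseteq> Iso C" "\<forall>a\<in>T B. f a = g a \<Longrightarrow> antipode f B = antipode g B"
    if "B \<in> dual_supp C \<phi>" for B f g
    using bspec[OF T' that] by (elim conjE; simp)+
  \<comment> \<open>Both sides see only the values of \<open>h\<close> on this finite set of
    classes, so \<open>h\<close> may be truncated to a member of \<open>Hall C\<close>.\<close>
  define U where "U = (\<Union>B\<in>dual_supp C \<phi>. T B) \<union> dual_supp C (antipode_dual \<phi>)"
  define h' where "h' a = (if a \<in> U then h a else 0)" for a
  have "finite U" "U \<subseteq> Iso C"
    using T(1,2) finite_dual_supp[OF \<phi>] finite_dual_supp[OF antipode_dual_in[OF \<phi>]]
    by (auto simp: U_def dual_supp_def)
  moreover have "{a. h' a \<noteq> 0} \<subseteq> U" by (auto simp: h'_def)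
  ultimately have h': "h' \<in> Hall C" using finite_subset[of _ U] by (simp add: Hall_def)
  have "(\<Sum>B\<in>dual_supp C \<phi>. \<phi> (delta B) * antipode h B) =
      (\<Sum>B\<in>dual_supp C \<phi>. \<phi> (delta B) * antipode h' B)"
    by (intro sum.cong refl arg_cong2[of _ _ _ _ times] T(3)) (auto simp: h'_def U_def)
  also have "\<dots> = antipode_dual \<phi> h'"
    using Hall_dual_expand[OF \<phi>, of "antipode h'"] by (simp add: antipode_dual_def h' antipode_Hall)
  also have "\<dots> = (\<Sum>B\<in>dual_supp C (antipode_dual \<phi>). antipode_dual \<phi> (delta B) * h' B)"
    using Hall_dual_expand[OF antipode_dual_in[OF \<phi>], of h'] by (simp add: h')
  also have "\<dots> = (\<Sum>B\<in>dual_supp C (antipode_dual \<phi>). antipode_dual \<phi> (delta B) * h B)"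
    by (intro sum.cong refl) (simp add: h'_def U_def)
  finally show ?thesis .
qed

theorem elim_iso_top_elim:
  "modules_isomorphic (prim C) (Hall_dual C) (elim C) (Hall_dual C) (top_elim C)"
  unfolding modules_isomorphic_def
proof (intro exI[of _ antipode_dual] conjI ballI allI)
  show "bij_betw antipode_dual (Hall_dual C) (Hall_dual C)"
    by (rule bij_betwI[where g = antipode_dual]) (auto simp: antipode_dual_in antipode_dual_dual)
  show "antipode_dual (\<lambda>x. f x + g x) = (\<lambda>y. antipode_dual f y + antipode_dual g y)" for f g
    by (auto simp: antipode_dual_def)
  show "antipode_dual (\<lambda>x. c * f x) = (\<lambda>y. c * antipode_dual f y)" for c f
    by (auto simp: antipode_dual_def)
  fix X \<phi> assume X: "X \<in> prim C" and \<phi>: "\<phi> \<in> Hall_dual C"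
  hence XH: "X \<in> Hall C" by (simp add: prim_def)
  show "antipode_dual (elim C X \<phi>) = top_elim C X (antipode_dual \<phi>)"
  proof
    fix f
    show "antipode_dual (elim C X \<phi>) f = top_elim C X (antipode_dual \<phi>) f"
    proof (cases "f \<in> Hall C")
      case True
      have "antipode_dual (elim C X \<phi>) f =
          - (\<Sum>B\<in>dual_supp C \<phi>. \<phi> (delta B) * conv X (antipode f) B)"
        by (simp add: antipode_dual_def True elim_eq[OF XH] antipode_Hall)
      also have "\<dots> = (\<Sum>B\<in>dual_supp C \<phi>. \<phi> (delta B) * antipode (conv f X) B)"
        unfolding sum_negf[symmetric]
        by (intro sum.cong refl)
          (simp add: dual_supp_def antipode_conv_primitive_right prim_primitive[OF X])
      also have "\<dots> = (\<Sum>B\<in>dual_supp C (antipode_dual \<phi>). antipode_dual \<phi> (delta B) * conv f X B)"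
        by (rule antipode_dual_transpose[OF \<phi>])
      also have "\<dots> = top_elim C X (antipode_dual \<phi>) f"
        by (simp add: top_elim_eq[OF XH] True)
      finally show ?thesis .
    qed (simp add: antipode_dual_def top_elim_eq[OF XH])
  qed
qed

end

section \<open>Combinatorial models of a Hall category\<close>

text \<open>
  Objects are described by combinatorial models in which a flag of subobjects \<open>U \<subseteq> W\<close> is
  literally the same as the subobject \<open>U\<close> together with the subobject \<open>W - U\<close> of the quotient.
\<close>

locale hall_model =
  fixes C :: "('o, 'n) hall_data" and models :: "'o \<Rightarrow> 'm \<Rightarrow> bool"
    and msubs :: "'m \<Rightarrow> 'u set set" and msub mquo :: "'m \<Rightarrow> 'u set \<Rightarrow> 'm" and mfull :: "'m \<Rightarrow> 'u set"
    and sz w :: "'o \<Rightarrow> nat"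
  assumes models_exists: "A \<in> Obj C \<Longrightarrow> \<exists>G. models A G"
    and iso_models: "A \<in> Obj C \<Longrightarrow> B \<in> Obj C \<Longrightarrow> models A G \<Longrightarrow> iso C A B \<longleftrightarrow> models B G"
    and models_subs: "A \<in> Obj C \<Longrightarrow> models A G \<Longrightarrow> \<exists>\<beta>. bij_betw \<beta> (Subs C A) (msubs G) \<and>
      (\<forall>S\<in>Subs C A. sub C A S \<in> Obj C \<and> quot C A S \<in> Obj C \<and>
        models (sub C A S) (msub G (\<beta> S)) \<and> models (quot C A S) (mquo G (\<beta> S)))"
    and finite_msubs: "A \<in> Obj C \<Longrightarrow> models A G \<Longrightarrow> finite (msubs G)"
    and flag_fwd: "A \<in> Obj C \<Longrightarrow> models A G \<Longrightarrow> W \<in> msubs G \<Longrightarrow> U \<in> msubs (msub G W) \<Longrightarrow>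
      U \<subseteq> W \<and> U \<in> msubs G \<and> W - U \<in> msubs (mquo G U)"
    and flag_bwd: "A \<in> Obj C \<Longrightarrow> models A G \<Longrightarrow> U \<in> msubs G \<Longrightarrow> W \<in> msubs (mquo G U) \<Longrightarrow>
      U \<inter> W = {} \<and> U \<union> W \<in> msubs G \<and> U \<in> msubs (msub G (U \<union> W))"
    and flag_eq: "A \<in> Obj C \<Longrightarrow> models A G \<Longrightarrow> W \<in> msubs G \<Longrightarrow> U \<in> msubs (msub G W) \<Longrightarrow>
      msub (msub G W) U = msub G U \<and> mquo (msub G W) U = msub (mquo G U) (W - U) \<and>
      mquo (mquo G U) (W - U) = mquo G W"
    and null_Obj: "null C \<in> Obj C"
    and empty_msubs: "A \<in> Obj C \<Longrightarrow> models A G \<Longrightarrow> {} \<in> msubs G \<and> mquo G {} = G"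
    and full_msubs: "A \<in> Obj C \<Longrightarrow> models A G \<Longrightarrow> mfull G \<in> msubs G \<and> msub G (mfull G) = G"
    and null_msub: "A \<in> Obj C \<Longrightarrow> models A G \<Longrightarrow> U \<in> msubs G \<Longrightarrow>
      models (null C) (msub G U) \<longleftrightarrow> U = {}"
    and null_mquo: "A \<in> Obj C \<Longrightarrow> models A G \<Longrightarrow> U \<in> msubs G \<Longrightarrow>
      models (null C) (mquo G U) \<longleftrightarrow> U = mfull G"
    and sz_iso: "A \<in> Obj C \<Longrightarrow> B \<in> Obj C \<Longrightarrow> iso C A B \<Longrightarrow> sz A = sz B"
    and sz_null: "sz (null C) = 0"
    and sz_sub: "A \<in> Obj C \<Longrightarrow> S \<in> Subs C A \<Longrightarrow> \<not> iso C (null C) (quot C A S) \<Longrightarrow> sz (sub C A S) < sz A"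
    and sz_quot: "A \<in> Obj C \<Longrightarrow> S \<in> Subs C A \<Longrightarrow> \<not> iso C (null C) (sub C A S) \<Longrightarrow> sz (quot C A S) < sz A"
    and w_iso: "A \<in> Obj C \<Longrightarrow> B \<in> Obj C \<Longrightarrow> iso C A B \<Longrightarrow> w A = w B"
    and w_subadditive: "A \<in> Obj C \<Longrightarrow> S \<in> Subs C A \<Longrightarrow> w A \<le> w (sub C A S) + w (quot C A S)"
    and w_bounded_finite: "finite (iso_class C ` {A \<in> Obj C. w A \<le> k})"
    and disj_exists: "A \<in> Obj C \<Longrightarrow> B \<in> Obj C \<Longrightarrow>
      \<exists>B' L. B' \<in> Obj C \<and> iso C B B' \<and> disj_union C A B' L"
    and disj_Obj: "A \<in> Obj C \<Longrightarrow> B \<in> Obj C \<Longrightarrow> disj_union C A B L \<Longrightarrow> L \<in> Obj C"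
    and disj_iso: "A \<in> Obj C \<Longrightarrow> B \<in> Obj C \<Longrightarrow> A' \<in> Obj C \<Longrightarrow> B' \<in> Obj C \<Longrightarrow>
      disj_union C A B L \<Longrightarrow> disj_union C A' B' L' \<Longrightarrow> iso C A A' \<Longrightarrow> iso C B B' \<Longrightarrow> iso C L L'"
    and disj_comm: "disj_union C A B L \<Longrightarrow> disj_union C B A L"
    and disj_assoc: "disj_union C A B L \<Longrightarrow> disj_union C L D K \<Longrightarrow>
      \<exists>N. disj_union C B D N \<and> disj_union C A N K"
    and disj_null: "disj_union C A (null C) A"
    and disj_eq_null: "A \<in> Obj C \<Longrightarrow> B \<in> Obj C \<Longrightarrow> disj_union C A B L \<Longrightarrow> iso C (null C) L \<Longrightarrow>
      iso C (null C) A"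
    and disj_w: "A \<in> Obj C \<Longrightarrow> B \<in> Obj C \<Longrightarrow> disj_union C A B L \<Longrightarrow> w L = w A + w B"
    and disj_subs: "A \<in> Obj C \<Longrightarrow> B \<in> Obj C \<Longrightarrow> disj_union C A B L \<Longrightarrow>
      \<exists>\<beta>. bij_betw \<beta> (Subs C A \<times> Subs C B) (Subs C L) \<and>
      (\<forall>S\<in>Subs C A. \<forall>T\<in>Subs C B.
         (\<exists>P. disj_union C (sub C A S) (sub C B T) P \<and> iso C P (sub C L (\<beta> (S, T)))) \<and>
         (\<exists>Q. disj_union C (quot C A S) (quot C B T) Q \<and> iso C Q (quot C L (\<beta> (S, T)))))"
begin

abbreviation cls where "cls \<equiv> iso_class C"

text \<open>Models name classes: the objects with a given model form one isomorphism class, so every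
  sum over subobjects can be evaluated inside a model.\<close>

definition mcls :: "'m \<Rightarrow> 'o set" where "mcls G = {A \<in> Obj C. models A G}"

definition good :: "'m \<Rightarrow> bool" where "good G \<longleftrightarrow> (\<exists>A\<in>Obj C. models A G)"

lemma cls_eq_mcls: "A \<in> Obj C \<Longrightarrow> models A G \<Longrightarrow> cls A = mcls G"
  using iso_models by (auto simp: iso_class_def mcls_def)

lemma iso_refl: "A \<in> Obj C \<Longrightarrow> iso C A A"
  using models_exists iso_models by blast

lemma iso_trans: "A \<in> Obj C \<Longrightarrow> B \<in> Obj C \<Longrightarrow> D \<in> Obj C \<Longrightarrow> iso C A B \<Longrightarrow> iso C B D \<Longrightarrow> iso C A D"
  using models_exists iso_models by metis

lemma cls_eq_iff: "A \<in> Obj C \<Longrightarrow> B \<in> Obj C \<Longrightarrow> cls A = cls B \<longleftrightarrow> iso C A B"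
proof
  assume "A \<in> Obj C" "B \<in> Obj C" "cls A = cls B"
  moreover from this have "B \<in> cls A" using iso_refl by (simp add: iso_class_def)
  ultimately show "iso C A B" unfolding iso_class_def by blast
next
  assume *: "A \<in> Obj C" "B \<in> Obj C" "iso C A B"
  then obtain G where "models A G" "models B G" using models_exists iso_models by blast
  thus "cls A = cls B" using cls_eq_mcls * by blast
qed

lemma cls_Iso: "A \<in> Obj C \<Longrightarrow> cls A \<in> Iso C"
  by (simp add: Iso_def)

lemma representative_in: "B \<in> Iso C \<Longrightarrow> representative B \<in> B"
  using iso_refl by (auto simp: Iso_def representative_def iso_class_def intro: someI2)

lemma representative_Obj: "B \<in> Iso C \<Longrightarrow> representative B \<in> Obj C"
  using representative_in by (auto simp: Iso_def iso_class_def)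

lemma cls_representative: "B \<in> Iso C \<Longrightarrow> cls (representative B) = B"
proof -
  assume B: "B \<in> Iso C"
  then obtain A where A: "A \<in> Obj C" "B = cls A" by (auto simp: Iso_def)
  hence "iso C A (representative B)" using representative_in[OF B] by (simp add: iso_class_def)
  thus ?thesis using A cls_eq_iff[OF A(1) representative_Obj[OF B]] by simp
qed

lemma good_Iso: "good G \<Longrightarrow> mcls G \<in> Iso C"
  using cls_eq_mcls cls_Iso by (metis good_def)

lemma Iso_good: "B \<in> Iso C \<Longrightarrow> \<exists>G. good G \<and> B = mcls G"
  using cls_eq_mcls models_exists unfolding Iso_def good_def by blast

lemma good_subs:
  assumes "good G" "U \<in> msubs G"
  shows "good (msub G U)" "good (mquo G U)"
proof -
  obtain A where A: "A \<in> Obj C" "models A G" using assms good_def by blast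
  obtain \<beta> where \<beta>: "bij_betw \<beta> (Subs C A) (msubs G)"
    "\<forall>S\<in>Subs C A. sub C A S \<in> Obj C \<and> quot C A S \<in> Obj C \<and>
        models (sub C A S) (msub G (\<beta> S)) \<and> models (quot C A S) (mquo G (\<beta> S))"
    using models_subs[OF A] by blast
  obtain S where S: "S \<in> Subs C A" "U = \<beta> S"
    using \<beta>(1) assms(2) by (auto simp: bij_betw_def)
  from bspec[OF \<beta>(2) S(1)] show "good (msub G U)" "good (mquo G U)"
    unfolding good_def S(2) by blast+
qed

lemma sum_Subs:
  assumes A: "A \<in> Obj C" "models A G"
  shows "(\<Sum>S\<in>Subs C A. F (cls (sub C A S)) (cls (quot C A S))) =
    (\<Sum>U\<in>msubs G. F (mcls (msub G U)) (mcls (mquo G U)))"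
proof -
  obtain \<beta> where \<beta>: "bij_betw \<beta> (Subs C A) (msubs G)"
    "\<forall>S\<in>Subs C A. sub C A S \<in> Obj C \<and> quot C A S \<in> Obj C \<and>
        models (sub C A S) (msub G (\<beta> S)) \<and> models (quot C A S) (mquo G (\<beta> S))"
    using models_subs[OF A] by blast
  have "(\<Sum>U\<in>msubs G. F (mcls (msub G U)) (mcls (mquo G U))) =
      (\<Sum>S\<in>Subs C A. F (mcls (msub G (\<beta> S))) (mcls (mquo G (\<beta> S))))"
    by (rule sum.reindex_bij_betw[OF \<beta>(1), symmetric])
  also have "\<dots> = (\<Sum>S\<in>Subs C A. F (cls (sub C A S)) (cls (quot C A S)))"
  proof (rule sum.cong[OF refl])
    fix S assume "S \<in> Subs C A"
    from bspec[OF \<beta>(2) this]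
    show "F (mcls (msub G (\<beta> S))) (mcls (mquo G (\<beta> S))) = F (cls (sub C A S)) (cls (quot C A S))"
      using cls_eq_mcls[of "sub C A S"] cls_eq_mcls[of "quot C A S"] by metis
  qed
  finally show ?thesis ..
qed

lemma models_representative:
  assumes "good G"
  shows "representative (mcls G) \<in> Obj C \<and> models (representative (mcls G)) G"
  using representative_in[OF good_Iso[OF assms]] by (simp add: mcls_def)

lemma sum_mcls:
  assumes "good G"
  shows "(\<Sum>S\<in>Subs C (representative (mcls G)). F (cls (sub C (representative (mcls G)) S))
      (cls (quot C (representative (mcls G)) S))) =
    (\<Sum>U\<in>msubs G. F (mcls (msub G U)) (mcls (mquo G U)))"
  using sum_Subs models_representative[OF assms] by blast

lemma finite_Subs:
  assumes "A \<in> Obj C"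
  shows "finite (Subs C A)"
proof -
  obtain G where G: "models A G" using models_exists[OF assms] by blast
  obtain \<beta> where "bij_betw \<beta> (Subs C A) (msubs G)" using models_subs[OF assms G] by blast
  thus ?thesis using finite_msubs[OF assms G] bij_betw_finite by blast
qed

lemma sub_quot_Obj:
  assumes "A \<in> Obj C" "S \<in> Subs C A"
  shows sub_Obj: "sub C A S \<in> Obj C" and quot_Obj: "quot C A S \<in> Obj C"
proof -
  obtain G where G: "models A G" using models_exists[OF assms(1)] by blast
  show "sub C A S \<in> Obj C" "quot C A S \<in> Obj C" using models_subs[OF assms(1) G] assms(2) by blast+
qed

text \<open>Both sides sum over flags, recorded as (W, U) on the left and as (U, W - U) on the
  right. The three layers agree as models and not merely up to isomorphism, so the reindexing needs
  no further choices.\<close>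

lemma coassociative:
  assumes G: "good G"
  shows "(\<Sum>W\<in>msubs G. \<Sum>U\<in>msubs (msub G W). F (mcls (msub (msub G W) U)) (mcls (mquo (msub G W) U)) (mcls (mquo G W))) =
    (\<Sum>U\<in>msubs G. \<Sum>W\<in>msubs (mquo G U). F (mcls (msub G U)) (mcls (msub (mquo G U) W)) (mcls (mquo (mquo G U) W)) :: rat)"
proof -
  obtain A where A: "A \<in> Obj C" "models A G" using G good_def by blast
  have fin: "finite (msubs H)" if "good H" for H using that finite_msubs good_def by blast
  let ?P = "SIGMA W:msubs G. msubs (msub G W)" and ?Q = "SIGMA U:msubs G. msubs (mquo G U)"
  have "(\<Sum>W\<in>msubs G. \<Sum>U\<in>msubs (msub G W). F (mcls (msub (msub G W) U)) (mcls (mquo (msub G W) U)) (mcls (mquo G W))) =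
     (\<Sum>(W, U)\<in>?P. F (mcls (msub (msub G W) U)) (mcls (mquo (msub G W) U)) (mcls (mquo G W)))"
    using fin G good_subs by (intro sum.Sigma) auto
  also have "\<dots> = (\<Sum>(U, W)\<in>?Q. F (mcls (msub G U)) (mcls (msub (mquo G U) W)) (mcls (mquo (mquo G U) W)))"
  proof (rule sum.reindex_bij_witness[where i = "\<lambda>(U, W). (U \<union> W, U)" and j = "\<lambda>(W, U). (U, W - U)"])
    fix x assume x: "x \<in> ?P"
    obtain W U where [simp]: "x = (W, U)" by (cases x)
    have W: "W \<in> msubs G" "U \<in> msubs (msub G W)" using x by auto
    note fl = flag_fwd[OF A W]
    show "(case case x of (W, U) \<Rightarrow> (U, W - U) of (U, W) \<Rightarrow> (U \<union> W, U)) = x" using fl by auto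
    show "(case x of (W, U) \<Rightarrow> (U, W - U)) \<in> ?Q" using fl by auto
    show "(case case x of (W, U) \<Rightarrow> (U, W - U) of (U, W) \<Rightarrow>
        F (mcls (msub G U)) (mcls (msub (mquo G U) W)) (mcls (mquo (mquo G U) W))) =
      (case x of (W, U) \<Rightarrow> F (mcls (msub (msub G W) U)) (mcls (mquo (msub G W) U)) (mcls (mquo G W)))"
      using flag_eq[OF A W] by simp
  next
    fix x assume x: "x \<in> ?Q"
    obtain U W where [simp]: "x = (U, W)" by (cases x)
    have W: "U \<in> msubs G" "W \<in> msubs (mquo G U)" using x by auto
    note fl = flag_bwd[OF A W]
    show "(case case x of (U, W) \<Rightarrow> (U \<union> W, U) of (W, U) \<Rightarrow> (U, W - U)) = x" using fl by auto
    show "(case x of (U, W) \<Rightarrow> (U \<union> W, U)) \<in> ?P" using fl by auto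
  qed
  also have "\<dots> = (\<Sum>U\<in>msubs G. \<Sum>W\<in>msubs (mquo G U). F (mcls (msub G U)) (mcls (msub (mquo G U) W)) (mcls (mquo (mquo G U) W)))"
    using fin G good_subs by (intro sum.Sigma[symmetric]) auto
  finally show ?thesis .
qed

text \<open>\<open>class_sum\<close> ranges over all disjointly labeled pairs of representatives;
  \<open>disj_iso\<close> says that they all give the same class.\<close>

lemma class_sum_cls:
  assumes A: "A \<in> Obj C" and B: "B \<in> Obj C" and L: "disj_union C A B L"
  shows "class_sum C (cls A) (cls B) = cls L"
proof
  have LO: "L \<in> Obj C" using disj_Obj assms by blast
  show "class_sum C (cls A) (cls B) \<subseteq> cls L"
  proof
    fix K assume "K \<in> class_sum C (cls A) (cls B)"
    then obtain A' B' L' where K: "K \<in> Obj C" "A' \<in> Obj C" "iso C A A'" "B' \<in> Obj C" "iso C B B'"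
      "disj_union C A' B' L'" "iso C L' K" by (auto simp: class_sum_def iso_class_def)
    hence "iso C L L'" "L' \<in> Obj C" using disj_iso[OF A B] disj_Obj L by blast+
    hence "iso C L K" using iso_trans K LO by blast
    thus "K \<in> cls L" using K by (simp add: iso_class_def)
  qed
  show "cls L \<subseteq> class_sum C (cls A) (cls B)"
    using iso_refl A B L by (auto simp: class_sum_def iso_class_def)
qed

text \<open>Only the second summand is relabeled. Keeping the first one fixed allows iterated sums
  to be built on the same objects, as associativity requires.\<close>

lemma class_sum_ex:
  assumes "M \<in> Iso C" "N \<in> Iso C" and A: "A \<in> Obj C" "M = cls A"
  shows "\<exists>B L. B \<in> Obj C \<and> N = cls B \<and> L \<in> Obj C \<and> disj_union C A B L \<and> class_sum C M N = cls L"
proof -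
  obtain B0 where B0: "B0 \<in> Obj C" "N = cls B0" using assms(2) by (auto simp: Iso_def)
  obtain B L where B: "B \<in> Obj C" "iso C B0 B" "disj_union C A B L"
    using disj_exists[OF A(1) B0(1)] by blast
  have "N = cls B" using B B0 cls_eq_iff by simp
  thus ?thesis using class_sum_cls[OF A(1) B(1,3)] B A disj_Obj by blast
qed

lemma cls_null_iff: "A \<in> Obj C \<Longrightarrow> cls A = cls (null C) \<longleftrightarrow> iso C (null C) A"
  using cls_eq_iff[OF null_Obj] by metis

lemma mcls_null_iff: "good G \<Longrightarrow> mcls G = cls (null C) \<longleftrightarrow> models (null C) G"
  using cls_eq_mcls[OF null_Obj] null_Obj iso_refl[OF null_Obj]
  by (auto simp: mcls_def iso_class_def)

text \<open>The monoid laws are checked on objects with disjoint labels; the counit and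
  coassociativity laws are checked in models, where subobjects are sets.\<close>

sublocale hall_bialgebra C "\<lambda>B. sz (representative B)" "\<lambda>B. w (representative B)"
proof unfold_locales
  fix B assume B: "B \<in> Iso C"
  let ?R = "representative B"
  note RO = representative_Obj[OF B]
  show "finite (Subs C ?R)" using finite_Subs RO .
  fix n assume n: "n \<in> Subs C ?R"
  show "cls (sub C ?R n) \<in> Iso C" "cls (quot C ?R n) \<in> Iso C"
    using sub_Obj quot_Obj RO n by (auto intro: cls_Iso)
  have S: "sub C ?R n \<in> Obj C" and Q: "quot C ?R n \<in> Obj C" using sub_Obj quot_Obj RO n by auto
  have rep: "iso C D (representative (cls D))" "representative (cls D) \<in> Obj C" if "D \<in> Obj C" for D
    using that cls_representative cls_Iso cls_eq_iff representative_Obj by metis+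
  show "cls (quot C ?R n) \<noteq> cls (null C) \<Longrightarrow> sz (representative (cls (sub C ?R n))) < sz ?R"
    using sz_iso[OF S rep(2)[OF S] rep(1)[OF S]] sz_sub[OF RO n] cls_null_iff[OF Q] by simp
  show "cls (sub C ?R n) \<noteq> cls (null C) \<Longrightarrow> sz (representative (cls (quot C ?R n))) < sz ?R"
    using sz_iso[OF Q rep(2)[OF Q] rep(1)[OF Q]] sz_quot[OF RO n] cls_null_iff[OF S] by simp
  show "w ?R \<le> w (representative (cls (sub C ?R n))) + w (representative (cls (quot C ?R n)))"
    using w_iso[OF S rep(2)[OF S] rep(1)[OF S]] w_iso[OF Q rep(2)[OF Q] rep(1)[OF Q]]
      w_subadditive[OF RO n] by simp
next
  show "cls (null C) \<in> Iso C" using cls_Iso null_Obj .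
  fix A B assume A: "A \<in> Iso C" and B: "B \<in> Iso C"
  obtain a where a: "a \<in> Obj C" "A = cls a" using A by (auto simp: Iso_def)
  obtain b L where b: "b \<in> Obj C" "B = cls b" "L \<in> Obj C" "disj_union C a b L" "class_sum C A B = cls L"
    using class_sum_ex[OF A B a] by blast
  show "class_sum C A B \<in> Iso C" using b cls_Iso by simp
  show comm: "class_sum C A B = class_sum C B A"
    using class_sum_cls[OF b(1) a(1) disj_comm[OF b(4)]] a b by simp
  show "class_sum C A (cls (null C)) = A"
    using class_sum_cls[OF a(1) null_Obj disj_null] a by simp
  show "class_sum C A B = cls (null C) \<Longrightarrow> A = cls (null C)"
    using b a disj_eq_null[OF a(1) b(1,4)] cls_null_iff[OF b(3)] cls_null_iff[OF a(1)] by metis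
  have rep: "iso C D (representative (cls D))" "representative (cls D) \<in> Obj C" if "D \<in> Obj C" for D
    using that cls_representative cls_Iso cls_eq_iff representative_Obj by metis+
  show "w (representative (class_sum C A B)) = w (representative A) + w (representative B)"
    using disj_w[OF a(1) b(1,4)] w_iso[OF _ rep(2) rep(1)] a b by simp
  fix D assume D: "D \<in> Iso C"
  obtain d K where d: "d \<in> Obj C" "D = cls d" "K \<in> Obj C" "disj_union C L d K" "class_sum C (cls L) D = cls K"
    using class_sum_ex[OF cls_Iso[OF b(3)] D b(3) refl] by blast
  obtain N where N: "disj_union C b d N" "disj_union C a N K"
    using disj_assoc[OF b(4) d(4)] by blast
  have NO: "N \<in> Obj C" using disj_Obj N b d by blast
  have "class_sum C B D = cls N" using class_sum_cls b d N by simp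
  thus "class_sum C (class_sum C A B) D = class_sum C A (class_sum C B D)"
    using class_sum_cls[OF a(1) NO N(2)] a b d by simp
next
  fix B and F :: "'o set \<Rightarrow> 'o set \<Rightarrow> 'o set \<Rightarrow> rat" assume B: "B \<in> Iso C"
  obtain G where G: "good G" and BG: "B = mcls G" using Iso_good[OF B] by blast
  let ?l = "\<lambda>B N. cls (sub C (representative B) N)" and ?r = "\<lambda>B N. cls (quot C (representative B) N)"
  have "(\<Sum>n\<in>Subs C (representative B). \<Sum>k\<in>Subs C (representative (?l B n)). F (?l (?l B n) k) (?r (?l B n) k) (?r B n)) =
     (\<Sum>W\<in>msubs G. \<Sum>k\<in>Subs C (representative (mcls (msub G W))). F (?l (mcls (msub G W)) k) (?r (mcls (msub G W)) k) (mcls (mquo G W)))"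
    unfolding BG
    by (rule sum_mcls[OF G, of "\<lambda>x y. \<Sum>k\<in>Subs C (representative x). F (?l x k) (?r x k) y"])
  also have "\<dots> = (\<Sum>W\<in>msubs G. \<Sum>U\<in>msubs (msub G W). F (mcls (msub (msub G W) U)) (mcls (mquo (msub G W) U)) (mcls (mquo G W)))"
    by (rule sum.cong[OF refl]) (rule sum_mcls[OF good_subs(1)[OF G]])
  also have "\<dots> = (\<Sum>U\<in>msubs G. \<Sum>W\<in>msubs (mquo G U). F (mcls (msub G U)) (mcls (msub (mquo G U) W)) (mcls (mquo (mquo G U) W)))"
    by (rule coassociative[OF G])
  also have "\<dots> = (\<Sum>U\<in>msubs G. \<Sum>k\<in>Subs C (representative (mcls (mquo G U))). F (mcls (msub G U)) (?l (mcls (mquo G U)) k) (?r (mcls (mquo G U)) k))"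
    by (rule sum.cong[OF refl]) (rule sum_mcls[OF good_subs(2)[OF G], symmetric])
  also have "\<dots> = (\<Sum>n\<in>Subs C (representative B). \<Sum>k\<in>Subs C (representative (?r B n)). F (?l B n) (?l (?r B n) k) (?r (?r B n) k))"
    unfolding BG
    by (rule sum_mcls[OF G, of "\<lambda>x y. \<Sum>k\<in>Subs C (representative y). F x (?l y k) (?r y k)", symmetric])
  finally show "(\<Sum>n\<in>Subs C (representative B). \<Sum>k\<in>Subs C (representative (?l B n)). F (?l (?l B n) k) (?r (?l B n) k) (?r B n)) =
    (\<Sum>n\<in>Subs C (representative B). \<Sum>k\<in>Subs C (representative (?r B n)). F (?l B n) (?l (?r B n) k) (?r (?r B n) k))" .
next
  fix B and K :: "'o set \<Rightarrow> rat" assume B: "B \<in> Iso C"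
  obtain G where G: "good G" and BG: "B = mcls G" using Iso_good[OF B] by blast
  obtain A where A: "A \<in> Obj C" "models A G" using G good_def by blast
  let ?l = "\<lambda>B N. cls (sub C (representative B) N)" and ?r = "\<lambda>B N. cls (quot C (representative B) N)"
  have fin: "finite (msubs G)" using finite_msubs A .
  have "(\<Sum>n\<in>Subs C (representative B). if ?l B n = cls (null C) then K (?r B n) else 0) =
     (\<Sum>U\<in>msubs G. if mcls (msub G U) = cls (null C) then K (mcls (mquo G U)) else 0)"
    unfolding BG by (rule sum_mcls[OF G, of "\<lambda>x y. if x = cls (null C) then K y else 0"])
  also have "\<dots> = (\<Sum>U\<in>msubs G. if U = {} then K (mcls (mquo G U)) else 0)"
    by (intro sum.cong refl) (simp add: mcls_null_iff good_subs[OF G] null_msub[OF A])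
  also have "\<dots> = K B" using fin empty_msubs[OF A] by (simp add: BG)
  finally show "(\<Sum>n\<in>Subs C (representative B). if ?l B n = cls (null C) then K (?r B n) else 0) = K B" .
  have "(\<Sum>n\<in>Subs C (representative B). if ?r B n = cls (null C) then K (?l B n) else 0) =
     (\<Sum>U\<in>msubs G. if mcls (mquo G U) = cls (null C) then K (mcls (msub G U)) else 0)"
    unfolding BG by (rule sum_mcls[OF G, of "\<lambda>x y. if y = cls (null C) then K x else 0"])
  also have "\<dots> = (\<Sum>U\<in>msubs G. if U = mfull G then K (mcls (msub G U)) else 0)"
    by (intro sum.cong refl) (simp add: mcls_null_iff good_subs[OF G] null_mquo[OF A])
  also have "\<dots> = K B" using fin full_msubs[OF A] by (simp add: BG)
  finally show "(\<Sum>n\<in>Subs C (representative B). if ?r B n = cls (null C) then K (?l B n) else 0) = K B" .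
next
  fix A B and K :: "'o set \<Rightarrow> 'o set \<Rightarrow> rat" assume A: "A \<in> Iso C" and B: "B \<in> Iso C"
  let ?l = "\<lambda>B N. cls (sub C (representative B) N)" and ?r = "\<lambda>B N. cls (quot C (representative B) N)"
  \<comment> \<open>A sum over subobjects depends only on the class. Sums over the chosen
    representatives may thus be computed in \<open>a\<close>, \<open>b\<close> and \<open>L\<close>,
    where \<open>disj_subs\<close> applies.\<close>
  have any: "(\<Sum>n\<in>Subs C (representative (cls D)). K' (?l (cls D) n) (?r (cls D) n)) =
      (\<Sum>n\<in>Subs C D. (K' (cls (sub C D n)) (cls (quot C D n)) :: rat))" if D: "D \<in> Obj C" for D K'
  proof -
    obtain G where G: "models D G" using models_exists[OF D] by blast
    hence "good G" "cls D = mcls G" using D cls_eq_mcls good_def by blast+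
    thus ?thesis using sum_mcls[of G K'] sum_Subs[OF D G, of K'] by simp
  qed
  obtain a where a: "a \<in> Obj C" "A = cls a" using A by (auto simp: Iso_def)
  obtain b L where b: "b \<in> Obj C" "B = cls b" "L \<in> Obj C" "disj_union C a b L" "class_sum C A B = cls L"
    using class_sum_ex[OF A B a] by blast
  obtain \<beta> where \<beta>: "bij_betw \<beta> (Subs C a \<times> Subs C b) (Subs C L)"
    "\<forall>S\<in>Subs C a. \<forall>T\<in>Subs C b.
         (\<exists>P. disj_union C (sub C a S) (sub C b T) P \<and> iso C P (sub C L (\<beta> (S, T)))) \<and>
         (\<exists>Q. disj_union C (quot C a S) (quot C b T) Q \<and> iso C Q (quot C L (\<beta> (S, T))))"
    using disj_subs[OF a(1) b(1,4)] by blast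
  have \<beta>_sums: "class_sum C (cls (sub C a S)) (cls (sub C b T)) = cls (sub C L (\<beta> (S, T)))"
      "class_sum C (cls (quot C a S)) (cls (quot C b T)) = cls (quot C L (\<beta> (S, T)))"
    if S: "S \<in> Subs C a" and T: "T \<in> Subs C b" for S T
  proof -
    have N: "\<beta> (S, T) \<in> Subs C L" using bij_betwE[OF \<beta>(1)] S T by blast
    note \<beta>ST = bspec[OF bspec[OF \<beta>(2) S] T]
    obtain P where P: "disj_union C (sub C a S) (sub C b T) P" "iso C P (sub C L (\<beta> (S, T)))"
      using \<beta>ST by blast
    note O = sub_Obj[OF a(1) S] sub_Obj[OF b(1) T]
    show "class_sum C (cls (sub C a S)) (cls (sub C b T)) = cls (sub C L (\<beta> (S, T)))"
      using class_sum_cls[OF O P(1)] cls_eq_iff[OF disj_Obj[OF O P(1)] sub_Obj[OF b(3) N]] P(2) by simp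
    obtain Q where Q: "disj_union C (quot C a S) (quot C b T) Q" "iso C Q (quot C L (\<beta> (S, T)))"
      using \<beta>ST by blast
    note O = quot_Obj[OF a(1) S] quot_Obj[OF b(1) T]
    show "class_sum C (cls (quot C a S)) (cls (quot C b T)) = cls (quot C L (\<beta> (S, T)))"
      using class_sum_cls[OF O Q(1)] cls_eq_iff[OF disj_Obj[OF O Q(1)] quot_Obj[OF b(3) N]] Q(2) by simp
  qed
  have "(\<Sum>n\<in>Subs C (representative (class_sum C A B)). K (?l (class_sum C A B) n) (?r (class_sum C A B) n)) =
      (\<Sum>n\<in>Subs C L. K (cls (sub C L n)) (cls (quot C L n)))"
    unfolding b(5) by (rule any[OF b(3)])
  also have "\<dots> = (\<Sum>x\<in>Subs C a \<times> Subs C b. K (cls (sub C L (\<beta> x))) (cls (quot C L (\<beta> x))))"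
    by (rule sum.reindex_bij_betw[OF \<beta>(1), symmetric])
  also have "\<dots> = (\<Sum>(S, T)\<in>Subs C a \<times> Subs C b. K (class_sum C (cls (sub C a S)) (cls (sub C b T)))
      (class_sum C (cls (quot C a S)) (cls (quot C b T))))"
    by (intro sum.cong refl) (auto simp: \<beta>_sums)
  also have "\<dots> = (\<Sum>S\<in>Subs C a. \<Sum>T\<in>Subs C b. K (class_sum C (cls (sub C a S)) (cls (sub C b T)))
      (class_sum C (cls (quot C a S)) (cls (quot C b T))))"
    by (simp add: sum.cartesian_product)
  also have "\<dots> = (\<Sum>n\<in>Subs C (representative A). \<Sum>T\<in>Subs C b. K (class_sum C (?l A n) (cls (sub C b T)))
      (class_sum C (?r A n) (cls (quot C b T))))"
    unfolding a(2)
    by (rule any[OF a(1), symmetric, of "\<lambda>x y. \<Sum>T\<in>Subs C b. K (class_sum C x (cls (sub C b T))) (class_sum C y (cls (quot C b T)))"])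
  also have "\<dots> = (\<Sum>n\<in>Subs C (representative A). \<Sum>k\<in>Subs C (representative B). K (class_sum C (?l A n) (?l B k))
      (class_sum C (?r A n) (?r B k)))"
    unfolding b(2)
    by (rule sum.cong[OF refl], rule any[OF b(1), symmetric, of "\<lambda>x y. K (class_sum C (?l A _) x) (class_sum C (?r A _) y)"])
  finally show "(\<Sum>n\<in>Subs C (representative (class_sum C A B)). K (?l (class_sum C A B) n) (?r (class_sum C A B) n)) =
    (\<Sum>n\<in>Subs C (representative A). \<Sum>k\<in>Subs C (representative B). K (class_sum C (?l A n) (?l B k))
      (class_sum C (?r A n) (?r B k)))" .
next
  have rep: "iso C D (representative (cls D))" "representative (cls D) \<in> Obj C" if "D \<in> Obj C" for D
    using that cls_representative cls_Iso cls_eq_iff representative_Obj by metis+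
  show "sz (representative (cls (null C))) = 0"
    using sz_iso[OF null_Obj rep(2)[OF null_Obj] rep(1)[OF null_Obj]] sz_null by simp
  fix k
  have "{B \<in> Iso C. w (representative B) \<le> k} \<subseteq> cls ` {A \<in> Obj C. w A \<le> k}"
    using representative_Obj cls_representative by (auto intro!: image_eqI[OF sym])
  thus "finite {B \<in> Iso C. w (representative B) \<le> k}"
    using w_bounded_finite finite_subset by blast
qed

end

section \<open>Graphs with bivalent and trivalent vertices\<close>

text \<open>
  The vertices are the classes of the equivalence relation \<open>blk\<close> on half-edges; \<open>lnk\<close> is the symmetric
  relation of adjacency.  The subobject given by a set \<open>U\<close> of links keeps all vertices; the ones
  not met by \<open>U\<close> become free.  The quotient by \<open>U\<close> turns each connected component of it into a
  vertex, whose half-edges are the external ones of the component.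
\<close>

record 'h leg_graph =
  legs :: "'h set"
  blk :: "('h \<times> 'h) set"
  lnk :: "('h \<times> 'h) set"

definition wf_leg :: "'h leg_graph \<Rightarrow> bool" where
  "wf_leg G \<longleftrightarrow> finite (legs G) \<and> equiv (legs G) (blk G) \<and>
     lnk G \<subseteq> legs G \<times> legs G \<and> sym (lnk G) \<and> irrefl (lnk G) \<and> single_valued (lnk G)"

definition conn :: "'h leg_graph \<Rightarrow> ('h \<times> 'h) set" where
  "conn G = (blk G \<union> lnk G)\<^sup>*"

definition free :: "'h leg_graph \<Rightarrow> 'h set" where
  "free G = legs G - Domain (lnk G)"

text \<open>The conditions on Feynman graphs minus the one on loops. The last clause forbids a
  bivalent vertex with one free and one linked leg, which could not be smoothed; for contractions it
  becomes the condition \<open>quotient_defined\<close>.\<close>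

definition valid_leg :: "'h leg_graph \<Rightarrow> bool" where
  "valid_leg G \<longleftrightarrow> wf_leg G \<and> (\<forall>x\<in>legs G. card (blk G `` {x}) \<in> {2, 3}) \<and>
     (\<forall>x\<in>legs G. card (conn G `` {x} \<inter> free G) \<in> {2, 3}) \<and>
     (\<forall>x\<in>free G. card (blk G `` {x}) = 2 \<longrightarrow> blk G `` {x} \<subseteq> free G)"

definition lsub :: "'h leg_graph \<Rightarrow> ('h \<times> 'h) set \<Rightarrow> 'h leg_graph" where
  "lsub G U = \<lparr>legs = legs G, blk = blk G, lnk = U\<rparr>"

definition lquo :: "'h leg_graph \<Rightarrow> ('h \<times> 'h) set \<Rightarrow> 'h leg_graph" where
  "lquo G U = (let L = legs G - Domain U in
     \<lparr>legs = L, blk = (blk G \<union> U)\<^sup>* \<inter> L \<times> L, lnk = lnk G - U\<rparr>)"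

text \<open>Validity of the contraction is demanded separately because a subgraph with valid
  components need not have a defined quotient.\<close>

definition lsubs :: "'h leg_graph \<Rightarrow> ('h \<times> 'h) set set" where
  "lsubs G = {U. U \<subseteq> lnk G \<and> sym U \<and> valid_leg (lsub G U) \<and> valid_leg (lquo G U)}"

lemma lsub_simps [simp]: "legs (lsub G U) = legs G" "blk (lsub G U) = blk G" "lnk (lsub G U) = U"
  by (simp_all add: lsub_def)

lemma lquo_simps [simp]: "legs (lquo G U) = legs G - Domain U"
  "lnk (lquo G U) = lnk G - U"
  by (simp_all add: lquo_def Let_def)

lemma lquo_blk: "blk (lquo G U) = (blk G \<union> U)\<^sup>* \<inter> (legs G - Domain U) \<times> (legs G - Domain U)"
  by (simp add: lquo_def Let_def)

lemma conn_lsub: "conn (lsub G U) = (blk G \<union> U)\<^sup>*"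
  by (simp add: conn_def)

lemma free_lsub: "free (lsub G U) = legs G - Domain U"
  by (simp add: free_def)

lemma sym_conn: "wf_leg G \<Longrightarrow> sym (conn G)"
  unfolding conn_def wf_leg_def equiv_def by (intro sym_rtrancl) (auto simp: sym_def)

lemma conn_trans: "(x, y) \<in> conn G \<Longrightarrow> (y, u) \<in> conn G \<Longrightarrow> (x, u) \<in> conn G"
  unfolding conn_def by (rule rtrancl_trans)

lemma conn_refl [simp]: "(x, x) \<in> conn G"
  by (simp add: conn_def)

lemma wf_legD:
  assumes "wf_leg G"
  shows blk_legs: "(x, y) \<in> blk G \<Longrightarrow> x \<in> legs G \<and> y \<in> legs G"
    and blk_refl: "x \<in> legs G \<Longrightarrow> (x, x) \<in> blk G"
    and blk_sym: "(x, y) \<in> blk G \<Longrightarrow> (y, x) \<in> blk G"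
    and blk_trans: "(x, y) \<in> blk G \<Longrightarrow> (y, u) \<in> blk G \<Longrightarrow> (x, u) \<in> blk G"
    and lnk_legs: "(x, y) \<in> lnk G \<Longrightarrow> x \<in> legs G \<and> y \<in> legs G"
    and lnk_sym: "(x, y) \<in> lnk G \<Longrightarrow> (y, x) \<in> lnk G"
    and lnk_unique: "(x, y) \<in> lnk G \<Longrightarrow> (x, u) \<in> lnk G \<Longrightarrow> y = u"
    and lnk_irrefl: "(x, x) \<notin> lnk G"
    and finite_legs: "finite (legs G)"
  using assms unfolding wf_leg_def equiv_def refl_on_def
  by (auto dest: symD transD single_valuedD irreflD)

lemma conn_legs:
  assumes "wf_leg G" "(x, y) \<in> conn G" "x \<in> legs G"
  shows "y \<in> legs G"
  using assms(2) unfolding conn_def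
proof (induction rule: rtrancl_induct)
  case (step y z)
  thus ?case using blk_legs[OF assms(1)] lnk_legs[OF assms(1)] by auto
qed (rule assms(3))

lemma conn_class_eq: "wf_leg G \<Longrightarrow> (x, y) \<in> conn G \<Longrightarrow> conn G `` {x} = conn G `` {y}"
  using conn_trans[of _ _ G] symD[OF sym_conn[of G], of x y] by blast

lemma wf_lsub: "wf_leg G \<Longrightarrow> U \<subseteq> lnk G \<Longrightarrow> sym U \<Longrightarrow> wf_leg (lsub G U)"
  unfolding wf_leg_def using single_valued_subset[of U "lnk G"] by (auto simp: irrefl_def)

text \<open>Links form a matching, so a link outside \<open>U\<close> shares no end with a link of
  \<open>U\<close>; both of its legs survive contraction.\<close>

lemma link_unique:
  assumes "wf_leg G" "U \<subseteq> lnk G" "sym U" "(a, b) \<in> lnk G" "(a, b) \<notin> U"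
  shows "a \<in> legs G - Domain U" "b \<in> legs G - Domain U"
proof -
  have sv: "single_valued (lnk G)" and sym: "sym (lnk G)" and L: "lnk G \<subseteq> legs G \<times> legs G"
    using assms(1) by (auto simp: wf_leg_def)
  have "(a, c) \<notin> U" for c using assms sv by (metis single_valuedD subsetD)
  moreover have "(b, c) \<notin> U" for c
    using assms sv sym by (metis single_valuedD subsetD symD)
  ultimately show "a \<in> legs G - Domain U" "b \<in> legs G - Domain U" using L assms(4) by auto
qed

lemma wf_lquo:
  assumes G: "wf_leg G" and U: "U \<subseteq> lnk G" "sym U"
  shows "wf_leg (lquo G U)"
proof -
  have "sym ((blk G \<union> U)\<^sup>*)" using sym_conn[OF wf_lsub[OF assms]] by (simp add: conn_lsub)
  hence "equiv (legs (lquo G U)) (blk (lquo G U))"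
    unfolding equiv_def lquo_blk by (auto simp: refl_on_def sym_def trans_def intro: rtrancl_trans)
  moreover have "lnk G - U \<subseteq> (legs G - Domain U) \<times> (legs G - Domain U)"
  proof
    fix e assume "e \<in> lnk G - U"
    thus "e \<in> (legs G - Domain U) \<times> (legs G - Domain U)"
      using link_unique[OF assms] by (cases e) blast
  qed
  moreover have "sym (lnk G - U)" using G U by (auto simp: wf_leg_def sym_def)
  ultimately show ?thesis using G single_valued_subset[of "lnk G - U" "lnk G"]
    by (auto simp: wf_leg_def irrefl_def)
qed

text \<open>
  A path using links of \<^term>\<open>W\<close> between legs not used by \<^term>\<open>U\<close> can be cut into paths
  inside the contracted blocks and links of \<^term>\<open>W - U\<close>.
\<close>

lemma contracted_path:
  assumes G: "wf_leg G" and W: "W \<subseteq> lnk G" and U: "U \<subseteq> W" "sym U"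
    and ab: "a \<in> legs G - Domain U" "b \<in> legs G - Domain U"
  shows "(a, b) \<in> (blk (lquo G U) \<union> (W - U))\<^sup>* \<longleftrightarrow> (a, b) \<in> (blk G \<union> W)\<^sup>*"
proof
  let ?M = "blk (lquo G U) \<union> (W - U)"
  have "?M \<subseteq> (blk G \<union> W)\<^sup>*"
  proof -
    have "(blk G \<union> U)\<^sup>* \<subseteq> (blk G \<union> W)\<^sup>*" using U by (intro rtrancl_mono) auto
    thus ?thesis by (auto simp: lquo_blk)
  qed
  thus "(a, b) \<in> ?M\<^sup>* \<Longrightarrow> (a, b) \<in> (blk G \<union> W)\<^sup>*"
    by (metis rtrancl_mono rtrancl_idemp subsetD)
  assume "(a, b) \<in> (blk G \<union> W)\<^sup>*"
  hence "\<exists>c\<in>legs G - Domain U. (a, c) \<in> ?M\<^sup>* \<and> (c, b) \<in> (blk G \<union> U)\<^sup>*"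
  proof (induction rule: rtrancl_induct)
    case base
    show ?case using ab(1) by blast
  next
    case (step b d)
    then obtain c where c: "c \<in> legs G - Domain U" "(a, c) \<in> ?M\<^sup>*" "(c, b) \<in> (blk G \<union> U)\<^sup>*" by blast
    show ?case
    proof (cases "(b, d) \<in> blk G \<union> U")
      case True
      thus ?thesis using c by (meson rtrancl.rtrancl_into_rtrancl)
    next
      case False
      hence bd: "(b, d) \<in> W - U" using step(2) by blast
      hence L: "b \<in> legs G - Domain U" "d \<in> legs G - Domain U"
        using link_unique[OF G _ U(2), of b d] U W by auto
      have "(c, b) \<in> ?M" using c L by (simp add: lquo_blk)
      hence "(a, d) \<in> ?M\<^sup>*" using c(2) bd by (meson UnI2 rtrancl.rtrancl_into_rtrancl)
      thus ?thesis using L by blast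
    qed
  qed
  then obtain c where c: "c \<in> legs G - Domain U" "(a, c) \<in> ?M\<^sup>*" "(c, b) \<in> (blk G \<union> U)\<^sup>*" by blast
  hence "(c, b) \<in> ?M" using ab by (simp add: lquo_blk)
  thus "(a, b) \<in> ?M\<^sup>*" using c(2) by (rule rtrancl_into_rtrancl[rotated])
qed

text \<open>Holds by unfolding: the blocks of a contraction depend on \<open>U\<close> only, not on
  the links that are kept.\<close>

lemma lquo_lsub: "lquo (lsub G W) U = lsub (lquo G U) (W - U)"
  by (simp add: lquo_def lsub_def Let_def)

lemma lsub_lsub: "lsub (lsub G W) U = lsub G U"
  by (simp add: lsub_def)

lemma Domain_Diff:
  assumes "wf_leg G" "W \<subseteq> lnk G" "U \<subseteq> W" "sym U"
  shows "Domain (W - U) = Domain W - Domain U"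
proof -
  have "a \<notin> Domain U" if "(a, b) \<in> W - U" for a b
    using link_unique(1)[OF assms(1) _ assms(4), of a b] assms(2,3) that by blast
  thus ?thesis by blast
qed

text \<open>Contraction in stages is an equality because legs keep their names and vertices are
  classes of legs; no name for a new vertex has to be chosen.\<close>

lemma lquo_lquo:
  assumes G: "wf_leg G" and W: "W \<subseteq> lnk G" and U: "U \<subseteq> W" "sym U"
  shows "lquo (lquo G U) (W - U) = lquo G W"
proof -
  have D: "Domain (W - U) = Domain W - Domain U" using Domain_Diff[OF assms] .
  have L: "legs G - Domain U - Domain (W - U) = legs G - Domain W" using D U by auto
  have "(blk (lquo G U) \<union> (W - U))\<^sup>* \<inter> (legs G - Domain W) \<times> (legs G - Domain W) =
    (blk G \<union> W)\<^sup>* \<inter> (legs G - Domain W) \<times> (legs G - Domain W)"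
  proof -
    have "legs G - Domain W \<subseteq> legs G - Domain U" using U by auto
    thus ?thesis using contracted_path[OF assms] by blast
  qed
  moreover have "lnk G - U - (W - U) = lnk G - W" using U W by auto
  ultimately show ?thesis
    using L by (auto simp: lquo_def[of "lquo G U"] lquo_def[of G W] Let_def)
qed

lemma free_lquo:
  assumes "wf_leg G" "U \<subseteq> lnk G" "sym U"
  shows "free (lquo G U) = free G"
  using Domain_Diff[OF assms(1) order_refl assms(2,3)] assms(2) by (auto simp: free_def)

text \<open>Contraction does not change which free legs are connected to each other, so the quotient
  inherits from \<open>G\<close> the condition on its components.\<close>

lemma conn_lquo:
  assumes "wf_leg G" "U \<subseteq> lnk G" "sym U" "a \<in> legs G - Domain U"
  shows "conn (lquo G U) `` {a} \<inter> free G = conn G `` {a} \<inter> free G"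
proof -
  have "free G \<subseteq> legs G - Domain U" using assms(2) by (auto simp: free_def)
  thus ?thesis using contracted_path[OF assms(1) order_refl assms(2,3,4)]
    by (auto simp: conn_def)
qed

lemma blk_lquo:
  assumes "a \<in> legs G - Domain U"
  shows "blk (lquo G U) `` {a} = conn (lsub G U) `` {a} \<inter> free (lsub G U)"
  using assms by (auto simp: conn_lsub free_lsub lquo_blk)

lemma valid_wf: "valid_leg G \<Longrightarrow> wf_leg G"
  by (simp add: valid_leg_def)

text \<open>Vertices of the quotient have the valences of components of the subobject, and its
  components have the free legs of those of \<open>G\<close>; only the clause on bivalent vertices
  remains to be checked.\<close>

lemma valid_lquo_iff:
  assumes G: "valid_leg G" and U: "U \<subseteq> lnk G" "sym U" and S: "valid_leg (lsub G U)"
  shows "valid_leg (lquo G U) \<longleftrightarrow>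
    (\<forall>x\<in>free G. card (conn (lsub G U) `` {x} \<inter> free (lsub G U)) = 2 \<longrightarrow>
       conn (lsub G U) `` {x} \<inter> free (lsub G U) \<subseteq> free G)"
proof -
  note wf = valid_wf[OF G]
  have F: "free G \<subseteq> legs G - Domain U" using U by (auto simp: free_def)
  have "card (blk (lquo G U) `` {x}) \<in> {2, 3}" if "x \<in> legs (lquo G U)" for x
    using blk_lquo[of x G U] that S by (simp add: valid_leg_def)
  moreover have "card (conn (lquo G U) `` {x} \<inter> free (lquo G U)) \<in> {2, 3}" if "x \<in> legs (lquo G U)" for x
    using conn_lquo[OF wf U, of x] that G free_lquo[OF wf U] by (simp add: valid_leg_def)
  ultimately have "valid_leg (lquo G U) \<longleftrightarrow>
      (\<forall>x\<in>free G. card (blk (lquo G U) `` {x}) = 2 \<longrightarrow> blk (lquo G U) `` {x} \<subseteq> free G)"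
    using wf_lquo[OF wf U] free_lquo[OF wf U] by (simp add: valid_leg_def)
  also have "\<dots> \<longleftrightarrow> (\<forall>x\<in>free G. card (conn (lsub G U) `` {x} \<inter> free (lsub G U)) = 2 \<longrightarrow>
       conn (lsub G U) `` {x} \<inter> free (lsub G U) \<subseteq> free G)"
  proof (intro ball_cong refl)
    fix x assume "x \<in> free G"
    hence "blk (lquo G U) `` {x} = conn (lsub G U) `` {x} \<inter> free (lsub G U)"
      using blk_lquo[of x G U] F by auto
    thus "(card (blk (lquo G U) `` {x}) = 2 \<longrightarrow> blk (lquo G U) `` {x} \<subseteq> free G) =
      (card (conn (lsub G U) `` {x} \<inter> free (lsub G U)) = 2 \<longrightarrow>
       conn (lsub G U) `` {x} \<inter> free (lsub G U) \<subseteq> free G)" by simp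
  qed
  finally show ?thesis .
qed

text \<open>Only the validity of the contraction of \<open>G\<close> by \<open>U\<close> is at
  stake. Take a component of \<open>U\<close> with two external legs, one of them free in
  \<open>G\<close>. Validity of the contraction inside \<open>W\<close> makes both legs free in
  \<open>W\<close>, so this component does not grow in \<open>W\<close>; validity of the contraction
  by \<open>W\<close> then makes both free in \<open>G\<close>.\<close>

lemma leg_flag_fwd:
  assumes G: "valid_leg G" and W: "W \<in> lsubs G" and U: "U \<in> lsubs (lsub G W)"
  shows "U \<subseteq> W \<and> U \<in> lsubs G \<and> W - U \<in> lsubs (lquo G U)"
proof -
  note wf = valid_wf[OF G]
  have UW: "U \<subseteq> W" "sym U" and W': "W \<subseteq> lnk G" "sym W" using W U by (auto simp: lsubs_def)
  have U': "U \<subseteq> lnk G" using UW W' by auto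
  have vU: "valid_leg (lsub G U)" using U by (simp add: lsubs_def lsub_lsub)
  have vW: "valid_leg (lsub G W)" using W by (simp add: lsubs_def)
  have vq: "valid_leg (lsub (lquo G U) (W - U))" using U by (simp add: lsubs_def lquo_lsub)
  have vqW: "valid_leg (lquo G W)" using W by (simp add: lsubs_def)
  let ?B = "\<lambda>x. conn (lsub G U) `` {x} \<inter> free (lsub G U)"
  have c1: "?B x \<subseteq> free (lsub G W)" if "x \<in> free (lsub G W)" "card (?B x) = 2" for x
  proof -
    have "valid_leg (lquo (lsub G W) U)" using vq by (simp add: lquo_lsub)
    thus ?thesis
      using valid_lquo_iff[of "lsub G W" U] vW UW vU that by (simp add: lsub_lsub)
  qed
  have c2: "conn (lsub G W) `` {x} \<inter> free (lsub G W) \<subseteq> free G"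
    if "x \<in> free G" "card (conn (lsub G W) `` {x} \<inter> free (lsub G W)) = 2" for x
    using valid_lquo_iff[OF G W' vW] vqW that by blast
  have "valid_leg (lquo G U)"
    unfolding valid_lquo_iff[OF G U' UW(2) vU]
  proof (intro ballI impI)
    fix x assume x: "x \<in> free G" and card: "card (?B x) = 2"
    have xW: "x \<in> free (lsub G W)" using x W' by (auto simp: free_def)
    have sub: "?B x \<subseteq> free (lsub G W)" using c1[OF xW card] .
    \<comment> \<open>All legs of the component of \<open>x\<close> that survive \<open>U\<close>
      are free in \<open>W\<close>, so no link of \<open>W - U\<close> leads out of it.\<close>
    have closed: "y \<in> ?B x" if "(x, y) \<in> (blk G \<union> W)\<^sup>*" "y \<in> legs G - Domain U" for y
    proof -
      have xU: "x \<in> legs G - Domain U" using x U' by (auto simp: free_def)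
      have "(x, y) \<in> (blk (lquo G U) \<union> (W - U))\<^sup>*"
        using contracted_path[OF wf W'(1) UW xU that(2)] that(1) by blast
      hence "y \<in> ?B x"
      proof (induction rule: rtrancl_induct)
        case base
        show ?case using xU by (simp add: free_lsub)
      next
        case (step y z)
        have "y \<notin> Domain W" using step(3) sub by (auto simp: free_lsub)
        hence "(y, z) \<in> blk (lquo G U)" using step(2) by blast
        thus ?case using step(3) by (auto simp: conn_lsub free_lsub lquo_blk intro: rtrancl_trans)
      qed
      thus ?thesis .
    qed
    have "conn (lsub G W) `` {x} \<inter> free (lsub G W) = ?B x"
    proof
      show "conn (lsub G W) `` {x} \<inter> free (lsub G W) \<subseteq> ?B x"
        using closed UW(1) by (auto simp: conn_lsub free_lsub[of G W])
      have "conn (lsub G U) \<subseteq> conn (lsub G W)"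
        using UW unfolding conn_lsub by (intro rtrancl_mono) auto
      thus "?B x \<subseteq> conn (lsub G W) `` {x} \<inter> free (lsub G W)" using sub by blast
    qed
    thus "?B x \<subseteq> free G" using c2[OF x] card by simp
  qed
  thus ?thesis
    using UW U' W' vU vq vqW lquo_lquo[OF wf W'(1) UW] by (auto simp: lsubs_def sym_def)
qed

text \<open>The point is the validity of the subobject with links \<open>U \<union> W\<close>: its
  components are read off from the contraction by \<open>U\<close>, its bivalent vertices from the
  two given subobjects in turn.\<close>

lemma leg_flag_bwd:
  assumes G: "valid_leg G" and U: "U \<in> lsubs G" and W: "W \<in> lsubs (lquo G U)"
  shows "U \<inter> W = {} \<and> U \<union> W \<in> lsubs G \<and> U \<in> lsubs (lsub G (U \<union> W))"
proof -
  note wf = valid_wf[OF G]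
  have U': "U \<subseteq> lnk G" "sym U" and W': "W \<subseteq> lnk G" "U \<inter> W = {}" "sym W"
    using U W by (auto simp: lsubs_def)
  define V where "V = U \<union> W"
  have V: "V \<subseteq> lnk G" "U \<subseteq> V" "sym V" "V - U = W" using U' W' by (auto simp: V_def sym_def)
  have vU: "valid_leg (lsub G U)" "valid_leg (lquo G U)" using U by (auto simp: lsubs_def)
  have vW: "valid_leg (lsub (lquo G U) W)" "valid_leg (lquo (lquo G U) W)" using W by (auto simp: lsubs_def)
  have vqV: "valid_leg (lquo G V)" using vW(2) lquo_lquo[OF wf V(1,2) U'(2)] V(4) by simp
  have vqs: "valid_leg (lquo (lsub G V) U)" using vW(1) V(4) by (simp add: lquo_lsub)
  have wfV: "wf_leg (lsub G V)" using wf_lsub[OF wf V(1,3)] .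
  \<comment> \<open>The leg \<open>x\<close> itself may be absorbed by \<open>U\<close>. Since
    components of the valid subobject given by \<open>U\<close> have free legs, the count is made
    from a leg \<open>y\<close> of the same component that survives in the quotient.\<close>
  have comp: "card (conn (lsub G V) `` {x} \<inter> free (lsub G V)) \<in> {2, 3}" if x: "x \<in> legs G" for x
  proof -
    have "conn (lsub G U) `` {x} \<inter> free (lsub G U) \<noteq> {}"
      using vU(1) x by (force simp: valid_leg_def)
    then obtain y where y: "(x, y) \<in> conn (lsub G U)" "y \<in> legs G - Domain U" by (auto simp: free_lsub)
    have "(x, y) \<in> conn (lsub G V)"
      using y(1) V(2) rtrancl_mono[of "blk G \<union> U" "blk G \<union> V"] unfolding conn_lsub by blast
    hence "conn (lsub G V) `` {x} = conn (lsub G V) `` {y}" using conn_class_eq[OF wfV] by blast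
    moreover have "conn (lsub G V) `` {y} \<inter> free (lsub G V) =
        conn (lquo (lsub G V) U) `` {y} \<inter> free (lsub G V)"
      using conn_lquo[OF wfV, of U y] V(2) U'(2) y(2) by simp
    moreover have "free (lquo (lsub G V) U) = free (lsub G V)"
      using free_lquo[OF wfV, of U] V(2) U'(2) by simp
    ultimately show ?thesis using vqs y(2) by (simp add: valid_leg_def)
  qed
  \<comment> \<open>A bivalent block with a leg free in \<open>V\<close> is entirely free in
    \<open>U\<close>, hence an isolated component there; it reappears unchanged as a block of the
    contraction, where validity of \<open>W\<close> applies.\<close>
  have clean: "blk G `` {x} \<subseteq> free (lsub G V)" if x: "x \<in> free (lsub G V)" and c: "card (blk G `` {x}) = 2" for x
  proof -
    have xU: "x \<in> free (lsub G U)" using x V by (auto simp: free_def)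
    have b: "blk G `` {x} \<subseteq> free (lsub G U)" using vU(1) xU c by (simp add: valid_leg_def)
    have "conn (lsub G U) `` {x} = blk G `` {x}"
    proof
      show "blk G `` {x} \<subseteq> conn (lsub G U) `` {x}" by (auto simp: conn_lsub)
      have "y \<in> blk G `` {x}" if "(x, y) \<in> (blk G \<union> U)\<^sup>*" for y
        using that
      proof (induction rule: rtrancl_induct)
        case base
        show ?case using xU wf by (auto simp: free_lsub wf_leg_def equiv_def refl_on_def)
      next
        case (step y z)
        have "(y, z) \<notin> U" using step(3) b by (auto simp: free_lsub)
        thus ?case using step wf by (auto simp: wf_leg_def equiv_def trans_def)
      qed
      thus "conn (lsub G U) `` {x} \<subseteq> blk G `` {x}" by (auto simp: conn_lsub)
    qed
    hence eq: "blk (lquo G U) `` {x} = blk G `` {x}"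
      using blk_lquo[of x G U] xU b by (auto simp: free_lsub)
    have "x \<in> free (lsub (lquo G U) W)" using x V by (auto simp: free_def V_def)
    hence "blk G `` {x} \<subseteq> free (lsub (lquo G U) W)"
      using vW(1) c eq unfolding valid_leg_def lsub_simps by metis
    thus ?thesis by (auto simp: free_def V_def)
  qed
  have "valid_leg (lsub G V)"
    using wfV comp clean G by (simp add: valid_leg_def)
  hence "V \<in> lsubs G" using V vqV by (simp add: lsubs_def)
  moreover have "U \<in> lsubs (lsub G V)"
    using V U' vU vqs by (simp add: lsubs_def lsub_lsub)
  ultimately show ?thesis using W' by (simp add: V_def)
qed

lemma leg_flag_eq:
  assumes G: "valid_leg G" and W: "W \<in> lsubs G" and U: "U \<in> lsubs (lsub G W)"
  shows "lsub (lsub G W) U = lsub G U \<and> lquo (lsub G W) U = lsub (lquo G U) (W - U) \<and>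
    lquo (lquo G U) (W - U) = lquo G W"
  using lquo_lquo[OF valid_wf[OF G], of W U] W U by (simp add: lsubs_def lsub_lsub lquo_lsub)

section \<open>Normal forms\<close>

definition ldrop :: "'h leg_graph \<Rightarrow> 'h set \<Rightarrow> 'h leg_graph" where
  "ldrop G B = \<lparr>legs = legs G - B, blk = blk G \<inter> (legs G - B) \<times> (legs G - B), lnk = lnk G\<rparr>"

definition droppable :: "'h leg_graph \<Rightarrow> 'h set \<Rightarrow> bool" where
  "droppable G B \<longleftrightarrow> (\<exists>x\<in>legs G. B = blk G `` {x}) \<and> B \<subseteq> free G \<and> card B \<in> {2, 3}"

text \<open>The path a, x, y, b runs through the bivalent vertex {x, y}; smoothing this vertex links
  \<open>a\<close> to \<open>b\<close> directly.\<close>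

definition lsplice :: "'h leg_graph \<Rightarrow> 'h \<Rightarrow> 'h \<Rightarrow> 'h \<Rightarrow> 'h \<Rightarrow> 'h leg_graph" where
  "lsplice G a x y b = \<lparr>legs = legs G - {x, y}, blk = blk G \<inter> (legs G - {x, y}) \<times> (legs G - {x, y}),
     lnk = lnk G - {(a, x), (x, a), (y, b), (b, y)} \<union> {(a, b), (b, a)}\<rparr>"

text \<open>The clause \<open>a \<noteq> y\<close> excludes a bivalent vertex whose two legs are
  linked to each other; smoothing it would leave a closed line without vertices.\<close>

definition spliceable :: "'h leg_graph \<Rightarrow> 'h \<Rightarrow> 'h \<Rightarrow> 'h \<Rightarrow> 'h \<Rightarrow> bool" where
  "spliceable G a x y b \<longleftrightarrow> blk G `` {x} = {x, y} \<and> x \<noteq> y \<and> (a, x) \<in> lnk G \<and> (y, b) \<in> lnk G \<and> a \<noteq> y"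

text \<open>The legs that survive smoothing: those at trivalent vertices carrying at least one
  link.\<close>

definition core :: "'h leg_graph \<Rightarrow> 'h set" where
  "core G = {h \<in> legs G. card (blk G `` {h}) = 3 \<and> \<not> blk G `` {h} \<subseteq> free G}"

text \<open>A step across a bivalent vertex. The relation contains pairs (x, x) too, which disappear
  when \<open>nf\<close> subtracts \<open>Id\<close>.\<close>

definition pairs :: "'h leg_graph \<Rightarrow> ('h \<times> 'h) set" where
  "pairs G = {(x, y) \<in> blk G. card (blk G `` {x}) = 2}"

text \<open>
  Forgets the vertices without links and smooths the remaining bivalent vertices.
\<close>

definition nf :: "'h leg_graph \<Rightarrow> 'h leg_graph" where
  "nf G = \<lparr>legs = core G, blk = blk G \<inter> core G \<times> core G,
     lnk = ((lnk G \<union> pairs G)\<^sup>* - Id) \<inter> core G \<times> core G\<rparr>"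

lemma ldrop_simps [simp]: "legs (ldrop G B) = legs G - B" "lnk (ldrop G B) = lnk G"
  "blk (ldrop G B) = blk G \<inter> (legs G - B) \<times> (legs G - B)"
  by (simp_all add: ldrop_def)

lemma lsplice_simps [simp]: "legs (lsplice G a x y b) = legs G - {x, y}"
  "lnk (lsplice G a x y b) = lnk G - {(a, x), (x, a), (y, b), (b, y)} \<union> {(a, b), (b, a)}"
  "blk (lsplice G a x y b) = blk G \<inter> (legs G - {x, y}) \<times> (legs G - {x, y})"
  by (simp_all add: lsplice_def)

lemma leg_graph_eqI:
  "legs G = legs G' \<Longrightarrow> blk G = blk G' \<Longrightarrow> lnk G = lnk G' \<Longrightarrow> G = (G' :: 'h leg_graph)"
  by (cases G; cases G') simp

lemma pairs_iff: "(u, v) \<in> pairs G \<longleftrightarrow> v \<in> blk G `` {u} \<and> card (blk G `` {u}) = 2"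
  by (simp add: pairs_def)

lemma equiv_restrict:
  assumes "equiv A r" "B \<subseteq> A"
  shows "equiv B (r \<inter> B \<times> B)"
proof (rule equivI)
  show "refl_on B (r \<inter> B \<times> B)" using assms by (auto simp: equiv_def refl_on_def)
  show "sym (r \<inter> B \<times> B)" using assms by (auto simp: equiv_def intro!: symI dest: symD)
  show "trans (r \<inter> B \<times> B)" using assms by (auto simp: equiv_def intro!: transI dest: transD)
qed simp

text \<open>Paths that cannot enter \<open>B\<close> do not notice its removal. Applied to dropped
  vertices, and later to subgraphs, components and disjoint sums.\<close>

lemma rtrancl_avoid:
  assumes "\<And>u v. (u, v) \<in> E \<Longrightarrow> u \<notin> B \<Longrightarrow> v \<notin> B \<and> (u, v) \<in> E'" "E' \<subseteq> E" "h \<notin> B"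
  shows "(h, k) \<in> E\<^sup>* \<longleftrightarrow> (h, k) \<in> E'\<^sup>*" and "(h, k) \<in> E\<^sup>* \<Longrightarrow> k \<notin> B"
proof -
  have *: "(h, k) \<in> E'\<^sup>* \<and> k \<notin> B" if "(h, k) \<in> E\<^sup>*"
    using that
  proof (induction rule: rtrancl_induct)
    case (step y z)
    thus ?case using assms(1) by (meson rtrancl.rtrancl_into_rtrancl)
  qed (use assms(3) in simp)
  thus "(h, k) \<in> E\<^sup>* \<longleftrightarrow> (h, k) \<in> E'\<^sup>*" using rtrancl_mono[OF assms(2)] by blast
  show "(h, k) \<in> E\<^sup>* \<Longrightarrow> k \<notin> B" using * by blast
qed

text \<open>Reachability is unaffected when a detour through \<open>x\<close> and \<open>y\<close>
  is replaced by a direct edge between \<open>a\<close> and \<open>b\<close>; needed both for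
  connectivity and for the links of the normal form.\<close>

lemma rtrancl_splice:
  assumes E: "\<And>u v. (u, v) \<in> E \<Longrightarrow> u \<notin> {x, y} \<Longrightarrow> v \<notin> {x, y} \<Longrightarrow> (u, v) \<in> E'"
    "\<And>u v. (u, v) \<in> E \<Longrightarrow> u \<notin> {x, y} \<Longrightarrow> v \<in> {x, y} \<Longrightarrow> u \<in> {a, b}"
    "\<And>u v. (u, v) \<in> E \<Longrightarrow> u \<in> {x, y} \<Longrightarrow> v \<in> {x, y, a, b}"
    and E': "E' \<subseteq> E\<^sup>*" "(a, b) \<in> E'" "(b, a) \<in> E'" and h: "h \<notin> {x, y}" and k: "k \<notin> {x, y}"
  shows "(h, k) \<in> E\<^sup>* \<longleftrightarrow> (h, k) \<in> E'\<^sup>*"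
proof
  assume "(h, k) \<in> E\<^sup>*"
  \<comment> \<open>While the original path stands at \<open>x\<close> or \<open>y\<close>, the
    shortened path waits at \<open>a\<close>, from where \<open>b\<close> is one step away.\<close>
  hence "(k \<notin> {x, y} \<longrightarrow> (h, k) \<in> E'\<^sup>*) \<and> (k \<in> {x, y} \<longrightarrow> (h, a) \<in> E'\<^sup>*)"
  proof (induction rule: rtrancl_induct)
    case base
    show ?case using h by blast
  next
    case (step u v)
    have ab: "(h, a) \<in> E'\<^sup>* \<longleftrightarrow> (h, b) \<in> E'\<^sup>*"
      using E'(2,3) by (meson rtrancl.rtrancl_into_rtrancl)
    show ?case
    proof (cases "u \<in> {x, y}")
      case True
      hence ha: "(h, a) \<in> E'\<^sup>*" "(h, b) \<in> E'\<^sup>*" using step.IH ab by blast+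
      have "v \<in> {x, y, a, b}" using E(3)[OF step(2) True] .
      thus ?thesis using ha by blast
    next
      case False
      hence hu: "(h, u) \<in> E'\<^sup>*" using step.IH by blast
      show ?thesis
      proof (cases "v \<in> {x, y}")
        case True
        hence "u \<in> {a, b}" using E(2)[OF step(2) False] by blast
        thus ?thesis using hu ab True by blast
      next
        case F2: False
        hence "(u, v) \<in> E'" using E(1)[OF step(2) False] by blast
        thus ?thesis using hu F2 by (meson rtrancl.rtrancl_into_rtrancl)
      qed
    qed
  qed
  thus "(h, k) \<in> E'\<^sup>*" using k by blast
next
  assume "(h, k) \<in> E'\<^sup>*"
  thus "(h, k) \<in> E\<^sup>*" using rtrancl_mono[OF E'(1)] by (auto simp: rtrancl_idemp)
qed

subsection \<open>Dropping a free block\<close>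

context
  fixes G :: "'h leg_graph" and B :: "'h set"
  assumes wf: "wf_leg G" and dr: "droppable G B"
begin

lemma drop_block: "u \<in> B \<Longrightarrow> blk G `` {u} = B"
proof -
  assume u: "u \<in> B"
  obtain x where x: "B = blk G `` {x}" using dr unfolding droppable_def by blast
  have "(x, u) \<in> blk G" "(u, x) \<in> blk G" using u x blk_sym[OF wf] by blast+
  thus ?thesis unfolding x using blk_trans[OF wf] by blast
qed

lemma drop_legs: "B \<subseteq> legs G"
  using dr by (auto simp: droppable_def free_def)

lemma drop_blk: "(u, v) \<in> blk G \<Longrightarrow> u \<in> B \<longleftrightarrow> v \<in> B"
  using drop_block[of u] drop_block[of v] blk_sym[OF wf, of u v] by (metis Image_singleton_iff)

lemma drop_free: "B \<subseteq> free G"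
  using dr by (simp add: droppable_def)

lemma drop_lnk: "(u, v) \<in> lnk G \<Longrightarrow> u \<notin> B \<and> v \<notin> B"
  using drop_free lnk_sym[OF wf, of u v] by (auto simp: free_def)

lemma wf_ldrop: "wf_leg (ldrop G B)"
  using wf drop_lnk equiv_restrict[of "legs G" "blk G" "legs G - B"] by (auto simp: wf_leg_def)

lemma blk_ldrop: "u \<notin> B \<Longrightarrow> blk (ldrop G B) `` {u} = blk G `` {u}"
  using drop_blk[of u] blk_legs[OF wf, of u] by auto

lemma conn_ldrop: "u \<in> legs G - B \<Longrightarrow> conn (ldrop G B) `` {u} = conn G `` {u}"
proof -
  assume u: "u \<in> legs G - B"
  have "(u, k) \<in> (blk G \<union> lnk G)\<^sup>* \<longleftrightarrow> (u, k) \<in> (blk (ldrop G B) \<union> lnk G)\<^sup>*" for k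
    by (rule rtrancl_avoid(1)[where B = B]) (use drop_blk drop_lnk blk_legs[OF wf] u in auto)
  thus ?thesis by (auto simp: conn_def)
qed

lemma conn_dropped: "u \<in> B \<Longrightarrow> conn G `` {u} = B"
proof
  assume u: "u \<in> B"
  have "v \<in> B" if "(u, v) \<in> conn G" for v
    using that unfolding conn_def
  proof (induction rule: rtrancl_induct)
    case (step y z)
    thus ?case using drop_blk drop_lnk by blast
  qed (rule u)
  thus "conn G `` {u} \<subseteq> B" by blast
  show "B \<subseteq> conn G `` {u}" using drop_block[OF u] by (auto simp: conn_def)
qed

lemma free_ldrop: "free (ldrop G B) = free G - B"
  using drop_lnk by (auto simp: free_def)

text \<open>A free block is a component of its own. Having two or three legs, all free, it satisfies
  every clause of validity by itself, and the rest of the graph does not see it.\<close>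

lemma valid_ldrop_iff: "valid_leg (ldrop G B) \<longleftrightarrow> valid_leg G"
proof -
  have BF: "B \<subseteq> free G" and cB: "card B \<in> {2, 3}" using dr by (auto simp: droppable_def)
  have LB: "legs G = (legs G - B) \<union> B" using drop_legs by blast
  have FB: "free G = (free G - B) \<union> B" using BF by blast
  have c: "conn (ldrop G B) `` {u} \<inter> free (ldrop G B) = conn G `` {u} \<inter> free G" if u: "u \<in> legs G - B" for u
  proof -
    have "conn G `` {u} \<inter> B = {}"
    proof (rule ccontr)
      assume "conn G `` {u} \<inter> B \<noteq> {}"
      then obtain v where "v \<in> B" "(u, v) \<in> conn G" by blast
      hence "u \<in> conn G `` {v}" using sym_conn[OF wf] by (auto simp: sym_def)
      thus False using conn_dropped[OF \<open>v \<in> B\<close>] u by blast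
    qed
    thus ?thesis using conn_ldrop[OF u] free_ldrop by auto
  qed
  have "(\<forall>x\<in>legs G. card (blk G `` {x}) \<in> {2, 3}) \<longleftrightarrow> (\<forall>x\<in>legs G - B. card (blk G `` {x}) \<in> {2, 3})"
    using cB drop_block by (subst LB) auto
  also have "\<dots> \<longleftrightarrow> (\<forall>x\<in>legs G - B. card (blk (ldrop G B) `` {x}) \<in> {2, 3})"
    using blk_ldrop by (simp del: ldrop_simps)
  finally have 1: "(\<forall>x\<in>legs G. card (blk G `` {x}) \<in> {2, 3}) \<longleftrightarrow>
      (\<forall>x\<in>legs (ldrop G B). card (blk (ldrop G B) `` {x}) \<in> {2, 3})" by simp
  have BB: "B \<inter> free G = B" using BF by blast
  have "(\<forall>x\<in>legs G. card (conn G `` {x} \<inter> free G) \<in> {2, 3}) \<longleftrightarrow>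
      (\<forall>x\<in>legs G - B. card (conn G `` {x} \<inter> free G) \<in> {2, 3})"
    using cB conn_dropped BB by (subst LB) auto
  also have "\<dots> \<longleftrightarrow> (\<forall>x\<in>legs G - B. card (conn (ldrop G B) `` {x} \<inter> free (ldrop G B)) \<in> {2, 3})"
    using c by simp
  finally have 2: "(\<forall>x\<in>legs G. card (conn G `` {x} \<inter> free G) \<in> {2, 3}) \<longleftrightarrow>
      (\<forall>x\<in>legs (ldrop G B). card (conn (ldrop G B) `` {x} \<inter> free (ldrop G B)) \<in> {2, 3})" by simp
  have "(\<forall>x\<in>free G. card (blk G `` {x}) = 2 \<longrightarrow> blk G `` {x} \<subseteq> free G) \<longleftrightarrow>
      (\<forall>x\<in>free G - B. card (blk G `` {x}) = 2 \<longrightarrow> blk G `` {x} \<subseteq> free G)"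
    using BF drop_block by (subst FB) auto
  also have "\<dots> \<longleftrightarrow> (\<forall>x\<in>free G - B. card (blk (ldrop G B) `` {x}) = 2 \<longrightarrow> blk (ldrop G B) `` {x} \<subseteq> free G - B)"
  proof (intro ball_cong refl)
    fix x assume x: "x \<in> free G - B"
    hence xL: "x \<notin> B" by simp
    have "blk G `` {x} \<inter> B = {}" using x drop_blk by blast
    thus "(card (blk G `` {x}) = 2 \<longrightarrow> blk G `` {x} \<subseteq> free G) =
      (card (blk (ldrop G B) `` {x}) = 2 \<longrightarrow> blk (ldrop G B) `` {x} \<subseteq> free G - B)"
      unfolding blk_ldrop[OF xL] by blast
  qed
  finally have 3: "(\<forall>x\<in>free G. card (blk G `` {x}) = 2 \<longrightarrow> blk G `` {x} \<subseteq> free G) \<longleftrightarrow>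
      (\<forall>x\<in>free (ldrop G B). card (blk (ldrop G B) `` {x}) = 2 \<longrightarrow> blk (ldrop G B) `` {x} \<subseteq> free (ldrop G B))"
    by (simp only: free_ldrop)
  show ?thesis unfolding valid_leg_def using wf wf_ldrop 1 2 3 by blast
qed

lemma core_ldrop: "core (ldrop G B) = core G"
proof -
  have notin: "u \<notin> B" if "u \<in> core G" for u
    using that drop_block[of u] dr by (auto simp: core_def droppable_def)
  have iff: "blk G `` {u} \<subseteq> free G \<longleftrightarrow> blk G `` {u} \<subseteq> free G - B" if "u \<in> legs G - B" for u
    using drop_blk that by blast
  have "u \<in> core (ldrop G B) \<longleftrightarrow> u \<in> core G" for u
  proof (cases "u \<in> legs G - B")
    case True
    hence "u \<notin> B" by blast
    thus ?thesis
      unfolding core_def free_ldrop mem_Collect_eq blk_ldrop[OF \<open>u \<notin> B\<close>] using iff[of u] True by simp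
  next
    case False
    thus ?thesis using notin[of u] by (auto simp: core_def)
  qed
  thus ?thesis by blast
qed

lemma nf_ldrop: "nf (ldrop G B) = nf G"
proof (rule leg_graph_eqI)
  have coreB: "core G \<subseteq> legs G - B" using core_ldrop by (auto simp: core_def)
  show "legs (nf (ldrop G B)) = legs (nf G)" by (simp add: nf_def core_ldrop)
  show "blk (nf (ldrop G B)) = blk (nf G)" using coreB by (auto simp: nf_def core_ldrop)
  have p: "(u, v) \<in> pairs (ldrop G B) \<longleftrightarrow> (u, v) \<in> pairs G" if "u \<notin> B" for u v
    unfolding pairs_iff blk_ldrop[OF that] ..
  have "(h, k) \<in> (lnk G \<union> pairs G)\<^sup>* \<longleftrightarrow> (h, k) \<in> (lnk G \<union> pairs (ldrop G B))\<^sup>*" if "h \<in> core G" for h k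
  proof (rule rtrancl_avoid(1)[where B = B])
    show "h \<notin> B" using that coreB by blast
    have "fst e \<notin> B" if "e \<in> pairs (ldrop G B)" for e
      using that by (auto simp: pairs_def)
    thus "lnk G \<union> pairs (ldrop G B) \<subseteq> lnk G \<union> pairs G" using p by force
    show "v \<notin> B \<and> (u, v) \<in> lnk G \<union> pairs (ldrop G B)"
      if "(u, v) \<in> lnk G \<union> pairs G" "u \<notin> B" for u v
      using that drop_lnk p drop_blk by (auto simp: pairs_def)
  qed
  thus "lnk (nf (ldrop G B)) = lnk (nf G)" by (auto simp: nf_def core_ldrop)
qed

end

subsection \<open>Splicing a linked block of two legs\<close>

context
  fixes G :: "'h leg_graph" and a x y b :: 'h
  assumes wf: "wf_leg G" and sp: "spliceable G a x y b"
begin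

lemma splice_lnk:
  shows "(a, x) \<in> lnk G" "(x, a) \<in> lnk G" "(y, b) \<in> lnk G" "(b, y) \<in> lnk G"
  using sp lnk_sym[OF wf] by (auto simp: spliceable_def)

lemma splice_blk: "(u, v) \<in> blk G \<Longrightarrow> u \<in> {x, y} \<longleftrightarrow> v \<in> {x, y}"
proof -
  have eq: "blk G `` {x} = {x, y}" using sp by (simp add: spliceable_def)
  assume uv: "(u, v) \<in> blk G"
  show ?thesis
  proof
    assume "u \<in> {x, y}"
    hence "(x, u) \<in> blk G" using eq by blast
    hence "(x, v) \<in> blk G" using uv blk_trans[OF wf] by blast
    thus "v \<in> {x, y}" using eq by blast
  next
    assume "v \<in> {x, y}"
    hence "(x, v) \<in> blk G" using eq by blast
    hence "(x, u) \<in> blk G" using uv blk_trans[OF wf] blk_sym[OF wf] by blast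
    thus "u \<in> {x, y}" using eq by blast
  qed
qed

lemma splice_block: "u \<in> {x, y} \<Longrightarrow> blk G `` {u} = {x, y}"
proof -
  assume u: "u \<in> {x, y}"
  have eq: "blk G `` {x} = {x, y}" using sp by (simp add: spliceable_def)
  have "(x, u) \<in> blk G" using eq u by blast
  hence "blk G `` {u} = blk G `` {x}" using blk_trans[OF wf] blk_sym[OF wf] by blast
  thus ?thesis using eq by simp
qed

lemma splice_distinct: "x \<noteq> y" "a \<notin> {x, y}" "b \<notin> {x, y}" "a \<noteq> b" "(a, b) \<notin> lnk G" "(b, a) \<notin> lnk G"
proof -
  note l = splice_lnk
  show xy: "x \<noteq> y" using sp by (simp add: spliceable_def)
  have "a \<noteq> x" "b \<noteq> y" using l lnk_irrefl[OF wf] by blast+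
  moreover have "a \<noteq> y" using sp by (simp add: spliceable_def)
  moreover have "b \<noteq> x" using l lnk_unique[OF wf, of x a y] \<open>a \<noteq> y\<close> by blast
  ultimately show "a \<notin> {x, y}" "b \<notin> {x, y}" by auto
  show "a \<noteq> b" using l lnk_unique[OF wf, of a x y] xy by blast
  show "(a, b) \<notin> lnk G" using l lnk_unique[OF wf, of a x b] \<open>b \<noteq> x\<close> by blast
  thus "(b, a) \<notin> lnk G" using lnk_sym[OF wf] by blast
qed

lemma splice_lnk_unique:
  assumes "(u, v) \<in> lnk G"
  shows "u = x \<longleftrightarrow> v = a" "u = y \<longleftrightarrow> v = b" "v = x \<longleftrightarrow> u = a" "v = y \<longleftrightarrow> u = b"
proof -
  have vu: "(v, u) \<in> lnk G" using lnk_sym[OF wf assms] .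
  show "u = x \<longleftrightarrow> v = a" using lnk_unique[OF wf, of x v a] lnk_unique[OF wf, of a u x] assms vu splice_lnk by auto
  show "u = y \<longleftrightarrow> v = b" using lnk_unique[OF wf, of y v b] lnk_unique[OF wf, of b u y] assms vu splice_lnk by auto
  show "v = x \<longleftrightarrow> u = a" using lnk_unique[OF wf, of x u a] lnk_unique[OF wf, of a v x] assms vu splice_lnk by auto
  show "v = y \<longleftrightarrow> u = b" using lnk_unique[OF wf, of y u b] lnk_unique[OF wf, of b v y] assms vu splice_lnk by auto
qed

lemma splice_legs: "{a, x, y, b} \<subseteq> legs G"
  using splice_lnk lnk_legs[OF wf] by blast

lemma wf_lsplice: "wf_leg (lsplice G a x y b)"
proof -
  let ?L = "lnk (lsplice G a x y b)"
  have "equiv (legs G - {x, y}) (blk G \<inter> (legs G - {x, y}) \<times> (legs G - {x, y}))"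
    using wf by (intro equiv_restrict) (auto simp: wf_leg_def)
  moreover have "?L \<subseteq> (legs G - {x, y}) \<times> (legs G - {x, y})"
  proof
    fix e assume e: "e \<in> ?L"
    obtain u v where [simp]: "e = (u, v)" by (cases e)
    show "e \<in> (legs G - {x, y}) \<times> (legs G - {x, y})"
      using e splice_legs splice_distinct splice_lnk_unique[of u v] lnk_legs[OF wf, of u v] by auto
  qed
  moreover have "sym ?L" using lnk_sym[OF wf] by (auto simp: sym_def)
  moreover have "irrefl ?L" using lnk_irrefl[OF wf] splice_distinct by (auto simp: irrefl_def)
  moreover have "single_valued ?L"
    using lnk_unique[OF wf] splice_lnk splice_distinct unfolding single_valued_def by auto
  ultimately show ?thesis using finite_legs[OF wf] by (simp add: wf_leg_def)
qed

lemma blk_lsplice: "u \<notin> {x, y} \<Longrightarrow> blk (lsplice G a x y b) `` {u} = blk G `` {u}"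
  using splice_blk[of u] blk_legs[OF wf, of u] by auto

lemma conn_lsplice:
  assumes "u \<notin> {x, y}" "v \<notin> {x, y}" "u \<in> legs G"
  shows "(u, v) \<in> conn (lsplice G a x y b) \<longleftrightarrow> (u, v) \<in> conn G"
  unfolding conn_def
proof (rule rtrancl_splice[symmetric, where x = x and y = y and a = a and b = b])
  let ?E = "blk G \<union> lnk G" and ?E' = "blk (lsplice G a x y b) \<union> lnk (lsplice G a x y b)"
  show "(p, q) \<in> ?E'" if "(p, q) \<in> ?E" "p \<notin> {x, y}" "q \<notin> {x, y}" for p q
    using that blk_legs[OF wf, of p q] splice_distinct by auto
  show "p \<in> {a, b}" if "(p, q) \<in> ?E" "p \<notin> {x, y}" "q \<in> {x, y}" for p q
    using that splice_blk[of p q] splice_lnk_unique[of p q] by blast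
  show "q \<in> {x, y, a, b}" if "(p, q) \<in> ?E" "p \<in> {x, y}" for p q
    using that splice_blk[of p q] splice_lnk_unique[of p q] by blast
  have xy: "(x, y) \<in> blk G" "(y, x) \<in> blk G" using splice_block by blast+
  have "(a, b) \<in> ?E\<^sup>*" "(b, a) \<in> ?E\<^sup>*"
    using xy splice_lnk by (meson UnCI converse_rtrancl_into_rtrancl r_into_rtrancl)+
  thus "?E' \<subseteq> ?E\<^sup>*" by auto
qed (use assms in auto)

lemma free_lsplice: "free (lsplice G a x y b) = free G"
proof -
  have "Domain (lnk (lsplice G a x y b)) \<union> {x, y} = Domain (lnk G)"
    using splice_lnk splice_distinct by (auto simp: Domain_iff)
  thus ?thesis unfolding free_def lsplice_simps(1) by blast
qed

text \<open>The legs \<open>x\<close> and \<open>y\<close> are linked, so no free leg is lost, and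
  they lie in the components of \<open>a\<close> and \<open>b\<close>, which remain present.\<close>

lemma valid_lsplice_iff: "valid_leg (lsplice G a x y b) \<longleftrightarrow> valid_leg G"
proof -
  let ?S = "lsplice G a x y b"
  have LB: "legs G = (legs G - {x, y}) \<union> {x, y}" using splice_legs by blast
  have nf: "x \<notin> free G" "y \<notin> free G" using splice_lnk by (auto simp: free_def)
  have fL: "free G \<subseteq> legs G - {x, y}" using nf by (auto simp: free_def)
  have c: "conn ?S `` {u} \<inter> free ?S = conn G `` {u} \<inter> free G" if u: "u \<in> legs G - {x, y}" for u
    unfolding free_lsplice using conn_lsplice[of u] u fL by blast
  have ca: "conn G `` {x} = conn G `` {a}" "conn G `` {y} = conn G `` {b}"
  proof -
    have "(x, a) \<in> conn G" "(y, b) \<in> conn G" using splice_lnk by (auto simp: conn_def)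
    thus "conn G `` {x} = conn G `` {a}" "conn G `` {y} = conn G `` {b}"
      by (simp_all only: conn_class_eq[OF wf])
  qed
  have "(\<forall>u\<in>legs G. card (blk G `` {u}) \<in> {2, 3}) \<longleftrightarrow> (\<forall>u\<in>legs G - {x, y}. card (blk G `` {u}) \<in> {2, 3})"
    using splice_block splice_distinct(1) by (subst LB) (auto simp: card_insert_if)
  also have "\<dots> \<longleftrightarrow> (\<forall>u\<in>legs ?S. card (blk ?S `` {u}) \<in> {2, 3})"
    using blk_lsplice by (simp del: lsplice_simps(3))
  finally have 1: "(\<forall>u\<in>legs G. card (blk G `` {u}) \<in> {2, 3}) \<longleftrightarrow>
      (\<forall>u\<in>legs ?S. card (blk ?S `` {u}) \<in> {2, 3})" .
  have "(\<forall>u\<in>legs G. card (conn G `` {u} \<inter> free G) \<in> {2, 3}) \<longleftrightarrow>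
      (\<forall>u\<in>legs G - {x, y}. card (conn G `` {u} \<inter> free G) \<in> {2, 3})"
  proof
    assume *: "\<forall>u\<in>legs G - {x, y}. card (conn G `` {u} \<inter> free G) \<in> {2, 3}"
    have "a \<in> legs G - {x, y}" "b \<in> legs G - {x, y}" using splice_legs splice_distinct by blast+
    hence "card (conn G `` {x} \<inter> free G) \<in> {2, 3}" "card (conn G `` {y} \<inter> free G) \<in> {2, 3}"
      unfolding ca using * by blast+
    thus "\<forall>u\<in>legs G. card (conn G `` {u} \<inter> free G) \<in> {2, 3}" using * by blast
  qed blast
  also have "\<dots> \<longleftrightarrow> (\<forall>u\<in>legs ?S. card (conn ?S `` {u} \<inter> free ?S) \<in> {2, 3})"
    using c by simp
  finally have 2: "(\<forall>u\<in>legs G. card (conn G `` {u} \<inter> free G) \<in> {2, 3}) \<longleftrightarrow>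
    (\<forall>u\<in>legs ?S. card (conn ?S `` {u} \<inter> free ?S) \<in> {2, 3})" .
  have 3: "(\<forall>u\<in>free G. card (blk G `` {u}) = 2 \<longrightarrow> blk G `` {u} \<subseteq> free G) \<longleftrightarrow>
      (\<forall>u\<in>free ?S. card (blk ?S `` {u}) = 2 \<longrightarrow> blk ?S `` {u} \<subseteq> free ?S)"
    unfolding free_lsplice
  proof (intro ball_cong refl)
    fix u assume "u \<in> free G"
    hence "u \<notin> {x, y}" using fL by blast
    from blk_lsplice[OF this] show "(card (blk G `` {u}) = 2 \<longrightarrow> blk G `` {u} \<subseteq> free G) \<longleftrightarrow>
      (card (blk ?S `` {u}) = 2 \<longrightarrow> blk ?S `` {u} \<subseteq> free G)" by (simp del: lsplice_simps)
  qed
  show ?thesis unfolding valid_leg_def using wf wf_lsplice 1 2 3 by blast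
qed

lemma core_lsplice: "core (lsplice G a x y b) = core G"
proof -
  have notin: "u \<notin> {x, y}" if "u \<in> core G" for u
  proof
    assume "u \<in> {x, y}"
    hence "card (blk G `` {u}) = 2" using splice_block splice_distinct(1) by simp
    thus False using that by (simp add: core_def)
  qed
  have "u \<in> core (lsplice G a x y b) \<longleftrightarrow> u \<in> core G" for u
  proof (cases "u \<in> legs G - {x, y}")
    case True
    hence "u \<notin> {x, y}" by blast
    thus ?thesis
      unfolding core_def free_lsplice mem_Collect_eq blk_lsplice[OF \<open>u \<notin> {x, y}\<close>] using True by simp
  next
    case False
    thus ?thesis using notin[of u] by (auto simp: core_def)
  qed
  thus ?thesis by blast
qed

lemma nf_lsplice: "nf (lsplice G a x y b) = nf G"
proof (rule leg_graph_eqI)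
  let ?S = "lsplice G a x y b"
  have coreB: "core G \<subseteq> legs G - {x, y}" using core_lsplice by (auto simp: core_def)
  show "legs (nf ?S) = legs (nf G)" by (simp add: nf_def core_lsplice)
  show "blk (nf ?S) = blk (nf G)" using coreB by (auto simp: nf_def core_lsplice)
  let ?E = "lnk G \<union> pairs G" and ?E' = "lnk ?S \<union> pairs ?S"
  have p: "(u, v) \<in> pairs ?S \<longleftrightarrow> (u, v) \<in> pairs G" if "u \<notin> {x, y}" for u v
    unfolding pairs_iff blk_lsplice[OF that] ..
  have p': "u \<notin> {x, y}" if "(u, v) \<in> pairs ?S" for u v
    using that by (auto simp: pairs_def)
  have "(h, k) \<in> ?E'\<^sup>* \<longleftrightarrow> (h, k) \<in> ?E\<^sup>*" if h: "h \<in> core G" and k: "k \<in> core G" for h k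
  proof (rule rtrancl_splice[symmetric, where x = x and y = y and a = a and b = b])
    show "h \<notin> {x, y}" "k \<notin> {x, y}" using h k coreB by blast+
    show "(p, q) \<in> ?E'" if "(p, q) \<in> ?E" "p \<notin> {x, y}" "q \<notin> {x, y}" for p q
      using that p[of p q] splice_distinct by auto
    show "p \<in> {a, b}" if "(p, q) \<in> ?E" "p \<notin> {x, y}" "q \<in> {x, y}" for p q
      using that splice_blk[of p q] splice_lnk_unique[of p q] unfolding pairs_def by blast
    show "q \<in> {x, y, a, b}" if "(p, q) \<in> ?E" "p \<in> {x, y}" for p q
      using that splice_blk[of p q] splice_lnk_unique[of p q] unfolding pairs_def by blast
    have "card (blk G `` {x}) = 2" "card (blk G `` {y}) = 2"
      using splice_block splice_distinct(1) by simp_all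
    hence xy: "(x, y) \<in> pairs G" "(y, x) \<in> pairs G" using splice_block unfolding pairs_def by blast+
    have "(a, b) \<in> ?E\<^sup>*" "(b, a) \<in> ?E\<^sup>*"
      using xy splice_lnk by (meson UnCI converse_rtrancl_into_rtrancl r_into_rtrancl)+
    moreover have "pairs ?S \<subseteq> pairs G" using p p' by auto
    ultimately show "?E' \<subseteq> ?E\<^sup>*" by auto
  qed auto
  thus "lnk (nf ?S) = lnk (nf G)" by (auto simp: nf_def core_lsplice)
qed

text \<open>Four entries of the link relation are traded for two. Smoothing thus never increases the
  number of links, which is what bounds the size of quotient graphs.\<close>

lemma card_lnk_lsplice: "card (lnk (lsplice G a x y b)) \<le> card (lnk G)"
proof -
  have fin: "finite (lnk G)"
    using wf finite_subset[of "lnk G" "legs G \<times> legs G"] by (auto simp: wf_leg_def)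
  let ?F = "{(a, x), (x, a), (y, b), (b, y)}"
  have "card ?F = 4" using splice_distinct by auto
  moreover have "?F \<subseteq> lnk G" using splice_lnk by blast
  ultimately have "card (lnk G - ?F) = card (lnk G) - 4" "4 \<le> card (lnk G)"
    using fin card_mono[of "lnk G" ?F] by (simp_all add: card_Diff_subset)
  moreover have "card (lnk (lsplice G a x y b)) \<le> card (lnk G - ?F) + card {(a, b), (b, a)}"
    unfolding lsplice_simps by (rule card_Un_le)
  moreover have "card {(a, b), (b, a)} = 2" using splice_distinct(4) by simp
  ultimately show ?thesis by simp
qed

end

section \<open>Subobjects and normal forms\<close>

text \<open>It is not enough that two graphs have the same normal form: their families of subobjects
  have to match, with matching normal forms of subobjects and quotients.\<close>

definition bisim :: "'h leg_graph \<Rightarrow> 'h leg_graph \<Rightarrow> bool" where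
  "bisim G G' \<longleftrightarrow> (\<exists>\<beta>. bij_betw \<beta> (lsubs G) (lsubs G') \<and>
     (\<forall>U\<in>lsubs G. nf (lsub G' (\<beta> U)) = nf (lsub G U) \<and> nf (lquo G' (\<beta> U)) = nf (lquo G U)))"

lemma bisim_refl: "bisim G G"
  unfolding bisim_def by (intro exI[of _ id]) simp

lemma bisim_trans:
  assumes "bisim G G'" "bisim G' G''"
  shows "bisim G G''"
proof -
  obtain \<beta> where \<beta>: "bij_betw \<beta> (lsubs G) (lsubs G')"
     "\<forall>U\<in>lsubs G. nf (lsub G' (\<beta> U)) = nf (lsub G U) \<and> nf (lquo G' (\<beta> U)) = nf (lquo G U)"
    using assms(1) unfolding bisim_def by blast
  obtain \<gamma> where \<gamma>: "bij_betw \<gamma> (lsubs G') (lsubs G'')"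
     "\<forall>U\<in>lsubs G'. nf (lsub G'' (\<gamma> U)) = nf (lsub G' U) \<and> nf (lquo G'' (\<gamma> U)) = nf (lquo G' U)"
    using assms(2) unfolding bisim_def by blast
  have "bij_betw (\<gamma> \<circ> \<beta>) (lsubs G) (lsubs G'')" using \<beta>(1) \<gamma>(1) by (rule bij_betw_trans)
  moreover have "\<beta> U \<in> lsubs G'" if "U \<in> lsubs G" for U using \<beta>(1) that bij_betwE by blast
  ultimately show ?thesis unfolding bisim_def using \<beta>(2) \<gamma>(2) by (intro exI[of _ "\<gamma> \<circ> \<beta>"]) simp
qed

lemma ldrop_lsub: "ldrop (lsub G U) B = lsub (ldrop G B) U"
  by (rule leg_graph_eqI) simp_all

lemma droppable_lsub:
  assumes "wf_leg G" "droppable G B" "U \<subseteq> lnk G"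
  shows "droppable (lsub G U) B"
proof -
  have "free G \<subseteq> free (lsub G U)" using assms(3) by (auto simp: free_def)
  thus ?thesis using assms(2) by (auto simp: droppable_def)
qed

lemma drop_lquo:
  assumes wf: "wf_leg G" and dr: "droppable G B" and U: "U \<subseteq> lnk G" "sym U"
  shows "droppable (lquo G U) B" "ldrop (lquo G U) B = lquo (ldrop G B) U"
proof -
  have wfs: "wf_leg (lsub G U)" using wf_lsub[OF wf U] .
  have drs: "droppable (lsub G U) B" using droppable_lsub[OF wf dr U(1)] .
  obtain x where x: "x \<in> legs G" "B = blk G `` {x}" using dr unfolding droppable_def by blast
  have xB: "x \<in> B" using x blk_refl[OF wf] by blast
  have BL: "B \<subseteq> legs G" using drop_legs[OF wf dr] .
  have BU: "B \<inter> Domain U = {}" using drop_lnk[OF wf dr] U(1) by blast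
  hence "blk (lquo G U) `` {x} = B"
    using blk_lquo[of x G U] conn_dropped[OF wfs drs xB] xB BL by (auto simp: free_lsub)
  moreover have "B \<subseteq> free (lquo G U)" using drop_free[OF wf dr] free_lquo[OF wf U] by simp
  ultimately show "droppable (lquo G U) B"
    using dr xB BU BL unfolding droppable_def lquo_simps by blast
  show "ldrop (lquo G U) B = lquo (ldrop G B) U"
  proof (rule leg_graph_eqI)
    show "blk (ldrop (lquo G U) B) = blk (lquo (ldrop G B) U)"
    proof -
      have "(u, v) \<in> (blk G \<union> U)\<^sup>* \<longleftrightarrow> (u, v) \<in> (blk (ldrop G B) \<union> U)\<^sup>*" if "u \<in> legs G - B" for u v
        using conn_ldrop[OF wfs drs, of u] that by (auto simp: conn_def)
      thus ?thesis by (auto simp: lquo_blk simp del: ldrop_simps(3)) (auto simp: lquo_blk)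
    qed
  qed auto
qed

lemma bisim_ldrop:
  assumes wf: "wf_leg G" and dr: "droppable G B"
  shows "bisim G (ldrop G B)"
  unfolding bisim_def
proof (intro exI[of _ id] conjI ballI)
  have eq: "U \<in> lsubs (ldrop G B) \<longleftrightarrow> U \<in> lsubs G" for U
  proof (cases "U \<subseteq> lnk G \<and> sym U")
    case True
    hence U: "U \<subseteq> lnk G" "sym U" by auto
    show ?thesis
      using True valid_ldrop_iff[OF wf_lsub[OF wf U] droppable_lsub[OF wf dr U(1)]]
        valid_ldrop_iff[OF wf_lquo[OF wf U] drop_lquo(1)[OF wf dr U]]
      by (simp add: lsubs_def ldrop_lsub drop_lquo(2)[OF wf dr U])
  qed (auto simp: lsubs_def)
  hence "lsubs (ldrop G B) = lsubs G" by blast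
  thus "bij_betw id (lsubs G) (lsubs (ldrop G B))" by simp
  fix U assume "U \<in> lsubs G"
  hence U: "U \<subseteq> lnk G" "sym U" by (auto simp: lsubs_def)
  show "nf (lsub (ldrop G B) (id U)) = nf (lsub G U)"
    using nf_ldrop[OF wf_lsub[OF wf U] droppable_lsub[OF wf dr U(1)]] by (simp add: ldrop_lsub)
  show "nf (lquo (ldrop G B) (id U)) = nf (lquo G U)"
    using nf_ldrop[OF wf_lquo[OF wf U] drop_lquo(1)[OF wf dr U]] by (simp add: drop_lquo(2)[OF wf dr U])
qed

text \<open>Translation of link sets between \<open>G\<close> and the spliced graph: the single link
  between \<open>a\<close> and \<open>b\<close> stands for the two links at the smoothed vertex.
  \<open>splice_link\<close> goes the other way.\<close>

definition lift_link :: "'h \<Rightarrow> 'h \<Rightarrow> 'h \<Rightarrow> 'h \<Rightarrow> ('h \<times> 'h) set \<Rightarrow> ('h \<times> 'h) set" where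
  "lift_link a x y b V = (if (a, b) \<in> V then V - {(a, b), (b, a)} \<union> {(a, x), (x, a), (y, b), (b, y)} else V)"

definition splice_link :: "'h \<Rightarrow> 'h \<Rightarrow> 'h \<Rightarrow> 'h \<Rightarrow> ('h \<times> 'h) set \<Rightarrow> ('h \<times> 'h) set" where
  "splice_link a x y b U = (if (a, x) \<in> U then U - {(a, x), (x, a), (y, b), (b, y)} \<union> {(a, b), (b, a)} else U)"

context
  fixes G :: "'h leg_graph" and a x y b :: 'h
  assumes wf: "wf_leg G" and sp: "spliceable G a x y b"
begin

context
  fixes U
  assumes U: "U \<subseteq> lnk G" "sym U"
begin

context
  assumes ax: "(a, x) \<in> U" and yb: "(y, b) \<in> U"
begin

lemma spliceable_lsub: "spliceable (lsub G U) a x y b"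
  using sp ax yb by (simp add: spliceable_def)

lemma lsplice_lsub: "lsplice (lsub G U) a x y b = lsub (lsplice G a x y b) (splice_link a x y b U)"
  by (rule leg_graph_eqI) (simp_all add: splice_link_def ax)

text \<open>If both links at {x, y} are contracted, this vertex vanishes inside a contracted
  component whether or not it was smoothed before.\<close>

lemma lquo_splice_absorbed: "lquo (lsplice G a x y b) (splice_link a x y b U) = lquo G U"
proof (rule leg_graph_eqI)
  let ?V = "splice_link a x y b U"
  note d = splice_distinct[OF wf sp]
  have "(x, a) \<in> U" "(b, y) \<in> U" using ax yb U(2) by (auto dest: symD)
  hence "Domain ?V \<union> {x, y} = Domain U"
    using ax yb d by (auto simp: splice_link_def Domain_iff)
  thus L: "legs (lquo (lsplice G a x y b) ?V) = legs (lquo G U)" by auto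
  have "(u, v) \<in> (blk (lsplice G a x y b) \<union> ?V)\<^sup>* \<longleftrightarrow> (u, v) \<in> (blk G \<union> U)\<^sup>*"
    if "u \<in> legs G - {x, y}" "v \<in> legs G - {x, y}" for u v
    using conn_lsplice[OF wf_lsub[OF wf U] spliceable_lsub, of u v] that
    by (simp add: conn_def lsplice_lsub del: lsplice_simps(3))
  moreover have "legs G - Domain U \<subseteq> legs G - {x, y}" using ax yb \<open>(x, a) \<in> U\<close> by auto
  ultimately show "blk (lquo (lsplice G a x y b) ?V) = blk (lquo G U)"
    using L unfolding lquo_blk lquo_simps by (auto simp del: lsplice_simps(3))
  show "lnk (lquo (lsplice G a x y b) ?V) = lnk (lquo G U)"
    using d U \<open>(x, a) \<in> U\<close> \<open>(b, y) \<in> U\<close> ax yb by (auto simp: splice_link_def)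
qed

end

context
  assumes ax: "(a, x) \<notin> U" and yb: "(y, b) \<notin> U"
begin

lemma splice_unused: "{a, x, y, b} \<inter> Domain U = {}"
proof -
  note l = splice_lnk[OF wf sp]
  have "(x, a) \<notin> U" "(b, y) \<notin> U" using ax yb U(2) by (auto dest: symD)
  thus ?thesis
    using link_unique[OF wf U l(1) ax] link_unique[OF wf U l(3) yb] by blast
qed

text \<open>If neither link is used, {x, y} is isolated in the subobject but still sits between
  \<open>a\<close> and \<open>b\<close> in the quotient: the subobject changes by a drop, the
  quotient by a splice.\<close>

lemma droppable_lsub_splice: "droppable (lsub G U) {x, y}"
proof -
  have "x \<in> legs G" "y \<in> legs G" using splice_legs[OF wf sp] by auto
  moreover have "{x, y} = blk G `` {x}" using splice_block[OF wf sp, of x] by simp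
  moreover have "card {x, y} = 2" using splice_distinct(1)[OF wf sp] by simp
  ultimately show ?thesis
    using splice_unused unfolding droppable_def free_lsub lsub_simps by blast
qed

lemma ldrop_lsub_splice: "ldrop (lsub G U) {x, y} = lsub (lsplice G a x y b) U"
  by (rule leg_graph_eqI) simp_all

lemma lsplice_lquo:
  shows "spliceable (lquo G U) a x y b" "lsplice (lquo G U) a x y b = lquo (lsplice G a x y b) U"
proof -
  note d = splice_distinct[OF wf sp] and l = splice_lnk[OF wf sp]
  have xyL: "x \<in> legs G" "y \<in> legs G" using splice_legs[OF wf sp] by auto
  have "blk (lquo G U) `` {x} = conn (lsub G U) `` {x} \<inter> free (lsub G U)"
    using splice_unused xyL by (intro blk_lquo) auto
  also have "conn (lsub G U) `` {x} = {x, y}"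
    using conn_dropped[OF wf_lsub[OF wf U] droppable_lsub_splice, of x] by simp
  also have "{x, y} \<inter> free (lsub G U) = {x, y}" using splice_unused xyL by (auto simp: free_lsub)
  finally show "spliceable (lquo G U) a x y b"
    using d l ax yb by (simp add: spliceable_def)
  show "lsplice (lquo G U) a x y b = lquo (lsplice G a x y b) U"
  proof (rule leg_graph_eqI)
    show "legs (lsplice (lquo G U) a x y b) = legs (lquo (lsplice G a x y b) U)" by auto
    have "(a, b) \<notin> U" "(b, a) \<notin> U" using d U(1) by auto
    thus "lnk (lsplice (lquo G U) a x y b) = lnk (lquo (lsplice G a x y b) U)" by auto
    have "(u, v) \<in> (blk G \<union> U)\<^sup>* \<longleftrightarrow> (u, v) \<in> (blk (lsplice G a x y b) \<union> U)\<^sup>*" if "u \<in> legs G - {x, y}" for u v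
      using conn_ldrop[OF wf_lsub[OF wf U] droppable_lsub_splice, of u] that
      by (auto simp: conn_def)
    thus "blk (lsplice (lquo G U) a x y b) = blk (lquo (lsplice G a x y b) U)"
      by (auto simp: lquo_blk simp del: lsplice_simps(3)) (auto simp: lquo_blk)
  qed
qed

end

text \<open>Using just one of the two links would produce a bivalent vertex with exactly one free
  leg, which the last clause of \<open>valid_leg\<close> rules out. This makes
  \<open>splice_link\<close> bijective on subobjects.\<close>

lemma splice_all_or_none:
  assumes "valid_leg (lsub G U)"
  shows "(a, x) \<in> U \<longleftrightarrow> (y, b) \<in> U"
proof -
  note l = splice_lnk[OF wf sp]
  have xyL: "x \<in> legs G" "y \<in> legs G" using splice_legs[OF wf sp] by auto
  have "card (blk G `` {u}) = 2" if "u \<in> {x, y}" for u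
    using splice_block[OF wf sp that] splice_distinct(1)[OF wf sp] by simp
  hence "{x, y} \<subseteq> free (lsub G U)" if "u \<in> free (lsub G U)" "u \<in> {x, y}" for u
    using assms that splice_block[OF wf sp that(2)] unfolding valid_leg_def lsub_simps by metis
  hence "x \<in> Domain U \<longleftrightarrow> y \<in> Domain U" using xyL by (auto simp: free_lsub)
  moreover have "x \<in> Domain U \<longleftrightarrow> (a, x) \<in> U"
    using lnk_unique[OF wf l(2)] U by (blast dest: symD)
  moreover have "y \<in> Domain U \<longleftrightarrow> (y, b) \<in> U"
    using lnk_unique[OF wf l(3)] U by (blast dest: symD)
  ultimately show ?thesis by simp
qed

end

lemma splice_link_lift:
  assumes "V \<subseteq> lnk (lsplice G a x y b)" "sym V"
  shows "lift_link a x y b V \<subseteq> lnk G" "sym (lift_link a x y b V)"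
    "splice_link a x y b (lift_link a x y b V) = V"
    "(a, x) \<in> lift_link a x y b V \<longleftrightarrow> (a, b) \<in> V" "(y, b) \<in> lift_link a x y b V \<longleftrightarrow> (a, b) \<in> V"
proof -
  note d = splice_distinct[OF wf sp] and l = splice_lnk[OF wf sp]
  have ba: "(b, a) \<in> V \<longleftrightarrow> (a, b) \<in> V" using assms(2) by (auto dest: symD)
  have n: "(a, x) \<notin> V" "(x, a) \<notin> V" "(y, b) \<notin> V" "(b, y) \<notin> V" using assms(1) d by auto
  show "lift_link a x y b V \<subseteq> lnk G" using assms(1) l ba by (auto simp: lift_link_def)
  show "sym (lift_link a x y b V)" using assms(2) by (auto simp: lift_link_def sym_def)
  show "(a, x) \<in> lift_link a x y b V \<longleftrightarrow> (a, b) \<in> V" "(y, b) \<in> lift_link a x y b V \<longleftrightarrow> (a, b) \<in> V"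
    using n by (auto simp: lift_link_def)
  show "splice_link a x y b (lift_link a x y b V) = V"
    using n ba d by (auto simp: lift_link_def splice_link_def)
qed

lemma lift_link_splice:
  assumes U: "U \<subseteq> lnk G" "sym U" and yb: "(a, x) \<in> U \<longleftrightarrow> (y, b) \<in> U"
  shows "splice_link a x y b U \<subseteq> lnk (lsplice G a x y b)" "sym (splice_link a x y b U)"
    "lift_link a x y b (splice_link a x y b U) = U"
proof -
  note d = splice_distinct[OF wf sp]
  have ba: "(x, a) \<in> U \<longleftrightarrow> (a, x) \<in> U" "(b, y) \<in> U \<longleftrightarrow> (a, x) \<in> U" using U(2) yb by (auto dest: symD)
  have n: "(a, b) \<notin> U" "(b, a) \<notin> U" using U(1) d by auto
  show "splice_link a x y b U \<subseteq> lnk (lsplice G a x y b)"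
    using U(1) yb ba by (auto simp: splice_link_def)
  show "sym (splice_link a x y b U)" using U(2) by (auto simp: splice_link_def sym_def)
  show "lift_link a x y b (splice_link a x y b U) = U"
    using n ba d yb by (auto simp: lift_link_def splice_link_def)
qed

lemma splice_lsubs:
  assumes U: "U \<subseteq> lnk G" "sym U" and yb: "(a, x) \<in> U \<longleftrightarrow> (y, b) \<in> U"
  shows "splice_link a x y b U \<in> lsubs (lsplice G a x y b) \<longleftrightarrow> U \<in> lsubs G"
    "nf (lsub (lsplice G a x y b) (splice_link a x y b U)) = nf (lsub G U)"
    "nf (lquo (lsplice G a x y b) (splice_link a x y b U)) = nf (lquo G U)"
proof -
  have *: "(splice_link a x y b U \<in> lsubs (lsplice G a x y b) \<longleftrightarrow> U \<in> lsubs G) \<and>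
    nf (lsub (lsplice G a x y b) (splice_link a x y b U)) = nf (lsub G U) \<and>
    nf (lquo (lsplice G a x y b) (splice_link a x y b U)) = nf (lquo G U)"
  proof (cases "(a, x) \<in> U")
    case True
    hence yb': "(y, b) \<in> U" using yb by simp
    note sps = spliceable_lsub[OF U True yb']
    show ?thesis
      using valid_lsplice_iff[OF wf_lsub[OF wf U] sps] nf_lsplice[OF wf_lsub[OF wf U] sps]
        lift_link_splice(1,2)[OF assms] U
      by (simp add: lsubs_def lsplice_lsub[OF U True yb'] lquo_splice_absorbed[OF U True yb'] del: lsplice_simps)
  next
    case False
    hence yb': "(y, b) \<notin> U" using yb by simp
    have eq: "splice_link a x y b U = U" using False by (simp add: splice_link_def)
    note dr = droppable_lsub_splice[OF U False yb'] and sq = lsplice_lquo[OF U False yb']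
    show ?thesis
      using valid_ldrop_iff[OF wf_lsub[OF wf U] dr] nf_ldrop[OF wf_lsub[OF wf U] dr]
        valid_lsplice_iff[OF wf_lquo[OF wf U] sq(1)] nf_lsplice[OF wf_lquo[OF wf U] sq(1)]
        lift_link_splice(1,2)[OF assms] U
      by (simp add: lsubs_def ldrop_lsub_splice[OF U False yb'] sq(2) eq del: lsplice_simps)
  qed
  thus "splice_link a x y b U \<in> lsubs (lsplice G a x y b) \<longleftrightarrow> U \<in> lsubs G"
    "nf (lsub (lsplice G a x y b) (splice_link a x y b U)) = nf (lsub G U)"
    "nf (lquo (lsplice G a x y b) (splice_link a x y b U)) = nf (lquo G U)" by blast+
qed

lemma bisim_lsplice: "bisim G (lsplice G a x y b)"
  unfolding bisim_def
proof (intro exI[of _ "splice_link a x y b"] conjI ballI)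
  have U: "U \<subseteq> lnk G" "sym U" "(a, x) \<in> U \<longleftrightarrow> (y, b) \<in> U" if "U \<in> lsubs G" for U
    using that splice_all_or_none[of U] by (auto simp: lsubs_def)
  show "bij_betw (splice_link a x y b) (lsubs G) (lsubs (lsplice G a x y b))"
  proof (rule bij_betwI[where g = "lift_link a x y b"])
    show "splice_link a x y b \<in> lsubs G \<rightarrow> lsubs (lsplice G a x y b)"
      using U splice_lsubs(1) by blast
    show "lift_link a x y b (splice_link a x y b U) = U" if "U \<in> lsubs G" for U
      using lift_link_splice(3)[OF U[OF that]] .
    fix V assume V: "V \<in> lsubs (lsplice G a x y b)"
    hence V': "V \<subseteq> lnk (lsplice G a x y b)" "sym V" unfolding lsubs_def by blast+
    show "splice_link a x y b (lift_link a x y b V) = V" using splice_link_lift(3)[OF V'] .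
  next
    show "lift_link a x y b \<in> lsubs (lsplice G a x y b) \<rightarrow> lsubs G"
    proof
      fix V assume V: "V \<in> lsubs (lsplice G a x y b)"
      hence V': "V \<subseteq> lnk (lsplice G a x y b)" "sym V" unfolding lsubs_def by blast+
      note s = splice_link_lift[OF V']
      have "(a, x) \<in> lift_link a x y b V \<longleftrightarrow> (y, b) \<in> lift_link a x y b V" using s(4,5) by simp
      from splice_lsubs(1)[OF s(1,2) this] show "lift_link a x y b V \<in> lsubs G" using s(3) V by simp
    qed
  qed
  fix V assume V: "V \<in> lsubs G"
  show "nf (lsub (lsplice G a x y b) (splice_link a x y b V)) = nf (lsub G V)"
    "nf (lquo (lsplice G a x y b) (splice_link a x y b V)) = nf (lquo G V)"
    using splice_lsubs(2,3)[OF U[OF V]] .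
qed

end

section \<open>Termination of smoothing and transfer of subobjects to the normal form\<close>

definition reduced :: "'h leg_graph \<Rightarrow> bool" where
  "reduced G \<longleftrightarrow> (\<forall>h\<in>legs G. card (blk G `` {h}) = 3 \<and> \<not> blk G `` {h} \<subseteq> free G)"

text \<open>Without bivalent vertices \<open>pairs\<close> is empty, and in a matching a chain of
  links either goes one step or returns to its start.\<close>

lemma nf_reduced:
  assumes wf: "wf_leg G" and "reduced G"
  shows "nf G = G"
proof (rule leg_graph_eqI)
  have core: "core G = legs G" using assms(2) by (auto simp: core_def reduced_def)
  show "legs (nf G) = legs G" by (simp add: nf_def core)
  have "blk G \<subseteq> legs G \<times> legs G" using wf by (auto simp: wf_leg_def equiv_def)
  thus "blk (nf G) = blk G" by (auto simp: nf_def core)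
  have "pairs G = {}"
    using assms(2) blk_legs[OF wf] by (force simp: pairs_def reduced_def)
  moreover have "(u, v) \<in> lnk G \<or> u = v" if "(u, v) \<in> (lnk G)\<^sup>*" for u v
    using that
  proof (induction rule: rtrancl_induct)
    case (step y z)
    thus ?case using lnk_unique[OF wf] lnk_sym[OF wf] by blast
  qed simp
  ultimately show "lnk (nf G) = lnk G"
    using lnk_legs[OF wf] lnk_irrefl[OF wf] by (auto simp: nf_def core)
qed

text \<open>An offending vertex that is not entirely free must be bivalent, and by the last clause
  of \<open>valid_leg\<close> none of its legs is free; so both are linked and it can be
  smoothed.\<close>

lemma reduction_step:
  assumes G: "valid_leg G" and "\<not> reduced G"
  shows "(\<exists>B. droppable G B) \<or> (\<exists>a x y b. spliceable G a x y b)"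
proof -
  note wf = valid_wf[OF G]
  obtain x where x: "x \<in> legs G" "card (blk G `` {x}) \<noteq> 3 \<or> blk G `` {x} \<subseteq> free G"
    using assms(2) by (auto simp: reduced_def)
  have c: "card (blk G `` {x}) \<in> {2, 3}" using G x(1) by (simp add: valid_leg_def)
  show ?thesis
  proof (cases "blk G `` {x} \<subseteq> free G")
    case True
    thus ?thesis using c x(1) by (auto simp: droppable_def)
  next
    case False
    hence c2: "card (blk G `` {x}) = 2" using c x(2) by auto
    have xx: "x \<in> blk G `` {x}" using blk_refl[OF wf x(1)] by blast
    obtain y where y: "blk G `` {x} = {x, y}" "x \<noteq> y"
    proof -
      obtain p q where pq: "blk G `` {x} = {p, q}" "p \<noteq> q" using c2 by (auto simp: card_2_iff)
      show ?thesis using xx pq that[of p] that[of q] by auto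
    qed
    have yL: "y \<in> legs G" using y(1) blk_legs[OF wf] by blast
    have "blk G `` {y} = blk G `` {x}" using y(1) blk_sym[OF wf] blk_trans[OF wf] by blast
    hence "u \<notin> free G" if "u \<in> {x, y}" for u
      using G False c2 that y(1) by (auto simp: valid_leg_def)
    hence "x \<notin> free G" "y \<notin> free G" by blast+
    then obtain a b where ab: "(x, a) \<in> lnk G" "(y, b) \<in> lnk G"
      using x(1) yL unfolding free_def by blast
    have ax: "(a, x) \<in> lnk G" using lnk_sym[OF wf ab(1)] .
    \<comment> \<open>If the two legs were linked to each other, {x, y} would be a component without
      free legs, against validity.\<close>
    have "a \<noteq> y"
    proof
      assume "a = y"
      have "v \<in> {x, y}" if "(x, v) \<in> conn G" for v
        using that unfolding conn_def
      proof (induction rule: rtrancl_induct)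
        case (step u v)
        have "v \<in> {x, y}" if "(u, v) \<in> blk G"
          using that step(3) y(1) \<open>blk G `` {y} = blk G `` {x}\<close> by blast
        moreover have "v \<in> {x, y}" if "(u, v) \<in> lnk G"
          using that step(3) lnk_unique[OF wf] ab(1) ax \<open>a = y\<close> by blast
        ultimately show ?case using step(2) by blast
      qed simp
      moreover have "x \<notin> free G" "y \<notin> free G" using ab by (auto simp: free_def)
      ultimately have "conn G `` {x} \<inter> free G = {}" by blast
      thus False using G x(1) by (auto simp: valid_leg_def)
    qed
    hence "spliceable G a x y b" using y ax ab by (simp add: spliceable_def)
    thus ?thesis by blast
  qed
qed

lemma reduction_induct [consumes 1, case_names reduced drop splice]:
  assumes "valid_leg G"
    and "\<And>G. valid_leg G \<Longrightarrow> reduced G \<Longrightarrow> P G"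
    and "\<And>G B. valid_leg G \<Longrightarrow> droppable G B \<Longrightarrow> P (ldrop G B) \<Longrightarrow> P G"
    and "\<And>G a x y b. valid_leg G \<Longrightarrow> spliceable G a x y b \<Longrightarrow> P (lsplice G a x y b) \<Longrightarrow> P G"
  shows "P G"
  using assms(1)
proof (induction "card (legs G)" arbitrary: G rule: less_induct)
  case less
  note G = less.prems and wf = valid_wf[OF less.prems]
  show ?case
  proof (cases "reduced G")
    case False
    then consider B where "droppable G B" | a x y b where "spliceable G a x y b"
      using reduction_step[OF G] by blast
    thus ?thesis
    proof cases
      case (1 B)
      have "B \<noteq> {}" using 1 by (auto simp: droppable_def)
      hence "card (legs (ldrop G B)) < card (legs G)"
        using drop_legs[OF wf 1] finite_legs[OF wf] by (auto intro: psubset_card_mono)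
      moreover have "valid_leg (ldrop G B)" using valid_ldrop_iff[OF wf 1] G by simp
      ultimately show ?thesis using assms(3)[OF G 1] less.hyps by blast
    next
      case (2 a x y b)
      have "card (legs (lsplice G a x y b)) < card (legs G)"
        using splice_legs[OF wf 2] finite_legs[OF wf] by (auto intro: psubset_card_mono)
      moreover have "valid_leg (lsplice G a x y b)" using valid_lsplice_iff[OF wf 2] G by simp
      ultimately show ?thesis using assms(4)[OF G 2] less.hyps by blast
    qed
  qed (use assms(2) G in blast)
qed

text \<open>Because \<open>nf\<close> is a closed formula invariant under both reduction steps, no
  confluence argument is needed; all properties are pulled back from the reduced graph along the
  steps.\<close>

theorem reduction:
  assumes "valid_leg G"
  shows "valid_leg (nf G) \<and> reduced (nf G) \<and> bisim G (nf G) \<and> card (lnk (nf G)) \<le> card (lnk G)"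
  using assms
proof (induction rule: reduction_induct)
  case (reduced G)
  thus ?case using nf_reduced[OF valid_wf[OF reduced(1)] reduced(2)] bisim_refl by simp
next
  case (drop G B)
  note wf = valid_wf[OF drop(1)]
  show ?case
    using drop(3) bisim_trans[OF bisim_ldrop[OF wf drop(2)]] by (simp add: nf_ldrop[OF wf drop(2)])
next
  case (splice G a x y b)
  note wf = valid_wf[OF splice(1)]
  show ?case
    using splice(3) bisim_trans[OF bisim_lsplice[OF wf splice(2)]] card_lnk_lsplice[OF wf splice(2)]
    by (simp add: nf_lsplice[OF wf splice(2)] del: lsplice_simps)
qed

lemma free_nf:
  assumes "valid_leg G"
  shows "free (nf G) = free G \<inter> core G"
  using assms
proof (induction rule: reduction_induct)
  case (reduced G)
  have "core G = legs G" using reduced(2) by (auto simp: core_def reduced_def)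
  thus ?case using nf_reduced[OF valid_wf[OF reduced(1)] reduced(2)] by (auto simp: free_def)
next
  case (drop G B)
  note wf = valid_wf[OF drop(1)]
  have "B \<inter> core G = {}" using core_ldrop[OF wf drop(2)] by (auto simp: core_def)
  thus ?case
    using drop(3) free_ldrop[OF wf drop(2)] core_ldrop[OF wf drop(2)] nf_ldrop[OF wf drop(2)] by auto
next
  case (splice G a x y b)
  note wf = valid_wf[OF splice(1)]
  show ?case
    using splice(3) by (simp add: free_lsplice[OF wf splice(2)] core_lsplice[OF wf splice(2)] nf_lsplice[OF wf splice(2)])
qed

text \<open>\<open>bisim\<close> supplies only some bijection of subobjects. For successive
  quotients one and the same link set has to be recognised in \<open>G\<close> and in
  \<open>nf G\<close>; its ends lie in the core, so smoothing steps leave it alone.\<close>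

lemma nf_lquo_common:
  assumes "valid_leg G" and "V \<in> lsubs (nf G)" and "V \<subseteq> lnk G"
  shows "V \<in> lsubs G \<and> nf (lquo (nf G) V) = nf (lquo G V)"
  using assms
proof (induction rule: reduction_induct)
  case (reduced G)
  thus ?case using nf_reduced[OF valid_wf[OF reduced(1)] reduced(2)] by simp
next
  case (drop G B)
  note wf = valid_wf[OF drop(1)] and V = drop.prems
  have U: "V \<subseteq> lnk G" "sym V" using V by (auto simp: lsubs_def)
  have IH: "V \<in> lsubs (ldrop G B)" "nf (lquo (nf G) V) = nf (lquo (ldrop G B) V)"
    using drop(3) V by (simp_all add: nf_ldrop[OF wf drop(2)])
  have "valid_leg (lsub G V) \<and> valid_leg (lquo G V)"
    using IH(1) valid_ldrop_iff[OF wf_lsub[OF wf U] droppable_lsub[OF wf drop(2) U(1)]]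
        valid_ldrop_iff[OF wf_lquo[OF wf U] drop_lquo(1)[OF wf drop(2) U]]
    by (simp add: lsubs_def ldrop_lsub drop_lquo(2)[OF wf drop(2) U])
  moreover have "nf (lquo (ldrop G B) V) = nf (lquo G V)"
    using nf_ldrop[OF wf_lquo[OF wf U] drop_lquo(1)[OF wf drop(2) U]] by (simp add: drop_lquo(2)[OF wf drop(2) U])
  ultimately show ?case using IH U by (simp add: lsubs_def)
next
  case (splice G a x y b)
  note wf = valid_wf[OF splice(1)] and V = splice.prems and sp = splice(2)
  have U: "V \<subseteq> lnk G" "sym V" using V by (auto simp: lsubs_def)
  have core: "V \<subseteq> core G \<times> core G" using V(1) by (auto simp: lsubs_def nf_def)
  have "core G \<subseteq> legs G - {x, y}" using core_lsplice[OF wf sp] by (auto simp: core_def)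
  hence n: "(a, x) \<notin> V" "(x, a) \<notin> V" "(y, b) \<notin> V" "(b, y) \<notin> V" using core by auto
  hence "V \<subseteq> lnk (lsplice G a x y b)" using U(1) by auto
  hence IH: "V \<in> lsubs (lsplice G a x y b)" "nf (lquo (nf G) V) = nf (lquo (lsplice G a x y b) V)"
    using splice(3) V by (simp_all add: nf_lsplice[OF wf sp] del: lsplice_simps)
  have "splice_link a x y b V = V" using n by (simp add: splice_link_def)
  thus ?case using splice_lsubs[OF wf sp U] n IH by simp
qed

section \<open>Relabeling of legs\<close>

abbreviation rel_map :: "('a \<Rightarrow> 'b) \<Rightarrow> ('a \<times> 'a) set \<Rightarrow> ('b \<times> 'b) set" where
  "rel_map g U \<equiv> map_prod g g ` U"

definition lmap :: "('h \<Rightarrow> 'k) \<Rightarrow> 'h leg_graph \<Rightarrow> 'k leg_graph" where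
  "lmap g G = \<lparr>legs = g ` legs G, blk = rel_map g (blk G), lnk = rel_map g (lnk G)\<rparr>"

lemma lmap_simps [simp]: "legs (lmap g G) = g ` legs G" "blk (lmap g G) = rel_map g (blk G)"
  "lnk (lmap g G) = rel_map g (lnk G)"
  by (simp_all add: lmap_def)

lemma Domain_rel_map: "Domain (rel_map g U) = g ` Domain U"
  by force

lemma rel_map_Image:
  assumes "inj_on g L" "E \<subseteq> L \<times> L" "u \<in> L"
  shows "rel_map g E `` {g u} = g ` (E `` {u})"
proof
  show "rel_map g E `` {g u} \<subseteq> g ` (E `` {u})"
  proof
    fix w assume "w \<in> rel_map g E `` {g u}"
    then obtain p q where pq: "(p, q) \<in> E" "g p = g u" "w = g q" by auto
    hence "p = u" using assms by (auto dest: inj_onD)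
    thus "w \<in> g ` (E `` {u})" using pq by blast
  qed
qed force

lemma rel_map_rtrancl_Image:
  assumes "inj_on g L" "E \<subseteq> L \<times> L" "u \<in> L"
  shows "(rel_map g E)\<^sup>* `` {g u} = g ` (E\<^sup>* `` {u})" "E\<^sup>* `` {u} \<subseteq> L"
proof -
  have EL: "v \<in> L" if "(u, v) \<in> E\<^sup>*" for v
    using that by (induction rule: rtrancl_induct) (use assms in auto)
  thus "E\<^sup>* `` {u} \<subseteq> L" by blast
  show "(rel_map g E)\<^sup>* `` {g u} = g ` (E\<^sup>* `` {u})"
  proof
    have "w \<in> g ` (E\<^sup>* `` {u})" if "(g u, w) \<in> (rel_map g E)\<^sup>*" for w
      using that
    proof (induction rule: rtrancl_induct)
      case (step p q)
      then obtain v where v: "p = g v" "(u, v) \<in> E\<^sup>*" by blast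
      have "q \<in> rel_map g E `` {g v}" unfolding v(1)[symmetric] Image_singleton_iff by (rule step(2))
      hence "q \<in> g ` (E `` {v})" by (simp only: rel_map_Image[OF assms(1,2) EL[OF v(2)]])
      then obtain v' where "q = g v'" "(v, v') \<in> E" by blast
      moreover from this have "(u, v') \<in> E\<^sup>*" using v(2) by simp
      ultimately show ?case by blast
    qed blast
    thus "(rel_map g E)\<^sup>* `` {g u} \<subseteq> g ` (E\<^sup>* `` {u})" by blast
    have "(g u, g v) \<in> (rel_map g E)\<^sup>*" if "(u, v) \<in> E\<^sup>*" for v
      using that
    proof (induction rule: rtrancl_induct)
      case (step p q)
      hence "(g p, g q) \<in> rel_map g E" by force
      thus ?case using step(3) by (rule rtrancl_into_rtrancl[rotated])
    qed simp
    thus "g ` (E\<^sup>* `` {u}) \<subseteq> (rel_map g E)\<^sup>* `` {g u}" by blast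
  qed
qed

lemma rel_map_rtrancl:
  assumes "inj_on g L" "E \<subseteq> L \<times> L" "K \<subseteq> L"
  shows "(rel_map g E)\<^sup>* \<inter> g ` K \<times> g ` K = rel_map g (E\<^sup>* \<inter> K \<times> K)"
proof -
  have "(g u, g v) \<in> (rel_map g E)\<^sup>* \<longleftrightarrow> (u, v) \<in> E\<^sup>*" if "u \<in> K" "v \<in> K" for u v
  proof -
    have "u \<in> L" "v \<in> L" using that assms by blast+
    note R = rel_map_rtrancl_Image[OF assms(1,2) this(1)]
    have "(g u, g v) \<in> (rel_map g E)\<^sup>* \<longleftrightarrow> g v \<in> g ` (E\<^sup>* `` {u})" using R(1) by blast
    also have "\<dots> \<longleftrightarrow> v \<in> E\<^sup>* `` {u}" using R(2) assms(1) \<open>v \<in> L\<close> by (auto dest: inj_onD)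
    finally show ?thesis by simp
  qed
  thus ?thesis by force
qed

lemma rel_map_Diff:
  assumes "inj_on g L" "E \<subseteq> L \<times> L" "F \<subseteq> L \<times> L"
  shows "rel_map g (E - F) = rel_map g E - rel_map g F"
proof -
  have "inj_on (map_prod g g) (L \<times> L)" using assms(1) by (simp add: map_prod_inj_on)
  thus ?thesis by (rule inj_on_image_set_diff) (use assms in blast)+
qed

lemma rel_map_inverse:
  assumes "inj_on g L" "U \<subseteq> L \<times> L"
  shows "rel_map (inv_into L g) (rel_map g U) = U"
proof -
  have "map_prod (inv_into L g) (inv_into L g) (map_prod g g e) = e" if "e \<in> U" for e
    using that assms by (cases e) auto
  thus ?thesis by (force simp: image_image)
qed

context
  fixes G :: "'h leg_graph" and g :: "'h \<Rightarrow> 'k"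
  assumes wf: "wf_leg G" and inj: "inj_on g (legs G)"
begin

lemma wf_rels: "blk G \<subseteq> legs G \<times> legs G" "lnk G \<subseteq> legs G \<times> legs G"
  using wf by (auto simp: wf_leg_def equiv_def)

lemma lmap_inverse: "lmap (inv_into (legs G) g) (lmap g G) = G"
  using inj wf_rels by (intro leg_graph_eqI) (simp_all add: rel_map_inverse)

lemma blk_lmap: "u \<in> legs G \<Longrightarrow> blk (lmap g G) `` {g u} = g ` (blk G `` {u})"
  using rel_map_Image[OF inj wf_rels(1)] by simp

lemma conn_lmap: "u \<in> legs G \<Longrightarrow> conn (lmap g G) `` {g u} = g ` (conn G `` {u})"
  using rel_map_rtrancl_Image(1)[OF inj, of "blk G \<union> lnk G" u] wf_rels by (simp add: conn_def image_Un)

lemma free_lmap: "free (lmap g G) = g ` free G"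
proof -
  have "Domain (lnk G) \<subseteq> legs G" using wf_rels by auto
  thus ?thesis
    using inj_on_image_set_diff[OF inj, of "legs G" "Domain (lnk G)"] by (auto simp: free_def Domain_rel_map)
qed

lemma card_lmap: "A \<subseteq> legs G \<Longrightarrow> card (g ` A) = card A"
  using inj by (auto intro: card_image inj_on_subset)

lemma blk_subset: "blk G `` {u} \<subseteq> legs G"
  using wf_rels by auto

lemma free_subset: "free G \<subseteq> legs G"
  by (auto simp: free_def)

lemma image_subset_iff_legs: "A \<subseteq> legs G \<Longrightarrow> B \<subseteq> legs G \<Longrightarrow> g ` A \<subseteq> g ` B \<longleftrightarrow> A \<subseteq> B"
  by (metis image_mono inj inj_on_image_mem_iff image_subset_iff subset_iff)

lemma wf_lmap: "wf_leg (lmap g G)"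
proof -
  have eq: "(g u, g v) \<in> rel_map g E \<longleftrightarrow> (u, v) \<in> E" if "E \<subseteq> legs G \<times> legs G" "u \<in> legs G" "v \<in> legs G" for E u v
  proof -
    have "(g u, g v) \<in> rel_map g E \<longleftrightarrow> g v \<in> rel_map g E `` {g u}" by simp
    also have "\<dots> \<longleftrightarrow> g v \<in> g ` (E `` {u})" by (simp only: rel_map_Image[OF inj that(1,2)])
    also have "\<dots> \<longleftrightarrow> v \<in> E `` {u}" using that inj by (auto dest: inj_onD)
    finally show ?thesis by simp
  qed
  have "equiv (g ` legs G) (rel_map g (blk G))"
  proof (rule equivI)
    show "rel_map g (blk G) \<subseteq> g ` legs G \<times> g ` legs G" using wf_rels by auto
    show "refl_on (g ` legs G) (rel_map g (blk G))"
      unfolding refl_on_def using eq[OF wf_rels(1)] blk_refl[OF wf] by blast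
    show "sym (rel_map g (blk G))" using blk_sym[OF wf] by (force intro!: symI)
    show "trans (rel_map g (blk G))"
    proof (rule transI)
      fix p q r assume "(p, q) \<in> rel_map g (blk G)" "(q, r) \<in> rel_map g (blk G)"
      then obtain u v v' w where *: "(u, v) \<in> blk G" "(v', w) \<in> blk G" "p = g u" "q = g v" "q = g v'" "r = g w"
        by auto
      hence "v = v'" using inj wf_rels by (auto dest: inj_onD)
      thus "(p, r) \<in> rel_map g (blk G)" using * blk_trans[OF wf] by force
    qed
  qed
  moreover have "rel_map g (lnk G) \<subseteq> g ` legs G \<times> g ` legs G" using wf_rels by auto
  moreover have "sym (rel_map g (lnk G))" using lnk_sym[OF wf] by (force intro!: symI)
  moreover have "irrefl (rel_map g (lnk G))"
  proof (rule irreflI)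
    fix p show "(p, p) \<notin> rel_map g (lnk G)"
    proof
      assume "(p, p) \<in> rel_map g (lnk G)"
      then obtain u v where "(u, v) \<in> lnk G" "g u = g v" by auto
      thus False using inj wf_rels lnk_irrefl[OF wf] by (auto dest: inj_onD)
    qed
  qed
  moreover have "single_valued (rel_map g (lnk G))"
  proof (rule single_valuedI)
    fix p q r assume "(p, q) \<in> rel_map g (lnk G)" "(p, r) \<in> rel_map g (lnk G)"
    then obtain u v u' w where *: "(u, v) \<in> lnk G" "(u', w) \<in> lnk G" "p = g u" "p = g u'" "q = g v" "r = g w"
      by auto
    hence "u = u'" using inj wf_rels by (auto dest: inj_onD)
    thus "q = r" using * lnk_unique[OF wf] by blast
  qed
  ultimately show ?thesis using finite_legs[OF wf] by (simp add: wf_leg_def)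
qed

lemma valid_lmap: "valid_leg G \<Longrightarrow> valid_leg (lmap g G)"
proof -
  assume v: "valid_leg G"
  have 1: "card (blk (lmap g G) `` {g u}) = card (blk G `` {u})" if "u \<in> legs G" for u
    using blk_lmap[OF that] card_lmap[OF blk_subset] by simp
  have 2: "card (conn (lmap g G) `` {g u} \<inter> free (lmap g G)) = card (conn G `` {u} \<inter> free G)"
    if u: "u \<in> legs G" for u
  proof -
    have cL: "conn G `` {u} \<subseteq> legs G" using conn_legs[OF wf] u by blast
    have "conn (lmap g G) `` {g u} \<inter> free (lmap g G) = g ` (conn G `` {u} \<inter> free G)"
      unfolding conn_lmap[OF u] free_lmap using inj_on_image_Int[OF inj cL free_subset] by simp
    thus ?thesis using card_lmap[of "conn G `` {u} \<inter> free G"] free_subset by auto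
  qed
  have 3: "blk (lmap g G) `` {g u} \<subseteq> free (lmap g G) \<longleftrightarrow> blk G `` {u} \<subseteq> free G" if u: "u \<in> legs G" for u
    unfolding blk_lmap[OF u] free_lmap using image_subset_iff_legs[OF blk_subset free_subset] .
  have 4: "u \<in> legs G" if "u \<in> free G" for u using that free_subset by blast
  show ?thesis
    unfolding valid_leg_def
  proof (intro conjI ballI impI)
    show "wf_leg (lmap g G)" by (rule wf_lmap)
    fix q assume "q \<in> legs (lmap g G)"
    then obtain u where u: "u \<in> legs G" "q = g u" by auto
    show "card (blk (lmap g G) `` {q}) \<in> {2, 3}" "card (conn (lmap g G) `` {q} \<inter> free (lmap g G)) \<in> {2, 3}"
      using 1[OF u(1)] 2[OF u(1)] v u by (simp_all add: valid_leg_def del: lmap_simps)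
  next
    fix q assume "q \<in> free (lmap g G)" and c: "card (blk (lmap g G) `` {q}) = 2"
    then obtain u where u: "u \<in> free G" "q = g u" using free_lmap by auto
    have "card (blk G `` {u}) = 2" using 1[OF 4[OF u(1)]] c u(2) by simp
    hence "blk G `` {u} \<subseteq> free G" using v u(1) by (simp add: valid_leg_def)
    thus "blk (lmap g G) `` {q} \<subseteq> free (lmap g G)" using 3[OF 4[OF u(1)]] u(2) by simp
  qed
qed

lemma lmap_lsub: "lmap g (lsub G U) = lsub (lmap g G) (rel_map g U)"
  by (rule leg_graph_eqI) simp_all

lemma lmap_lquo:
  assumes U: "U \<subseteq> lnk G"
  shows "lmap g (lquo G U) = lquo (lmap g G) (rel_map g U)"
proof (rule leg_graph_eqI)
  have UL: "U \<subseteq> legs G \<times> legs G" using U wf_rels by blast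
  hence "Domain U \<subseteq> legs G" by auto
  hence L: "g ` (legs G - Domain U) = g ` legs G - Domain (rel_map g U)"
    using inj_on_image_set_diff[OF inj, of "legs G" "Domain U"] by (auto simp: Domain_rel_map)
  thus "legs (lmap g (lquo G U)) = legs (lquo (lmap g G) (rel_map g U))" by simp
  show "lnk (lmap g (lquo G U)) = lnk (lquo (lmap g G) (rel_map g U))"
    using rel_map_Diff[OF inj wf_rels(2) UL] by simp
  have "rel_map g ((blk G \<union> U)\<^sup>* \<inter> (legs G - Domain U) \<times> (legs G - Domain U)) =
      (rel_map g (blk G \<union> U))\<^sup>* \<inter> g ` (legs G - Domain U) \<times> g ` (legs G - Domain U)"
    using rel_map_rtrancl[OF inj, of "blk G \<union> U" "legs G - Domain U"] wf_rels UL by blast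
  thus "blk (lmap g (lquo G U)) = blk (lquo (lmap g G) (rel_map g U))"
    unfolding lquo_blk lmap_simps L by (simp add: image_Un)
qed

lemma core_lmap: "core (lmap g G) = g ` core G"
proof -
  have "g u \<in> core (lmap g G) \<longleftrightarrow> u \<in> core G" if u: "u \<in> legs G" for u
    unfolding core_def mem_Collect_eq blk_lmap[OF u] free_lmap
      image_subset_iff_legs[OF blk_subset free_subset] card_lmap[OF blk_subset] using u by simp
  moreover have "core (lmap g G) \<subseteq> g ` legs G" "core G \<subseteq> legs G" by (auto simp: core_def)
  ultimately show ?thesis by blast
qed

lemma pairs_lmap: "pairs (lmap g G) = rel_map g (pairs G)"
proof -
  have p: "(g u, q) \<in> pairs (lmap g G) \<longleftrightarrow> q \<in> g ` (pairs G `` {u})" if u: "u \<in> legs G" for u q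
    unfolding pairs_iff blk_lmap[OF u] card_lmap[OF blk_subset] by (auto simp: pairs_iff)
  have 1: "p \<in> g ` legs G" if "(p, q) \<in> pairs (lmap g G)" for p q
    using that wf_rels(1) by (auto simp: pairs_def)
  have 2: "u \<in> legs G" if "(u, v) \<in> pairs G" for u v
    using that wf_rels(1) by (auto simp: pairs_def)
  show ?thesis
  proof (intro equalityI subsetI)
    fix e assume e: "e \<in> pairs (lmap g G)"
    obtain p' q where [simp]: "e = (p', q)" by (cases e)
    obtain u where u: "u \<in> legs G" "p' = g u" using 1 e by auto
    hence "q \<in> g ` (pairs G `` {u})" using p[OF u(1)] e by simp
    thus "e \<in> rel_map g (pairs G)" using u(2) by force
  next
    fix e assume "e \<in> rel_map g (pairs G)"
    then obtain u v where uv: "(u, v) \<in> pairs G" "e = (g u, g v)" by auto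
    have "g v \<in> g ` (pairs G `` {u})" using uv(1) by blast
    thus "e \<in> pairs (lmap g G)" using p[OF 2[OF uv(1)]] uv(2) by simp
  qed
qed

lemma nf_lmap: "nf (lmap g G) = lmap g (nf G)"
proof (rule leg_graph_eqI)
  have cL: "core G \<subseteq> legs G" by (auto simp: core_def)
  show "legs (nf (lmap g G)) = legs (lmap g (nf G))" by (simp add: nf_def core_lmap)
  have int: "rel_map g E \<inter> g ` core G \<times> g ` core G = rel_map g (E \<inter> core G \<times> core G)"
    if "E \<subseteq> legs G \<times> legs G" for E
  proof -
    have c: "u \<in> core G" if "g u \<in> g ` core G" "u \<in> legs G" for u
      using that cL inj by (auto dest: inj_onD)
    show ?thesis
    proof
      show "rel_map g E \<inter> g ` core G \<times> g ` core G \<subseteq> rel_map g (E \<inter> core G \<times> core G)"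
      proof
        fix e assume e: "e \<in> rel_map g E \<inter> g ` core G \<times> g ` core G"
        then obtain u v where uv: "(u, v) \<in> E" "e = (g u, g v)" by auto
        hence "u \<in> core G" "v \<in> core G" using c e that by blast+
        thus "e \<in> rel_map g (E \<inter> core G \<times> core G)" using uv by force
      qed
    qed auto
  qed
  show "blk (nf (lmap g G)) = blk (lmap g (nf G))"
    using int[OF wf_rels(1)] by (simp add: nf_def core_lmap)
  have pL: "pairs G \<subseteq> legs G \<times> legs G" using wf_rels by (auto simp: pairs_def)
  let ?E = "lnk G \<union> pairs G"
  have "(rel_map g ?E)\<^sup>* \<inter> g ` core G \<times> g ` core G - Id = rel_map g (?E\<^sup>* \<inter> core G \<times> core G) - Id"
    using rel_map_rtrancl[OF inj _ cL, of ?E] wf_rels pL by simp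
  also have "\<dots> = rel_map g (?E\<^sup>* \<inter> core G \<times> core G - Id)"
  proof -
    have inj': "u = v" if "g u = g v" "u \<in> core G" "v \<in> core G" for u v
      using that cL inj by (auto dest: inj_onD)
    have "rel_map g (R - Id) = rel_map g R - Id" if R: "R \<subseteq> core G \<times> core G" for R
    proof
      show "rel_map g (R - Id) \<subseteq> rel_map g R - Id" using inj' R by auto
      show "rel_map g R - Id \<subseteq> rel_map g (R - Id)"
      proof
        fix e assume "e \<in> rel_map g R - Id"
        then obtain u v where "(u, v) \<in> R" "e = (g u, g v)" "u \<noteq> v" by auto
        thus "e \<in> rel_map g (R - Id)" by force
      qed
    qed
    thus ?thesis by (metis (no_types, lifting) inf_le2)
  qed
  finally have "(rel_map g ?E)\<^sup>* \<inter> g ` core G \<times> g ` core G - Id = rel_map g (?E\<^sup>* \<inter> core G \<times> core G - Id)" .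
  thus "lnk (nf (lmap g G)) = lnk (lmap g (nf G))"
  proof -
    assume *: "(rel_map g ?E)\<^sup>* \<inter> g ` core G \<times> g ` core G - Id = rel_map g (?E\<^sup>* \<inter> core G \<times> core G - Id)"
    have swap: "(A - Id) \<inter> B = A \<inter> B - Id" for A B :: "('x \<times> 'x) set" by blast
    show ?thesis using * by (simp add: swap nf_def core_lmap pairs_lmap image_Un)
  qed
qed

end

lemma lmap_lsubs:
  assumes wf: "wf_leg G" and inj: "inj_on g (legs G)" and U: "U \<in> lsubs G"
  shows "rel_map g U \<in> lsubs (lmap g G)"
proof -
  have U': "U \<subseteq> lnk G" "sym U" and v: "valid_leg (lsub G U)" "valid_leg (lquo G U)"
    using U by (auto simp: lsubs_def)
  have "inj_on g (legs (lsub G U))" "inj_on g (legs (lquo G U))"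
    using inj by (auto intro: inj_on_subset)
  hence "valid_leg (lmap g (lsub G U))" "valid_leg (lmap g (lquo G U))"
    using v valid_lmap[OF valid_wf] by blast+
  moreover have "sym (rel_map g U)" using U'(2) by (force intro!: symI dest: symD)
  ultimately show ?thesis
    using U'(1) lmap_lsub[OF wf inj] lmap_lquo[OF wf inj U'(1)] by (auto simp: lsubs_def)
qed

lemma bij_lmap_lsubs:
  assumes wf: "wf_leg G" and inj: "inj_on g (legs G)"
  shows "bij_betw (rel_map g) (lsubs G) (lsubs (lmap g G))"
proof (rule bij_betwI[where g = "rel_map (inv_into (legs G) g)"])
  let ?i = "inv_into (legs G) g"
  have i: "inj_on ?i (legs (lmap g G))" by (simp add: inj_on_inv_into)
  show "rel_map g \<in> lsubs G \<rightarrow> lsubs (lmap g G)" using lmap_lsubs[OF assms] by blast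
  show "rel_map ?i \<in> lsubs (lmap g G) \<rightarrow> lsubs G"
    using lmap_lsubs[OF wf_lmap[OF assms] i] by (simp add: lmap_inverse[OF assms])
  show "rel_map ?i (rel_map g U) = U" if "U \<in> lsubs G" for U
    using that wf_rels(2)[OF assms] by (intro rel_map_inverse[OF inj]) (auto simp: lsubs_def)
  show "rel_map g (rel_map ?i V) = V" if "V \<in> lsubs (lmap g G)" for V
  proof -
    have "V \<subseteq> rel_map g (lnk G)" using that by (simp add: lsubs_def)
    also have "\<dots> \<subseteq> g ` legs G \<times> g ` legs G" using wf_rels(2)[OF assms] by auto
    finally have "map_prod g g (map_prod ?i ?i e) = e" if "e \<in> V" for e
      using that by (cases e) (auto intro: f_inv_into_f)
    thus ?thesis by (force simp: image_image)
  qed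
qed

definition leg_iso :: "'h leg_graph \<Rightarrow> 'k leg_graph \<Rightarrow> bool" where
  "leg_iso G G' \<longleftrightarrow> (\<exists>g. inj_on g (legs G) \<and> G' = lmap g G)"

lemma leg_iso_refl: "leg_iso G G"
  unfolding leg_iso_def by (intro exI[of _ id]) (simp add: lmap_def prod.map_id0)

lemma leg_iso_sym:
  assumes "wf_leg G" "leg_iso G G'"
  shows "leg_iso G' G"
proof -
  obtain g where g: "inj_on g (legs G)" "G' = lmap g G" using assms(2) leg_iso_def by blast
  thus ?thesis unfolding leg_iso_def
    using lmap_inverse[OF assms(1) g(1)] by (intro exI[of _ "inv_into (legs G) g"]) (simp add: inj_on_inv_into)
qed

lemma leg_iso_trans:
  assumes "leg_iso G G'" "leg_iso G' G''"
  shows "leg_iso G G''"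
proof -
  obtain g where g: "inj_on g (legs G)" "G' = lmap g G" using assms(1) leg_iso_def by blast
  obtain g' where g': "inj_on g' (legs G')" "G'' = lmap g' G'" using assms(2) leg_iso_def by blast
  have "inj_on (g' \<circ> g) (legs G)" using g g' by (auto intro: comp_inj_on)
  moreover have "G'' = lmap (g' \<circ> g) G"
    using g g' by (auto intro!: leg_graph_eqI simp: image_comp map_prod_compose)
  ultimately show ?thesis unfolding leg_iso_def by blast
qed

lemma legs_nf: "legs (nf G) \<subseteq> legs G"
  by (auto simp: nf_def core_def)

text \<open>The bijection is a composite: from \<open>G\<close> to its normal form, along the
  relabeling, and back from the normal form of \<open>H\<close>. Hence subobjects up to isomorphism
  depend on the normal form only.\<close>

lemma leg_iso_nf_lsubs:
  assumes G: "valid_leg G" and H: "valid_leg H" and GH: "leg_iso (nf G) (nf H)"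
  shows "\<exists>\<beta>. bij_betw \<beta> (lsubs G) (lsubs H) \<and> (\<forall>U\<in>lsubs G.
     leg_iso (nf (lsub G U)) (nf (lsub H (\<beta> U))) \<and> leg_iso (nf (lquo G U)) (nf (lquo H (\<beta> U))))"
proof -
  note rG = reduction[OF G] and rH = reduction[OF H]
  have wfn: "wf_leg (nf G)" using rG valid_wf by blast
  obtain g where g: "inj_on g (legs (nf G))" "nf H = lmap g (nf G)" using GH leg_iso_def by blast
  obtain \<beta> where \<beta>: "bij_betw \<beta> (lsubs G) (lsubs (nf G))"
     "\<forall>U\<in>lsubs G. nf (lsub (nf G) (\<beta> U)) = nf (lsub G U) \<and> nf (lquo (nf G) (\<beta> U)) = nf (lquo G U)"
    using rG unfolding bisim_def by blast
  obtain \<gamma> where \<gamma>: "bij_betw \<gamma> (lsubs H) (lsubs (nf H))"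
     "\<forall>U\<in>lsubs H. nf (lsub (nf H) (\<gamma> U)) = nf (lsub H U) \<and> nf (lquo (nf H) (\<gamma> U)) = nf (lquo H U)"
    using rH unfolding bisim_def by blast
  let ?c = "inv_into (lsubs H) \<gamma>"
  let ?d = "\<lambda>U. ?c (rel_map g (\<beta> U))"
  have m: "bij_betw (rel_map g) (lsubs (nf G)) (lsubs (nf H))"
    using bij_lmap_lsubs[OF wfn g(1)] g(2) by simp
  have c: "bij_betw ?c (lsubs (nf H)) (lsubs H)" by (rule bij_betw_inv_into[OF \<gamma>(1)])
  have "bij_betw (?c \<circ> (rel_map g \<circ> \<beta>)) (lsubs G) (lsubs H)"
    by (rule bij_betw_trans[OF bij_betw_trans[OF \<beta>(1) m] c])
  hence bij: "bij_betw ?d (lsubs G) (lsubs H)" by (simp add: comp_def)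
  have "leg_iso (nf (lsub G U)) (nf (lsub H (?d U))) \<and> leg_iso (nf (lquo G U)) (nf (lquo H (?d U)))"
    if U: "U \<in> lsubs G" for U
  proof -
    have bU: "\<beta> U \<in> lsubs (nf G)" using bij_betwE[OF \<beta>(1)] U by blast
    have mU: "rel_map g (\<beta> U) \<in> lsubs (nf H)" using bij_betwE[OF m] bU by blast
    have dU: "?d U \<in> lsubs H" using bij_betwE[OF c] mU by blast
    have gd: "\<gamma> (?d U) = rel_map g (\<beta> U)"
      using mU \<gamma>(1) by (intro f_inv_into_f) (simp add: bij_betw_def)
    have bl: "\<beta> U \<subseteq> lnk (nf G)" "sym (\<beta> U)" using bU by (auto simp: lsubs_def)
    have i1: "inj_on g (legs (lsub (nf G) (\<beta> U)))" and i2: "inj_on g (legs (lquo (nf G) (\<beta> U)))"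
      using g(1) by (auto intro: inj_on_subset)
    have e1: "nf (lsub H (?d U)) = lmap g (nf (lsub G U))"
    proof -
      have "nf (lsub H (?d U)) = nf (lsub (nf H) (rel_map g (\<beta> U)))" using \<gamma>(2) dU gd by metis
      also have "\<dots> = lmap g (nf (lsub (nf G) (\<beta> U)))"
        using nf_lmap[OF wf_lsub[OF wfn bl] i1] lmap_lsub[OF wfn g(1)] g(2) by simp
      finally show ?thesis using \<beta>(2) U by simp
    qed
    have e2: "nf (lquo H (?d U)) = lmap g (nf (lquo G U))"
    proof -
      have "nf (lquo H (?d U)) = nf (lquo (nf H) (rel_map g (\<beta> U)))" using \<gamma>(2) dU gd by metis
      also have "\<dots> = lmap g (nf (lquo (nf G) (\<beta> U)))"
        using nf_lmap[OF wf_lquo[OF wfn bl] i2] lmap_lquo[OF wfn g(1) bl(1)] g(2) by simp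
      finally show ?thesis using \<beta>(2) U by simp
    qed
    have "legs (nf (lsub (nf G) (\<beta> U))) \<subseteq> legs (nf G)" "legs (nf (lquo (nf G) (\<beta> U))) \<subseteq> legs (nf G)"
      using legs_nf[of "lsub (nf G) (\<beta> U)"] legs_nf[of "lquo (nf G) (\<beta> U)"] by auto
    hence "legs (nf (lsub G U)) \<subseteq> legs (nf G)" "legs (nf (lquo G U)) \<subseteq> legs (nf G)"
      using \<beta>(2) U by simp_all
    thus ?thesis unfolding leg_iso_def using e1 e2 g(1) by (blast intro: inj_on_subset)
  qed
  thus ?thesis using bij by (intro exI[of _ ?d]) blast
qed

section \<open>Disjoint sums of leg graphs\<close>

definition lsum :: "'h leg_graph \<Rightarrow> 'h leg_graph \<Rightarrow> 'h leg_graph" where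
  "lsum G H = \<lparr>legs = legs G \<union> legs H, blk = blk G \<union> blk H, lnk = lnk G \<union> lnk H\<rparr>"

lemma lsum_simps [simp]: "legs (lsum G H) = legs G \<union> legs H" "blk (lsum G H) = blk G \<union> blk H"
  "lnk (lsum G H) = lnk G \<union> lnk H"
  by (simp_all add: lsum_def)

lemma lsum_commute: "lsum G H = lsum H G"
  by (rule leg_graph_eqI) auto

lemma rtrancl_Un_disjoint:
  assumes E: "E \<subseteq> L \<times> L" and F: "F \<subseteq> M \<times> M" and LM: "L \<inter> M = {}" and u: "u \<in> L"
  shows "(u, v) \<in> (E \<union> F)\<^sup>* \<longleftrightarrow> (u, v) \<in> E\<^sup>*" "(u, v) \<in> (E \<union> F)\<^sup>* \<Longrightarrow> v \<in> L"
proof -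
  have step: "q \<notin> - L \<and> (p, q) \<in> E" if "(p, q) \<in> E \<union> F" "p \<notin> - L" for p q
    using that E F LM by auto
  have E': "E \<subseteq> E \<union> F" and u': "u \<notin> - L" using u by auto
  show "(u, v) \<in> (E \<union> F)\<^sup>* \<longleftrightarrow> (u, v) \<in> E\<^sup>*"
    by (rule rtrancl_avoid(1)[where B = "- L" and E' = E]) (use step E' u' in blast)+
  show "v \<in> L" if uv: "(u, v) \<in> (E \<union> F)\<^sup>*"
    using rtrancl_avoid(2)[where B = "- L" and E' = E, OF step E' u' uv] by simp
qed

lemma rtrancl_Un_restrict:
  assumes E: "E \<subseteq> L \<times> L" and F: "F \<subseteq> M \<times> M" and LM: "L \<inter> M = {}" and K: "K \<subseteq> L" "N \<subseteq> M"
  shows "(E \<union> F)\<^sup>* \<inter> (K \<union> N) \<times> (K \<union> N) = E\<^sup>* \<inter> K \<times> K \<union> F\<^sup>* \<inter> N \<times> N"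
proof -
  have 1: "(u, v) \<in> (E \<union> F)\<^sup>* \<and> v \<in> K \<union> N \<longleftrightarrow> (u, v) \<in> E\<^sup>* \<and> v \<in> K" if "u \<in> K" for u v
  proof -
    have u: "u \<in> L" using that K by blast
    have "v \<in> L" if "(u, v) \<in> (E \<union> F)\<^sup>*" using rtrancl_Un_disjoint(2)[OF E F LM u that] .
    thus ?thesis using rtrancl_Un_disjoint(1)[OF E F LM u, of v] K LM by blast
  qed
  have 2: "(u, v) \<in> (E \<union> F)\<^sup>* \<and> v \<in> K \<union> N \<longleftrightarrow> (u, v) \<in> F\<^sup>* \<and> v \<in> N" if "u \<in> N" for u v
  proof -
    have u: "u \<in> M" using that K by blast
    have ML0: "M \<inter> L = {}" using LM by blast
    have "v \<in> M" if "(u, v) \<in> (F \<union> E)\<^sup>*" using rtrancl_Un_disjoint(2)[OF F E ML0 u that] .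
    thus ?thesis using rtrancl_Un_disjoint(1)[OF F E ML0 u, of v] K LM by (auto simp: Un_commute)
  qed
  have KN: "K \<inter> N = {}" using K LM by blast
  have "e \<in> (E \<union> F)\<^sup>* \<inter> (K \<union> N) \<times> (K \<union> N) \<longleftrightarrow> e \<in> E\<^sup>* \<inter> K \<times> K \<union> F\<^sup>* \<inter> N \<times> N" for e
  proof (cases e)
    case (Pair u v)
    consider "u \<in> K" "u \<notin> N" | "u \<in> N" "u \<notin> K" | "u \<notin> K" "u \<notin> N" using KN by blast
    thus ?thesis using 1[of u v] 2[of u v] Pair by cases auto
  qed
  thus ?thesis by (rule set_eqI)
qed

lemma wf_lnk_subset: "wf_leg G \<Longrightarrow> lnk G \<subseteq> legs G \<times> legs G"
  and wf_blk_subset: "wf_leg G \<Longrightarrow> blk G \<subseteq> legs G \<times> legs G"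
  by (auto simp: wf_leg_def equiv_def)

lemma wf_lsum_left:
  assumes "wf_leg G" "wf_leg H" "legs G \<inter> legs H = {}"
  shows "u \<in> legs G \<Longrightarrow> blk (lsum G H) `` {u} = blk G `` {u}"
    and "u \<in> legs G \<Longrightarrow> conn (lsum G H) `` {u} = conn G `` {u}"
    and "u \<in> legs G \<Longrightarrow> u \<in> free (lsum G H) \<longleftrightarrow> u \<in> free G"
    and "U \<subseteq> legs G \<Longrightarrow> U \<subseteq> free (lsum G H) \<longleftrightarrow> U \<subseteq> free G"
    and "U \<subseteq> legs G \<Longrightarrow> U \<inter> free (lsum G H) = U \<inter> free G"
proof -
  note s = wf_lnk_subset[OF assms(1)] wf_blk_subset[OF assms(1)] wf_lnk_subset[OF assms(2)] wf_blk_subset[OF assms(2)]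
  show "blk (lsum G H) `` {u} = blk G `` {u}" if "u \<in> legs G"
    using that s assms(3) by auto
  have "(blk G \<union> blk H \<union> (lnk G \<union> lnk H)) = (blk G \<union> lnk G) \<union> (blk H \<union> lnk H)" by blast
  moreover have "blk G \<union> lnk G \<subseteq> legs G \<times> legs G" "blk H \<union> lnk H \<subseteq> legs H \<times> legs H" using s by auto
  ultimately show "conn (lsum G H) `` {u} = conn G `` {u}" if "u \<in> legs G"
    using rtrancl_Un_disjoint(1)[OF _ _ assms(3) that, of "blk G \<union> lnk G" "blk H \<union> lnk H"]
    by (auto simp: conn_def)
  have f: "u \<in> free (lsum G H) \<longleftrightarrow> u \<in> free G" if "u \<in> legs G" for u
    using that s assms(3) by (auto simp: free_def)
  show "u \<in> legs G \<Longrightarrow> u \<in> free (lsum G H) \<longleftrightarrow> u \<in> free G" by (rule f)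
  show "U \<subseteq> legs G \<Longrightarrow> U \<subseteq> free (lsum G H) \<longleftrightarrow> U \<subseteq> free G"
    "U \<subseteq> legs G \<Longrightarrow> U \<inter> free (lsum G H) = U \<inter> free G" using f by blast+
qed

lemma wf_lsum:
  assumes "wf_leg G" "wf_leg H" "legs G \<inter> legs H = {}"
  shows "wf_leg (lsum G H)"
proof -
  note s = wf_lnk_subset[OF assms(1)] wf_blk_subset[OF assms(1)] wf_lnk_subset[OF assms(2)] wf_blk_subset[OF assms(2)]
  have "equiv (legs G \<union> legs H) (blk G \<union> blk H)"
  proof (rule equivI)
    show "blk G \<union> blk H \<subseteq> (legs G \<union> legs H) \<times> (legs G \<union> legs H)" using s by blast
    show "refl_on (legs G \<union> legs H) (blk G \<union> blk H)"
      using blk_refl[OF assms(1)] blk_refl[OF assms(2)] by (auto simp: refl_on_def)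
    show "sym (blk G \<union> blk H)"
      using blk_sym[OF assms(1)] blk_sym[OF assms(2)] by (auto intro!: symI)
    show "trans (blk G \<union> blk H)"
    proof (rule transI)
      fix p q r assume *: "(p, q) \<in> blk G \<union> blk H" "(q, r) \<in> blk G \<union> blk H"
      hence "(p, q) \<in> blk G \<and> (q, r) \<in> blk G \<or> (p, q) \<in> blk H \<and> (q, r) \<in> blk H"
        using s assms(3) by blast
      thus "(p, r) \<in> blk G \<union> blk H" using blk_trans[OF assms(1)] blk_trans[OF assms(2)] by blast
    qed
  qed
  moreover have "sym (lnk G \<union> lnk H)"
    using lnk_sym[OF assms(1)] lnk_sym[OF assms(2)] by (auto intro!: symI)
  moreover have "irrefl (lnk G \<union> lnk H)"
    using lnk_irrefl[OF assms(1)] lnk_irrefl[OF assms(2)] by (auto simp: irrefl_def)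
  moreover have "single_valued (lnk G \<union> lnk H)"
  proof (rule single_valuedI)
    fix p q r assume *: "(p, q) \<in> lnk G \<union> lnk H" "(p, r) \<in> lnk G \<union> lnk H"
    hence "(p, q) \<in> lnk G \<and> (p, r) \<in> lnk G \<or> (p, q) \<in> lnk H \<and> (p, r) \<in> lnk H"
      using s assms(3) by blast
    thus "q = r" using lnk_unique[OF assms(1)] lnk_unique[OF assms(2)] by blast
  qed
  ultimately show ?thesis
    using s finite_legs[OF assms(1)] finite_legs[OF assms(2)] by (auto simp: wf_leg_def)
qed

text \<open>Validity is local to a leg and its component; in this form it is visibly unaffected by a
  disjoint summand.\<close>

definition valid_at :: "'h leg_graph \<Rightarrow> 'h \<Rightarrow> bool" where
  "valid_at G u \<longleftrightarrow> card (blk G `` {u}) \<in> {2, 3} \<and> card (conn G `` {u} \<inter> free G) \<in> {2, 3} \<and>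
     (u \<in> free G \<and> card (blk G `` {u}) = 2 \<longrightarrow> blk G `` {u} \<subseteq> free G)"

lemma valid_leg_iff: "valid_leg G \<longleftrightarrow> wf_leg G \<and> (\<forall>u\<in>legs G. valid_at G u)"
proof -
  have "free G \<subseteq> legs G" by (auto simp: free_def)
  thus ?thesis unfolding valid_leg_def valid_at_def by blast
qed

lemma valid_at_lsum:
  assumes "wf_leg G" "wf_leg H" "legs G \<inter> legs H = {}" "u \<in> legs G"
  shows "valid_at (lsum G H) u \<longleftrightarrow> valid_at G u"
proof -
  have "blk G `` {u} \<subseteq> legs G" "conn G `` {u} \<subseteq> legs G"
    using blk_legs[OF assms(1)] conn_legs[OF assms(1)] assms(4) by blast+
  thus ?thesis
    unfolding valid_at_def
    using wf_lsum_left[OF assms(1-3)] assms(4) by (simp del: lsum_simps)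
qed

lemma valid_lsum_iff:
  assumes "wf_leg G" "wf_leg H" "legs G \<inter> legs H = {}"
  shows "valid_leg (lsum G H) \<longleftrightarrow> valid_leg G \<and> valid_leg H"
proof -
  have "valid_at (lsum G H) u \<longleftrightarrow> valid_at H u" if "u \<in> legs H" for u
    using valid_at_lsum[OF assms(2,1) _ that] assms(3) by (simp add: lsum_commute[of G] Int_commute)
  thus ?thesis
    using valid_at_lsum[OF assms] wf_lsum[OF assms] assms(1,2) unfolding valid_leg_iff lsum_simps by blast
qed

context
  fixes G H :: "'h leg_graph"
  assumes wfG: "wf_leg G" and wfH: "wf_leg H" and disj: "legs G \<inter> legs H = {}"
begin

lemma lsum_subsets: "lnk G \<subseteq> legs G \<times> legs G" "lnk H \<subseteq> legs H \<times> legs H"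
    "blk G \<subseteq> legs G \<times> legs G" "blk H \<subseteq> legs H \<times> legs H"
  using wfG wfH by (auto simp: wf_leg_def equiv_def)

lemma lsub_lsum: "lsub (lsum G H) (U \<union> V) = lsum (lsub G U) (lsub H V)"
  by (rule leg_graph_eqI) simp_all

lemma lquo_lsum:
  assumes U: "U \<subseteq> lnk G" and V: "V \<subseteq> lnk H"
  shows "lquo (lsum G H) (U \<union> V) = lsum (lquo G U) (lquo H V)"
proof (rule leg_graph_eqI)
  have s: "U \<subseteq> legs G \<times> legs G" "V \<subseteq> legs H \<times> legs H" using U V lsum_subsets by blast+
  have D: "legs G \<union> legs H - Domain (U \<union> V) = (legs G - Domain U) \<union> (legs H - Domain V)"
    using s disj by auto
  thus "legs (lquo (lsum G H) (U \<union> V)) = legs (lsum (lquo G U) (lquo H V))" by simp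
  have "lnk G \<inter> V = {}" "lnk H \<inter> U = {}" using lsum_subsets s disj by auto
  thus "lnk (lquo (lsum G H) (U \<union> V)) = lnk (lsum (lquo G U) (lquo H V))" by auto
  have "blk G \<union> blk H \<union> (U \<union> V) = (blk G \<union> U) \<union> (blk H \<union> V)" by blast
  thus "blk (lquo (lsum G H) (U \<union> V)) = blk (lsum (lquo G U) (lquo H V))"
    unfolding lquo_blk lsum_simps D
    using rtrancl_Un_restrict[of "blk G \<union> U" "legs G" "blk H \<union> V" "legs H"
        "legs G - Domain U" "legs H - Domain V"] s lsum_subsets disj by simp
qed

lemma core_lsum: "core (lsum G H) = core G \<union> core H"
proof -
  have "u \<in> core (lsum G H) \<longleftrightarrow> u \<in> core G" if u: "u \<in> legs G" for u
  proof -
    have "blk G `` {u} \<subseteq> legs G" using lsum_subsets(3) by blast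
    note e = wf_lsum_left(1)[OF wfG wfH disj u] wf_lsum_left(4)[OF wfG wfH disj this]
    show ?thesis unfolding core_def mem_Collect_eq e using u by simp
  qed
  moreover have "u \<in> core (lsum G H) \<longleftrightarrow> u \<in> core H" if u: "u \<in> legs H" for u
  proof -
    have "blk H `` {u} \<subseteq> legs H" and d: "legs H \<inter> legs G = {}" using lsum_subsets(4) disj by blast+
    note e = wf_lsum_left(1)[OF wfH wfG d u] wf_lsum_left(4)[OF wfH wfG d this(1)]
    show ?thesis unfolding core_def mem_Collect_eq lsum_commute[of G H] e using u by simp
  qed
  moreover have "core (lsum G H) \<subseteq> legs G \<union> legs H" "core G \<subseteq> legs G" "core H \<subseteq> legs H"
    by (auto simp: core_def)
  ultimately show ?thesis using disj by blast
qed

lemma pairs_lsum: "pairs (lsum G H) = pairs G \<union> pairs H"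
proof -
  have "(u, v) \<in> pairs (lsum G H) \<longleftrightarrow> (u, v) \<in> pairs G" if "u \<in> legs G" for u v
    using wf_lsum_left(1)[OF wfG wfH disj that] unfolding pairs_iff by (simp del: lsum_simps)
  moreover have "(u, v) \<in> pairs (lsum G H) \<longleftrightarrow> (u, v) \<in> pairs H" if "u \<in> legs H" for u v
    using wf_lsum_left(1)[OF wfH wfG _ that] disj unfolding pairs_iff lsum_commute[of G]
    by (simp add: Int_commute del: lsum_simps)
  moreover have "pairs G \<subseteq> legs G \<times> legs G" "pairs H \<subseteq> legs H \<times> legs H"
    "pairs (lsum G H) \<subseteq> (legs G \<union> legs H) \<times> (legs G \<union> legs H)"
    using lsum_subsets by (auto simp: pairs_def)
  ultimately show ?thesis using disj by (intro equalityI subrelI) blast+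
qed

lemma nf_lsum: "nf (lsum G H) = lsum (nf G) (nf H)"
proof (rule leg_graph_eqI)
  have c: "core G \<subseteq> legs G" "core H \<subseteq> legs H" by (auto simp: core_def)
  show "legs (nf (lsum G H)) = legs (lsum (nf G) (nf H))" by (simp add: nf_def core_lsum)
  show "blk (nf (lsum G H)) = blk (lsum (nf G) (nf H))"
    using lsum_subsets c disj by (simp add: nf_def core_lsum) blast
  have p: "pairs G \<subseteq> legs G \<times> legs G" "pairs H \<subseteq> legs H \<times> legs H"
    using lsum_subsets by (auto simp: pairs_def)
  have e: "lnk G \<union> lnk H \<union> (pairs G \<union> pairs H) = (lnk G \<union> pairs G) \<union> (lnk H \<union> pairs H)" by blast
  have "(lnk G \<union> lnk H \<union> (pairs G \<union> pairs H))\<^sup>* \<inter> (core G \<union> core H) \<times> (core G \<union> core H) =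
      (lnk G \<union> pairs G)\<^sup>* \<inter> core G \<times> core G \<union> (lnk H \<union> pairs H)\<^sup>* \<inter> core H \<times> core H"
    unfolding e by (rule rtrancl_Un_restrict[OF _ _ disj c]) (use lsum_subsets p in auto)
  thus "lnk (nf (lsum G H)) = lnk (lsum (nf G) (nf H))"
    by (simp add: nf_def core_lsum pairs_lsum) blast
qed

lemma lsubs_lsum:
  assumes U: "U \<subseteq> lnk G" and V: "V \<subseteq> lnk H"
  shows "U \<union> V \<in> lsubs (lsum G H) \<longleftrightarrow> U \<in> lsubs G \<and> V \<in> lsubs H"
proof (cases "sym U \<and> sym V")
  case True
  hence S: "sym U" "sym V" "sym (U \<union> V)" by (auto intro: sym_Un)
  have d: "legs (lsub G U) \<inter> legs (lsub H V) = {}" "legs (lquo G U) \<inter> legs (lquo H V) = {}"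
    using disj by auto
  have UV: "U \<union> V \<subseteq> lnk G \<union> lnk H" using U V by blast
  show ?thesis
    unfolding lsubs_def mem_Collect_eq lsum_simps lsub_lsum lquo_lsum[OF U V]
      valid_lsum_iff[OF wf_lsub[OF wfG U S(1)] wf_lsub[OF wfH V S(2)] d(1)]
      valid_lsum_iff[OF wf_lquo[OF wfG U S(1)] wf_lquo[OF wfH V S(2)] d(2)]
    using S U V UV by blast
next
  case False
  have restr: "(U \<union> V) \<inter> legs G \<times> legs G = U" "(U \<union> V) \<inter> legs H \<times> legs H = V"
    using U V lsum_subsets disj by blast+
  have "sym (R \<inter> A \<times> A)" if "sym R" for R :: "('h \<times> 'h) set" and A
    using that by (auto simp: sym_def)
  from this[of "U \<union> V" "legs G"] this[of "U \<union> V" "legs H"]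
  have "\<not> sym (U \<union> V)" using False unfolding restr by blast
  thus ?thesis using False by (auto simp: lsubs_def)
qed

text \<open>The two parts of a link set of the sum are recovered by restricting it to the legs of
  each summand.\<close>

lemma bij_lsubs_lsum: "bij_betw (\<lambda>(U, V). U \<union> V) (lsubs G \<times> lsubs H) (lsubs (lsum G H))"
proof (rule bij_betw_imageI)
  have restrict: "(U \<union> V) \<inter> legs G \<times> legs G = U" "(U \<union> V) \<inter> legs H \<times> legs H = V"
    if "U \<in> lsubs G" "V \<in> lsubs H" for U V
  proof -
    have "U \<subseteq> legs G \<times> legs G" "V \<subseteq> legs H \<times> legs H"
      using that lsum_subsets unfolding lsubs_def by blast+
    thus "(U \<union> V) \<inter> legs G \<times> legs G = U" "(U \<union> V) \<inter> legs H \<times> legs H = V" using disj by blast+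
  qed
  show "inj_on (\<lambda>(U, V). U \<union> V) (lsubs G \<times> lsubs H)"
  proof (rule inj_onI, clarify)
    fix U V U' V' assume *: "U \<in> lsubs G" "V \<in> lsubs H" "U' \<in> lsubs G" "V' \<in> lsubs H" "U \<union> V = U' \<union> V'"
    show "U = U' \<and> V = V'" using restrict[OF *(1,2)] restrict[OF *(3,4)] *(5) by simp
  qed
  show "(\<lambda>(U, V). U \<union> V) ` (lsubs G \<times> lsubs H) = lsubs (lsum G H)"
  proof
    show "(\<lambda>(U, V). U \<union> V) ` (lsubs G \<times> lsubs H) \<subseteq> lsubs (lsum G H)"
    proof clarify
      fix U V assume *: "U \<in> lsubs G" "V \<in> lsubs H"
      hence "U \<subseteq> lnk G" "V \<subseteq> lnk H" by (auto simp: lsubs_def)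
      from lsubs_lsum[OF this] show "U \<union> V \<in> lsubs (lsum G H)" using * by blast
    qed
    show "lsubs (lsum G H) \<subseteq> (\<lambda>(U, V). U \<union> V) ` (lsubs G \<times> lsubs H)"
    proof
      fix W assume W: "W \<in> lsubs (lsum G H)"
      hence WL: "W \<subseteq> lnk G \<union> lnk H" by (simp add: lsubs_def)
      have "W = (W \<inter> legs G \<times> legs G) \<union> (W \<inter> legs H \<times> legs H)" using WL lsum_subsets by blast
      moreover have "W \<inter> legs G \<times> legs G \<subseteq> lnk G" "W \<inter> legs H \<times> legs H \<subseteq> lnk H"
        using WL lsum_subsets disj by blast+
      from lsubs_lsum[OF this]
      have "W \<inter> legs G \<times> legs G \<in> lsubs G \<and> W \<inter> legs H \<times> legs H \<in> lsubs H"
        using calculation W by simp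
      ultimately show "W \<in> (\<lambda>(U, V). U \<union> V) ` (lsubs G \<times> lsubs H)" by blast
    qed
  qed
qed

end

text \<open>A symmetric, irreflexive, single-valued relation partitions its domain into unordered
  pairs.\<close>

lemma handshake:
  assumes fin: "finite R" and "sym R" "irrefl R" "single_valued R"
  shows "2 * card {{h, k} | h k. (h, k) \<in> R} = card (Domain R)"
proof -
  let ?C = "{{h, k} | h k. (h, k) \<in> R}"
  have U: "\<Union> ?C = Domain R" using assms(2) by (auto dest: symD)
  have fD: "finite (Domain R)" using fin by (rule finite_Domain)
  have "?C \<subseteq> Pow (Domain R)" using U by blast
  hence fC: "finite ?C" using fD finite_subset by blast
  have "2 * card ?C = card (\<Union> ?C)"
  proof (rule card_partition)
    show "finite ?C" by (rule fC)
    show "finite (\<Union> ?C)" using fD U by simp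
    show "card c = 2" if c: "c \<in> ?C" for c
    proof -
      obtain h k where hk: "c = {h, k}" "(h, k) \<in> R" using c by blast
      hence "h \<noteq> k" using assms(3) by (auto dest: irreflD)
      thus ?thesis using hk by simp
    qed
    show "c1 \<inter> c2 = {}" if c: "c1 \<in> ?C" "c2 \<in> ?C" "c1 \<noteq> c2" for c1 c2
    proof (rule ccontr)
      assume "c1 \<inter> c2 \<noteq> {}"
      then obtain u where u: "u \<in> c1" "u \<in> c2" by blast
      have part: "\<exists>k. c = {u, k} \<and> (u, k) \<in> R" if "c \<in> ?C" "u \<in> c" for c
      proof -
        obtain h k where hk: "c = {h, k}" "(h, k) \<in> R" using \<open>c \<in> ?C\<close> by blast
        hence "(k, h) \<in> R" using assms(2) by (auto dest: symD)
        thus ?thesis using hk \<open>u \<in> c\<close> by (auto simp: insert_commute)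
      qed
      from part[OF c(1) u(1)] obtain k where k: "c1 = {u, k}" "(u, k) \<in> R" by (elim exE conjE)
      from part[OF c(2) u(2)] obtain k' where "c2 = {u, k'}" "(u, k') \<in> R" by (elim exE conjE)
      thus False using k assms(4) c(3) by (auto dest: single_valuedD)
    qed
  qed
  thus ?thesis using U by simp
qed

section \<open>Feynman graphs\<close>

text \<open>Vertices are remembered only as classes of half-edges. Nothing is lost for trivalent
  graphs, where every vertex carries half-edges.\<close>

definition leg_graph_of :: "('v, 'h) hgraph \<Rightarrow> 'h leg_graph" where
  "leg_graph_of A = \<lparr>legs = halves A, blk = {(h, k). \<exists>v. (h, v) \<in> inc A \<and> (k, v) \<in> inc A}, lnk = adj A\<rparr>"

text \<open>The Feynman conditions without those on components; subgraphs and quotients are first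
  shown to be of this kind, and the rest is then read off from leg graphs.\<close>

definition trivalent :: "('v, 'h) hgraph \<Rightarrow> bool" where
  "trivalent A \<longleftrightarrow> hgraph A \<and> (\<forall>v\<in>verts A. card {h. (h, v) \<in> inc A} = 3)"

lemma leg_graph_of_simps [simp]: "legs (leg_graph_of A) = halves A" "lnk (leg_graph_of A) = adj A"
  by (simp_all add: leg_graph_of_def)

lemma blk_leg_graph_of: "(h, k) \<in> blk (leg_graph_of A) \<longleftrightarrow> (\<exists>v. (h, v) \<in> inc A \<and> (k, v) \<in> inc A)"
  by (simp add: leg_graph_of_def)

lemma blk_conn: "(p, q) \<in> blk G \<Longrightarrow> (p, q) \<in> conn G"
  and lnk_conn: "(p, q) \<in> lnk G \<Longrightarrow> (p, q) \<in> conn G"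
  by (auto simp: conn_def)

lemma same_vertex_conn: "(p, w) \<in> inc A \<Longrightarrow> (q, w) \<in> inc A \<Longrightarrow> (p, q) \<in> conn (leg_graph_of A)"
  by (rule blk_conn) (auto simp: blk_leg_graph_of)

lemma external_eq: "external A = free (leg_graph_of A)"
  by (auto simp: external_def free_def)

lemma trivalentD:
  assumes "trivalent A"
  shows inc_mem: "(h, v) \<in> inc A \<Longrightarrow> h \<in> halves A \<and> v \<in> verts A"
    and inc_ex: "h \<in> halves A \<Longrightarrow> \<exists>v. (h, v) \<in> inc A"
    and inc_unique: "(h, v) \<in> inc A \<Longrightarrow> (h, v') \<in> inc A \<Longrightarrow> v = v'"
    and adj_mem: "(h, k) \<in> adj A \<Longrightarrow> h \<in> halves A \<and> k \<in> halves A"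
    and half_ex: "v \<in> verts A \<Longrightarrow> \<exists>h. (h, v) \<in> inc A"
    and finite_halves: "finite (halves A)" and finite_verts: "finite (verts A)"
    and adj_sym: "sym (adj A)" and adj_irrefl: "irrefl (adj A)" and adj_sv: "single_valued (adj A)"
    and card_vertex: "v \<in> verts A \<Longrightarrow> card {h. (h, v) \<in> inc A} = 3"
proof -
  have H: "hgraph A" and c3: "\<forall>v\<in>verts A. card {h. (h, v) \<in> inc A} = 3" using assms by (auto simp: trivalent_def)
  show im: "(h, v) \<in> inc A \<Longrightarrow> h \<in> halves A \<and> v \<in> verts A" for h v using H by (auto simp: hgraph_def)
  show "h \<in> halves A \<Longrightarrow> \<exists>v. (h, v) \<in> inc A" for h using H by (auto simp: hgraph_def)
  show "v = v'" if "(h, v) \<in> inc A" "(h, v') \<in> inc A" for h v v'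
  proof -
    have "\<exists>!v. (h, v) \<in> inc A" using H im that by (simp add: hgraph_def)
    thus ?thesis using that by blast
  qed
  show "(h, k) \<in> adj A \<Longrightarrow> h \<in> halves A \<and> k \<in> halves A" using H by (auto simp: hgraph_def)
  show "\<exists>h. (h, v) \<in> inc A" if "v \<in> verts A"
  proof -
    have "card {h. (h, v) \<in> inc A} \<noteq> 0" using c3 that by simp
    thus ?thesis by (metis (no_types, lifting) Collect_empty_eq card.empty)
  qed
qed (use assms in \<open>auto simp: trivalent_def hgraph_def\<close>)

context
  fixes A :: "('v, 'h) hgraph"
  assumes T: "trivalent A"
begin

lemma blk_at: "(h, v) \<in> inc A \<Longrightarrow> blk (leg_graph_of A) `` {h} = {k. (k, v) \<in> inc A}"
  by (auto simp: blk_leg_graph_of dest: inc_unique[OF T, of h v])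

lemma card_blk: "h \<in> halves A \<Longrightarrow> card (blk (leg_graph_of A) `` {h}) = 3"
proof -
  assume "h \<in> halves A"
  then obtain v where v: "(h, v) \<in> inc A" using inc_ex[OF T] by blast
  thus ?thesis using blk_at[OF v] card_vertex[OF T] inc_mem[OF T v] by simp
qed

lemma wf_leg_graph_of: "wf_leg (leg_graph_of A)"
proof -
  have "equiv (halves A) (blk (leg_graph_of A))"
  proof (rule equivI)
    show "blk (leg_graph_of A) \<subseteq> halves A \<times> halves A"
      using inc_mem[OF T] by (auto simp: leg_graph_of_def)
    show "refl_on (halves A) (blk (leg_graph_of A))"
      using inc_ex[OF T] by (auto simp: refl_on_def blk_leg_graph_of)
    show "sym (blk (leg_graph_of A))" by (auto intro!: symI simp: blk_leg_graph_of)
    show "trans (blk (leg_graph_of A))"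
    proof (rule transI)
      fix p q r assume "(p, q) \<in> blk (leg_graph_of A)" "(q, r) \<in> blk (leg_graph_of A)"
      then obtain v v' where "(p, v) \<in> inc A" "(q, v) \<in> inc A" "(q, v') \<in> inc A" "(r, v') \<in> inc A"
        by (auto simp: blk_leg_graph_of)
      thus "(p, r) \<in> blk (leg_graph_of A)" using inc_unique[OF T, of q v v'] by (auto simp: blk_leg_graph_of)
    qed
  qed
  thus ?thesis
    using finite_halves[OF T] adj_mem[OF T] adj_sym[OF T] adj_irrefl[OF T] adj_sv[OF T]
    by (auto simp: wf_leg_def)
qed

lemma card_halves: "card (halves A) = 3 * card (verts A)"
proof -
  have "halves A = (\<Union>v\<in>verts A. {h. (h, v) \<in> inc A})"
  proof (intro equalityI subsetI)
    fix h assume "h \<in> halves A"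
    then obtain v where v: "(h, v) \<in> inc A" using inc_ex[OF T] by blast
    thus "h \<in> (\<Union>v\<in>verts A. {h. (h, v) \<in> inc A})" using inc_mem[OF T v] by blast
  next
    fix h assume "h \<in> (\<Union>v\<in>verts A. {h. (h, v) \<in> inc A})"
    thus "h \<in> halves A" using inc_mem[OF T] by blast
  qed
  also have "card \<dots> = (\<Sum>v\<in>verts A. card {h. (h, v) \<in> inc A})"
  proof (rule card_UN_disjoint)
    show "finite (verts A)" by (rule finite_verts[OF T])
    show "\<forall>v\<in>verts A. finite {h. (h, v) \<in> inc A}"
      using card_vertex[OF T] by (metis card.infinite zero_neq_numeral)
    show "\<forall>v\<in>verts A. \<forall>v'\<in>verts A. v \<noteq> v' \<longrightarrow> {h. (h, v) \<in> inc A} \<inter> {h. (h, v') \<in> inc A} = {}"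
      using inc_unique[OF T] by blast
  qed
  also have "\<dots> = (\<Sum>v\<in>verts A. 3)" by (rule sum.cong) (simp_all add: card_vertex[OF T])
  finally show ?thesis by simp
qed

lemma edge_count: "3 * card (verts A) = card (external A) + 2 * card (internal A)"
proof -
  have "adj A \<subseteq> halves A \<times> halves A" using adj_mem[OF T] by auto
  hence fin: "finite (adj A)" using finite_halves[OF T] finite_subset by blast
  have "halves A = external A \<union> Domain (adj A)" "external A \<inter> Domain (adj A) = {}"
    using adj_mem[OF T] by (auto simp: external_def)
  moreover have "finite (external A)" "finite (Domain (adj A))"
    using finite_halves[OF T] fin by (auto simp: external_def finite_Domain)
  ultimately have "card (halves A) = card (external A) + card (Domain (adj A))"
    using card_Un_disjoint by metis
  thus ?thesis
    using card_halves handshake[OF fin adj_sym[OF T] adj_irrefl[OF T] adj_sv[OF T]]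
    unfolding internal_def by simp
qed

text \<open>\<open>component_of\<close> is phrased through vertices, connectivity of leg graphs
  through half-edges; a half-edge \<open>h\<close> at \<open>v\<close> anchors the translation
  between the two.\<close>

lemma component_of_simps:
  assumes v: "v \<in> verts A" and h: "(h, v) \<in> inc A"
  shows "halves (component_of A v) = conn (leg_graph_of A) `` {h}"
    "verts (component_of A v) = {w. \<exists>k. (h, k) \<in> conn (leg_graph_of A) \<and> (k, w) \<in> inc A}"
    "inc (component_of A v) = inc A \<inter> (conn (leg_graph_of A) `` {h} \<times> UNIV)"
    "adj (component_of A v) = adj A \<inter> (conn (leg_graph_of A) `` {h} \<times> conn (leg_graph_of A) `` {h})"
proof -
  let ?c = "conn (leg_graph_of A)"
  define W where "W = {w \<in> verts A. (v, w) \<in> (joined A)\<^sup>*}"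
  have 1: "(h, k) \<in> ?c" if "(v, w) \<in> (joined A)\<^sup>*" "(k, w) \<in> inc A" for w k
    using that
  proof (induction arbitrary: k rule: rtrancl_induct)
    case base
    hence "(h, k) \<in> blk (leg_graph_of A)" using h by (auto simp: blk_leg_graph_of)
    thus ?case by (auto simp: conn_def)
  next
    case (step w w')
    obtain p q where pq: "(p, w) \<in> inc A" "(p, q) \<in> adj A" "(q, w') \<in> inc A"
      using step(2) by (auto simp: joined_def)
    have "(h, p) \<in> ?c" using step.IH pq(1) .
    moreover have "(p, q) \<in> ?c" using pq(2) by (auto simp: conn_def)
    moreover have "(q, k) \<in> ?c" using same_vertex_conn[OF pq(3) step.prems] .
    ultimately show ?case using conn_trans by metis
  qed
  have 2: "\<exists>w. (v, w) \<in> (joined A)\<^sup>* \<and> (k, w) \<in> inc A" if "(h, k) \<in> ?c" for k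
    using that unfolding conn_def
  proof (induction rule: rtrancl_induct)
    case base
    show ?case using h by blast
  next
    case (step k k')
    then obtain w where w: "(v, w) \<in> (joined A)\<^sup>*" "(k, w) \<in> inc A" by blast
    show ?case
    proof (cases "(k, k') \<in> adj A")
      case True
      then obtain w' where w': "(k', w') \<in> inc A" using adj_mem[OF T] inc_ex[OF T] by blast
      hence "(w, w') \<in> joined A" using w(2) True by (auto simp: joined_def)
      thus ?thesis using w(1) w' by (meson rtrancl.rtrancl_into_rtrancl)
    next
      case False
      hence "(k, k') \<in> blk (leg_graph_of A)" using step(2) by simp
      then obtain u where "(k, u) \<in> inc A" "(k', u) \<in> inc A" by (auto simp: blk_leg_graph_of)
      moreover from this have "u = w" using w(2) inc_unique[OF T] by blast
      ultimately show ?thesis using w by blast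
    qed
  qed
  have W: "w \<in> W \<longleftrightarrow> (\<exists>k. (h, k) \<in> ?c \<and> (k, w) \<in> inc A)" for w
  proof
    assume "w \<in> W"
    thus "\<exists>k. (h, k) \<in> ?c \<and> (k, w) \<in> inc A" using 1 half_ex[OF T, of w] unfolding W_def by blast
  next
    assume "\<exists>k. (h, k) \<in> ?c \<and> (k, w) \<in> inc A"
    then obtain k where k: "(h, k) \<in> ?c" "(k, w) \<in> inc A" by blast
    then obtain w' where w': "(v, w') \<in> (joined A)\<^sup>*" "(k, w') \<in> inc A" using 2 by blast
    hence "w' = w" using k inc_unique[OF T] by blast
    thus "w \<in> W" using w' inc_mem[OF T] by (auto simp: W_def)
  qed
  have HW: "{k. \<exists>w\<in>W. (k, w) \<in> inc A} = ?c `` {h}"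
  proof (intro equalityI subsetI)
    fix k assume "k \<in> {k. \<exists>w\<in>W. (k, w) \<in> inc A}"
    thus "k \<in> ?c `` {h}" using 1 by (auto simp: W_def)
  next
    fix k assume "k \<in> ?c `` {h}"
    then obtain w where "(v, w) \<in> (joined A)\<^sup>*" "(k, w) \<in> inc A" using 2 by blast
    thus "k \<in> {k. \<exists>w\<in>W. (k, w) \<in> inc A}" using inc_mem[OF T] by (auto simp: W_def)
  qed
  have K: "component_of A v = restrict_hgraph A W (?c `` {h})"
    using HW by (simp add: component_of_def Let_def W_def)
  show "halves (component_of A v) = ?c `` {h}" "adj (component_of A v) = adj A \<inter> (?c `` {h} \<times> ?c `` {h})"
    by (simp_all add: K restrict_hgraph_def)
  show "verts (component_of A v) = {w. \<exists>k. (h, k) \<in> ?c \<and> (k, w) \<in> inc A}"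
    using W by (auto simp: K restrict_hgraph_def)
  have "inc A \<inter> (?c `` {h} \<times> W) = inc A \<inter> (?c `` {h} \<times> UNIV)" using W by auto
  thus "inc (component_of A v) = inc A \<inter> (?c `` {h} \<times> UNIV)" by (simp add: K restrict_hgraph_def)
qed

end

text \<open>The subgraph condition without the Feynman property. \<open>adj K\<close> need not be
  everything induced on \<open>halves K\<close>: internal edges may be cut.\<close>

definition full_sub :: "('v, 'h) hgraph \<Rightarrow> ('v, 'h) hgraph \<Rightarrow> bool" where
  "full_sub K A \<longleftrightarrow> verts K \<subseteq> verts A \<and> inc K = inc A \<inter> (UNIV \<times> verts K) \<and>
     halves K = {h. \<exists>v\<in>verts K. (h, v) \<in> inc A} \<and> adj K \<subseteq> adj A \<inter> halves K \<times> halves K \<and> sym (adj K)"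

lemma trivalent_full_sub:
  assumes T: "trivalent A" and K: "full_sub K A"
  shows "trivalent K"
proof -
  have "adj K \<subseteq> adj A" using K by (auto simp: full_sub_def)
  hence "irrefl (adj K)" "single_valued (adj K)"
    using adj_irrefl[OF T] single_valued_subset[OF _ adj_sv[OF T]] by (auto simp: irrefl_def)
  moreover have "halves K \<subseteq> halves A" using K inc_mem[OF T] by (auto simp: full_sub_def)
  moreover have "\<exists>!v. (h, v) \<in> inc K" if h: "h \<in> halves K" for h
  proof -
    obtain v where "v \<in> verts K" "(h, v) \<in> inc A" using h K by (auto simp: full_sub_def)
    thus ?thesis using K inc_unique[OF T] by (intro ex1I[of _ v]) (auto simp: full_sub_def)
  qed
  moreover have "{h. (h, v) \<in> inc K} = {h. (h, v) \<in> inc A}" "v \<in> verts A" if "v \<in> verts K" for v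
    using that K by (auto simp: full_sub_def)
  ultimately show ?thesis
    using K finite_halves[OF T] finite_verts[OF T] card_vertex[OF T]
    unfolding trivalent_def hgraph_def
    by (auto simp: full_sub_def intro: finite_subset)
qed

lemma full_sub_component:
  assumes T: "trivalent A" and K: "K \<in> components A"
  shows "full_sub K A" "verts K \<noteq> {}" "h \<in> halves K \<Longrightarrow> halves K = conn (leg_graph_of A) `` {h}"
    "adj K = adj A \<inter> halves K \<times> halves K"
    "external K = halves K \<inter> external A"
proof -
  obtain v where v: "v \<in> verts A" "K = component_of A v" using K by (auto simp: components_def)
  obtain h0 where h0: "(h0, v) \<in> inc A" using half_ex[OF T v(1)] by blast
  let ?c = "conn (leg_graph_of A)"
  note s = component_of_simps[OF T v(1) h0, folded v(2)]
  note wf = wf_leg_graph_of[OF T]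
  have close: "(h0, q) \<in> ?c" if "(h0, p) \<in> ?c" "(p, w) \<in> inc A" "(q, w) \<in> inc A" for p q w
    using conn_trans[OF that(1) same_vertex_conn[OF that(2,3)]] .
  show "adj K = adj A \<inter> halves K \<times> halves K" using s by simp
  have "sym (adj K)" using adj_sym[OF T] unfolding s(4) by (auto intro!: symI dest: symD)
  moreover have "inc K = inc A \<inter> (UNIV \<times> verts K)" unfolding s(2,3) using close by blast
  moreover have "halves K = {h. \<exists>v\<in>verts K. (h, v) \<in> inc A}"
  proof (intro equalityI subsetI)
    fix k assume "k \<in> halves K"
    hence k: "(h0, k) \<in> ?c" using s by simp
    moreover have "h0 \<in> halves A" using h0 inc_mem[OF T] by blast
    ultimately have "k \<in> halves A" using conn_legs[OF wf k] by simp
    then obtain w where "(k, w) \<in> inc A" using inc_ex[OF T] by blast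
    thus "k \<in> {h. \<exists>v\<in>verts K. (h, v) \<in> inc A}" using k s(2) by blast
  next
    fix k assume "k \<in> {h. \<exists>v\<in>verts K. (h, v) \<in> inc A}"
    thus "k \<in> halves K" unfolding s(1,2) using close by blast
  qed
  moreover have "verts K \<subseteq> verts A" unfolding s(2) using inc_mem[OF T] by blast
  ultimately show "full_sub K A" unfolding full_sub_def using s by auto
  have "(h0, h0) \<in> ?c" by simp
  hence "v \<in> verts K" unfolding s(2) using h0 by blast
  thus "verts K \<noteq> {}" by blast
  show "halves K = ?c `` {h}" if "h \<in> halves K"
    using that conn_class_eq[OF wf, of h0 h] unfolding s(1) by simp
  show "external K = halves K \<inter> external A"
  proof -
    have "(k, k') \<in> adj K" if "k \<in> halves K" "(k, k') \<in> adj A" for k k'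
    proof -
      have "(k, k') \<in> ?c" using that(2) by (auto simp: conn_def)
      moreover have "(h0, k) \<in> ?c" using that(1) unfolding s(1) by simp
      ultimately have "(h0, k') \<in> ?c" using conn_trans by metis
      hence "k' \<in> halves K" unfolding s(1) by simp
      thus ?thesis using that s by simp
    qed
    moreover have "adj K \<subseteq> adj A" "halves K \<subseteq> halves A"
      using \<open>full_sub K A\<close> inc_mem[OF T] by (auto simp: full_sub_def)
    ultimately show ?thesis unfolding external_def by blast
  qed
qed

lemma halves_component:
  assumes T: "trivalent A" and h: "h \<in> halves A"
  obtains K where "K \<in> components A" "h \<in> halves K"
proof -
  obtain v where v: "(h, v) \<in> inc A" using inc_ex[OF T h] by blast
  hence "v \<in> verts A" using inc_mem[OF T] by blast
  thus ?thesis using that[of "component_of A v"] component_of_simps(1)[OF T _ v] by (simp add: components_def)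
qed

lemma isolated_block:
  assumes wf: "wf_leg G" and h: "h \<in> legs G" and "card (blk G `` {h}) = 3" "blk G `` {h} \<subseteq> free G"
  shows "conn G `` {h} = blk G `` {h}"
proof -
  have "droppable G (blk G `` {h})" using assms by (auto simp: droppable_def)
  thus ?thesis using conn_dropped[OF wf] blk_refl[OF wf h] by blast
qed

text \<open>Counting half-edges gives 3V = e + 2I for a component with e external and I internal
  edges. For e = 2 or 3 this makes I \<ge> V equivalent to I \<ge> 1, so the loop condition says no
  more than that there is an internal edge, that is, that no vertex has only external
  half-edges.\<close>

lemma component_loop_iff:
  assumes T: "trivalent A" and K: "K \<in> components A" and h: "h \<in> halves K"
  shows "card (external K) \<in> {2, 3} \<and> loop_number K \<ge> 1 \<longleftrightarrow>
    card (conn (leg_graph_of A) `` {h} \<inter> free (leg_graph_of A)) \<in> {2, 3} \<and>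
    (\<forall>k\<in>halves K. \<not> blk (leg_graph_of A) `` {k} \<subseteq> free (leg_graph_of A))"
proof -
  note wf = wf_leg_graph_of[OF T]
  note full = full_sub_component[OF T K]
  note TK = trivalent_full_sub[OF T full(1)]
  have HK: "halves K \<subseteq> halves A" using full(1) inc_mem[OF T] by (auto simp: full_sub_def)
  have ext: "external K = conn (leg_graph_of A) `` {h} \<inter> free (leg_graph_of A)"
    using full(3)[OF h] full(5) by (simp add: external_eq[of A])
  have fv: "finite (verts K)" by (rule finite_verts[OF TK])
  hence V: "card (verts K) \<ge> 1" using full(2) by (simp add: Suc_leI card_gt_0_iff)
  have fin: "finite (adj K)"
  proof -
    have "adj K \<subseteq> halves K \<times> halves K" using adj_mem[OF TK] by auto
    thus ?thesis using finite_halves[OF TK] finite_subset by blast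
  qed
  have "internal K = (\<lambda>(h, k). {h, k}) ` adj K" by (auto simp: internal_def)
  hence E: "card (internal K) \<ge> 1 \<longleftrightarrow> adj K \<noteq> {}"
    using fin by (simp add: Suc_le_eq card_gt_0_iff)
  have iso: "adj K \<noteq> {} \<longleftrightarrow> (\<forall>k\<in>halves K. \<not> blk (leg_graph_of A) `` {k} \<subseteq> free (leg_graph_of A))"
  proof
    assume ne: "adj K \<noteq> {}"
    show "\<forall>k\<in>halves K. \<not> blk (leg_graph_of A) `` {k} \<subseteq> free (leg_graph_of A)"
    proof (intro ballI notI)
      fix k assume k: "k \<in> halves K" and f: "blk (leg_graph_of A) `` {k} \<subseteq> free (leg_graph_of A)"
      have kA: "k \<in> halves A" using k HK by blast
      have "conn (leg_graph_of A) `` {k} = blk (leg_graph_of A) `` {k}"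
        using isolated_block[OF wf _ card_blk[OF T kA] f] kA by simp
      hence "halves K \<subseteq> external A" using full(3)[OF k] f by (simp add: external_eq)
      moreover obtain p q where "(p, q) \<in> adj K" using ne by auto
      hence "p \<in> halves K" "(p, q) \<in> adj A" using full(4) by blast+
      ultimately show False by (auto simp: external_def)
    qed
  next
    assume "\<forall>k\<in>halves K. \<not> blk (leg_graph_of A) `` {k} \<subseteq> free (leg_graph_of A)"
    then obtain k where k: "(h, k) \<in> blk (leg_graph_of A)" "k \<notin> free (leg_graph_of A)" using h by blast
    have "(h, k) \<in> conn (leg_graph_of A)" using k(1) by (auto simp: conn_def)
    hence kK: "k \<in> halves K" using full(3)[OF h] by blast
    hence "k \<notin> external K" using k(2) full(5) by (simp add: external_eq)
    thus "adj K \<noteq> {}" using kK by (auto simp: external_def)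
  qed
  \<comment> \<open>Parity decides. For e = 2 the number of vertices is even, hence at least 2; for
    e = 3 it is odd, and an internal edge excludes the value 1.\<close>
  have euler: "n \<le> m \<longleftrightarrow> 1 \<le> m" if "3 * n = e + 2 * m" "e = 2 \<or> e = 3" "1 \<le> n" for n e m :: nat
  proof
    show "1 \<le> m" if "n \<le> m" using that \<open>1 \<le> n\<close> by linarith
    show "n \<le> m" if "1 \<le> m" using \<open>e = 2 \<or> e = 3\<close>
    proof
      assume "e = 2" thus ?thesis using \<open>3 * n = e + 2 * m\<close> \<open>1 \<le> n\<close> by linarith
    next
      assume "e = 3" thus ?thesis using \<open>3 * n = e + 2 * m\<close> \<open>1 \<le> n\<close> \<open>1 \<le> m\<close> by linarith
    qed
  qed
  have "loop_number K \<ge> 1 \<longleftrightarrow> card (internal K) \<ge> 1" if e: "card (external K) \<in> {2, 3}"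
  proof -
    have "3 * card (verts K) = card (external K) + 2 * card (internal K)" by (rule edge_count[OF TK])
    moreover have "loop_number K \<ge> 1 \<longleftrightarrow> card (internal K) \<ge> card (verts K)"
      unfolding loop_number_def by linarith
    moreover have "card (external K) = 2 \<or> card (external K) = 3" using e by simp
    ultimately show ?thesis using euler V by metis
  qed
  thus ?thesis using E iso ext by auto
qed

text \<open>\<open>reduced\<close> takes over the role of the loop condition, so that from here on
  loops need not be counted.\<close>

theorem feynman_iff:
  "feynman A \<longleftrightarrow> trivalent A \<and> valid_leg (leg_graph_of A) \<and> reduced (leg_graph_of A)"
proof (cases "trivalent A")
  case T: True
  let ?G = "leg_graph_of A"
  have b3: "card (blk ?G `` {h}) = 3" if "h \<in> halves A" for h using card_blk[OF T that] .
  have "feynman A \<longleftrightarrow> (\<forall>K\<in>components A. card (external K) \<in> {2, 3} \<and> loop_number K \<ge> 1)"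
    using T unfolding feynman_def trivalent_def by blast
  also have "\<dots> \<longleftrightarrow> (\<forall>h\<in>halves A. card (conn ?G `` {h} \<inter> free ?G) \<in> {2, 3} \<and> \<not> blk ?G `` {h} \<subseteq> free ?G)"
  proof (intro iffI ballI)
    fix h assume *: "\<forall>K\<in>components A. card (external K) \<in> {2, 3} \<and> loop_number K \<ge> 1" and h: "h \<in> halves A"
    obtain K where K: "K \<in> components A" "h \<in> halves K" using halves_component[OF T h] .
    have "card (external K) \<in> {2, 3} \<and> loop_number K \<ge> 1" using * K by blast
    from this[unfolded component_loop_iff[OF T K]]
    show "card (conn ?G `` {h} \<inter> free ?G) \<in> {2, 3} \<and> \<not> blk ?G `` {h} \<subseteq> free ?G" using K(2) by blast
  next
    fix K assume *: "\<forall>h\<in>halves A. card (conn ?G `` {h} \<inter> free ?G) \<in> {2, 3} \<and> \<not> blk ?G `` {h} \<subseteq> free ?G"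
      and K: "K \<in> components A"
    note full = full_sub_component[OF T K]
    obtain v where "v \<in> verts K" using full(2) by blast
    then obtain h where h: "h \<in> halves K"
      using half_ex[OF trivalent_full_sub[OF T full(1)]] inc_mem[OF trivalent_full_sub[OF T full(1)]] by blast
    have HK: "halves K \<subseteq> halves A" using full(1) inc_mem[OF T] by (auto simp: full_sub_def)
    show "card (external K) \<in> {2, 3} \<and> loop_number K \<ge> 1"
      unfolding component_loop_iff[OF T K h] using * h HK by blast
  qed
  also have "\<dots> \<longleftrightarrow> valid_leg ?G \<and> reduced ?G"
    using wf_leg_graph_of[OF T] b3 unfolding valid_leg_iff valid_at_def reduced_def leg_graph_of_simps
    by auto
  finally show ?thesis using T by simp
next
  case False
  thus ?thesis unfolding feynman_def trivalent_def by blast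
qed

lemma feynman_trivalent: "feynman A \<Longrightarrow> trivalent A"
  and feynman_valid: "feynman A \<Longrightarrow> valid_leg (leg_graph_of A)"
  and feynman_reduced: "feynman A \<Longrightarrow> reduced (leg_graph_of A)"
  by (simp_all add: feynman_iff)

lemma external_not_block: "feynman A \<Longrightarrow> h \<in> halves A \<Longrightarrow> \<not> blk (leg_graph_of A) `` {h} \<subseteq> external A"
  using feynman_reduced[of A] by (simp add: reduced_def external_eq)

lemma subgraph_iff_full_sub:
  assumes T: "trivalent A"
  shows "subgraph S A \<longleftrightarrow> feynman S \<and> full_sub S A"
proof
  assume S: "subgraph S A"
  hence F: "feynman S" by (simp add: subgraph_def)
  note TS = feynman_trivalent[OF F]
  have sub: "verts S \<subseteq> verts A" "halves S \<subseteq> halves A" "inc S \<subseteq> inc A" "adj S \<subseteq> adj A"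
    "\<forall>h v. (h, v) \<in> inc A \<and> v \<in> verts S \<longrightarrow> (h, v) \<in> inc S"
    using S unfolding subgraph_def by blast+
  have "inc S = inc A \<inter> (UNIV \<times> verts S)"
  proof (intro equalityI subrelI)
    fix h v assume "(h, v) \<in> inc S"
    thus "(h, v) \<in> inc A \<inter> (UNIV \<times> verts S)" using inc_mem[OF TS] sub(3) by blast
  next
    fix h v assume "(h, v) \<in> inc A \<inter> (UNIV \<times> verts S)"
    thus "(h, v) \<in> inc S" using sub(5) by blast
  qed
  moreover have "halves S = {h. \<exists>v\<in>verts S. (h, v) \<in> inc A}"
  proof (intro equalityI subsetI)
    fix h assume "h \<in> halves S"
    then obtain v where v: "(h, v) \<in> inc S" using inc_ex[OF TS] by blast
    thus "h \<in> {h. \<exists>v\<in>verts S. (h, v) \<in> inc A}" using inc_mem[OF TS v] sub(3) by blast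
  next
    fix h assume "h \<in> {h. \<exists>v\<in>verts S. (h, v) \<in> inc A}"
    then obtain v where "v \<in> verts S" "(h, v) \<in> inc A" by blast
    hence "(h, v) \<in> inc S" using sub(5) by blast
    thus "h \<in> halves S" using inc_mem[OF TS] by blast
  qed
  moreover have "adj S \<subseteq> halves S \<times> halves S" using adj_mem[OF TS] by auto
  ultimately show "feynman S \<and> full_sub S A"
    unfolding full_sub_def using F sub adj_sym[OF TS] by blast
next
  assume "feynman S \<and> full_sub S A"
  thus "subgraph S A"
    unfolding subgraph_def full_sub_def using inc_mem[OF T] by auto
qed

lemma matching_rtrancl:
  assumes "sym R" "irrefl R" "single_valued R"
  shows "R\<^sup>* - Id = R"
proof -
  have "(u, v) \<in> R \<or> u = v" if "(u, v) \<in> R\<^sup>*" for u v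
    using that
  proof (induction rule: rtrancl_induct)
    case (step y z)
    show ?case
    proof (cases "u = y")
      case False
      hence "(y, u) \<in> R" using step.IH assms(1) by (auto dest: symD)
      thus ?thesis using step(2) assms(3) by (auto dest: single_valuedD)
    qed (use step(2) in simp)
  qed simp
  thus ?thesis using assms(2) by (auto dest: irreflD)
qed

context
  fixes A S :: "('v, 'h) hgraph"
  assumes T: "trivalent A" and S: "full_sub S A"
begin

lemma full_sub_trivalent: "trivalent S"
  by (rule trivalent_full_sub[OF T S])

lemma full_sub_halves: "halves S \<subseteq> halves A" "Domain (adj S) \<subseteq> halves S" "adj S \<subseteq> adj A" "sym (adj S)"
  using S inc_mem[OF T] by (auto simp: full_sub_def)

lemma full_sub_inc: "(h, v) \<in> inc A \<Longrightarrow> h \<in> halves S \<longleftrightarrow> v \<in> verts S"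
  using S inc_unique[OF T, of h v] unfolding full_sub_def by blast

lemma full_sub_blk: "(h, k) \<in> blk (leg_graph_of A) \<Longrightarrow> h \<in> halves S \<longleftrightarrow> k \<in> halves S"
  unfolding blk_leg_graph_of using full_sub_inc by blast

lemma full_sub_blk_eq: "h \<in> halves S \<Longrightarrow> blk (leg_graph_of S) `` {h} = blk (leg_graph_of A) `` {h}"
proof -
  assume h: "h \<in> halves S"
  then obtain v where v: "(h, v) \<in> inc A" "v \<in> verts S" using S by (auto simp: full_sub_def)
  hence vS: "(h, v) \<in> inc S" using S by (simp add: full_sub_def)
  have "{k. (k, v) \<in> inc S} = {k. (k, v) \<in> inc A}" using S v(2) by (auto simp: full_sub_def)
  thus ?thesis using blk_at[OF full_sub_trivalent vS] blk_at[OF T v(1)] by simp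
qed

abbreviation sub_legs where "sub_legs \<equiv> lsub (leg_graph_of A) (adj S)"

lemma wf_sub_legs: "wf_leg sub_legs"
  using wf_lsub[OF wf_leg_graph_of[OF T]] full_sub_halves by simp

lemma conn_sub_legs: "h \<in> halves S \<Longrightarrow> conn sub_legs `` {h} = conn (leg_graph_of S) `` {h}"
proof -
  assume h: "h \<in> halves S"
  have step: "v \<notin> - halves S \<and> (u, v) \<in> blk (leg_graph_of S) \<union> adj S"
    if "(u, v) \<in> blk (leg_graph_of A) \<union> adj S" "u \<notin> - halves S" for u v
  proof (cases "(u, v) \<in> adj S")
    case True
    thus ?thesis using adj_mem[OF full_sub_trivalent] by blast
  next
    case False
    hence uv: "(u, v) \<in> blk (leg_graph_of A)" using that(1) by blast
    hence "v \<in> blk (leg_graph_of S) `` {u}" using full_sub_blk_eq[of u] that(2) by blast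
    thus ?thesis using full_sub_blk[OF uv] that(2) by blast
  qed
  have sub: "blk (leg_graph_of S) \<union> adj S \<subseteq> blk (leg_graph_of A) \<union> adj S"
    using S by (auto simp: blk_leg_graph_of full_sub_def)
  have "(h, k) \<in> (blk (leg_graph_of A) \<union> adj S)\<^sup>* \<longleftrightarrow> (h, k) \<in> (blk (leg_graph_of S) \<union> adj S)\<^sup>*" for k
    by (rule rtrancl_avoid(1)[OF step sub]) (use h in auto)
  thus ?thesis by (auto simp: conn_def)
qed

lemma free_sub_legs: "halves S \<inter> free sub_legs = external S"
  using full_sub_halves by (auto simp: free_lsub external_def)

text \<open>\<open>lsub\<close> retains the vertices outside \<open>S\<close>. Each becomes an
  isolated component with three free legs, which is valid and is discarded by
  \<open>nf\<close>.\<close>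

lemma conn_sub_legs_outside:
  assumes h: "h \<in> halves A" "h \<notin> halves S"
  shows "conn sub_legs `` {h} = blk (leg_graph_of A) `` {h}" "blk (leg_graph_of A) `` {h} \<subseteq> free sub_legs"
proof -
  have "k \<in> free sub_legs" if "(h, k) \<in> blk (leg_graph_of A)" for k
    using that full_sub_blk[OF that] h full_sub_halves(2) blk_legs[OF wf_leg_graph_of[OF T] that]
    by (auto simp: free_lsub)
  thus f: "blk (leg_graph_of A) `` {h} \<subseteq> free sub_legs" by blast
  thus "conn sub_legs `` {h} = blk (leg_graph_of A) `` {h}"
    using isolated_block[OF wf_sub_legs, of h] h card_blk[OF T h(1)] by simp
qed

lemma conn_S_subset: "h \<in> halves S \<Longrightarrow> conn (leg_graph_of S) `` {h} \<subseteq> halves S"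
  using conn_legs[OF wf_leg_graph_of[OF full_sub_trivalent]] by auto

lemma valid_sub_legs:
  assumes F: "feynman S"
  shows "valid_leg sub_legs"
  unfolding valid_leg_iff
proof (intro conjI ballI)
  show "wf_leg sub_legs" by (rule wf_sub_legs)
  fix h assume "h \<in> legs sub_legs"
  hence h: "h \<in> halves A" by simp
  have b3: "card (blk sub_legs `` {h}) = 3" using card_blk[OF T h] by simp
  have "card (conn sub_legs `` {h} \<inter> free sub_legs) \<in> {2, 3}"
  proof (cases "h \<in> halves S")
    case True
    have "conn sub_legs `` {h} \<inter> free sub_legs = conn (leg_graph_of S) `` {h} \<inter> free (leg_graph_of S)"
      using conn_sub_legs[OF True] conn_S_subset[OF True] free_sub_legs by (auto simp: external_eq)
    thus ?thesis using feynman_valid[OF F] True by (simp add: valid_leg_def)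
  next
    case False
    hence "conn sub_legs `` {h} \<inter> free sub_legs = blk (leg_graph_of A) `` {h}" using conn_sub_legs_outside[OF h] by blast
    thus ?thesis using card_blk[OF T h] by simp
  qed
  thus "valid_at sub_legs h" using b3 by (simp add: valid_at_def)
qed

lemma core_sub_legs:
  assumes F: "feynman S"
  shows "core sub_legs = halves S"
proof (intro equalityI subsetI)
  fix h assume "h \<in> core sub_legs"
  hence h: "h \<in> halves A" "\<not> blk (leg_graph_of A) `` {h} \<subseteq> free sub_legs" by (auto simp: core_def)
  thus "h \<in> halves S" using conn_sub_legs_outside(2) by blast
next
  fix h assume h: "h \<in> halves S"
  hence hA: "h \<in> halves A" using full_sub_halves by blast
  have "\<not> blk (leg_graph_of S) `` {h} \<subseteq> external S" using external_not_block[OF F h] .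
  hence "\<not> blk (leg_graph_of A) `` {h} \<subseteq> free sub_legs"
    using full_sub_blk_eq[OF h] full_sub_blk h free_sub_legs by blast
  thus "h \<in> core sub_legs" using hA card_blk[OF T hA] by (simp add: core_def)
qed

lemma pairs_sub_legs: "pairs sub_legs = {}"
proof -
  have "card (blk sub_legs `` {h}) \<noteq> 2" if "(h, k) \<in> blk sub_legs" for h k
    using that card_blk[OF T, of h] blk_legs[OF wf_sub_legs that] by simp
  thus ?thesis by (auto simp: pairs_def)
qed

text \<open>Assumes the core instead of \<open>feynman S\<close>: when a subgraph is built from a
  given link set, its leg graph is needed in order to prove that it is a Feynman graph.\<close>

lemma nf_sub_legs_core:
  assumes core: "core sub_legs = halves S"
  shows "nf sub_legs = leg_graph_of S"
proof (rule leg_graph_eqI)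
  note TS = full_sub_trivalent
  show "legs (nf sub_legs) = legs (leg_graph_of S)" by (simp add: nf_def core)
  have "adj S \<subseteq> halves S \<times> halves S" using adj_mem[OF TS] by auto
  thus "lnk (nf sub_legs) = lnk (leg_graph_of S)"
    using matching_rtrancl[OF adj_sym[OF TS] adj_irrefl[OF TS] adj_sv[OF TS]]
    by (auto simp: nf_def core pairs_sub_legs)
  have "(h, k) \<in> blk (leg_graph_of A) \<and> h \<in> halves S \<and> k \<in> halves S \<longleftrightarrow> (h, k) \<in> blk (leg_graph_of S)" for h k
  proof (cases "h \<in> halves S")
    case True
    thus ?thesis using full_sub_blk_eq[OF True] blk_legs[OF wf_leg_graph_of[OF TS], of h k] by auto
  next
    case False
    thus ?thesis using blk_legs[OF wf_leg_graph_of[OF TS], of h k] by auto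
  qed
  thus "blk (nf sub_legs) = blk (leg_graph_of S)" by (auto simp: nf_def core)
qed

lemma nf_sub_legs: "feynman S \<Longrightarrow> nf sub_legs = leg_graph_of S"
  by (rule nf_sub_legs_core[OF core_sub_legs])

end

definition leg_connected :: "('v, 'h) hgraph \<Rightarrow> bool" where
  "leg_connected K \<longleftrightarrow> verts K \<noteq> {} \<and> (\<forall>h\<in>halves K. conn (leg_graph_of K) `` {h} = halves K)"

lemma component_leg_connected:
  assumes T: "trivalent S" and K: "K \<in> components S"
  shows "leg_connected K"
  unfolding leg_connected_def
proof (intro conjI ballI)
  note full = full_sub_component[OF T K]
  show "verts K \<noteq> {}" by (rule full(2))
  fix h assume h: "h \<in> halves K"
  have step: "v \<notin> - halves K \<and> (u, v) \<in> blk (leg_graph_of S) \<union> adj K"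
    if "(u, v) \<in> blk (leg_graph_of S) \<union> adj S" "u \<notin> - halves K" for u v
  proof -
    have "v \<in> halves K"
      using that full(3)[of u] unfolding conn_def by auto
    thus ?thesis using that full(4) by blast
  qed
  have "(h, k) \<in> (blk (leg_graph_of S) \<union> adj S)\<^sup>* \<longleftrightarrow> (h, k) \<in> (blk (leg_graph_of S) \<union> adj K)\<^sup>*" for k
    by (rule rtrancl_avoid(1)[OF step]) (use full(4) h in auto)
  hence "conn (lsub (leg_graph_of S) (adj K)) `` {h} = conn (leg_graph_of S) `` {h}"
    by (auto simp: conn_def)
  thus "conn (leg_graph_of K) `` {h} = halves K"
    using conn_sub_legs[OF T full(1) h] full(3)[OF h] by simp
qed

lemma components_connected:
  assumes T: "trivalent K" and C: "leg_connected K"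
  shows "components K = {K}"
proof -
  have "component_of K v = K" if v: "v \<in> verts K" for v
  proof -
    obtain h where h: "(h, v) \<in> inc K" using half_ex[OF T v] by blast
    have c: "conn (leg_graph_of K) `` {h} = halves K"
      using C inc_mem[OF T h] by (simp add: leg_connected_def)
    note s = component_of_simps[OF T v h]
    have "verts (component_of K v) = verts K"
      unfolding s(2) using c half_ex[OF T] inc_mem[OF T] by blast
    moreover have "inc (component_of K v) = inc K" unfolding s(3) c using inc_mem[OF T] by auto
    moreover have "adj (component_of K v) = adj K" unfolding s(4) c using adj_mem[OF T] by auto
    moreover have "halves (component_of K v) = halves K" unfolding s(1) c ..
    ultimately show ?thesis by simp
  qed
  moreover have "verts K \<noteq> {}" using C by (simp add: leg_connected_def)
  ultimately show ?thesis unfolding components_def by auto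
qed

lemma component_feynman:
  assumes F: "feynman S" and K: "K \<in> components S"
  shows "feynman K"
proof -
  note T = feynman_trivalent[OF F]
  note TK = trivalent_full_sub[OF T full_sub_component(1)[OF T K]]
  have "components K = {K}" using components_connected[OF TK component_leg_connected[OF T K]] .
  thus ?thesis using F K TK unfolding feynman_def trivalent_def by auto
qed

text \<open>If every external half-edge of \<open>K\<close> is external in \<open>A\<close>, no edge
  of \<open>A\<close> is cut by \<open>K\<close>, so \<open>K\<close> is closed under connectivity
  in \<open>A\<close>; being connected it is a whole component.\<close>

lemma component_iff_external:
  assumes T: "trivalent A" and K: "full_sub K A" and C: "leg_connected K"
  shows "K \<in> components A \<longleftrightarrow> external K \<subseteq> external A"
proof
  assume "K \<in> components A"
  thus "external K \<subseteq> external A" using full_sub_component(5)[OF T] by blast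
next
  assume ext: "external K \<subseteq> external A"
  note TK = trivalent_full_sub[OF T K]
  obtain v where v: "v \<in> verts K" using C by (auto simp: leg_connected_def)
  hence vA: "v \<in> verts A" using K by (auto simp: full_sub_def)
  obtain h where h: "(h, v) \<in> inc K" using half_ex[OF TK v] by blast
  hence hA: "(h, v) \<in> inc A" and hK: "h \<in> halves K" using K inc_mem[OF TK h] by (auto simp: full_sub_def)
  have adjK: "(k, k') \<in> adj K" if kK: "k \<in> halves K" and kk: "(k, k') \<in> adj A" for k k'
  proof -
    have "k \<notin> external A" using kk by (auto simp: external_def)
    hence "k \<notin> external K" using ext by blast
    then obtain k'' where k'': "(k, k'') \<in> adj K" using kK by (auto simp: external_def)
    hence "(k, k'') \<in> adj A" using K by (auto simp: full_sub_def)
    hence "k'' = k'" using kk adj_sv[OF T] by (auto dest: single_valuedD)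
    thus ?thesis using k'' by simp
  qed
  have c: "conn (leg_graph_of A) `` {h} = halves K"
  proof
    have "k \<in> halves K" if "(h, k) \<in> conn (leg_graph_of A)" for k
      using that unfolding conn_def
    proof (induction rule: rtrancl_induct)
      case (step p q)
      show ?case
      proof (cases "(p, q) \<in> adj A")
        case True
        thus ?thesis using adjK[OF step(3)] adj_mem[OF TK] by blast
      next
        case False
        hence "(p, q) \<in> blk (leg_graph_of A)" using step(2) by simp
        thus ?thesis using full_sub_blk[OF T K] step(3) by blast
      qed
    qed (rule hK)
    thus "conn (leg_graph_of A) `` {h} \<subseteq> halves K" by blast
    have "conn (leg_graph_of K) \<subseteq> conn (leg_graph_of A)"
      unfolding conn_def by (rule rtrancl_mono) (use K in \<open>auto simp: blk_leg_graph_of full_sub_def\<close>)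
    thus "halves K \<subseteq> conn (leg_graph_of A) `` {h}" using C hK by (auto simp: leg_connected_def)
  qed
  note s = component_of_simps[OF T vA hA, unfolded c]
  have cK: "k \<in> halves K" if "(h, k) \<in> conn (leg_graph_of A)" for k using c that by blast
  have "verts (component_of A v) = verts K"
  proof (intro equalityI subsetI)
    fix u assume "u \<in> verts (component_of A v)"
    then obtain k where "k \<in> halves K" "(k, u) \<in> inc A" unfolding s(2) using cK by blast
    thus "u \<in> verts K" using full_sub_inc[OF T K] by blast
  next
    fix u assume "u \<in> verts K"
    then obtain k where k: "(k, u) \<in> inc K" using half_ex[OF TK] by blast
    hence "(k, u) \<in> inc A" "k \<in> halves K" using K inc_mem[OF TK k] by (auto simp: full_sub_def)
    thus "u \<in> verts (component_of A v)" unfolding s(2) using c by blast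
  qed
  moreover have "inc (component_of A v) = inc K"
    unfolding s(3) using full_sub_inc[OF T K] K by (auto simp: full_sub_def)
  moreover have "adj (component_of A v) = adj K"
    unfolding s(4) using adjK K by (auto simp: full_sub_def)
  ultimately have "component_of A v = K" using s(1) by simp
  thus "K \<in> components A" using vA by (auto simp: components_def)
qed

text \<open>A two-leg component of the leg subobject must come from \<open>S\<close>, as vertices
  outside have three legs. If one of its legs is external in \<open>A\<close>, validity asks for
  both, which by \<open>component_iff_external\<close> means a whole component of \<open>A\<close>;
  this is \<open>quotient_defined\<close>.\<close>

lemma valid_lquo_subgraph_iff:
  assumes A: "feynman A" and S: "full_sub S A" and F: "feynman S"
  shows "valid_leg (lquo (leg_graph_of A) (adj S)) \<longleftrightarrow> quotient_defined A S"
proof -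
  note T = feynman_trivalent[OF A] and TS = feynman_trivalent[OF F]
  let ?L = "lsub (leg_graph_of A) (adj S)"
  have U: "adj S \<subseteq> lnk (leg_graph_of A)" "sym (adj S)" using full_sub_halves[OF T S] by auto
  have comp: "conn ?L `` {h} \<inter> free ?L = external K" if K: "K \<in> components S" "h \<in> halves K" for K h
  proof -
    note full = full_sub_component[OF TS K(1)]
    have "h \<in> halves S" using full(1) K(2) inc_mem[OF TS] by (auto simp: full_sub_def)
    hence "conn ?L `` {h} = halves K" using conn_sub_legs[OF T S] full(3)[OF K(2)] by simp
    moreover have "halves K \<subseteq> halves S" using full(1) inc_mem[OF TS] by (auto simp: full_sub_def)
    ultimately show ?thesis using free_sub_legs[OF T S] full(5) by auto
  qed
  have KA: "full_sub K A" if "K \<in> components S" for K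
    using full_sub_component(1)[OF TS that] S unfolding full_sub_def by auto
  have ci: "K \<in> components A \<longleftrightarrow> external K \<subseteq> external A" if "K \<in> components S" for K
    using component_iff_external[OF T KA[OF that] component_leg_connected[OF TS that]] .
  have extK: "external K \<subseteq> halves K" for K :: "('a, 'b) hgraph" by (auto simp: external_def)
  show ?thesis
    unfolding valid_lquo_iff[OF feynman_valid[OF A] U valid_sub_legs[OF T S F]] external_eq[symmetric]
  proof
    assume *: "\<forall>x\<in>external A. card (conn ?L `` {x} \<inter> free ?L) = 2 \<longrightarrow> conn ?L `` {x} \<inter> free ?L \<subseteq> external A"
    show "quotient_defined A S"
      unfolding quotient_defined_def
    proof (intro ballI impI)
      fix K assume K: "K \<in> components S" and c: "card (external K) = 2"
      show "K \<in> components A \<or> external K \<inter> external A = {}"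
      proof (cases "external K \<inter> external A = {}")
        case False
        then obtain x where x: "x \<in> external K" "x \<in> external A" by blast
        hence "x \<in> halves K" using extK by blast
        note e = comp[OF K this]
        have "external K \<subseteq> external A" using *[rule_format, OF x(2)] c unfolding e by blast
        thus ?thesis using ci[OF K] by blast
      qed blast
    qed
  next
    assume q: "quotient_defined A S"
    show "\<forall>x\<in>external A. card (conn ?L `` {x} \<inter> free ?L) = 2 \<longrightarrow> conn ?L `` {x} \<inter> free ?L \<subseteq> external A"
    proof (intro ballI impI)
      fix x assume x: "x \<in> external A" and c: "card (conn ?L `` {x} \<inter> free ?L) = 2"
      have xA: "x \<in> halves A" using x by (auto simp: external_def)
      have xS: "x \<in> halves S"
      proof (rule ccontr)
        assume "x \<notin> halves S"
        note o = conn_sub_legs_outside[OF T S xA this]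
        hence "conn ?L `` {x} \<inter> free ?L = blk (leg_graph_of A) `` {x}" by blast
        thus False using c card_blk[OF T xA] by simp
      qed
      obtain K where K: "K \<in> components S" "x \<in> halves K" using halves_component[OF TS xS] .
      note e = comp[OF K]
      have "x \<notin> Domain (adj A)" using x by (auto simp: external_def)
      moreover have "adj K \<subseteq> adj A" using KA[OF K(1)] by (auto simp: full_sub_def)
      ultimately have "x \<in> external K" using K(2) by (auto simp: external_def)
      hence "K \<in> components A" using q K(1) c x unfolding e quotient_defined_def by blast
      thus "conn ?L `` {x} \<inter> free ?L \<subseteq> external A" unfolding e using ci[OF K(1)] by blast
    qed
  qed
qed

lemma adj_lsubs:
  assumes A: "feynman A" and S: "full_sub S A" "feynman S" "quotient_defined A S"
  shows "adj S \<in> lsubs (leg_graph_of A)"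
  using full_sub_halves[OF feynman_trivalent[OF A] S(1)] valid_sub_legs[OF feynman_trivalent[OF A] S(1,2)]
    valid_lquo_subgraph_iff[OF A S(1,2)] S(3) by (simp add: lsubs_def)

section \<open>Feynman quotients as smoothed contractions\<close>

context
  fixes A S :: "('v, 'h) hgraph"
  assumes A: "feynman A" and S: "full_sub S A"
begin

abbreviation quo_legs where "quo_legs \<equiv> lquo (leg_graph_of A) (adj S)"

lemma legs_quo_legs: "legs quo_legs = (halves A - halves S) \<union> external S"
  using full_sub_halves[OF feynman_trivalent[OF A] S] by (auto simp: external_def)

lemma free_quo_legs: "free quo_legs = external A"
proof -
  note T = feynman_trivalent[OF A]
  have "adj S \<subseteq> lnk (leg_graph_of A)" "sym (adj S)" using full_sub_halves[OF T S] by auto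
  thus ?thesis using free_lquo[OF wf_leg_graph_of[OF T]] by (simp add: external_eq)
qed

lemma blk_quo_legs_outside:
  assumes h: "h \<in> halves A" "h \<notin> halves S"
  shows "blk quo_legs `` {h} = blk (leg_graph_of A) `` {h}"
proof -
  note T = feynman_trivalent[OF A]
  note o = conn_sub_legs_outside[OF T S h]
  have "h \<in> legs (leg_graph_of A) - Domain (adj S)"
    using h full_sub_halves(2)[OF T S] by auto
  from blk_lquo[OF this] show ?thesis using o by blast
qed

lemma core_quo_legs_outside:
  assumes h: "h \<in> halves A" "h \<notin> halves S"
  shows "h \<in> core quo_legs"
  using legs_quo_legs h blk_quo_legs_outside[OF h] card_blk[OF feynman_trivalent[OF A] h(1)]
    external_not_block[OF A h(1)] by (simp add: core_def free_quo_legs del: lquo_simps)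

lemma blk_quo_legs_inside:
  assumes C: "leg_connected S" and F: "feynman S" and h: "h \<in> external S"
  shows "blk quo_legs `` {h} = external S"
proof -
  note T = feynman_trivalent[OF A]
  have hS: "h \<in> halves S" using h by (auto simp: external_def)
  have "h \<in> legs (leg_graph_of A) - Domain (adj S)"
    using h full_sub_halves(1)[OF T S] by (auto simp: external_def)
  from blk_lquo[OF this] show ?thesis
    using conn_sub_legs[OF T S hS] C hS free_sub_legs[OF T S] by (simp add: leg_connected_def)
qed

end

lemma trivalentI:
  assumes "wf_leg G" "legs G = halves P" "lnk G = adj P" "finite (verts P)"
    and "\<And>h v. (h, v) \<in> inc P \<Longrightarrow> h \<in> halves P \<and> v \<in> verts P"
    and "\<And>h. h \<in> halves P \<Longrightarrow> \<exists>v. (h, v) \<in> inc P"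
    and "\<And>h v v'. (h, v) \<in> inc P \<Longrightarrow> (h, v') \<in> inc P \<Longrightarrow> v = v'"
    and "\<And>v. v \<in> verts P \<Longrightarrow> card {h. (h, v) \<in> inc P} = 3"
  shows "trivalent P"
proof -
  have "\<exists>!v. (h, v) \<in> inc P" if h: "h \<in> halves P" for h
  proof -
    obtain v where "(h, v) \<in> inc P" using assms(6)[OF h] by blast
    thus ?thesis using assms(7) by (intro ex1I[of _ v]) blast+
  qed
  moreover have "inc P \<subseteq> halves P \<times> verts P" using assms(5) by auto
  ultimately show ?thesis
    using assms(1,4,8) unfolding trivalent_def hgraph_def wf_leg_def assms(2,3) by blast
qed

context
  fixes Q K :: "('v, 'h) hgraph"
  assumes Q: "feynman Q" and K: "full_sub K Q" and FK: "feynman K" and C: "leg_connected K"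
    and qd: "quotient_defined Q K"
begin

abbreviation contr where "contr \<equiv> lquo (leg_graph_of Q) (adj K)"

lemma tri_Q: "trivalent Q" and tri_K: "trivalent K"
  using feynman_trivalent Q FK by blast+

text \<open>Contraction turns the external half-edges of \<open>K\<close> into one vertex. It
  survives smoothing if it is trivalent and not entirely free, the latter meaning that
  \<open>K\<close> is not a component.\<close>

lemma core_contr: "core contr = (halves Q - halves K) \<union>
    (if card (external K) = 3 \<and> \<not> external K \<subseteq> external Q then external K else {})"
proof -
  have "h \<in> core contr \<longleftrightarrow> card (external K) = 3 \<and> \<not> external K \<subseteq> external Q" if h: "h \<in> external K" for h
    using blk_quo_legs_inside[OF Q K C FK h] legs_quo_legs[OF Q K] h
    by (simp add: core_def free_quo_legs[OF Q K] del: lquo_simps)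
  moreover have "h \<in> core contr" if "h \<in> halves Q - halves K" for h
    using core_quo_legs_outside[OF Q K] that by blast
  moreover have "core contr \<subseteq> (halves Q - halves K) \<union> external K"
    using legs_quo_legs[OF Q K] by (auto simp: core_def)
  ultimately show ?thesis by auto
qed

lemma pairs_contr: "(u, v) \<in> pairs contr \<longleftrightarrow>
    u \<in> external K \<and> v \<in> external K \<and> card (external K) = 2"
proof (cases "u \<in> external K")
  case True
  thus ?thesis using blk_quo_legs_inside[OF Q K C FK True] unfolding pairs_iff by simp
next
  case False
  have "card (blk contr `` {u}) \<noteq> 2" if "v \<in> blk contr `` {u}"
  proof -
    have "u \<in> legs contr" using that by (simp add: lquo_blk)
    hence u: "u \<in> halves Q" "u \<notin> halves K" using legs_quo_legs[OF Q K] False by auto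
    thus ?thesis using blk_quo_legs_outside[OF Q K u] card_blk[OF tri_Q u(1)] by simp
  qed
  thus ?thesis using False unfolding pairs_iff by blast
qed

lemma K_inc: "(h, v) \<in> inc Q \<Longrightarrow> h \<in> halves Q - halves K \<longleftrightarrow> v \<in> verts Q - verts K"
  using full_sub_inc[OF tri_Q K, of h v] inc_mem[OF tri_Q, of h v] by blast

lemma ext_card: "card (external K) = 2 \<or> card (external K) = 3"
  using components_connected[OF tri_K C] FK by (auto simp: feynman_def)

lemma comp_iff: "K \<in> components Q \<longleftrightarrow> external K \<subseteq> external Q"
  by (rule component_iff_external[OF tri_Q K C])

lemma valid_contr: "valid_leg contr"
  using adj_lsubs[OF Q K FK qd] by (simp add: lsubs_def)

text \<open>An edge joining the outside to \<open>K\<close> is cut by \<open>K\<close>, so its end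
  in \<open>K\<close> is external there although it is internal in \<open>Q\<close>.\<close>

lemma adj_out:
  assumes "(h, k) \<in> adj Q" "h \<in> halves Q - halves K" "k \<in> halves K"
  shows "k \<in> external K" "k \<notin> external Q"
proof -
  have kh: "(k, h) \<in> adj Q" using assms(1) adj_sym[OF tri_Q] by (auto dest: symD)
  show "k \<notin> external Q" using kh by (auto simp: external_def)
  have "(k, k') \<notin> adj K" for k'
  proof
    assume k': "(k, k') \<in> adj K"
    hence "(k, k') \<in> adj Q" using K by (auto simp: full_sub_def)
    hence "k' = h" using kh adj_sv[OF tri_Q] by (auto dest: single_valuedD)
    thus False using k' adj_mem[OF tri_K] assms(2) by blast
  qed
  thus "k \<in> external K" using assms(3) by (auto simp: external_def)
qed

lemma outside_vertex_card: "v \<in> verts Q - verts K \<Longrightarrow> {h. (h, v) \<in> inc Q \<inter> (halves Q - halves K) \<times> (verts Q - verts K)} = {h. (h, v) \<in> inc Q}"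
  using K_inc by blast

lemma outside_unique: "(h, v) \<in> inc Q \<inter> X \<Longrightarrow> (h, v') \<in> inc Q \<inter> X \<Longrightarrow> v = v'"
  using inc_unique[OF tri_Q] by blast

lemma outside_ex: "h \<in> halves Q - halves K \<Longrightarrow> \<exists>v. (h, v) \<in> inc Q \<inter> (halves Q - halves K) \<times> (verts Q - verts K)"
  using inc_ex[OF tri_Q, of h] K_inc by blast

lemma blk_contr_outside: "h \<in> halves Q - halves K \<Longrightarrow> (h, k) \<in> blk contr \<longleftrightarrow> (h, k) \<in> blk (leg_graph_of Q)"
  using blk_quo_legs_outside[OF Q K, of h] by blast

text \<open>Treats together the two cases in which no vertex is created, removal of a component and
  of a two-leg subgraph; they differ only in the adjacency.\<close>

lemma contr_without_new_vertex:
  fixes P :: "('v, 'h) hgraph"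
  assumes P: "verts P = verts Q - verts K" "halves P = halves Q - halves K"
      "inc P = inc Q \<inter> (halves Q - halves K) \<times> (verts Q - verts K)"
    and no3: "\<not> (card (external K) = 3 \<and> \<not> external K \<subseteq> external Q)"
    and adjP: "adj P = lnk (nf contr)"
  shows "trivalent P" "leg_graph_of P = nf contr"
proof -
  have core: "core contr = halves P" using core_contr no3 P(2) by simp
  have wf: "wf_leg (nf contr)" using reduction[OF valid_contr] valid_wf by blast
  show "trivalent P"
  proof (rule trivalentI[OF wf])
    show "legs (nf contr) = halves P" by (simp add: nf_def core)
    show "lnk (nf contr) = adj P" by (simp add: adjP)
    show "finite (verts P)" using finite_verts[OF tri_Q] P(1) by simp
    show "(h, v) \<in> inc P \<Longrightarrow> h \<in> halves P \<and> v \<in> verts P" for h v using P by simp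
    show "h \<in> halves P \<Longrightarrow> \<exists>v. (h, v) \<in> inc P" for h using outside_ex P by simp
    show "(h, v) \<in> inc P \<Longrightarrow> (h, v') \<in> inc P \<Longrightarrow> v = v'" for h v v'
      unfolding P(3) by (rule outside_unique)
    show "v \<in> verts P \<Longrightarrow> card {h. (h, v) \<in> inc P} = 3" for v
      using outside_vertex_card[of v] card_vertex[OF tri_Q, of v] unfolding P by auto
  qed
  show "leg_graph_of P = nf contr"
  proof (rule leg_graph_eqI)
    show "legs (leg_graph_of P) = legs (nf contr)" by (simp add: nf_def core)
    show "lnk (leg_graph_of P) = lnk (nf contr)" by (simp add: adjP)
    have "(h, k) \<in> blk (leg_graph_of P) \<longleftrightarrow> (h, k) \<in> blk (leg_graph_of Q) \<and> h \<in> halves P \<and> k \<in> halves P" for h k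
      unfolding blk_leg_graph_of P using K_inc by blast
    moreover have "(h, k) \<in> blk (nf contr) \<longleftrightarrow> (h, k) \<in> blk (leg_graph_of Q) \<and> h \<in> halves P \<and> k \<in> halves P" for h k
      using blk_contr_outside[of h k] by (auto simp: nf_def core P(2))
    ultimately show "blk (leg_graph_of P) = blk (nf contr)" by auto
  qed
qed

lemma quotient_conn_component:
  assumes c: "K \<in> components Q"
  shows "trivalent (quotient_conn K Q) \<and> leg_graph_of (quotient_conn K Q) = nf contr"
proof -
  let ?P = "quotient_conn K Q" and ?H = "halves Q - halves K"
  have ext: "external K \<subseteq> external Q" using c comp_iff by simp
  have P: "verts ?P = verts Q - verts K" "halves ?P = ?H"
      "inc ?P = inc Q \<inter> ?H \<times> (verts Q - verts K)" "adj ?P = adj Q \<inter> ?H \<times> ?H"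
    using c by (simp_all add: quotient_conn_def restrict_hgraph_def Let_def)
  have no3: "\<not> (card (external K) = 3 \<and> \<not> external K \<subseteq> external Q)" using ext by simp
  have core: "core contr = ?H" using core_contr no3 by simp
  have step: "v \<notin> - ?H \<and> (u, v) \<in> adj Q \<inter> ?H \<times> ?H" if "(u, v) \<in> adj Q - adj K \<union> pairs contr" "u \<notin> - ?H" for u v
  proof -
    have uH: "u \<in> ?H" using that(2) by blast
    hence "u \<notin> external K" by (auto simp: external_def)
    hence uv: "(u, v) \<in> adj Q" using that(1) pairs_contr by blast
    have "v \<notin> halves K" using adj_out[OF uv uH] ext by blast
    thus ?thesis using uv uH adj_mem[OF tri_Q] by blast
  qed
  have sub: "adj Q \<inter> ?H \<times> ?H \<subseteq> adj Q - adj K \<union> pairs contr"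
    using adj_mem[OF tri_K] by auto
  have "(u, v) \<in> (adj Q - adj K \<union> pairs contr)\<^sup>* \<longleftrightarrow> (u, v) \<in> (adj Q \<inter> ?H \<times> ?H)\<^sup>*" if "u \<in> ?H" for u v
    by (rule rtrancl_avoid(1)[OF step sub]) (use that in auto)
  hence "lnk (nf contr) = ((adj Q \<inter> ?H \<times> ?H)\<^sup>* - Id) \<inter> ?H \<times> ?H"
    by (auto simp: nf_def core)
  also have "(adj Q \<inter> ?H \<times> ?H)\<^sup>* - Id = adj Q \<inter> ?H \<times> ?H"
    using adj_sym[OF tri_Q] adj_irrefl[OF tri_Q] single_valued_subset[OF Int_lower1 adj_sv[OF tri_Q]]
    by (intro matching_rtrancl) (auto simp: sym_def irrefl_def)
  finally have "adj ?P = lnk (nf contr)" using P(4) by auto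
  from contr_without_new_vertex[OF P(1-3) no3 this] show ?thesis by blast
qed

text \<open>No bivalent vertex arises, so smoothing leaves the links alone; since \<open>K\<close>
  is not a component, the new vertex carries a link and stays in the core.\<close>

lemma quotient_conn_vertex:
  assumes c: "K \<notin> components Q" and e: "card (external K) = 3"
  shows "trivalent (quotient_conn K Q) \<and> leg_graph_of (quotient_conn K Q) = nf contr"
proof -
  let ?P = "quotient_conn K Q" and ?H = "halves Q - halves K" and ?W = "verts Q - verts K"
  define n where "n = (SOME v. v \<in> verts K)"
  let ?H' = "?H \<union> external K"
  have nK: "n \<in> verts K" unfolding n_def using C by (auto simp: leg_connected_def some_in_eq)
  have extK: "external K \<subseteq> halves K" by (auto simp: external_def)
  have ext: "\<not> external K \<subseteq> external Q" using c comp_iff by simp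
  have P: "verts ?P = insert n ?W" "halves ?P = ?H'"
      "inc ?P = inc Q \<inter> ?H \<times> ?W \<union> external K \<times> {n}" "adj ?P = adj Q \<inter> ?H' \<times> ?H'"
    using c e by (simp_all add: quotient_conn_def Let_def n_def)
  have core: "core contr = ?H'" using core_contr e ext by simp
  have legs: "legs contr = ?H'" by (rule legs_quo_legs[OF Q K])
  have "pairs contr = {}" using pairs_contr e by auto
  hence "lnk (nf contr) = ((adj Q - adj K)\<^sup>* - Id) \<inter> ?H' \<times> ?H'" by (simp add: nf_def core)
  also have "(adj Q - adj K)\<^sup>* - Id = adj Q - adj K"
    using valid_wf[OF valid_contr] by (intro matching_rtrancl) (auto simp: wf_leg_def)
  also have "(adj Q - adj K) \<inter> ?H' \<times> ?H' = adj Q \<inter> ?H' \<times> ?H'"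
    using adj_mem[OF tri_K] extK by (auto simp: external_def)
  finally have adjP: "lnk (nf contr) = adj ?P" using P(4) by simp
  have wf: "wf_leg (nf contr)" using reduction[OF valid_contr] valid_wf by blast
  have T: "trivalent ?P"
  proof (rule trivalentI[OF wf])
    show "legs (nf contr) = halves ?P" by (simp add: nf_def core P)
    show "lnk (nf contr) = adj ?P" by (rule adjP)
    show "finite (verts ?P)" using finite_verts[OF tri_Q] P(1) by simp
    show "(h, v) \<in> inc ?P \<Longrightarrow> h \<in> halves ?P \<and> v \<in> verts ?P" for h v using P by auto
    show "\<exists>v. (h, v) \<in> inc ?P" if "h \<in> halves ?P" for h
      using that outside_ex[of h] unfolding P by blast
    show "v = v'" if "(h, v) \<in> inc ?P" "(h, v') \<in> inc ?P" for h v v'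
      using that outside_unique[of h v _ v'] extK unfolding P by blast
    show "card {h. (h, v) \<in> inc ?P} = 3" if v: "v \<in> verts ?P" for v
    proof (cases "v = n")
      case True
      have "{h. (h, v) \<in> inc ?P} = external K" unfolding P using nK True by auto
      thus ?thesis using e by simp
    next
      case False
      hence vW: "v \<in> ?W" using v P by simp
      hence "{h. (h, v) \<in> inc ?P} = {h. (h, v) \<in> inc Q}"
        using outside_vertex_card[OF vW] False unfolding P by auto
      thus ?thesis using card_vertex[OF tri_Q] vW by simp
    qed
  qed
  have "leg_graph_of ?P = nf contr"
  proof (rule leg_graph_eqI)
    show "legs (leg_graph_of ?P) = legs (nf contr)" by (simp add: nf_def core P)
    show "lnk (leg_graph_of ?P) = lnk (nf contr)" by (simp add: adjP)
    have "blk (leg_graph_of ?P) `` {h} = blk contr `` {h} \<inter> ?H'" if h: "h \<in> ?H'" for h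
    proof (cases "h \<in> external K")
      case True
      hence "(h, n) \<in> inc ?P" unfolding P by blast
      hence "blk (leg_graph_of ?P) `` {h} = external K"
        using blk_at[OF T] nK unfolding P by auto
      thus ?thesis using blk_quo_legs_inside[OF Q K C FK True] by auto
    next
      case False
      hence hH: "h \<in> ?H" using h by blast
      then obtain v where v: "(h, v) \<in> inc Q \<inter> ?H \<times> ?W" using outside_ex by blast
      hence "(h, v) \<in> inc ?P" unfolding P by blast
      hence "blk (leg_graph_of ?P) `` {h} = {k. (k, v) \<in> inc ?P}" using blk_at[OF T] by blast
      also have "\<dots> = {k. (k, v) \<in> inc Q}"
        using outside_vertex_card[of v] v nK unfolding P by auto
      also have "\<dots> = blk (leg_graph_of Q) `` {h}" using blk_at[OF tri_Q] v by blast
      also have "\<dots> = blk contr `` {h}" using blk_quo_legs_outside[OF Q K] hH by blast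
      also have "\<dots> = blk contr `` {h} \<inter> ?H'" using legs by (auto simp: lquo_blk)
      finally show ?thesis .
    qed
    moreover have "h \<in> ?H'" if "(h, k) \<in> blk (leg_graph_of ?P)" for h k
      using blk_legs[OF wf_leg_graph_of[OF T] that] P by simp
    ultimately have "(h, k) \<in> blk (leg_graph_of ?P) \<longleftrightarrow> (h, k) \<in> blk contr \<inter> ?H' \<times> ?H'" for h k
      by (cases "h \<in> ?H'") blast+
    thus "blk (leg_graph_of ?P) = blk (nf contr)" by (auto simp: nf_def core)
  qed
  thus ?thesis using T by blast
qed

text \<open>The new vertex is bivalent, and its smoothing is the joining of the two outside
  half-edges in the definition of the quotient.\<close>

lemma quotient_conn_splice:
  assumes c: "K \<notin> components Q" and e: "card (external K) = 2"
  shows "trivalent (quotient_conn K Q) \<and> leg_graph_of (quotient_conn K Q) = nf contr"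
proof -
  let ?P = "quotient_conn K Q" and ?H = "halves Q - halves K"
  have P: "verts ?P = verts Q - verts K" "halves ?P = ?H"
      "inc ?P = inc Q \<inter> ?H \<times> (verts Q - verts K)"
      "adj ?P = adj Q \<inter> ?H \<times> ?H \<union>
          {(a, b) \<in> ?H \<times> ?H. \<exists>x y. external K = {x, y} \<and> x \<noteq> y \<and> (a, x) \<in> adj Q \<and> (b, y) \<in> adj Q}"
    using c e by (simp_all add: quotient_conn_def Let_def)
  have no3: "\<not> (card (external K) = 3 \<and> \<not> external K \<subseteq> external Q)" using e by simp
  have core: "core contr = ?H" using core_contr no3 by simp
  have extK: "external K \<subseteq> halves K" by (auto simp: external_def)
  let ?R = "adj Q - adj K" and ?E = "adj Q - adj K \<union> pairs contr"
  note wfC = valid_wf[OF valid_contr]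
  have Rsym: "(q, p) \<in> ?R" if "(p, q) \<in> ?R" for p q using lnk_sym[OF wfC, of p q] that by simp
  have Rsv: "q = q'" if "(p, q) \<in> ?R" "(p, q') \<in> ?R" for p q q' using lnk_unique[OF wfC, of p q q'] that by simp
  have pr: "(u, v) \<in> pairs contr \<longleftrightarrow> u \<in> external K \<and> v \<in> external K" for u v
    using pairs_contr e by simp
  have HR: "(a, b) \<in> ?R" if "(a, b) \<in> adj Q" "a \<in> ?H" for a b
    using that adj_mem[OF tri_K] by blast
  \<comment> \<open>All positions on the chain that starts at an outside half-edge \<open>a\<close>:
    \<open>a\<close>, its partner, and, if the partner is an external half-edge \<open>x\<close> of
    \<open>K\<close>, the other one \<open>y\<close> and the partner of \<open>y\<close>.\<close>
  have reach: "k = a \<or> (a, k) \<in> ?R \<or> (\<exists>x y. external K = {x, y} \<and> x \<noteq> y \<and> (a, x) \<in> ?R \<and> (k = y \<or> (k, y) \<in> ?R))"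
    if a: "a \<in> ?H" and "(a, k) \<in> ?E\<^sup>*" for a k
    using that(2)
  proof (induction rule: rtrancl_induct)
    case (step k k')
    obtain p q where pq: "external K = {p, q}" "p \<noteq> q" using e by (auto simp: card_2_iff)
    have aK: "a \<notin> external K" using a extK by blast
    show ?case
    proof (cases "(k, k') \<in> ?R")
      case True
      consider "k = a" | "(a, k) \<in> ?R"
        | x y where "external K = {x, y}" "x \<noteq> y" "(a, x) \<in> ?R" "k = y"
        | x y where "external K = {x, y}" "x \<noteq> y" "(a, x) \<in> ?R" "(k, y) \<in> ?R"
        using step.IH by blast
      thus ?thesis
      proof cases
        case 1 thus ?thesis using True by blast
      next
        case 2
        hence "k' = a" using Rsv[OF True Rsym] by blast
        thus ?thesis by blast
      next
        case 3
        thus ?thesis using Rsym[OF True] by blast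
      next
        case 4
        hence "k' = y" using Rsv[OF True] by blast
        thus ?thesis using 4 by blast
      qed
    next
      case False
      hence kk: "k \<in> external K" "k' \<in> external K" using step(2) pr by blast+
      consider "k = a" | "(a, k) \<in> ?R"
        | x y where "external K = {x, y}" "x \<noteq> y" "(a, x) \<in> ?R" "k = y"
        | x y where "external K = {x, y}" "x \<noteq> y" "(a, x) \<in> ?R" "(k, y) \<in> ?R"
        using step.IH by blast
      thus ?thesis
      proof cases
        case 1 thus ?thesis using kk aK by blast
      next
        case 2
        show ?thesis
        proof (cases "k' = k")
          case False
          hence "external K = {k, k'}" using kk pq by auto
          thus ?thesis using 2 False by blast
        qed (use 2 in blast)
      next
        case 3
        hence "k' = x \<or> k' = y" using kk by blast
        thus ?thesis using 3 by blast
      next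
        case 4
        \<comment> \<open>Here the partner of \<open>y\<close> would be \<open>x\<close>. But the
          partner of \<open>x\<close> is the outside half-edge \<open>a\<close>, which is not in
          \<open>K\<close>.\<close>
        have "k = x \<or> k = y" using kk 4 by blast
        moreover have "k \<noteq> y" using 4 lnk_irrefl[OF wfC] by auto
        ultimately have "(x, y) \<in> ?R" "(x, a) \<in> ?R" using 4 Rsym by blast+
        hence "a = y" using Rsv by blast
        thus ?thesis using aK 4 by blast
      qed
    qed
  qed blast
  have "lnk (nf contr) = adj ?P"
  proof (intro equalityI subrelI)
    fix a b assume "(a, b) \<in> lnk (nf contr)"
    hence ab: "a \<in> ?H" "b \<in> ?H" "a \<noteq> b" "(a, b) \<in> ?E\<^sup>*" by (auto simp: nf_def core)
    have "b \<notin> external K" using ab(2) extK by blast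
    thus "(a, b) \<in> adj ?P" using reach[OF ab(1,4)] ab(1-3) unfolding P by blast
  next
    fix a b assume "(a, b) \<in> adj ?P"
    hence ab: "a \<in> ?H" "b \<in> ?H" and cases: "(a, b) \<in> adj Q \<or>
        (\<exists>x y. external K = {x, y} \<and> x \<noteq> y \<and> (a, x) \<in> adj Q \<and> (b, y) \<in> adj Q)"
      unfolding P by blast+
    from cases have "a \<noteq> b \<and> (a, b) \<in> ?E\<^sup>*"
    proof
      assume 1: "(a, b) \<in> adj Q"
      hence "a \<noteq> b" using adj_irrefl[OF tri_Q] by (auto dest: irreflD)
      thus ?thesis using HR[OF 1 ab(1)] by blast
    next
      assume "\<exists>x y. external K = {x, y} \<and> x \<noteq> y \<and> (a, x) \<in> adj Q \<and> (b, y) \<in> adj Q"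
      then obtain x y where xy: "external K = {x, y}" "x \<noteq> y" "(a, x) \<in> adj Q" "(b, y) \<in> adj Q" by blast
      have "a \<noteq> b" using xy adj_sv[OF tri_Q] by (auto dest: single_valuedD)
      moreover have "(a, x) \<in> ?E" using HR[OF xy(3) ab(1)] by blast
      moreover have "(x, y) \<in> ?E" using pr xy(1) by blast
      moreover have "(y, b) \<in> ?E" using Rsym[OF HR[OF xy(4) ab(2)]] by blast
      ultimately show ?thesis by (meson converse_rtrancl_into_rtrancl r_into_rtrancl)
    qed
    thus "(a, b) \<in> lnk (nf contr)" using ab by (auto simp: nf_def core)
  qed
  from contr_without_new_vertex[OF P(1-3) no3 this[symmetric]] show ?thesis by blast
qed

lemma quotient_conn_legs: "leg_graph_of (quotient_conn K Q) = nf contr"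
  and quotient_conn_feynman: "feynman (quotient_conn K Q)"
proof -
  have *: "trivalent (quotient_conn K Q) \<and> leg_graph_of (quotient_conn K Q) = nf contr"
    using quotient_conn_component quotient_conn_vertex quotient_conn_splice ext_card by blast
  thus "leg_graph_of (quotient_conn K Q) = nf contr" by blast
  show "feynman (quotient_conn K Q)" unfolding feynman_iff using * reduction[OF valid_contr] by simp
qed

lemma quotient_conn_verts: "verts (quotient_conn K Q) \<subseteq> verts Q"
    "verts Q - verts K \<subseteq> verts (quotient_conn K Q)"
proof -
  have "(SOME v. v \<in> verts K) \<in> verts K" using C by (auto simp: leg_connected_def some_in_eq)
  moreover have "verts K \<subseteq> verts Q" using K by (simp add: full_sub_def)
  ultimately show "verts (quotient_conn K Q) \<subseteq> verts Q"
    by (auto simp: quotient_conn_def Let_def restrict_hgraph_def)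
  show "verts Q - verts K \<subseteq> verts (quotient_conn K Q)"
    by (auto simp: quotient_conn_def Let_def restrict_hgraph_def)
qed

lemma quotient_conn_inc: "v \<in> verts Q - verts K \<Longrightarrow> (h, v) \<in> inc (quotient_conn K Q) \<longleftrightarrow> (h, v) \<in> inc Q"
proof -
  assume v: "v \<in> verts Q - verts K"
  have "(SOME v. v \<in> verts K) \<in> verts K" using C by (auto simp: leg_connected_def some_in_eq)
  thus ?thesis using v K_inc[of h v] by (auto simp: quotient_conn_def Let_def restrict_hgraph_def)
qed

lemma quotient_conn_adj:
  "adj Q \<inter> (halves Q - halves K) \<times> (halves Q - halves K) \<subseteq> adj (quotient_conn K Q)"
  by (auto simp: quotient_conn_def Let_def restrict_hgraph_def)

lemma quotient_conn_external:
  "external (quotient_conn K Q) = external Q \<inter> halves (quotient_conn K Q)"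
proof -
  have "external (quotient_conn K Q) = free contr \<inter> core contr"
    unfolding external_eq quotient_conn_legs using free_nf[OF valid_contr] .
  moreover have "core contr = halves (quotient_conn K Q)"
    using quotient_conn_legs by (metis leg_graph_of_simps(1) nf_def leg_graph.select_convs(1))
  ultimately show ?thesis by (simp add: free_quo_legs[OF Q K])
qed

lemma quotient_conn_halves: "halves (quotient_conn K Q) \<subseteq> halves Q"
  "halves Q - halves K \<subseteq> halves (quotient_conn K Q)"
proof -
  have "external K \<subseteq> halves Q" using full_sub_halves(1)[OF tri_Q K] by (auto simp: external_def)
  thus "halves (quotient_conn K Q) \<subseteq> halves Q"
    by (auto simp: quotient_conn_def Let_def restrict_hgraph_def)
  show "halves Q - halves K \<subseteq> halves (quotient_conn K Q)"
    by (auto simp: quotient_conn_def Let_def restrict_hgraph_def)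
qed

text \<open>Quotients by vertex-disjoint connected subgraphs do not interfere: incidences and
  adjacencies of \<open>D\<close> survive, and so do its external half-edges that are external in
  the ambient graph. This is what allows quotients to be taken one after another.\<close>

lemma quotient_conn_preserves:
  assumes D: "full_sub D Q" "feynman D" "leg_connected D" "quotient_defined Q D"
    and disj: "verts D \<inter> verts K = {}"
  shows "full_sub D (quotient_conn K Q)" "quotient_defined (quotient_conn K Q) D"
    "adj D \<subseteq> adj Q - adj K"
proof -
  let ?P = "quotient_conn K Q"
  have V: "verts D \<subseteq> verts Q - verts K" using D(1) disj by (auto simp: full_sub_def)
  have "halves D \<inter> halves K = {}"
    using D(1) K disj inc_unique[OF tri_Q] unfolding full_sub_def by blast
  hence H: "halves D \<subseteq> halves Q - halves K" using full_sub_halves(1)[OF tri_Q D(1)] by blast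
  have inc: "(h, v) \<in> inc ?P \<longleftrightarrow> (h, v) \<in> inc Q" if "v \<in> verts D" for h v
    using quotient_conn_inc V that by blast
  have aD: "adj D \<subseteq> adj Q \<inter> halves D \<times> halves D" using D(1) unfolding full_sub_def by (elim conjE)
  hence "adj D \<subseteq> adj ?P" using quotient_conn_adj H by blast
  moreover have "halves D = {h. \<exists>v\<in>verts D. (h, v) \<in> inc ?P}"
    using D(1) inc unfolding full_sub_def by blast
  moreover have "inc D = inc ?P \<inter> UNIV \<times> verts D"
  proof (intro equalityI subrelI)
    show "(h, v) \<in> inc ?P \<inter> UNIV \<times> verts D" if "(h, v) \<in> inc D" for h v
      using that D(1) inc[of v h] unfolding full_sub_def by blast
    show "(h, v) \<in> inc D" if "(h, v) \<in> inc ?P \<inter> UNIV \<times> verts D" for h v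
      using that D(1) inc[of v h] unfolding full_sub_def by blast
  qed
  moreover have "verts D \<subseteq> verts ?P" using V quotient_conn_verts(2) by blast
  moreover have "sym (adj D)" "adj D \<subseteq> halves D \<times> halves D" using D(1) unfolding full_sub_def by blast+
  ultimately show full: "full_sub D ?P" unfolding full_sub_def by blast
  have ext: "external D \<subseteq> halves ?P"
    using H quotient_conn_halves(2) by (auto simp: external_def)
  note TP = feynman_trivalent[OF quotient_conn_feynman]
  have "D \<in> components ?P \<longleftrightarrow> D \<in> components Q"
    unfolding component_iff_external[OF TP full D(3)] component_iff_external[OF tri_Q D(1,3)]
      quotient_conn_external using ext by blast
  moreover have "components D = {D}" using components_connected[OF feynman_trivalent[OF D(2)] D(3)] .
  moreover have "external D \<inter> external ?P = external D \<inter> external Q"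
    using ext quotient_conn_external by blast
  ultimately show "quotient_defined ?P D"
    using D(4) by (simp add: quotient_defined_def)
  show "adj D \<subseteq> adj Q - adj K" using aD H adj_mem[OF tri_K] by auto
qed

end

lemma lquo_empty:
  assumes wf: "wf_leg G"
  shows "lquo G {} = G"
proof (rule leg_graph_eqI)
  have "(u, v) \<in> (blk G)\<^sup>* \<longleftrightarrow> (u, v) \<in> blk G" if "u \<in> legs G" for u v
  proof
    assume "(u, v) \<in> (blk G)\<^sup>*"
    thus "(u, v) \<in> blk G"
      by (induction rule: rtrancl_induct) (use that blk_refl[OF wf] blk_trans[OF wf] in blast)+
  qed simp
  thus "blk (lquo G {}) = blk G" using wf_blk_subset[OF wf] by (auto simp: lquo_blk)
qed simp_all

lemma empty_lsubs:
  assumes G: "valid_leg G"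
  shows "{} \<in> lsubs G"
proof -
  note wf = valid_wf[OF G]
  have wfs: "wf_leg (lsub G {})" using wf_lsub[OF wf] by (simp add: sym_def)
  have f: "free (lsub G {}) = legs G" by (simp add: free_def)
  have "valid_at (lsub G {}) u" if u: "u \<in> legs G" for u
  proof -
    have c: "card (blk G `` {u}) \<in> {2, 3}" using G u by (simp add: valid_leg_def)
    have BL: "blk G `` {u} \<subseteq> legs G" using wf_blk_subset[OF wf] by blast
    have "droppable (lsub G {}) (blk G `` {u})" using c u BL f by (auto simp: droppable_def)
    hence "conn (lsub G {}) `` {u} = blk G `` {u}" using conn_dropped[OF wfs] blk_refl[OF wf u] by blast
    moreover have "blk G `` {u} \<inter> legs G = blk G `` {u}" using BL by blast
    ultimately show ?thesis using c BL by (simp add: valid_at_def f)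
  qed
  hence "valid_leg (lsub G {})" using wfs by (simp add: valid_leg_iff)
  thus ?thesis using G lquo_empty[OF wf] by (simp add: lsubs_def sym_def)
qed

lemma lnk_lsubs:
  assumes G: "valid_leg G"
  shows "lnk G \<in> lsubs G"
proof -
  have eq: "lsub G (lnk G) = G" by (rule leg_graph_eqI) simp_all
  have "sym (lnk G)" using valid_wf[OF G] by (simp add: wf_leg_def)
  moreover from this have "valid_leg (lquo G (lnk G))"
    using valid_lquo_iff[OF G order_refl] G by (simp add: eq)
  ultimately show ?thesis using G by (simp add: lsubs_def eq)
qed

text \<open>No reduction step can remove the last link: dropping keeps all links and splicing
  creates one.\<close>

lemma core_empty:
  assumes "valid_leg G" and "core G = {}"
  shows "lnk G = {}"
  using assms
proof (induction rule: reduction_induct)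
  case (reduced G)
  have "core G = legs G" using reduced(2) by (auto simp: core_def reduced_def)
  thus ?case using reduced(3) wf_lnk_subset[OF valid_wf[OF reduced(1)]] by auto
next
  case (drop G B)
  thus ?case using core_ldrop[OF valid_wf[OF drop(1)] drop(2)] by simp
next
  case (splice G a x y b)
  hence "lnk (lsplice G a x y b) = {}"
    using core_lsplice[OF valid_wf[OF splice(1)] splice(2)] by (simp del: lsplice_simps)
  thus ?case by simp
qed

definition contractible :: "('v, 'h) hgraph \<Rightarrow> ('v, 'h) hgraph \<Rightarrow> bool" where
  "contractible K Q \<longleftrightarrow> full_sub K Q \<and> feynman K \<and> leg_connected K \<and> quotient_defined Q K"

text \<open>The induction hypothesis concerns the smoothed contraction by \<open>K\<close>.
  \<open>nf_lquo_common\<close> carries the remaining link set back to the contraction before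
  smoothing, where \<open>leg_flag_bwd\<close> and \<open>lquo_lquo\<close> merge the two
  contractions into one. The result involves only the union of the adjacencies, hence not the order.
  The bounds on vertices and half-edges keep quotients of disjoint graphs disjoint.\<close>

lemma fold_quotient_conn:
  assumes "feynman Q" and "\<And>K. K \<in> set Ks \<Longrightarrow> contractible K Q" and "distinct Ks"
    and "\<And>K D. K \<in> set Ks \<Longrightarrow> D \<in> set Ks \<Longrightarrow> K \<noteq> D \<Longrightarrow> verts K \<inter> verts D = {}"
  shows "feynman (fold quotient_conn Ks Q) \<and> (\<Union>K\<in>set Ks. adj K) \<in> lsubs (leg_graph_of Q) \<and>
    leg_graph_of (fold quotient_conn Ks Q) = nf (lquo (leg_graph_of Q) (\<Union>K\<in>set Ks. adj K)) \<and>
    verts (fold quotient_conn Ks Q) \<subseteq> verts Q \<and> halves (fold quotient_conn Ks Q) \<subseteq> halves Q"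
  using assms
proof (induction Ks arbitrary: Q)
  case Nil
  note wf = wf_leg_graph_of[OF feynman_trivalent[OF Nil(1)]]
  show ?case
    using Nil(1) empty_lsubs[OF feynman_valid] lquo_empty[OF wf] nf_reduced[OF wf feynman_reduced] by simp
next
  case (Cons K Ks)
  note Q = Cons.prems(1)
  let ?P = "quotient_conn K Q" and ?G = "leg_graph_of Q"
  define V where "V = (\<Union>D\<in>set Ks. adj D)"
  have K: "full_sub K Q" "feynman K" "leg_connected K" "quotient_defined Q K"
    using Cons.prems(2)[of K] by (simp_all add: contractible_def)
  have D: "full_sub D Q" "feynman D" "leg_connected D" "quotient_defined Q D" "verts D \<inter> verts K = {}"
    if "D \<in> set Ks" for D
    using that Cons.prems(2)[of D] Cons.prems(4)[of D K] Cons.prems(3) by (auto simp: contractible_def)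
  note pres = quotient_conn_preserves[OF Q K D]
  have P: "feynman ?P" by (rule quotient_conn_feynman[OF Q K])
  have "\<And>D. D \<in> set Ks \<Longrightarrow> contractible D ?P"
    using pres(1,2) D(2,3) by (simp add: contractible_def)
  moreover have "distinct Ks" using Cons.prems(3) by simp
  moreover have "\<And>D E. D \<in> set Ks \<Longrightarrow> E \<in> set Ks \<Longrightarrow> D \<noteq> E \<Longrightarrow> verts D \<inter> verts E = {}"
    using Cons.prems(4) by simp
  ultimately have IH: "feynman (fold quotient_conn Ks ?P)" "V \<in> lsubs (leg_graph_of ?P)"
    "leg_graph_of (fold quotient_conn Ks ?P) = nf (lquo (leg_graph_of ?P) V)"
    "verts (fold quotient_conn Ks ?P) \<subseteq> verts ?P" "halves (fold quotient_conn Ks ?P) \<subseteq> halves ?P"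
    using Cons.IH[OF P] unfolding V_def by blast+
  let ?M = "lquo ?G (adj K)"
  have M: "valid_leg ?M" by (rule valid_contr[OF Q K])
  have VM: "V \<subseteq> lnk ?M" using pres(3) by (auto simp: V_def)
  have eqP: "leg_graph_of ?P = nf ?M" by (rule quotient_conn_legs[OF Q K])
  have V: "V \<in> lsubs ?M" "nf (lquo (nf ?M) V) = nf (lquo ?M V)"
    using nf_lquo_common[OF M _ VM] IH(2) eqP by simp_all
  have KQ: "adj K \<in> lsubs ?G" by (rule adj_lsubs[OF Q K(1,2,4)])
  have flag: "adj K \<inter> V = {}" "adj K \<union> V \<in> lsubs ?G"
    using leg_flag_bwd[OF feynman_valid[OF Q] KQ V(1)] by blast+
  have "lquo ?M V = lquo ?G (adj K \<union> V)"
  proof -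
    have "adj K \<union> V - adj K = V" using flag(1) by blast
    moreover have "adj K \<union> V \<subseteq> lnk ?G" "sym (adj K)" using flag(2) KQ by (auto simp: lsubs_def)
    ultimately show ?thesis
      using lquo_lquo[OF wf_leg_graph_of[OF feynman_trivalent[OF Q]], of "adj K \<union> V" "adj K"] by simp
  qed
  hence "leg_graph_of (fold quotient_conn (K # Ks) Q) = nf (lquo ?G (adj K \<union> V))"
    using IH(3) eqP V(2) by simp
  moreover have "(\<Union>D\<in>set (K # Ks). adj D) = adj K \<union> V" by (simp add: V_def)
  ultimately show ?case
    using IH(1,4,5) flag(2) quotient_conn_verts(1)[OF Q K] quotient_conn_halves(1)[OF Q K] by auto
qed

text \<open>Every vertex carries a half-edge, so the half-edges determine the vertices and these the
  incidences.\<close>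

lemma full_sub_eqI:
  assumes T: "trivalent A" and X: "full_sub X A" and Y: "full_sub Y A"
    and H: "halves X = halves Y" and adj: "adj X = adj Y"
  shows "X = Y"
proof -
  have V: "verts X \<subseteq> verts Y" if "full_sub X A" "full_sub Y A" "halves X = halves Y" for X Y
  proof
    fix u assume u: "u \<in> verts X"
    hence "u \<in> verts A" using that(1) by (auto simp: full_sub_def)
    then obtain g where g: "(g, u) \<in> inc A" using half_ex[OF T] by blast
    hence "g \<in> halves Y" using u that by (auto simp: full_sub_def)
    thus "u \<in> verts Y" using full_sub_inc[OF T that(2) g] by blast
  qed
  have "verts X = verts Y" using V[OF X Y] V[OF Y X] H by blast
  moreover from this have "inc X = inc Y" using X Y by (simp add: full_sub_def)
  ultimately show ?thesis using H adj by simp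
qed

lemma components_disjoint:
  assumes T: "trivalent S" and K: "K \<in> components S" "D \<in> components S" and v: "v \<in> verts K" "v \<in> verts D"
  shows "K = D"
proof -
  note k = full_sub_component[OF T K(1)] and d = full_sub_component[OF T K(2)]
  have "v \<in> verts S" using k(1) v(1) by (auto simp: full_sub_def)
  then obtain h where h: "(h, v) \<in> inc S" using half_ex[OF T] by blast
  have hK: "h \<in> halves K" "h \<in> halves D" using k(1) d(1) v h by (auto simp: full_sub_def)
  have H: "halves K = halves D" using k(3)[OF hK(1)] d(3)[OF hK(2)] by simp
  thus ?thesis using full_sub_eqI[OF T k(1) d(1)] k(4) d(4) by simp
qed

theorem hgraph_quotient_legs:
  assumes A: "feynman A" and S: "full_sub S A" "feynman S" "quotient_defined A S"
  shows "feynman (hgraph_quotient A S)"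
    and "leg_graph_of (hgraph_quotient A S) = nf (lquo (leg_graph_of A) (adj S))"
    and "verts (hgraph_quotient A S) \<subseteq> verts A" and "halves (hgraph_quotient A S) \<subseteq> halves A"
proof -
  note TS = feynman_trivalent[OF S(2)]
  define Ks where "Ks = (SOME Ks. distinct Ks \<and> set Ks = components S)"
  have "finite (components S)" using finite_verts[OF TS] by (simp add: components_def)
  hence "\<exists>Ks. distinct Ks \<and> set Ks = components S" using finite_distinct_list by blast
  hence Ks: "distinct Ks \<and> set Ks = components S" unfolding Ks_def by (rule someI_ex)
  have contr: "contractible K A" if K: "K \<in> set Ks" for K
  proof -
    have KC: "K \<in> components S" using K Ks by simp
    note full = full_sub_component[OF TS KC]
    have "full_sub K A" using full(1) S(1) unfolding full_sub_def by auto
    moreover have conn: "leg_connected K" by (rule component_leg_connected[OF TS KC])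
    moreover have F: "feynman K" by (rule component_feynman[OF S(2) KC])
    moreover have "components K = {K}" by (rule components_connected[OF feynman_trivalent[OF F] conn])
    hence "quotient_defined A K" using S(3) KC by (simp add: quotient_defined_def)
    ultimately show ?thesis by (simp add: contractible_def)
  qed
  have "adj S = (\<Union>K\<in>set Ks. adj K)"
  proof (intro equalityI subrelI)
    fix h k assume hk: "(h, k) \<in> adj S"
    hence "h \<in> halves S" using adj_mem[OF TS] by blast
    then obtain K where K: "K \<in> components S" "h \<in> halves K" using halves_component[OF TS] by blast
    note full = full_sub_component[OF TS K(1)]
    have "(h, k) \<in> conn (leg_graph_of S)" by (rule lnk_conn) (simp add: hk)
    hence "k \<in> halves K" using full(3)[OF K(2)] by blast
    hence "(h, k) \<in> adj K" using full(4) hk K(2) by blast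
    thus "(h, k) \<in> (\<Union>K\<in>set Ks. adj K)" using K(1) Ks by blast
  next
    fix h k assume "(h, k) \<in> (\<Union>K\<in>set Ks. adj K)"
    then obtain K where "K \<in> components S" "(h, k) \<in> adj K" using Ks by blast
    thus "(h, k) \<in> adj S" using full_sub_component(4)[OF TS] by blast
  qed
  moreover have "hgraph_quotient A S = fold quotient_conn Ks A"
    unfolding hgraph_quotient_def Ks_def ..
  moreover have "K \<in> set Ks \<Longrightarrow> D \<in> set Ks \<Longrightarrow> K \<noteq> D \<Longrightarrow> verts K \<inter> verts D = {}" for K D
    using components_disjoint[OF TS] Ks by blast
  ultimately show "feynman (hgraph_quotient A S)"
    "leg_graph_of (hgraph_quotient A S) = nf (lquo (leg_graph_of A) (adj S))"
    "verts (hgraph_quotient A S) \<subseteq> verts A" "halves (hgraph_quotient A S) \<subseteq> halves A"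
    using fold_quotient_conn[OF A contr, of Ks] Ks by simp_all
qed

section \<open>Isomorphisms, models and classes of Feynman graphs\<close>

lemma leg_iso_of_feynman_iso:
  assumes A: "trivalent A" and B: "trivalent B" and iso: "feynman_iso A B"
  shows "leg_iso (leg_graph_of A) (leg_graph_of B)"
proof -
  obtain f g where fg: "bij_betw f (verts A) (verts B)" "bij_betw g (halves A) (halves B)"
     "\<forall>h\<in>halves A. \<forall>v\<in>verts A. (h, v) \<in> inc A \<longleftrightarrow> (g h, f v) \<in> inc B"
     "\<forall>h\<in>halves A. \<forall>k\<in>halves A. (h, k) \<in> adj A \<longleftrightarrow> (g h, g k) \<in> adj B"
    using iso unfolding feynman_iso_def by blast
  have img: "g ` halves A = halves B" "inj_on g (halves A)" "f ` verts A = verts B"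
    using fg(1,2) by (simp_all add: bij_betw_def)
  have "leg_graph_of B = lmap g (leg_graph_of A)"
  proof (rule leg_graph_eqI)
    show "legs (leg_graph_of B) = legs (lmap g (leg_graph_of A))" using img by simp
    show "lnk (leg_graph_of B) = lnk (lmap g (leg_graph_of A))"
    proof (intro equalityI subrelI)
      fix p q assume pq: "(p, q) \<in> lnk (leg_graph_of B)"
      hence "p \<in> g ` halves A" "q \<in> g ` halves A" using adj_mem[OF B] img(1) by auto
      then obtain h k where hk: "h \<in> halves A" "k \<in> halves A" "p = g h" "q = g k" by blast
      hence "(h, k) \<in> adj A" using fg(4) pq by simp
      thus "(p, q) \<in> lnk (lmap g (leg_graph_of A))" using hk by force
    next
      fix p q assume "(p, q) \<in> lnk (lmap g (leg_graph_of A))"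
      then obtain h k where hk: "(h, k) \<in> adj A" "p = g h" "q = g k" by auto
      thus "(p, q) \<in> lnk (leg_graph_of B)" using fg(4) adj_mem[OF A hk(1)] by simp
    qed
    show "blk (leg_graph_of B) = blk (lmap g (leg_graph_of A))"
    proof (intro equalityI subrelI)
      fix p q assume "(p, q) \<in> blk (leg_graph_of B)"
      then obtain w where w: "(p, w) \<in> inc B" "(q, w) \<in> inc B" by (auto simp: blk_leg_graph_of)
      hence "p \<in> g ` halves A" "q \<in> g ` halves A" "w \<in> f ` verts A" using inc_mem[OF B] img by blast+
      then obtain h k v where hk: "h \<in> halves A" "k \<in> halves A" "v \<in> verts A" "p = g h" "q = g k" "w = f v"
        by blast
      hence "(h, v) \<in> inc A" "(k, v) \<in> inc A" using fg(3) w by simp_all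
      hence "(h, k) \<in> blk (leg_graph_of A)" by (auto simp: blk_leg_graph_of)
      thus "(p, q) \<in> blk (lmap g (leg_graph_of A))" using hk by force
    next
      fix p q assume "(p, q) \<in> blk (lmap g (leg_graph_of A))"
      then obtain h k where hk: "(h, k) \<in> blk (leg_graph_of A)" "p = g h" "q = g k" by auto
      then obtain v where v: "(h, v) \<in> inc A" "(k, v) \<in> inc A" by (auto simp: blk_leg_graph_of)
      hence "(p, f v) \<in> inc B" "(q, f v) \<in> inc B"
        using fg(3) inc_mem[OF A v(1)] inc_mem[OF A v(2)] hk by auto
      thus "(p, q) \<in> blk (leg_graph_of B)" by (auto simp: blk_leg_graph_of)
    qed
  qed
  thus ?thesis using img(2) by (auto simp: leg_iso_def)
qed

lemma feynman_iso_of_leg_iso: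
  assumes A: "trivalent A" and B: "trivalent B" and iso: "leg_iso (leg_graph_of A) (leg_graph_of B)"
  shows "feynman_iso A B"
proof -
  obtain g where g: "inj_on g (halves A)" and eq: "leg_graph_of B = lmap g (leg_graph_of A)"
    using iso unfolding leg_iso_def by auto
  have H: "halves B = g ` halves A" and adj: "adj B = rel_map g (adj A)"
    using arg_cong[OF eq, of legs] arg_cong[OF eq, of lnk] by simp_all
  note wfA = wf_leg_graph_of[OF A]
  have blk: "(g h, g k) \<in> blk (leg_graph_of B) \<longleftrightarrow> (h, k) \<in> blk (leg_graph_of A)"
    if "h \<in> halves A" "k \<in> halves A" for h k
  proof -
    have "(g h, g k) \<in> blk (leg_graph_of B) \<longleftrightarrow> g k \<in> blk (lmap g (leg_graph_of A)) `` {g h}" by (simp add: eq)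
    also have "\<dots> \<longleftrightarrow> g k \<in> g ` (blk (leg_graph_of A) `` {h})"
      using blk_lmap[OF wfA, of g h] g that by simp
    also have "\<dots> \<longleftrightarrow> (h, k) \<in> blk (leg_graph_of A)"
      using inj_on_image_mem_iff[OF g that(2), of "blk (leg_graph_of A) `` {h}"] wf_blk_subset[OF wfA] by auto
    finally show ?thesis .
  qed
  \<comment> \<open>The vertex map is induced by the half-edge map; since blocks go to blocks, it
    does not matter which half-edge at \<open>v\<close> is used.\<close>
  define f where "f v = (SOME w. \<exists>h. (h, v) \<in> inc A \<and> (g h, w) \<in> inc B)" for v
  have f: "(g h, f v) \<in> inc B" if hv: "(h, v) \<in> inc A" for h v
  proof -
    have "h \<in> halves A" using inc_mem[OF A hv] by blast
    then obtain w where "(g h, w) \<in> inc B" using inc_ex[OF B, of "g h"] H by blast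
    hence "\<exists>w h. (h, v) \<in> inc A \<and> (g h, w) \<in> inc B" using hv by blast
    hence "\<exists>h. (h, v) \<in> inc A \<and> (g h, f v) \<in> inc B" unfolding f_def by (rule someI_ex)
    then obtain k where k: "(k, v) \<in> inc A" "(g k, f v) \<in> inc B" by blast
    have "(k, h) \<in> blk (leg_graph_of A)" using k hv by (auto simp: blk_leg_graph_of)
    hence "(g k, g h) \<in> blk (leg_graph_of B)" using blk inc_mem[OF A hv] inc_mem[OF A k(1)] by blast
    then obtain u where "(g k, u) \<in> inc B" "(g h, u) \<in> inc B" by (auto simp: blk_leg_graph_of)
    thus ?thesis using inc_unique[OF B k(2)] by blast
  qed
  have inc: "(h, v) \<in> inc A \<longleftrightarrow> (g h, f v) \<in> inc B" if h: "h \<in> halves A" and v: "v \<in> verts A" for h v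
  proof
    assume "(g h, f v) \<in> inc B"
    obtain k where k: "(k, v) \<in> inc A" using half_ex[OF A v] by blast
    have "(g h, g k) \<in> blk (leg_graph_of B)"
      using \<open>(g h, f v) \<in> inc B\<close> f[OF k] by (auto simp: blk_leg_graph_of)
    hence "(h, k) \<in> blk (leg_graph_of A)" using blk h inc_mem[OF A k] by blast
    then obtain u where "(h, u) \<in> inc A" "(k, u) \<in> inc A" by (auto simp: blk_leg_graph_of)
    thus "(h, v) \<in> inc A" using inc_unique[OF A k] by blast
  qed (rule f)
  have "bij_betw f (verts A) (verts B)"
  proof (rule bij_betw_imageI)
    show "inj_on f (verts A)"
    proof (rule inj_onI)
      fix u v assume uv: "u \<in> verts A" "v \<in> verts A" "f u = f v"
      obtain h where h: "(h, u) \<in> inc A" using half_ex[OF A uv(1)] by blast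
      hence "(g h, f v) \<in> inc B" using f uv(3) by metis
      hence "(h, v) \<in> inc A" using inc uv(2) inc_mem[OF A h] by blast
      thus "u = v" using inc_unique[OF A h] by blast
    qed
    show "f ` verts A = verts B"
    proof (intro equalityI subsetI)
      fix w assume "w \<in> f ` verts A"
      then obtain v where v: "v \<in> verts A" "w = f v" by blast
      obtain h where "(h, v) \<in> inc A" using half_ex[OF A v(1)] by blast
      thus "w \<in> verts B" using f inc_mem[OF B] v(2) by blast
    next
      fix w assume "w \<in> verts B"
      then obtain p where p: "(p, w) \<in> inc B" using half_ex[OF B] by blast
      then obtain h where h: "h \<in> halves A" "p = g h" using inc_mem[OF B p] H by blast
      then obtain v where v: "(h, v) \<in> inc A" using inc_ex[OF A] by blast
      have "w = f v" using inc_unique[OF B p] f[OF v] h(2) by blast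
      thus "w \<in> f ` verts A" using inc_mem[OF A v] by blast
    qed
  qed
  moreover have "(h, k) \<in> adj A \<longleftrightarrow> (g h, g k) \<in> adj B" if "h \<in> halves A" "k \<in> halves A" for h k
  proof
    assume "(g h, g k) \<in> adj B"
    then obtain h' k' where hk: "(h', k') \<in> adj A" "g h = g h'" "g k = g k'" unfolding adj by auto
    hence "h = h'" "k = k'" using adj_mem[OF A hk(1)] that g by (auto dest: inj_onD)
    thus "(h, k) \<in> adj A" using hk(1) by simp
  qed (force simp: adj)
  moreover have "bij_betw g (halves A) (halves B)" using g H by (simp add: bij_betw_def)
  ultimately show ?thesis unfolding feynman_iso_def using inc by (intro exI[of _ f] exI[of _ g]) blast
qed

lemma feynman_iso_iff:
  "trivalent A \<Longrightarrow> trivalent B \<Longrightarrow> feynman_iso A B \<longleftrightarrow> leg_iso (leg_graph_of A) (leg_graph_of B)"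
  using leg_iso_of_feynman_iso feynman_iso_of_leg_iso by blast

lemma feynman_isoI: "trivalent A \<Longrightarrow> trivalent B \<Longrightarrow> leg_graph_of A = leg_graph_of B \<Longrightarrow> feynman_iso A B"
  using feynman_iso_iff leg_iso_refl by metis

text \<open>Models need not be reduced: flags are compared in unsmoothed graphs, and only the
  relation to an actual Feynman graph passes through \<open>nf\<close>.\<close>

definition models_legs :: "('v, 'h) hgraph \<Rightarrow> 'h leg_graph \<Rightarrow> bool" where
  "models_legs A G \<longleftrightarrow> valid_leg G \<and> leg_iso (leg_graph_of A) (nf G)"

lemma nf_feynman: "feynman A \<Longrightarrow> nf (leg_graph_of A) = leg_graph_of A"
  using nf_reduced wf_leg_graph_of feynman_trivalent feynman_reduced by blast

lemma LFG_simps [simp]: "Obj LFG = {G. feynman G}" "iso LFG = feynman_iso"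
  "null LFG = \<lparr>verts = {}, halves = {}, inc = {}, adj = {}\<rparr>" "disj_union LFG = hgraph_disj_union"
  "Subs LFG A = {S. subgraph S A \<and> quotient_defined A S}" "sub LFG A S = S" "quot LFG A S = hgraph_quotient A S"
  by (simp_all add: LFG_def)

lemma subs_iff:
  assumes "feynman A"
  shows "S \<in> Subs LFG A \<longleftrightarrow> full_sub S A \<and> feynman S \<and> quotient_defined A S"
  using subgraph_iff_full_sub[OF feynman_trivalent[OF assms]] by auto

text \<open>Every vertex of a Feynman subgraph meets an internal edge, so the subgraph is determined
  by its adjacency.\<close>

lemma bij_adj_lsubs:
  assumes A: "feynman A"
  shows "bij_betw adj (Subs LFG A) (lsubs (leg_graph_of A))"
proof (rule bij_betw_imageI)
  note T = feynman_trivalent[OF A]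
  show "inj_on adj (Subs LFG A)"
  proof (rule inj_onI)
    fix X Y assume *: "X \<in> Subs LFG A" "Y \<in> Subs LFG A" and adj: "adj X = adj Y"
    hence X: "full_sub X A" "feynman X" and Y: "full_sub Y A" "feynman Y" using subs_iff[OF A] by auto
    have "leg_graph_of X = leg_graph_of Y"
      using nf_sub_legs[OF T X] nf_sub_legs[OF T Y] adj by simp
    hence "halves X = halves Y" using leg_graph_of_simps(1) by metis
    thus "X = Y" using full_sub_eqI[OF T X(1) Y(1)] adj by blast
  qed
  show "adj ` Subs LFG A = lsubs (leg_graph_of A)"
  proof (intro equalityI subsetI)
    fix U assume "U \<in> adj ` Subs LFG A"
    thus "U \<in> lsubs (leg_graph_of A)" using adj_lsubs[OF A] subs_iff[OF A] by blast
  next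
    fix U assume U: "U \<in> lsubs (leg_graph_of A)"
    hence UA: "U \<subseteq> adj A" "sym U" and vs: "valid_leg (lsub (leg_graph_of A) U)"
      and vq: "valid_leg (lquo (leg_graph_of A) U)" by (auto simp: lsubs_def)
    \<comment> \<open>Only vertices touched by \<open>U\<close>: any other vertex would form a
      component without a loop.\<close>
    define V where "V = {v. \<exists>h\<in>Domain U. (h, v) \<in> inc A}"
    define S where "S = \<lparr>verts = V, halves = {h. \<exists>v\<in>V. (h, v) \<in> inc A}, inc = inc A \<inter> (UNIV \<times> V), adj = U\<rparr>"
    have VA: "V \<subseteq> verts A" using inc_mem[OF T] by (auto simp: V_def)
    have "h \<in> halves S" if h: "h \<in> Domain U" for h
    proof -
      have "h \<in> halves A" using h UA adj_mem[OF T] by blast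
      then obtain v where "(h, v) \<in> inc A" using inc_ex[OF T] by blast
      thus ?thesis using h by (auto simp: S_def V_def)
    qed
    moreover have "k \<in> Domain U" if "(h, k) \<in> U" for h k using that UA(2) by (auto dest: symD)
    ultimately have "U \<subseteq> halves S \<times> halves S" by auto
    hence full: "full_sub S A" using UA VA unfolding full_sub_def S_def by simp
    have core: "core (lsub (leg_graph_of A) (adj S)) = halves S"
    proof (intro equalityI subsetI)
      fix h assume "h \<in> core (lsub (leg_graph_of A) (adj S))"
      hence h: "h \<in> halves A" and "\<not> blk (leg_graph_of A) `` {h} \<subseteq> halves A - Domain U"
        by (auto simp: core_def free_lsub S_def)
      then obtain k where k: "(h, k) \<in> blk (leg_graph_of A)" "k \<in> Domain U"
        using blk_legs[OF wf_leg_graph_of[OF T]] by fastforce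
      thus "h \<in> halves S" by (auto simp: S_def V_def blk_leg_graph_of)
    next
      fix h assume "h \<in> halves S"
      then obtain v k where v: "(h, v) \<in> inc A" "k \<in> Domain U" "(k, v) \<in> inc A" by (auto simp: S_def V_def)
      hence "(h, k) \<in> blk (leg_graph_of A)" by (auto simp: blk_leg_graph_of)
      thus "h \<in> core (lsub (leg_graph_of A) (adj S))"
        using v inc_mem[OF T v(1)] card_blk[OF T, of h] by (auto simp: core_def free_lsub S_def)
    qed
    have "adj S = U" by (simp add: S_def)
    hence legs: "leg_graph_of S = nf (lsub (leg_graph_of A) U)"
      using nf_sub_legs_core[OF T full core] by simp
    have F: "feynman S"
      unfolding feynman_iff legs using trivalent_full_sub[OF T full] reduction[OF vs] by simp
    have "quotient_defined A S"
      using valid_lquo_subgraph_iff[OF A full F] vq \<open>adj S = U\<close> by simp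
    hence "S \<in> Subs LFG A" using subs_iff[OF A] full F by blast
    thus "U \<in> adj ` Subs LFG A" using \<open>adj S = U\<close> by blast
  qed
qed

lemma subs_models:
  assumes A: "feynman A" and S: "S \<in> Subs LFG A"
  shows "feynman S" "feynman (hgraph_quotient A S)"
    "leg_graph_of S = nf (lsub (leg_graph_of A) (adj S))"
    "leg_graph_of (hgraph_quotient A S) = nf (lquo (leg_graph_of A) (adj S))"
    "adj S \<in> lsubs (leg_graph_of A)" "full_sub S A"
    "verts (hgraph_quotient A S) \<subseteq> verts A" "halves (hgraph_quotient A S) \<subseteq> halves A"
proof -
  have S': "full_sub S A" "feynman S" "quotient_defined A S" using S subs_iff[OF A] by auto
  show "feynman S" "full_sub S A" using S' by blast+
  show "feynman (hgraph_quotient A S)"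
    "leg_graph_of (hgraph_quotient A S) = nf (lquo (leg_graph_of A) (adj S))"
    "verts (hgraph_quotient A S) \<subseteq> verts A" "halves (hgraph_quotient A S) \<subseteq> halves A"
    using hgraph_quotient_legs[OF A S'] .
  show "leg_graph_of S = nf (lsub (leg_graph_of A) (adj S))"
    using nf_sub_legs[OF feynman_trivalent[OF A] S'(1,2)] by simp
  show "adj S \<in> lsubs (leg_graph_of A)" using adj_lsubs[OF A S'] .
qed

lemma finite_adj: "feynman A \<Longrightarrow> finite (adj A)"
proof -
  assume A: "feynman A"
  have "adj A \<subseteq> halves A \<times> halves A" using adj_mem[OF feynman_trivalent[OF A]] by auto
  thus ?thesis using finite_halves[OF feynman_trivalent[OF A]] finite_subset by blast
qed

text \<open>Composite of \<open>adj\<close> with the transfer of subobjects between leg graphs that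
  have isomorphic normal forms.\<close>

lemma models_legs_subs:
  assumes A: "feynman A" and G: "models_legs A G"
  shows "\<exists>\<beta>. bij_betw \<beta> (Subs LFG A) (lsubs G) \<and>
      (\<forall>S\<in>Subs LFG A. S \<in> Obj LFG \<and> hgraph_quotient A S \<in> Obj LFG \<and>
        models_legs S (lsub G (\<beta> S)) \<and> models_legs (hgraph_quotient A S) (lquo G (\<beta> S)))"
proof -
  have vG: "valid_leg G" and iso: "leg_iso (nf (leg_graph_of A)) (nf G)"
    using G nf_feynman[OF A] by (simp_all add: models_legs_def)
  obtain \<gamma> where \<gamma>: "bij_betw \<gamma> (lsubs (leg_graph_of A)) (lsubs G)"
    "\<forall>U\<in>lsubs (leg_graph_of A). leg_iso (nf (lsub (leg_graph_of A) U)) (nf (lsub G (\<gamma> U))) \<and>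
       leg_iso (nf (lquo (leg_graph_of A) U)) (nf (lquo G (\<gamma> U)))"
    using leg_iso_nf_lsubs[OF feynman_valid[OF A] vG iso] by blast
  have "bij_betw (\<gamma> \<circ> adj) (Subs LFG A) (lsubs G)"
    using bij_adj_lsubs[OF A] \<gamma>(1) by (rule bij_betw_trans)
  moreover have "S \<in> Obj LFG \<and> hgraph_quotient A S \<in> Obj LFG \<and>
        models_legs S (lsub G ((\<gamma> \<circ> adj) S)) \<and> models_legs (hgraph_quotient A S) (lquo G ((\<gamma> \<circ> adj) S))"
    if S: "S \<in> Subs LFG A" for S
  proof -
    note m = subs_models[OF A S]
    have "\<gamma> (adj S) \<in> lsubs G" using bij_betwE[OF \<gamma>(1)] m(5) by blast
    hence "valid_leg (lsub G (\<gamma> (adj S)))" "valid_leg (lquo G (\<gamma> (adj S)))" by (simp_all add: lsubs_def)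
    thus ?thesis using m(1,2) bspec[OF \<gamma>(2) m(5)] by (simp add: models_legs_def m(3,4))
  qed
  ultimately show ?thesis by (intro exI[of _ "\<gamma> \<circ> adj"]) blast
qed

lemma feynman_null: "feynman \<lparr>verts = {}, halves = {}, inc = {}, adj = {}\<rparr>"
  by (auto simp: feynman_def hgraph_def sym_def irrefl_def components_def)

lemma leg_graph_of_null [simp]:
  "leg_graph_of \<lparr>verts = {}, halves = {}, inc = {}, adj = {}\<rparr> = \<lparr>legs = {}, blk = {}, lnk = {}\<rparr>"
  by (simp add: leg_graph_of_def)

lemma models_null_iff:
  assumes G: "valid_leg G"
  shows "models_legs \<lparr>verts = {}, halves = {}, inc = {}, adj = {}\<rparr> G \<longleftrightarrow> lnk G = {}"
proof
  assume "models_legs \<lparr>verts = {}, halves = {}, inc = {}, adj = {}\<rparr> G"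
  hence "legs (nf G) = {}" by (auto simp: models_legs_def leg_iso_def)
  hence "core G = {}" by (simp add: nf_def)
  thus "lnk G = {}" using core_empty[OF G] by blast
next
  assume l: "lnk G = {}"
  have "blk G `` {h} \<subseteq> free G" for h
    using wf_blk_subset[OF valid_wf[OF G]] by (auto simp: free_def l)
  hence "core G = {}" by (auto simp: core_def)
  hence "nf G = \<lparr>legs = {}, blk = {}, lnk = {}\<rparr>" by (simp add: nf_def)
  thus "models_legs \<lparr>verts = {}, halves = {}, inc = {}, adj = {}\<rparr> G"
    using G by (simp add: models_legs_def leg_iso_refl)
qed

lemma models_self: "feynman A \<Longrightarrow> models_legs A (leg_graph_of A)"
  by (simp add: models_legs_def feynman_valid nf_feynman leg_iso_refl)

lemma iso_models_legs:
  assumes A: "feynman A" and B: "feynman B" and m: "models_legs A G"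
  shows "feynman_iso A B \<longleftrightarrow> models_legs B G"
proof -
  have G: "valid_leg G" "leg_iso (leg_graph_of A) (nf G)" using m by (simp_all add: models_legs_def)
  note wA = wf_leg_graph_of[OF feynman_trivalent[OF A]] and wB = wf_leg_graph_of[OF feynman_trivalent[OF B]]
  have "wf_leg (nf G)" using reduction[OF G(1)] valid_wf by blast
  thus ?thesis
    unfolding feynman_iso_iff[OF feynman_trivalent[OF A] feynman_trivalent[OF B]] models_legs_def
    using G leg_iso_sym[OF wA] leg_iso_sym[OF wB] leg_iso_trans by blast
qed

lemma lmap_card:
  assumes "wf_leg G" "leg_iso G G'"
  shows "card (legs G') = card (legs G)" "card (lnk G') = card (lnk G)"
proof -
  obtain g where g: "inj_on g (legs G)" "G' = lmap g G" using assms(2) leg_iso_def by blast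
  show "card (legs G') = card (legs G)" using g by (simp add: card_image)
  have "inj_on (map_prod g g) (legs G \<times> legs G)" using g(1) by (simp add: map_prod_inj_on)
  hence "inj_on (map_prod g g) (lnk G)" using wf_lnk_subset[OF assms(1)] inj_on_subset by blast
  thus "card (lnk G') = card (lnk G)" using g(2) by (simp add: card_image)
qed

lemma feynman_iso_card:
  assumes "feynman A" "feynman B" "feynman_iso A B"
  shows "card (halves A) = card (halves B)" "card (adj A) = card (adj B)"
  using lmap_card[OF wf_leg_graph_of[OF feynman_trivalent[OF assms(1)]]
      leg_iso_of_feynman_iso[OF feynman_trivalent[OF assms(1)] feynman_trivalent[OF assms(2)] assms(3)]]
  by simp_all

lemma feynman_iso_null_iff:
  assumes A: "feynman A"
  shows "feynman_iso \<lparr>verts = {}, halves = {}, inc = {}, adj = {}\<rparr> A \<longleftrightarrow> adj A = {}"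
proof -
  have "feynman_iso \<lparr>verts = {}, halves = {}, inc = {}, adj = {}\<rparr> A \<longleftrightarrow>
      feynman_iso A \<lparr>verts = {}, halves = {}, inc = {}, adj = {}\<rparr>"
    using feynman_iso_iff[OF feynman_trivalent[OF A] feynman_trivalent[OF feynman_null]]
      feynman_iso_iff[OF feynman_trivalent[OF feynman_null] feynman_trivalent[OF A]]
      leg_iso_sym[OF wf_leg_graph_of[OF feynman_trivalent[OF A]]]
      leg_iso_sym[OF wf_leg_graph_of[OF feynman_trivalent[OF feynman_null]]] by blast
  also have "\<dots> \<longleftrightarrow> adj A = {}"
    using iso_models_legs[OF A feynman_null models_self[OF A]] models_null_iff[OF feynman_valid[OF A]] by simp
  finally show ?thesis .
qed

text \<open>Adjacencies rather than half-edges are counted because a proper subgraph may contain all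
  half-edges and differ from the whole graph only by cut edges.\<close>

lemma card_adj_sub:
  assumes A: "feynman A" and S: "S \<in> Subs LFG A"
  shows "adj (hgraph_quotient A S) \<noteq> {} \<Longrightarrow> card (adj S) < card (adj A)"
    and "adj S \<noteq> {} \<Longrightarrow> card (adj (hgraph_quotient A S)) < card (adj A)"
proof -
  note m = subs_models[OF A S]
  have sub: "adj S \<subseteq> adj A" using m(5) by (simp add: lsubs_def)
  note fin = finite_adj[OF A]
  have vq: "valid_leg (lquo (leg_graph_of A) (adj S))" using m(5) by (simp add: lsubs_def)
  have "card (lnk (nf (lquo (leg_graph_of A) (adj S)))) \<le> card (adj A - adj S)"
    using reduction[OF vq] by simp
  hence le: "card (adj (hgraph_quotient A S)) \<le> card (adj A - adj S)"
    using m(4) leg_graph_of_simps(2) by metis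
  show "card (adj S) < card (adj A)" if "adj (hgraph_quotient A S) \<noteq> {}"
  proof -
    have "card (adj (hgraph_quotient A S)) \<noteq> 0" using that finite_adj[OF m(2)] by simp
    hence "card (adj A - adj S) \<noteq> 0" using le by simp
    hence "adj A - adj S \<noteq> {}" by (metis card.empty)
    thus ?thesis using sub fin by (intro psubset_card_mono) auto
  qed
  show "card (adj (hgraph_quotient A S)) < card (adj A)" if "adj S \<noteq> {}"
  proof -
    have "card (adj A - adj S) < card (adj A)" using that sub fin by (intro psubset_card_mono) auto
    thus ?thesis using le by simp
  qed
qed

text \<open>A vertex outside \<open>S\<close> keeps its three half-edges in the quotient even when
  edges there are joined; adjacencies would not be covered in this way.\<close>

lemma halves_cover:
  assumes A: "feynman A" and S: "S \<in> Subs LFG A"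
  shows "halves A \<subseteq> halves S \<union> halves (hgraph_quotient A S)"
proof
  note m = subs_models[OF A S]
  fix h assume h: "h \<in> halves A"
  have "legs (leg_graph_of (hgraph_quotient A S)) = core (lquo (leg_graph_of A) (adj S))"
    unfolding m(4) by (simp add: nf_def)
  hence "halves (hgraph_quotient A S) = core (lquo (leg_graph_of A) (adj S))" by simp
  thus "h \<in> halves S \<union> halves (hgraph_quotient A S)"
    using core_quo_legs_outside[OF A m(6) h] by blast
qed

lemma disjoint_injection:
  assumes "infinite (UNIV :: 'a set)" "finite (X :: 'a set)" "finite (Y :: 'b set)"
  shows "\<exists>f :: 'b \<Rightarrow> 'a. inj_on f Y \<and> f ` Y \<inter> X = {}"
proof -
  have "infinite (- X)" using assms(1,2) by (simp add: Compl_eq_Diff_UNIV)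
  then obtain Z where Z: "finite Z" "card Z = card Y" "Z \<subseteq> - X" by (meson infinite_arbitrarily_large)
  then obtain f where "bij_betw f Y Z" using finite_same_card_bij[OF assms(3) Z(1)] by auto
  thus ?thesis using Z(3) by (intro exI[of _ f]) (auto simp: bij_betw_def)
qed

text \<open>Half-edges can be renamed into a fixed set of \<open>k\<close> labels, and the leg graph
  on these labels determines the class; there are finitely many relations on a finite set.\<close>

lemma finite_feynman_classes:
  assumes inf: "infinite (UNIV :: 'h set)"
  shows "finite (iso_class LFG ` {A :: ('v, 'h) hgraph. A \<in> Obj LFG \<and> card (halves A) \<le> k})"
proof -
  obtain Z :: "'h set" where Z: "finite Z" "card Z = k" using infinite_arbitrarily_large[OF inf] by blast
  have "iso_class LFG ` {A :: ('v, 'h) hgraph. A \<in> Obj LFG \<and> card (halves A) \<le> k} \<subseteq>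
      (\<lambda>(L, B, E). {A. feynman A \<and> models_legs A \<lparr>legs = L, blk = B, lnk = E\<rparr>}) `
        (Pow Z \<times> Pow (Z \<times> Z) \<times> Pow (Z \<times> Z))"
  proof
    fix I assume "I \<in> iso_class LFG ` {A :: ('v, 'h) hgraph. A \<in> Obj LFG \<and> card (halves A) \<le> k}"
    then obtain A :: "('v, 'h) hgraph" where A: "feynman A" and c: "card (halves A) \<le> k"
        and I: "I = iso_class LFG A" by auto
    obtain g where g: "inj_on g (legs (leg_graph_of A))" "g ` halves A \<subseteq> Z"
      using card_le_inj[OF finite_halves[OF feynman_trivalent[OF A]] Z(1)] c Z(2) by auto
    note wf = wf_leg_graph_of[OF feynman_trivalent[OF A]]
    let ?G = "lmap g (leg_graph_of A)"
    have "nf ?G = ?G" using nf_lmap[OF wf g(1)] nf_feynman[OF A] by simp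
    hence m: "models_legs A ?G"
      using valid_lmap[OF wf g(1) feynman_valid[OF A]] g(1) by (auto simp: models_legs_def leg_iso_def)
    hence "I = {B. feynman B \<and> models_legs B ?G}"
      using iso_models_legs[OF A _ m] by (auto simp: I iso_class_def)
    hence "I = (\<lambda>(L, B, E). {A. feynman A \<and> models_legs A \<lparr>legs = L, blk = B, lnk = E\<rparr>}) (legs ?G, blk ?G, lnk ?G)"
      by (simp add: lmap_def)
    moreover have "(legs ?G, blk ?G, lnk ?G) \<in> Pow Z \<times> Pow (Z \<times> Z) \<times> Pow (Z \<times> Z)"
      using g(2) wf_blk_subset[OF wf] wf_lnk_subset[OF wf] by fastforce
    ultimately show "I \<in> (\<lambda>(L, B, E). {A. feynman A \<and> models_legs A \<lparr>legs = L, blk = B, lnk = E\<rparr>}) `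
        (Pow Z \<times> Pow (Z \<times> Z) \<times> Pow (Z \<times> Z))"
      by (rule image_eqI)
  qed
  thus ?thesis by (rule finite_subset) (use Z(1) in simp)
qed

definition hgraph_sum :: "('v, 'h) hgraph \<Rightarrow> ('v, 'h) hgraph \<Rightarrow> ('v, 'h) hgraph" where
  "hgraph_sum A B = \<lparr>verts = verts A \<union> verts B, halves = halves A \<union> halves B,
     inc = inc A \<union> inc B, adj = adj A \<union> adj B\<rparr>"

lemma hgraph_disj_union_iff:
  "hgraph_disj_union A B L \<longleftrightarrow> verts A \<inter> verts B = {} \<and> halves A \<inter> halves B = {} \<and> L = hgraph_sum A B"
  by (simp add: hgraph_disj_union_def hgraph_sum_def)

context
  fixes A B :: "('v, 'h) hgraph"
  assumes A: "feynman A" and B: "feynman B"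
    and V: "verts A \<inter> verts B = {}" and H: "halves A \<inter> halves B = {}"
begin

lemma leg_graph_of_sum: "leg_graph_of (hgraph_sum A B) = lsum (leg_graph_of A) (leg_graph_of B)"
proof (rule leg_graph_eqI)
  have "(h, k) \<in> blk (leg_graph_of (hgraph_sum A B)) \<longleftrightarrow>
      (h, k) \<in> blk (leg_graph_of A) \<or> (h, k) \<in> blk (leg_graph_of B)" for h k
  proof -
    have "\<not> ((p, v) \<in> inc A \<and> (q, v) \<in> inc B)" for p q v
      using inc_mem[OF feynman_trivalent[OF A]] inc_mem[OF feynman_trivalent[OF B]] V by blast
    thus ?thesis by (auto simp: blk_leg_graph_of hgraph_sum_def)
  qed
  thus "blk (leg_graph_of (hgraph_sum A B)) = blk (lsum (leg_graph_of A) (leg_graph_of B))" by auto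
qed (simp_all add: hgraph_sum_def)

lemma wf_summands: "wf_leg (leg_graph_of A)" "wf_leg (leg_graph_of B)"
    "legs (leg_graph_of A) \<inter> legs (leg_graph_of B) = {}"
  using wf_leg_graph_of[OF feynman_trivalent[OF A]] wf_leg_graph_of[OF feynman_trivalent[OF B]] H by simp_all

lemma feynman_sum: "feynman (hgraph_sum A B)"
proof -
  note TA = feynman_trivalent[OF A] and TB = feynman_trivalent[OF B]
  let ?G = "lsum (leg_graph_of A) (leg_graph_of B)"
  have v: "valid_leg ?G" using valid_lsum_iff[OF wf_summands] feynman_valid A B by blast
  have "nf ?G = ?G" using nf_lsum[OF wf_summands] nf_feynman[OF A] nf_feynman[OF B] by simp
  hence r: "reduced ?G" using reduction[OF v] by simp
  have "trivalent (hgraph_sum A B)"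
  proof (rule trivalentI[OF valid_wf[OF v]])
    show "legs ?G = halves (hgraph_sum A B)" "lnk ?G = adj (hgraph_sum A B)"
      by (simp_all add: hgraph_sum_def)
    show "finite (verts (hgraph_sum A B))"
      using finite_verts[OF TA] finite_verts[OF TB] by (simp add: hgraph_sum_def)
    show "h \<in> halves (hgraph_sum A B) \<and> v \<in> verts (hgraph_sum A B)" if "(h, v) \<in> inc (hgraph_sum A B)" for h v
      using that inc_mem[OF TA] inc_mem[OF TB] by (auto simp: hgraph_sum_def)
    show "\<exists>v. (h, v) \<in> inc (hgraph_sum A B)" if "h \<in> halves (hgraph_sum A B)" for h
      using that inc_ex[OF TA, of h] inc_ex[OF TB, of h] by (auto simp: hgraph_sum_def)
    show "v = v'" if "(h, v) \<in> inc (hgraph_sum A B)" "(h, v') \<in> inc (hgraph_sum A B)" for h v v'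
    proof -
      have "(h, v) \<in> inc A \<and> (h, v') \<in> inc A \<or> (h, v) \<in> inc B \<and> (h, v') \<in> inc B"
      proof -
        have "\<not> ((h, u) \<in> inc A \<and> (h, w) \<in> inc B)" for u w
          using inc_mem[OF TA] inc_mem[OF TB] H by blast
        thus ?thesis using that by (auto simp: hgraph_sum_def)
      qed
      thus ?thesis using inc_unique[OF TA] inc_unique[OF TB] by blast
    qed
    show "card {h. (h, v) \<in> inc (hgraph_sum A B)} = 3" if v: "v \<in> verts (hgraph_sum A B)" for v
    proof (cases "v \<in> verts A")
      case True
      hence "{h. (h, v) \<in> inc (hgraph_sum A B)} = {h. (h, v) \<in> inc A}"
        using inc_mem[OF TB] V by (fastforce simp: hgraph_sum_def)
      thus ?thesis using card_vertex[OF TA True] by simp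
    next
      case False
      hence vB: "v \<in> verts B" using v by (simp add: hgraph_sum_def)
      hence "{h. (h, v) \<in> inc (hgraph_sum A B)} = {h. (h, v) \<in> inc B}"
        using inc_mem[OF TA] False by (fastforce simp: hgraph_sum_def)
      thus ?thesis using card_vertex[OF TB vB] by simp
    qed
  qed
  thus ?thesis unfolding feynman_iff leg_graph_of_sum using v r by blast
qed

end

text \<open>The bijection is defined through adjacencies and pulled back along
  \<open>bij_adj_lsubs\<close> instead of assembling subgraphs. Leg graphs of subobjects and
  quotients then agree exactly, which suffices for isomorphism.\<close>

lemma sum_subs:
  fixes A B :: "('v, 'h) hgraph"
  assumes A: "feynman A" and B: "feynman B"
    and V: "verts A \<inter> verts B = {}" and H: "halves A \<inter> halves B = {}"
  shows "\<exists>\<beta>. bij_betw \<beta> (Subs LFG A \<times> Subs LFG B) (Subs LFG (hgraph_sum A B)) \<and>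
    (\<forall>S\<in>Subs LFG A. \<forall>T\<in>Subs LFG B.
       (\<exists>P. hgraph_disj_union S T P \<and> feynman_iso P (\<beta> (S, T))) \<and>
       (\<exists>Q. hgraph_disj_union (hgraph_quotient A S) (hgraph_quotient B T) Q \<and>
          feynman_iso Q (hgraph_quotient (hgraph_sum A B) (\<beta> (S, T)))))"
proof -
  let ?L = "hgraph_sum A B" and ?GA = "leg_graph_of A" and ?GB = "leg_graph_of B"
  note FL = feynman_sum[OF A B V H]
  note sumAB = leg_graph_of_sum[OF A B V H]
  define \<gamma> where "\<gamma> = (\<lambda>(U, V). U \<union> V) \<circ> map_prod (adj :: ('v, 'h) hgraph \<Rightarrow> ('h \<times> 'h) set) (adj :: ('v, 'h) hgraph \<Rightarrow> ('h \<times> 'h) set)"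
  have \<gamma>: "bij_betw \<gamma> (Subs LFG A \<times> Subs LFG B) (lsubs (leg_graph_of ?L))"
    unfolding \<gamma>_def sumAB
    by (rule bij_betw_trans[OF bij_betw_map_prod[OF bij_adj_lsubs[OF A] bij_adj_lsubs[OF B]]
          bij_lsubs_lsum[OF wf_summands[OF A B V H]]])
  let ?i = "inv_into (Subs LFG ?L) adj"
  note bL = bij_adj_lsubs[OF FL]
  have \<beta>: "bij_betw (?i \<circ> \<gamma>) (Subs LFG A \<times> Subs LFG B) (Subs LFG ?L)"
    by (rule bij_betw_trans[OF \<gamma> bij_betw_inv_into[OF bL]])
  have "(\<exists>P. hgraph_disj_union S T P \<and> feynman_iso P ((?i \<circ> \<gamma>) (S, T))) \<and>
       (\<exists>Q. hgraph_disj_union (hgraph_quotient A S) (hgraph_quotient B T) Q \<and>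
          feynman_iso Q (hgraph_quotient ?L ((?i \<circ> \<gamma>) (S, T))))"
    if S: "S \<in> Subs LFG A" and T: "T \<in> Subs LFG B" for S T
  proof -
    define R where "R = (?i \<circ> \<gamma>) (S, T)"
    have RL: "R \<in> Subs LFG ?L" using bij_betwE[OF \<beta>] S T unfolding R_def by blast
    have "\<gamma> (S, T) \<in> lsubs (leg_graph_of ?L)" using bij_betwE[OF \<gamma>] S T by blast
    hence "adj R = \<gamma> (S, T)" using bL unfolding R_def by (simp add: bij_betw_def f_inv_into_f)
    hence adjR: "adj R = adj S \<union> adj T" by (simp add: \<gamma>_def)
    note mS = subs_models[OF A S] and mT = subs_models[OF B T] and mR = subs_models[OF FL RL]
    have sub: "adj S \<subseteq> lnk ?GA" "sym (adj S)" "adj T \<subseteq> lnk ?GB" "sym (adj T)"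
      using mS(5) mT(5) by (auto simp: lsubs_def)
    note wf = wf_summands[OF A B V H]
    have d1: "verts S \<inter> verts T = {}" "halves S \<inter> halves T = {}"
    proof -
      show "verts S \<inter> verts T = {}" using mS(6) mT(6) V by (auto simp: full_sub_def)
      show "halves S \<inter> halves T = {}"
        using H full_sub_halves(1)[OF feynman_trivalent[OF A] mS(6)]
          full_sub_halves(1)[OF feynman_trivalent[OF B] mT(6)] by blast
    qed
    have dl: "legs (lsub ?GA (adj S)) \<inter> legs (lsub ?GB (adj T)) = {}"
        "legs (lquo ?GA (adj S)) \<inter> legs (lquo ?GB (adj T)) = {}" using H by auto
    have "leg_graph_of (hgraph_sum S T) = lsum (leg_graph_of S) (leg_graph_of T)"
      by (rule leg_graph_of_sum[OF mS(1) mT(1) d1])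
    also have "\<dots> = nf (lsum (lsub ?GA (adj S)) (lsub ?GB (adj T)))"
      unfolding mS(3) mT(3)
      using nf_lsum[OF wf_lsub[OF wf(1) sub(1,2)] wf_lsub[OF wf(2) sub(3,4)] dl(1)] by simp
    also have "\<dots> = leg_graph_of R"
      using mR(3) by (simp add: adjR sumAB lsub_lsum[OF wf])
    finally have "feynman_iso (hgraph_sum S T) R"
      using feynman_isoI feynman_trivalent feynman_sum[OF mS(1) mT(1) d1] mR(1) by blast
    hence P: "hgraph_disj_union S T (hgraph_sum S T) \<and> feynman_iso (hgraph_sum S T) R"
      using d1 by (simp add: hgraph_disj_union_iff)
    let ?S = "hgraph_quotient A S" and ?T = "hgraph_quotient B T"
    have d2: "verts ?S \<inter> verts ?T = {}" "halves ?S \<inter> halves ?T = {}"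
      using mS(7,8) mT(7,8) V H by blast+
    have "leg_graph_of (hgraph_sum ?S ?T) = lsum (leg_graph_of ?S) (leg_graph_of ?T)"
      by (rule leg_graph_of_sum[OF mS(2) mT(2) d2])
    also have "\<dots> = nf (lsum (lquo ?GA (adj S)) (lquo ?GB (adj T)))"
      unfolding mS(4) mT(4)
      using nf_lsum[OF wf_lquo[OF wf(1) sub(1,2)] wf_lquo[OF wf(2) sub(3,4)] dl(2)] by simp
    also have "\<dots> = leg_graph_of (hgraph_quotient ?L R)"
      using mR(4) lquo_lsum[OF wf sub(1,3)] by (simp add: adjR sumAB)
    finally have "feynman_iso (hgraph_sum ?S ?T) (hgraph_quotient ?L R)"
      using feynman_isoI feynman_trivalent feynman_sum[OF mS(2) mT(2) d2] mR(2) by blast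
    hence Q: "hgraph_disj_union ?S ?T (hgraph_sum ?S ?T) \<and> feynman_iso (hgraph_sum ?S ?T) (hgraph_quotient ?L R)"
      using d2 by (simp add: hgraph_disj_union_iff)
    show ?thesis using P Q unfolding R_def by blast
  qed
  thus ?thesis using \<beta> by (intro exI[of _ "?i \<circ> \<gamma>"]) blast
qed

lemma feynman_iso_sum:
  assumes F: "feynman A" "feynman B" "feynman A'" "feynman B'"
    and d: "verts A \<inter> verts B = {}" "halves A \<inter> halves B = {}"
    and d': "verts A' \<inter> verts B' = {}" "halves A' \<inter> halves B' = {}"
    and iso: "feynman_iso A A'" "feynman_iso B B'"
  shows "feynman_iso (hgraph_sum A B) (hgraph_sum A' B')"
proof -
  have T: "trivalent A" "trivalent B" "trivalent A'" "trivalent B'" using F feynman_trivalent by blast+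
  obtain g where g: "inj_on g (halves A)" "leg_graph_of A' = lmap g (leg_graph_of A)"
    using leg_iso_of_feynman_iso[OF T(1,3) iso(1)] by (auto simp: leg_iso_def)
  obtain k where k: "inj_on k (halves B)" "leg_graph_of B' = lmap k (leg_graph_of B)"
    using leg_iso_of_feynman_iso[OF T(2,4) iso(2)] by (auto simp: leg_iso_def)
  define m where "m h = (if h \<in> halves A then g h else k h)" for h
  have m: "m h = g h" if "h \<in> halves A" for h using that by (simp add: m_def)
  have m': "m h = k h" if "h \<in> halves B" for h using that d(2) by (auto simp: m_def)
  have img: "g ` halves A = halves A'" "k ` halves B = halves B'"
    using arg_cong[OF g(2), of legs] arg_cong[OF k(2), of legs] by simp_all
  have rm: "rel_map m E = rel_map g E" if "E \<subseteq> halves A \<times> halves A" for E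
    using that m by (intro image_cong refl) auto
  have rm': "rel_map m E = rel_map k E" if "E \<subseteq> halves B \<times> halves B" for E
    using that m' by (intro image_cong refl) auto
  note wfA = wf_leg_graph_of[OF T(1)] and wfB = wf_leg_graph_of[OF T(2)]
  have "inj_on m (halves A \<union> halves B)"
  proof (rule inj_onI)
    fix p q assume pq: "p \<in> halves A \<union> halves B" "q \<in> halves A \<union> halves B" "m p = m q"
    have "p \<in> halves A \<longleftrightarrow> q \<in> halves A"
    proof -
      have "m p \<in> halves A' \<longleftrightarrow> p \<in> halves A" if "p \<in> halves A \<union> halves B" for p
        using that m m' img d'(2) by (cases "p \<in> halves A") auto
      thus ?thesis using pq by metis
    qed
    thus "p = q" using pq m m' g(1) k(1) by (auto dest: inj_onD)
  qed
  moreover have "lsum (leg_graph_of A') (leg_graph_of B') = lmap m (lsum (leg_graph_of A) (leg_graph_of B))"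
  proof (rule leg_graph_eqI)
    have "m ` halves A = g ` halves A" "m ` halves B = k ` halves B"
      using m m' by (auto intro: image_cong)
    thus "legs (lsum (leg_graph_of A') (leg_graph_of B')) = legs (lmap m (lsum (leg_graph_of A) (leg_graph_of B)))"
      using img by (simp add: image_Un)
    show "blk (lsum (leg_graph_of A') (leg_graph_of B')) = blk (lmap m (lsum (leg_graph_of A) (leg_graph_of B)))"
      using wf_blk_subset[OF wfA] wf_blk_subset[OF wfB] by (simp add: g(2) k(2) rm rm' image_Un)
    show "lnk (lsum (leg_graph_of A') (leg_graph_of B')) = lnk (lmap m (lsum (leg_graph_of A) (leg_graph_of B)))"
      unfolding lsum_simps lmap_simps g(2) k(2) image_Un
      using rm rm' wf_lnk_subset[OF wfA] wf_lnk_subset[OF wfB] by simp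
  qed
  ultimately have "leg_iso (leg_graph_of (hgraph_sum A B)) (leg_graph_of (hgraph_sum A' B'))"
    unfolding leg_iso_def leg_graph_of_sum[OF F(1,2) d] leg_graph_of_sum[OF F(3,4) d'] by auto
  thus ?thesis
    using feynman_iso_of_leg_iso feynman_trivalent feynman_sum[OF F(1,2) d] feynman_sum[OF F(3,4) d'] by blast
qed

lemma feynman_disjoint_copy:
  fixes A B :: "('v, 'h) hgraph"
  assumes inf: "infinite (UNIV :: 'v set)" "infinite (UNIV :: 'h set)" and A: "feynman A" and B: "feynman B"
  shows "\<exists>B'. feynman B' \<and> feynman_iso B B' \<and> verts A \<inter> verts B' = {} \<and> halves A \<inter> halves B' = {}"
proof -
  note TA = feynman_trivalent[OF A] and TB = feynman_trivalent[OF B]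
  obtain f :: "'v \<Rightarrow> 'v" where f: "inj_on f (verts B)" "f ` verts B \<inter> verts A = {}"
    using disjoint_injection[OF inf(1) finite_verts[OF TA] finite_verts[OF TB]] by blast
  obtain g :: "'h \<Rightarrow> 'h" where g: "inj_on g (halves B)" "g ` halves B \<inter> halves A = {}"
    using disjoint_injection[OF inf(2) finite_halves[OF TA] finite_halves[OF TB]] by blast
  define B' where "B' = \<lparr>verts = f ` verts B, halves = g ` halves B, inc = map_prod g f ` inc B, adj = rel_map g (adj B)\<rparr>"
  note wf = wf_leg_graph_of[OF TB]
  have g': "inj_on g (legs (leg_graph_of B))" using g(1) by simp
  have inc': "\<exists>h v. p = g h \<and> w = f v \<and> (h, v) \<in> inc B" if "(p, w) \<in> inc B'" for p w
    using that by (auto simp: B'_def)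
  have inc: "(g h, f v) \<in> inc B' \<longleftrightarrow> (h, v) \<in> inc B" if "h \<in> halves B" "v \<in> verts B" for h v
  proof
    assume "(g h, f v) \<in> inc B'"
    then obtain h' v' where *: "g h = g h'" "f v = f v'" "(h', v') \<in> inc B" using inc' by blast
    hence "h = h'" "v = v'" using that inc_mem[OF TB *(3)] f(1) g(1) by (auto dest: inj_onD)
    thus "(h, v) \<in> inc B" using * by simp
  qed (force simp: B'_def)
  have "leg_graph_of B' = lmap g (leg_graph_of B)"
  proof (rule leg_graph_eqI)
    show "blk (leg_graph_of B') = blk (lmap g (leg_graph_of B))"
    proof (intro equalityI subrelI)
      fix p q assume "(p, q) \<in> blk (leg_graph_of B')"
      then obtain w where w: "(p, w) \<in> inc B'" "(q, w) \<in> inc B'" by (auto simp: blk_leg_graph_of)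
      obtain h v where hv: "p = g h" "w = f v" "(h, v) \<in> inc B" using inc'[OF w(1)] by blast
      obtain k u where ku: "q = g k" "w = f u" "(k, u) \<in> inc B" using inc'[OF w(2)] by blast
      have "v = u" using hv ku f(1) inc_mem[OF TB hv(3)] inc_mem[OF TB ku(3)] by (auto dest: inj_onD)
      hence "(h, k) \<in> blk (leg_graph_of B)" using hv ku by (auto simp: blk_leg_graph_of)
      thus "(p, q) \<in> blk (lmap g (leg_graph_of B))" using hv(1) ku(1) by force
    next
      fix p q assume "(p, q) \<in> blk (lmap g (leg_graph_of B))"
      then obtain h k where hk: "p = g h" "q = g k" "(h, k) \<in> blk (leg_graph_of B)" by auto
      then obtain v where "(h, v) \<in> inc B" "(k, v) \<in> inc B" by (auto simp: blk_leg_graph_of)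
      hence "(g h, f v) \<in> inc B'" "(g k, f v) \<in> inc B'" by (force simp: B'_def)+
      thus "(p, q) \<in> blk (leg_graph_of B')" using hk by (auto simp: blk_leg_graph_of)
    qed
  qed (simp_all add: B'_def)
  hence eq: "leg_graph_of B' = lmap g (leg_graph_of B)" .
  have "trivalent B'"
  proof (rule trivalentI[OF wf_lmap[OF wf g']])
    show "legs (lmap g (leg_graph_of B)) = halves B'" "lnk (lmap g (leg_graph_of B)) = adj B'"
      by (simp_all add: B'_def)
    show "finite (verts B')" using finite_verts[OF TB] by (simp add: B'_def)
    show "p \<in> halves B' \<and> w \<in> verts B'" if pw: "(p, w) \<in> inc B'" for p w
    proof -
      obtain h v where "p = g h" "w = f v" "(h, v) \<in> inc B" using inc'[OF pw] by blast
      thus ?thesis using inc_mem[OF TB] by (auto simp: B'_def)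
    qed
    show "\<exists>w. (p, w) \<in> inc B'" if p: "p \<in> halves B'" for p
    proof -
      obtain h where h: "h \<in> halves B" "p = g h" using p by (auto simp: B'_def)
      then obtain v where "(h, v) \<in> inc B" using inc_ex[OF TB] by blast
      thus ?thesis using h(2) by (force simp: B'_def)
    qed
    show "w = w'" if w: "(p, w) \<in> inc B'" "(p, w') \<in> inc B'" for p w w'
    proof -
      obtain h v where hv: "p = g h" "w = f v" "(h, v) \<in> inc B" using inc'[OF w(1)] by blast
      obtain k u where ku: "p = g k" "w' = f u" "(k, u) \<in> inc B" using inc'[OF w(2)] by blast
      have "h = k" using hv ku g(1) inc_mem[OF TB hv(3)] inc_mem[OF TB ku(3)] by (auto dest: inj_onD)
      thus ?thesis using hv ku inc_unique[OF TB] by blast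
    qed
    show "card {p. (p, w) \<in> inc B'} = 3" if w: "w \<in> verts B'" for w
    proof -
      obtain v where v: "v \<in> verts B" "w = f v" using w by (auto simp: B'_def)
      have "{p. (p, w) \<in> inc B'} = g ` {h. (h, v) \<in> inc B}"
      proof (intro equalityI subsetI)
        fix p assume "p \<in> {p. (p, w) \<in> inc B'}"
        then obtain h u where hu: "p = g h" "w = f u" "(h, u) \<in> inc B" using inc' by blast
        hence "u = v" using v f(1) inc_mem[OF TB hu(3)] by (auto dest: inj_onD)
        thus "p \<in> g ` {h. (h, v) \<in> inc B}" using hu by blast
      next
        fix p assume "p \<in> g ` {h. (h, v) \<in> inc B}"
        thus "p \<in> {p. (p, w) \<in> inc B'}" using v by (force simp: B'_def)
      qed
      moreover have "inj_on g {h. (h, v) \<in> inc B}"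
        using g(1) inc_mem[OF TB] by (auto intro: inj_on_subset)
      ultimately show ?thesis using card_vertex[OF TB v(1)] by (simp add: card_image)
    qed
  qed
  moreover have "valid_leg (leg_graph_of B')" unfolding eq by (rule valid_lmap[OF wf g' feynman_valid[OF B]])
  moreover have "reduced (leg_graph_of B')"
  proof -
    have "nf (leg_graph_of B') = leg_graph_of B'"
      unfolding eq using nf_lmap[OF wf g'] nf_feynman[OF B] by simp
    thus ?thesis using reduction[OF \<open>valid_leg (leg_graph_of B')\<close>] by simp
  qed
  ultimately have F: "feynman B'" by (simp add: feynman_iff)
  moreover have "feynman_iso B B'"
    using feynman_iso_of_leg_iso[OF TB feynman_trivalent[OF F]] g(1) eq by (auto simp: leg_iso_def)
  ultimately show ?thesis using f(2) g(2) by (intro exI[of _ B']) (auto simp: B'_def)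
qed

text \<open>Both types have to be infinite, since disjoint copies require fresh vertices as well as
  fresh half-edge labels.\<close>

theorem hall_model_LFG:
  assumes inf: "infinite (UNIV :: 'v set)" "infinite (UNIV :: 'h set)"
  shows "hall_model (LFG :: ('v, 'h) lfg_data) models_legs lsubs lsub lquo lnk
    (\<lambda>A. card (adj A)) (\<lambda>A. card (halves A))"
proof
  let ?N = "\<lparr>verts = {}, halves = {}, inc = {}, adj = {}\<rparr> :: ('v, 'h) hgraph"
  let ?C = "LFG :: ('v, 'h) lfg_data"
  have val: "valid_leg G" if "models_legs A G" for A :: "('v, 'h) hgraph" and G :: "'h leg_graph"
    using that by (simp add: models_legs_def)
  show "\<exists>G. models_legs A G" if "A \<in> Obj ?C" for A :: "('v, 'h) hgraph"
    using models_self that by auto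
  show "null ?C \<in> Obj ?C" using feynman_null by simp
  show "card (adj (null ?C)) = 0" by simp
  show "finite (iso_class ?C ` {A \<in> Obj ?C. card (halves A) \<le> k})" for k
    by (rule finite_feynman_classes[OF inf(2)])
  show "disj_union ?C A (null ?C) A" for A by (simp add: hgraph_disj_union_def)
  show "disj_union ?C A B L \<Longrightarrow> disj_union ?C B A L" for A B L
    by (auto simp: hgraph_disj_union_def Un_commute)
  show "\<exists>N. disj_union ?C B D N \<and> disj_union ?C A N K" if "disj_union ?C A B L" "disj_union ?C L D K" for A B D L K
    using that by (auto simp: hgraph_disj_union_def Un_assoc)
  fix A :: "('v, 'h) hgraph" assume "A \<in> Obj ?C"
  hence A: "feynman A" by simp
  {
    fix B assume "B \<in> Obj ?C"
    hence B: "feynman B" by simp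
    show "models_legs A G \<Longrightarrow> iso ?C A B \<longleftrightarrow> models_legs B G" for G
      using iso_models_legs[OF A B] by simp
    show "iso ?C A B \<Longrightarrow> card (adj A) = card (adj B)" "iso ?C A B \<Longrightarrow> card (halves A) = card (halves B)"
      using feynman_iso_card[OF A B] by simp_all
    show "\<exists>B' L. B' \<in> Obj ?C \<and> iso ?C B B' \<and> disj_union ?C A B' L"
      using feynman_disjoint_copy[OF inf A B] by (auto simp: hgraph_disj_union_iff)
    fix L assume "disj_union ?C A B L"
    hence L: "verts A \<inter> verts B = {}" "halves A \<inter> halves B = {}" "L = hgraph_sum A B"
      by (auto simp: hgraph_disj_union_iff)
    show "L \<in> Obj ?C" using feynman_sum[OF A B L(1,2)] L(3) by simp
    show "card (halves L) = card (halves A) + card (halves B)"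
      using L finite_halves[OF feynman_trivalent[OF A]] finite_halves[OF feynman_trivalent[OF B]]
      by (simp add: hgraph_sum_def card_Un_disjoint)
    show "iso ?C (null ?C) L \<Longrightarrow> iso ?C (null ?C) A"
      using feynman_iso_null_iff[OF A] feynman_iso_null_iff[OF feynman_sum[OF A B L(1,2)]] L(3)
      by (simp add: hgraph_sum_def)
    show "\<exists>\<beta>. bij_betw \<beta> (Subs ?C A \<times> Subs ?C B) (Subs ?C L) \<and>
      (\<forall>S\<in>Subs ?C A. \<forall>T\<in>Subs ?C B.
         (\<exists>P. disj_union ?C (sub ?C A S) (sub ?C B T) P \<and> iso ?C P (sub ?C L (\<beta> (S, T)))) \<and>
         (\<exists>Q. disj_union ?C (quot ?C A S) (quot ?C B T) Q \<and> iso ?C Q (quot ?C L (\<beta> (S, T)))))"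
      using sum_subs[OF A B L(1,2)] L(3) by simp
    fix A' B' L'
    assume "A' \<in> Obj ?C" "B' \<in> Obj ?C" "disj_union ?C A' B' L'" "iso ?C A A'" "iso ?C B B'"
    thus "iso ?C L L'"
      using feynman_iso_sum[OF A B _ _ L(1,2)] L(3) by (simp add: hgraph_disj_union_iff)
  }
  {
    fix S assume S: "S \<in> Subs ?C A"
    note c = card_adj_sub[OF A S] and m = subs_models[OF A S]
    show "\<not> iso ?C (null ?C) (quot ?C A S) \<Longrightarrow> card (adj (sub ?C A S)) < card (adj A)"
      using c(1) feynman_iso_null_iff[OF m(2)] by simp
    show "\<not> iso ?C (null ?C) (sub ?C A S) \<Longrightarrow> card (adj (quot ?C A S)) < card (adj A)"
      using c(2) feynman_iso_null_iff[OF m(1)] by simp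
    have "card (halves A) \<le> card (halves S \<union> halves (hgraph_quotient A S))"
      using halves_cover[OF A S] finite_halves[OF feynman_trivalent[OF m(1)]]
        finite_halves[OF feynman_trivalent[OF m(2)]] by (intro card_mono) auto
    also have "\<dots> \<le> card (halves S) + card (halves (hgraph_quotient A S))" by (rule card_Un_le)
    finally show "card (halves A) \<le> card (halves (sub ?C A S)) + card (halves (quot ?C A S))" by simp
  }
  fix G assume G: "models_legs A G"
  note vG = val[OF G] and wfG = valid_wf[OF val[OF G]]
  show "\<exists>\<beta>. bij_betw \<beta> (Subs ?C A) (lsubs G) \<and>
      (\<forall>S\<in>Subs ?C A. sub ?C A S \<in> Obj ?C \<and> quot ?C A S \<in> Obj ?C \<and>
        models_legs (sub ?C A S) (lsub G (\<beta> S)) \<and> models_legs (quot ?C A S) (lquo G (\<beta> S)))"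
    using models_legs_subs[OF A G] by simp
  show "finite (lsubs G)"
  proof -
    have "finite (lnk G)"
      using wf_lnk_subset[OF wfG] finite_legs[OF wfG] finite_subset by blast
    moreover have "lsubs G \<subseteq> Pow (lnk G)" by (auto simp: lsubs_def)
    ultimately show ?thesis by (meson finite_Pow_iff finite_subset)
  qed
  show "{} \<in> lsubs G \<and> lquo G {} = G" using empty_lsubs[OF vG] lquo_empty[OF wfG] by blast
  have "lsub G (lnk G) = G" by (rule leg_graph_eqI) simp_all
  thus "lnk G \<in> lsubs G \<and> lsub G (lnk G) = G" using lnk_lsubs[OF vG] by blast
  fix U assume U: "U \<in> lsubs G"
  hence v: "valid_leg (lsub G U)" "valid_leg (lquo G U)" "U \<subseteq> lnk G" by (auto simp: lsubs_def)
  show "models_legs (null ?C) (lsub G U) \<longleftrightarrow> U = {}" using models_null_iff[OF v(1)] by simp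
  show "models_legs (null ?C) (lquo G U) \<longleftrightarrow> U = lnk G" using models_null_iff[OF v(2)] v(3) by auto
  fix W
  show "W \<in> lsubs (lsub G U) \<Longrightarrow> W \<subseteq> U \<and> W \<in> lsubs G \<and> U - W \<in> lsubs (lquo G W)"
    by (rule leg_flag_fwd[OF vG U])
  show "W \<in> lsubs (lsub G U) \<Longrightarrow> lsub (lsub G U) W = lsub G W \<and> lquo (lsub G U) W = lsub (lquo G W) (U - W) \<and>
      lquo (lquo G W) (U - W) = lquo G U"
    by (rule leg_flag_eq[OF vG U])
  show "W \<in> lsubs (lquo G U) \<Longrightarrow> U \<inter> W = {} \<and> U \<union> W \<in> lsubs G \<and> U \<in> lsubs (lsub G (U \<union> W))"
    by (rule leg_flag_bwd[OF vG U])
qed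

section \<open>Rooted forests\<close>

type_synonym 's digraph = "'s set \<times> ('s \<times> 's) set"

text \<open>Acyclic with at most one parent for each vertex: precisely the digraphs underlying
  rooted forests.\<close>

definition arborescent :: "'s digraph \<Rightarrow> bool" where
  "arborescent G \<longleftrightarrow> finite (fst G) \<and> snd G \<subseteq> fst G \<times> fst G \<and> acyclic (snd G) \<and> single_valued ((snd G)\<inverse>)"

definition branch :: "('s \<times> 's) set \<Rightarrow> 's \<Rightarrow> 's rtree" where
  "branch E r = \<lparr>tverts = {w. (r, w) \<in> E\<^sup>*}, troot = r, tedges = {(a, b) \<in> E. (r, a) \<in> E\<^sup>*}\<rparr>"

definition roots :: "'s digraph \<Rightarrow> 's set" where "roots G = fst G - Range (snd G)"

definition trees :: "'s digraph \<Rightarrow> 's rtree set" where "trees G = branch (snd G) ` roots G"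

definition digraph_of :: "'s rtree set \<Rightarrow> 's digraph" where
  "digraph_of F = (\<Union>T\<in>F. tverts T, \<Union>T\<in>F. tedges T)"

text \<open>Closed in the direction of the leaves, as the union of the parts cut off is.\<close>

definition downsets :: "'s digraph \<Rightarrow> 's set set" where
  "downsets G = {D. D \<subseteq> fst G \<and> (\<forall>u v. (u, v) \<in> snd G \<longrightarrow> u \<in> D \<longrightarrow> v \<in> D)}"

definition induced :: "'s digraph \<Rightarrow> 's set \<Rightarrow> 's digraph" where
  "induced G D = (D, snd G \<inter> D \<times> D)"

definition dmap :: "('s \<Rightarrow> 't) \<Rightarrow> 's digraph \<Rightarrow> 't digraph" where
  "dmap f G = (f ` fst G, map_prod f f ` snd G)"

definition diso :: "'s digraph \<Rightarrow> 't digraph \<Rightarrow> bool" where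
  "diso G G' \<longleftrightarrow> (\<exists>f. inj_on f (fst G) \<and> G' = dmap f G)"

lemma dmap_simps [simp]: "fst (dmap f G) = f ` fst G" "snd (dmap f G) = map_prod f f ` snd G"
  by (simp_all add: dmap_def)

lemma induced_simps [simp]: "fst (induced G D) = D" "snd (induced G D) = snd G \<inter> D \<times> D"
  by (simp_all add: induced_def)

lemma digraph_of_simps [simp]: "fst (digraph_of F) = (\<Union>T\<in>F. tverts T)" "snd (digraph_of F) = (\<Union>T\<in>F. tedges T)"
  by (simp_all add: digraph_of_def)

lemma branch_simps [simp]: "tverts (branch E r) = {w. (r, w) \<in> E\<^sup>*}" "troot (branch E r) = r"
    "tedges (branch E r) = {(a, b) \<in> E. (r, a) \<in> E\<^sup>*}"
  by (simp_all add: branch_def)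

lemma cut_component_eq: "cut_component T K v = branch (tedges T - K) v"
  by (simp add: cut_component_def branch_def)

text \<open>A branch depends only on the edges that leave a closed set containing its root; this
  compares branches before and after edges elsewhere are removed.\<close>

lemma branch_cong:
  assumes "r \<in> X" and closed: "\<And>a b. a \<in> X \<Longrightarrow> (a, b) \<in> E \<Longrightarrow> b \<in> X"
    and eq: "\<And>a b. a \<in> X \<Longrightarrow> (a, b) \<in> E \<longleftrightarrow> (a, b) \<in> E'"
  shows "branch E r = branch E' r"
proof -
  have 1: "w \<in> X \<and> (r, w) \<in> E'\<^sup>*" if "(r, w) \<in> E\<^sup>*" for w
    using that
  proof induction
    case (step y z)
    thus ?case using closed[of y z] eq[of y z] by (meson rtrancl.rtrancl_into_rtrancl)
  qed (use \<open>r \<in> X\<close> in simp)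
  have 2: "w \<in> X \<and> (r, w) \<in> E\<^sup>*" if "(r, w) \<in> E'\<^sup>*" for w
    using that
  proof induction
    case (step y z)
    thus ?case using closed[of y z] eq[of y z] by (meson rtrancl.rtrancl_into_rtrancl)
  qed (use \<open>r \<in> X\<close> in simp)
  have "(r, w) \<in> E\<^sup>* \<longleftrightarrow> (r, w) \<in> E'\<^sup>*" for w using 1 2 by blast
  moreover have "{(a, b) \<in> E. (r, a) \<in> E\<^sup>*} = {(a, b) \<in> E'. (r, a) \<in> E'\<^sup>*}"
    using 1 2 eq by blast
  ultimately show ?thesis by (simp add: branch_def)
qed

text \<open>The way up from \<open>w\<close> is deterministic, so any two ancestors lie on the same
  path.\<close>

lemma ancestors_linear:
  assumes "single_valued (E\<inverse>)" "(a, w) \<in> E\<^sup>*" "(b, w) \<in> E\<^sup>*"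
  shows "(a, b) \<in> E\<^sup>* \<or> (b, a) \<in> E\<^sup>*"
  using assms(2,3)
proof (induction arbitrary: b)
  case (step y z)
  show ?case
  proof (cases "b = z")
    case True
    thus ?thesis using step.hyps by (meson rtrancl.rtrancl_into_rtrancl)
  next
    case False
    then obtain x where "(b, x) \<in> E\<^sup>*" "(x, z) \<in> E" using step.prems by (meson rtranclE)
    hence "x = y" using step.hyps(2) assms(1) by (auto dest: single_valuedD)
    thus ?thesis using step.IH \<open>(b, x) \<in> E\<^sup>*\<close> by blast
  qed
qed auto

lemma rtrancl_mem: "E \<subseteq> V \<times> V \<Longrightarrow> (a, b) \<in> E\<^sup>* \<Longrightarrow> a \<in> V \<Longrightarrow> b \<in> V"
  by (metis SigmaE2 rtranclE subsetD)

text \<open>Passing to parents terminates because a finite acyclic relation is well-founded.\<close>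

lemma exists_root:
  assumes G: "arborescent G" and w: "w \<in> fst G"
  shows "\<exists>r\<in>roots G. (r, w) \<in> (snd G)\<^sup>*"
proof -
  have "finite (snd G)" using G by (auto simp: arborescent_def intro: finite_subset)
  hence "wf (snd G)" using G finite_acyclic_wf by (auto simp: arborescent_def)
  thus ?thesis using w
  proof (induction w rule: wf_induct_rule)
    case (less w)
    show ?case
    proof (cases "w \<in> Range (snd G)")
      case True
      then obtain u where u: "(u, w) \<in> snd G" by blast
      hence "u \<in> fst G" using G by (auto simp: arborescent_def)
      then obtain r where "r \<in> roots G" "(r, u) \<in> (snd G)\<^sup>*" using less.IH[OF u] by blast
      thus ?thesis using u by (meson rtrancl.rtrancl_into_rtrancl)
    next
      case False
      thus ?thesis using less.prems by (auto simp: roots_def)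
    qed
  qed
qed

lemma root_unique:
  assumes G: "arborescent G" and "r \<in> roots G" "s \<in> roots G" "(r, w) \<in> (snd G)\<^sup>*" "(s, w) \<in> (snd G)\<^sup>*"
  shows "r = s"
proof -
  have "(r, s) \<in> (snd G)\<^sup>* \<or> (s, r) \<in> (snd G)\<^sup>*" 
    using ancestors_linear[OF _ assms(4,5)] G by (simp add: arborescent_def)
  thus ?thesis using assms(2,3) by (auto simp: roots_def elim: rtranclE)
qed

lemma rooted_tree_branch:
  assumes G: "arborescent G" and r: "r \<in> roots G"
  shows "rooted_tree (branch (snd G) r)"
proof -
  let ?E = "snd G"
  have sub: "?E \<subseteq> fst G \<times> fst G" using G by (simp add: arborescent_def)
  have rV: "r \<in> fst G" using r by (simp add: roots_def)
  have "{w. (r, w) \<in> ?E\<^sup>*} \<subseteq> fst G" using rtrancl_mem[OF sub _ rV] by blast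
  hence fin: "finite {w. (r, w) \<in> ?E\<^sup>*}" using G finite_subset by (auto simp: arborescent_def)
  have ex1: "\<exists>!u. (u, v) \<in> {(a, b) \<in> ?E. (r, a) \<in> ?E\<^sup>*}" if v: "(r, v) \<in> ?E\<^sup>*" "v \<noteq> r" for v
  proof -
    obtain u where "(r, u) \<in> ?E\<^sup>*" "(u, v) \<in> ?E" using v by (metis rtranclE)
    moreover have "u' = u" if "(u', v) \<in> ?E" for u'
      using that \<open>(u, v) \<in> ?E\<close> G by (auto simp: arborescent_def dest: single_valuedD)
    ultimately show ?thesis by blast
  qed
  have reach: "(r, v) \<in> {(a, b) \<in> ?E. (r, a) \<in> ?E\<^sup>*}\<^sup>*" if "(r, v) \<in> ?E\<^sup>*" for v
    using that
  proof induction
    case (step y z)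
    have "(y, z) \<in> {(a, b) \<in> ?E. (r, a) \<in> ?E\<^sup>*}" using step.hyps by simp
    thus ?case by (rule rtrancl_into_rtrancl[OF step.IH])
  qed simp
  have "(r, b) \<in> ?E\<^sup>*" if "(a, b) \<in> ?E" "(r, a) \<in> ?E\<^sup>*" for a b
    using that by (meson rtrancl.rtrancl_into_rtrancl)
  hence "{(a, b) \<in> ?E. (r, a) \<in> ?E\<^sup>*} \<subseteq> {w. (r, w) \<in> ?E\<^sup>*} \<times> {w. (r, w) \<in> ?E\<^sup>*}" by blast
  thus ?thesis
    unfolding rooted_tree_def branch_simps
    using fin ex1 reach r by (auto simp: roots_def)
qed

text \<open>Together with \<open>trees_digraph_of\<close> this identifies forests with arborescent
  digraphs, where subobjects and quotients are induced subgraphs.\<close>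

lemma trees_forest:
  assumes G: "arborescent G"
  shows "rooted_forest (trees G)" "digraph_of (trees G) = G"
proof -
  have sub: "snd G \<subseteq> fst G \<times> fst G" using G by (simp add: arborescent_def)
  have fin: "finite (trees G)" using G by (auto simp: trees_def roots_def arborescent_def)
  have "tverts S \<inter> tverts T = {}" if ST: "S \<in> trees G" "T \<in> trees G" "S \<noteq> T" for S T
  proof (rule ccontr)
    assume "tverts S \<inter> tverts T \<noteq> {}"
    then obtain w where w: "w \<in> tverts S" "w \<in> tverts T" by blast
    obtain r s where "r \<in> roots G" "s \<in> roots G" "S = branch (snd G) r" "T = branch (snd G) s"
      using ST(1,2) unfolding trees_def by blast
    moreover from this have "(r, w) \<in> (snd G)\<^sup>*" "(s, w) \<in> (snd G)\<^sup>*" using w by simp_all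
    ultimately show False using root_unique[OF G] ST(3) by blast
  qed
  thus "rooted_forest (trees G)"
    unfolding rooted_forest_def using fin rooted_tree_branch[OF G] by (auto simp: trees_def)
  have "(\<Union>T\<in>trees G. tverts T) = fst G"
  proof (intro equalityI subsetI)
    fix w assume "w \<in> (\<Union>T\<in>trees G. tverts T)"
    then obtain r where "r \<in> fst G" "(r, w) \<in> (snd G)\<^sup>*" by (auto simp: trees_def roots_def)
    thus "w \<in> fst G" using rtrancl_mem[OF sub] by blast
  next
    fix w assume "w \<in> fst G"
    thus "w \<in> (\<Union>T\<in>trees G. tverts T)" using exists_root[OF G] by (auto simp: trees_def)
  qed
  moreover have "(\<Union>T\<in>trees G. tedges T) = snd G"
  proof (intro equalityI subrelI)
    fix a b assume ab: "(a, b) \<in> snd G"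
    then obtain r where "r \<in> roots G" "(r, a) \<in> (snd G)\<^sup>*" using exists_root[OF G, of a] sub by blast
    thus "(a, b) \<in> (\<Union>T\<in>trees G. tedges T)" using ab by (auto simp: trees_def)
  qed (auto simp: trees_def)
  ultimately show "digraph_of (trees G) = G" by (simp add: digraph_of_def)
qed

lemma rooted_treeD:
  assumes "rooted_tree T"
  shows "finite (tverts T)" "troot T \<in> tverts T" "tedges T \<subseteq> tverts T \<times> tverts T"
    "(u, troot T) \<notin> tedges T" "v \<in> tverts T \<Longrightarrow> v \<noteq> troot T \<Longrightarrow> \<exists>u. (u, v) \<in> tedges T"
    "(u, v) \<in> tedges T \<Longrightarrow> (u', v) \<in> tedges T \<Longrightarrow> u = u'"
    "v \<in> tverts T \<Longrightarrow> (troot T, v) \<in> (tedges T)\<^sup>*"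
proof -
  have *: "(u, troot T) \<notin> tedges T" "v \<in> tverts T - {troot T} \<Longrightarrow> \<exists>!u. (u, v) \<in> tedges T"
    "tedges T \<subseteq> tverts T \<times> tverts T" for u v
    using assms unfolding rooted_tree_def by blast+
  show "finite (tverts T)" "troot T \<in> tverts T" "tedges T \<subseteq> tverts T \<times> tverts T"
    "(u, troot T) \<notin> tedges T" "v \<in> tverts T \<Longrightarrow> (troot T, v) \<in> (tedges T)\<^sup>*"
    using assms unfolding rooted_tree_def by blast+
  show "v \<in> tverts T \<Longrightarrow> v \<noteq> troot T \<Longrightarrow> \<exists>u. (u, v) \<in> tedges T" using *(2) by blast
  show "u = u'" if "(u, v) \<in> tedges T" "(u', v) \<in> tedges T"
  proof -
    have "v \<in> tverts T - {troot T}" using that *(1,3) by blast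
    thus ?thesis using *(2) that by blast
  qed
qed

text \<open>By uniqueness of parents, a cycle through a vertex also passes through its parent; so it
  climbs to the root, which has no incoming edge.\<close>

lemma tree_acyclic:
  assumes T: "rooted_tree T"
  shows "acyclic (tedges T)"
proof -
  note t = rooted_treeD[OF T]
  have "(v, v) \<notin> (tedges T)\<^sup>+" for v
  proof
    assume v: "(v, v) \<in> (tedges T)\<^sup>+"
    have cyc: "(w, w) \<in> (tedges T)\<^sup>+" if wz: "(w, z) \<in> tedges T" "(z, z) \<in> (tedges T)\<^sup>+" for w z
    proof -
      obtain y where y: "(z, y) \<in> (tedges T)\<^sup>*" "(y, z) \<in> tedges T" using wz(2) by (meson tranclD2)
      hence "y = w" using t(6) wz(1) by blast
      thus ?thesis using y wz(1) by (meson rtrancl_into_trancl2)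
    qed
    have "v \<in> tverts T" using v t(3) by (meson mem_Sigma_iff subsetD tranclD)
    hence "(troot T, v) \<in> (tedges T)\<^sup>*" by (rule t(7))
    hence "(troot T, troot T) \<in> (tedges T)\<^sup>+" using v
      by (induction rule: converse_rtrancl_induct) (blast intro: cyc)+
    thus False using t(4) by (meson tranclD2)
  qed
  thus ?thesis by (simp add: acyclic_def)
qed

lemma forestD:
  assumes "rooted_forest F"
  shows "finite F" "T \<in> F \<Longrightarrow> rooted_tree T"
    "T \<in> F \<Longrightarrow> T' \<in> F \<Longrightarrow> v \<in> tverts T \<Longrightarrow> v \<in> tverts T' \<Longrightarrow> T = T'"
  using assms unfolding rooted_forest_def by blast+

lemma forest_edge:
  assumes F: "rooted_forest F" and T: "T \<in> F" "a \<in> tverts T"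
  shows "(a, b) \<in> snd (digraph_of F) \<longleftrightarrow> (a, b) \<in> tedges T"
    "(b, a) \<in> snd (digraph_of F) \<longleftrightarrow> (b, a) \<in> tedges T"
proof -
  have *: "T' = T" if "T' \<in> F" "a \<in> tverts T'" for T' using forestD(3)[OF F that(1) T(1) that(2) T(2)] .
  show "(a, b) \<in> snd (digraph_of F) \<longleftrightarrow> (a, b) \<in> tedges T"
    using * T rooted_treeD(3)[OF forestD(2)[OF F]] unfolding digraph_of_simps by blast
  show "(b, a) \<in> snd (digraph_of F) \<longleftrightarrow> (b, a) \<in> tedges T"
    using * T rooted_treeD(3)[OF forestD(2)[OF F]] unfolding digraph_of_simps by blast
qed

lemma forest_reach:
  assumes F: "rooted_forest F" and T: "T \<in> F" and "(a, b) \<in> (snd (digraph_of F))\<^sup>*" and a: "a \<in> tverts T"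
  shows "(a, b) \<in> (tedges T)\<^sup>* \<and> b \<in> tverts T"
  using assms(3)
proof induction
  case (step y z)
  hence "(y, z) \<in> tedges T" using forest_edge(1)[OF F T] by blast
  thus ?case using step.IH rooted_treeD(3)[OF forestD(2)[OF F T]] by (meson mem_Sigma_iff rtrancl.rtrancl_into_rtrancl subsetD)
qed (use a in simp)

lemma forest_arborescent:
  assumes F: "rooted_forest F"
  shows "arborescent (digraph_of F)"
proof -
  let ?E = "snd (digraph_of F)"
  note t = rooted_treeD[OF forestD(2)[OF F]]
  have sub: "?E \<subseteq> fst (digraph_of F) \<times> fst (digraph_of F)" using t(3) by fastforce
  have "(v, v) \<notin> ?E\<^sup>+" for v
  proof
    assume "(v, v) \<in> ?E\<^sup>+"
    then obtain u where u: "(v, u) \<in> ?E" "(u, v) \<in> ?E\<^sup>*" by (meson tranclD)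
    then obtain T where T: "T \<in> F" "(v, u) \<in> tedges T" by auto
    hence "u \<in> tverts T" using t(3) by blast
    hence "(u, v) \<in> (tedges T)\<^sup>*" using forest_reach[OF F T(1) u(2)] by blast
    hence "(v, v) \<in> (tedges T)\<^sup>+" using T(2) by (meson rtrancl_into_trancl2)
    thus False using tree_acyclic[OF forestD(2)[OF F T(1)]] by (simp add: acyclic_def)
  qed
  moreover have "single_valued (?E\<inverse>)"
  proof (rule single_valuedI)
    fix v u u' assume uv: "(v, u) \<in> ?E\<inverse>" "(v, u') \<in> ?E\<inverse>"
    then obtain T where T: "T \<in> F" "v \<in> tverts T" using sub by auto
    thus "u = u'" using uv forest_edge(2)[OF F T] t(6)[OF T(1)] by blast
  qed
  ultimately show ?thesis
    using sub forestD(1)[OF F] t(1) by (auto simp: arborescent_def acyclic_def)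
qed

lemma tree_eq_branch:
  assumes F: "rooted_forest F" and T: "T \<in> F"
  shows "troot T \<in> roots (digraph_of F)" "branch (snd (digraph_of F)) (troot T) = T"
proof -
  note t = rooted_treeD[OF forestD(2)[OF F T]]
  show "troot T \<in> roots (digraph_of F)"
    using forest_edge(2)[OF F T t(2)] t(2,4) T unfolding roots_def digraph_of_simps by blast
  have "branch (snd (digraph_of F)) (troot T) = branch (tedges T) (troot T)"
  proof (rule branch_cong[where X = "tverts T"])
    show "b \<in> tverts T" if "a \<in> tverts T" "(a, b) \<in> snd (digraph_of F)" for a b
      using forest_edge(1)[OF F T that(1)] that(2) t(3) by blast
  qed (use forest_edge(1)[OF F T] t(2) in blast)+
  also have "\<dots> = T"
  proof -
    have "{w. (troot T, w) \<in> (tedges T)\<^sup>*} = tverts T" using t(7) rtrancl_mem[OF t(3) _ t(2)] by blast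
    moreover have "{(a, b) \<in> tedges T. (troot T, a) \<in> (tedges T)\<^sup>*} = tedges T" using t(3,7) by blast
    ultimately show ?thesis by (simp add: branch_def)
  qed
  finally show "branch (snd (digraph_of F)) (troot T) = T" .
qed

lemma trees_digraph_of:
  assumes F: "rooted_forest F"
  shows "trees (digraph_of F) = F"
proof (intro equalityI subsetI)
  fix T assume "T \<in> trees (digraph_of F)"
  then obtain r where r: "r \<in> roots (digraph_of F)" "T = branch (snd (digraph_of F)) r" by (auto simp: trees_def)
  then obtain S where S: "S \<in> F" "r \<in> tverts S" by (auto simp: roots_def)
  have "r = troot S"
    using r(1) rooted_treeD(5)[OF forestD(2)[OF F S(1)] S(2)] forest_edge(2)[OF F S] by (auto simp: roots_def)
  thus "T \<in> F" using tree_eq_branch(2)[OF F S(1)] r(2) S(1) by simp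
next
  fix T assume "T \<in> F"
  thus "T \<in> trees (digraph_of F)" using tree_eq_branch[OF F] by (metis imageI trees_def)
qed

section \<open>Admissible cuts as downsets\<close>

abbreviation tree_digraph :: "'s rtree \<Rightarrow> 's digraph" where
  "tree_digraph T \<equiv> (tverts T, tedges T)"

text \<open>The vertices cut off. \<open>Full_Cut\<close> is what accounts for the downset
  containing the root, since no set of edges separates the root.\<close>

definition lower :: "'s rtree \<Rightarrow> 's tree_cut \<Rightarrow> 's set" where
  "lower T c = (case c of Edge_Cut K \<Rightarrow> {w. \<exists>u v. (u, v) \<in> K \<and> (v, w) \<in> (tedges T)\<^sup>*} | Full_Cut \<Rightarrow> tverts T)"

definition cut_above :: "'s rtree \<Rightarrow> 's set \<Rightarrow> 's tree_cut" where
  "cut_above T D = (if troot T \<in> D then Full_Cut else Edge_Cut {(u, v) \<in> tedges T. u \<notin> D \<and> v \<in> D})"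

lemma lower_simps [simp]: "lower T (Edge_Cut K) = {w. \<exists>u v. (u, v) \<in> K \<and> (v, w) \<in> (tedges T)\<^sup>*}"
    "lower T Full_Cut = tverts T"
  by (simp_all add: lower_def)

lemma downset_reach: "D \<in> downsets G \<Longrightarrow> u \<in> D \<Longrightarrow> (u, v) \<in> (snd G)\<^sup>* \<Longrightarrow> v \<in> D"
  by (rotate_tac 2, induction rule: rtrancl_induct) (auto simp: downsets_def)

context
  fixes T :: "'s rtree"
  assumes T: "rooted_tree T"
begin

lemma tree_cycle: "(a, b) \<in> tedges T \<Longrightarrow> (b, a) \<notin> (tedges T)\<^sup>*"
  using tree_acyclic[OF T] by (meson acyclic_def rtrancl_into_trancl2)

lemma reach_parent: "(v, w) \<in> (tedges T)\<^sup>* \<Longrightarrow> v \<noteq> w \<Longrightarrow> (u, w) \<in> tedges T \<Longrightarrow> (v, u) \<in> (tedges T)\<^sup>*"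
  using rooted_treeD(6)[OF T] by (metis rtranclE)

lemma leaf_below:
  assumes v: "v \<in> tverts T"
  shows "\<exists>l\<in>leaves T. (v, l) \<in> (tedges T)\<^sup>*"
proof -
  have "finite (tedges T)" using rooted_treeD(1,3)[OF T] finite_subset by blast
  hence "wf ((tedges T)\<inverse>)" using tree_acyclic[OF T] finite_acyclic_wf_converse by blast
  thus ?thesis using v
  proof (induction v rule: wf_induct_rule)
    case (less v)
    show ?case
    proof (cases "v \<in> leaves T")
      case False
      then obtain w where w: "(v, w) \<in> tedges T" using less.prems by (auto simp: leaves_def)
      hence "w \<in> tverts T" using rooted_treeD(3)[OF T] by blast
      then obtain l where "l \<in> leaves T" "(w, l) \<in> (tedges T)\<^sup>*" using less.IH[of w] w by blast
      thus ?thesis using w by (meson converse_rtrancl_into_rtrancl)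
    qed blast
  qed
qed

text \<open>The condition on leaf paths says that no cut edge lies below another: below the lower of
  two such edges there is a leaf whose path contains both, and conversely two edges on one path are
  comparable.\<close>

lemma admissible_iff:
  "Edge_Cut K \<in> admissible_cuts T \<longleftrightarrow>
     K \<subseteq> tedges T \<and> (\<forall>u v u' v'. (u, v) \<in> K \<longrightarrow> (u', v') \<in> K \<longrightarrow> (v, u') \<notin> (tedges T)\<^sup>*)"
proof -
  have fin: "finite (K \<inter> path_to_root T l)" for l
    using rooted_treeD(1,3)[OF T] by (auto simp: path_to_root_def intro: finite_subset[of _ "tverts T \<times> tverts T"])
  have 1: "(v, u') \<notin> (tedges T)\<^sup>*"
    if K: "K \<subseteq> tedges T" and c: "\<forall>l\<in>leaves T. card (K \<inter> path_to_root T l) \<le> 1"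
      and uv: "(u, v) \<in> K" "(u', v') \<in> K" for u v u' v'
  proof
    assume vu: "(v, u') \<in> (tedges T)\<^sup>*"
    have e: "(u, v) \<in> tedges T" "(u', v') \<in> tedges T" using K uv by blast+
    then obtain l where l: "l \<in> leaves T" "(v', l) \<in> (tedges T)\<^sup>*" using leaf_below rooted_treeD(3)[OF T] by blast
    hence "(v, l) \<in> (tedges T)\<^sup>*" using vu e(2) by (meson rtrancl.rtrancl_into_rtrancl rtrancl_trans)
    hence "(u, v) \<in> K \<inter> path_to_root T l" "(u', v') \<in> K \<inter> path_to_root T l"
      using uv e l by (auto simp: path_to_root_def)
    hence "(u, v) = (u', v')"
      using c l(1) fin[of l] card_le_Suc0_iff_eq[OF fin[of l]] by (metis One_nat_def)
    thus False using tree_cycle[OF e(2)] vu by blast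
  qed
  have 2: "card (K \<inter> path_to_root T l) \<le> 1"
    if K: "K \<subseteq> tedges T" and c: "\<forall>u v u' v'. (u, v) \<in> K \<longrightarrow> (u', v') \<in> K \<longrightarrow> (v, u') \<notin> (tedges T)\<^sup>*" for l
  proof -
    have sv: "single_valued ((tedges T)\<inverse>)" using rooted_treeD(6)[OF T] by (auto intro: single_valuedI)
    have "(u, v) = (u', v')" if uv: "(u, v) \<in> K \<inter> path_to_root T l" "(u', v') \<in> K \<inter> path_to_root T l" for u v u' v'
    proof -
      have e: "(u, v) \<in> tedges T" "(u', v') \<in> tedges T" using K uv by blast+
      have "(v, v') \<in> (tedges T)\<^sup>* \<or> (v', v) \<in> (tedges T)\<^sup>*"
        using uv ancestors_linear[OF sv] by (auto simp: path_to_root_def)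
      hence "v = v'" using c uv reach_parent[of v v' u'] reach_parent[of v' v u] e by blast
      thus ?thesis using rooted_treeD(6)[OF T] e by blast
    qed
    hence "\<forall>x\<in>K \<inter> path_to_root T l. \<forall>y\<in>K \<inter> path_to_root T l. x = y" by auto
    thus ?thesis using card_le_Suc0_iff_eq[OF fin[of l]] by simp
  qed
  show ?thesis unfolding admissible_cuts_def using 1 2 by auto
qed

lemma tree_trees: "trees (tree_digraph T) = {T}"
proof -
  have "rooted_forest {T}" using T by (simp add: rooted_forest_def)
  from trees_digraph_of[OF this] show ?thesis by (simp add: digraph_of_def)
qed

context
  fixes K assumes K: "Edge_Cut K \<in> admissible_cuts T"
begin

abbreviation "below \<equiv> lower T (Edge_Cut K)"

lemma cut_edge: "(u, v) \<in> K \<Longrightarrow> (u, v) \<in> tedges T"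
  using K admissible_iff by blast

lemma cut_source: "(u, v) \<in> K \<Longrightarrow> u \<notin> below"
  using K unfolding admissible_iff lower_simps by blast

lemma cut_target: "(u, v) \<in> K \<Longrightarrow> v \<in> below"
  by auto

lemma below_step: "a \<in> below \<Longrightarrow> (a, b) \<in> tedges T \<Longrightarrow> b \<in> below"
  unfolding lower_simps by (blast intro: rtrancl.rtrancl_into_rtrancl)

text \<open>Parents are unique, so the part cut off can be entered only through a cut edge.\<close>

lemma below_back: "b \<in> below \<Longrightarrow> (a, b) \<in> tedges T \<Longrightarrow> a \<notin> below \<Longrightarrow> (a, b) \<in> K"
  using reach_parent rooted_treeD(6)[OF T] cut_edge unfolding lower_simps by blast

lemma below_subset: "below \<subseteq> tverts T"
proof
  fix w assume "w \<in> below"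
  then obtain u v where uv: "(u, v) \<in> K" "(v, w) \<in> (tedges T)\<^sup>*" by auto
  hence "v \<in> tverts T" using cut_edge rooted_treeD(3)[OF T] by blast
  thus "w \<in> tverts T" by (rule rtrancl_mem[OF rooted_treeD(3)[OF T] uv(2)])
qed

lemma root_not_below: "troot T \<notin> below"
proof
  assume "troot T \<in> below"
  then obtain u v where uv: "(u, v) \<in> K" "(v, troot T) \<in> (tedges T)\<^sup>*" by auto
  hence "v = troot T" using rooted_treeD(4)[OF T] by (meson rtranclE)
  thus False using cut_edge[OF uv(1)] rooted_treeD(4)[OF T] by blast
qed

lemma lower_edge_downset: "below \<in> downsets (tree_digraph T)"
  using below_subset below_step by (auto simp: downsets_def)

lemma cut_above_lower_edge: "cut_above T below = Edge_Cut K"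
proof -
  have "{(u, v) \<in> tedges T. u \<notin> below \<and> v \<in> below} = K" using cut_edge cut_source cut_target below_back by blast
  thus ?thesis using root_not_below by (simp add: cut_above_def)
qed

text \<open>The roots of the part cut off are the lower ends of the cut edges; no cut edge starts
  below another, so branches inside this part are the same before and after cutting.\<close>

lemma tree_P_edge: "tree_P T (Edge_Cut K) = trees (induced (tree_digraph T) below)"
proof -
  have br: "branch (tedges T - K) v = branch (tedges T \<inter> below \<times> below) v" if "v \<in> below" for v
    by (rule branch_cong[where X = below]) (use that below_step cut_source in blast)+
  have "roots (induced (tree_digraph T) below) = snd ` K"
  proof (intro equalityI subsetI)
    fix w assume w: "w \<in> roots (induced (tree_digraph T) below)"
    hence "w \<in> below" by (simp add: roots_def)
    then obtain u v where uv: "(u, v) \<in> K" "(v, w) \<in> (tedges T)\<^sup>*" by auto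
    have "v = w"
    proof (rule ccontr)
      assume "v \<noteq> w"
      then obtain y where "(v, y) \<in> (tedges T)\<^sup>*" "(y, w) \<in> tedges T" using uv(2) by (metis rtranclE)
      moreover from this have "y \<in> below" using uv(1) by auto
      ultimately show False using w \<open>w \<in> below\<close> unfolding roots_def induced_simps by auto
    qed
    thus "w \<in> snd ` K" using uv(1) by force
  next
    fix v assume "v \<in> snd ` K"
    then obtain u where u: "(u, v) \<in> K" by auto
    have "v \<notin> Range (tedges T \<inter> below \<times> below)"
    proof
      assume "v \<in> Range (tedges T \<inter> below \<times> below)"
      then obtain a where "(a, v) \<in> tedges T" "a \<in> below" by blast
      thus False using rooted_treeD(6)[OF T] cut_edge[OF u] cut_source[OF u] by blast
    qed
    thus "v \<in> roots (induced (tree_digraph T) below)" using cut_target[OF u] by (simp add: roots_def)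
  qed
  hence "trees (induced (tree_digraph T) below) = branch (tedges T - K) ` snd ` K"
    unfolding trees_def using br cut_target by (auto intro!: image_cong)
  thus ?thesis by (auto simp: cut_component_eq image_image case_prod_beta)
qed

text \<open>The part cut off is closed downwards, so every remaining vertex keeps its parent and
  only the old root is a root.\<close>

lemma tree_R_edge: "tree_R T (Edge_Cut K) = trees (induced (tree_digraph T) (tverts T - below))"
proof -
  let ?X = "tverts T - below"
  have rX: "troot T \<in> ?X" using rooted_treeD(2)[OF T] root_not_below by (rule DiffI)
  have "b \<in> ?X" if "a \<in> ?X" "(a, b) \<in> tedges T - K" for a b using that below_back rooted_treeD(3)[OF T] by blast
  moreover have "(a, b) \<in> tedges T - K \<longleftrightarrow> (a, b) \<in> tedges T \<inter> ?X \<times> ?X" if "a \<in> ?X" for a b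
    using that below_back cut_target rooted_treeD(3)[OF T] by blast
  ultimately have br: "branch (tedges T - K) (troot T) = branch (tedges T \<inter> ?X \<times> ?X) (troot T)"
    by (rule branch_cong[OF rX])
  have "roots (induced (tree_digraph T) ?X) = {troot T}"
  proof (intro equalityI subsetI)
    fix w assume w: "w \<in> roots (induced (tree_digraph T) ?X)"
    hence wX: "w \<in> tverts T" "w \<notin> below" by (auto simp: roots_def)
    have "\<not> (a, w) \<in> tedges T" for a
    proof
      assume a: "(a, w) \<in> tedges T"
      hence "a \<in> ?X" using wX below_step rooted_treeD(3)[OF T] by blast
      thus False using a w wX unfolding roots_def induced_simps by auto
    qed
    thus "w \<in> {troot T}" using rooted_treeD(5)[OF T wX(1)] by blast
  next
    fix w assume "w \<in> {troot T}"
    thus "w \<in> roots (induced (tree_digraph T) ?X)"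
      using rooted_treeD(2,4)[OF T] root_not_below unfolding roots_def induced_simps by auto
  qed
  thus ?thesis using br by (simp add: trees_def cut_component_eq)
qed

end

lemma lower_downset: "c \<in> admissible_cuts T \<Longrightarrow> lower T c \<in> downsets (tree_digraph T)"
  using lower_edge_downset rooted_treeD(3)[OF T] by (cases c) (auto simp: downsets_def)

lemma cut_above_lower: "c \<in> admissible_cuts T \<Longrightarrow> cut_above T (lower T c) = c"
  using cut_above_lower_edge rooted_treeD(2)[OF T] by (cases c) (auto simp: cut_above_def)

lemma tree_P_trees: "c \<in> admissible_cuts T \<Longrightarrow> tree_P T c = trees (induced (tree_digraph T) (lower T c))"
proof (cases c)
  case Full_Cut
  have "induced (tree_digraph T) (tverts T) = tree_digraph T" using rooted_treeD(3)[OF T] by (auto simp: induced_def)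
  thus ?thesis using Full_Cut tree_trees by simp
qed (use tree_P_edge in simp)

lemma tree_R_trees: "c \<in> admissible_cuts T \<Longrightarrow> tree_R T c = trees (induced (tree_digraph T) (tverts T - lower T c))"
proof (cases c)
  case Full_Cut
  thus ?thesis by (simp add: trees_def roots_def)
qed (use tree_R_edge in simp)

lemma cut_above:
  assumes X: "X \<in> downsets (tree_digraph T)"
  shows "cut_above T X \<in> admissible_cuts T" "lower T (cut_above T X) = X"
proof -
  have XV: "X \<subseteq> tverts T" using X by (simp add: downsets_def)
  note reach = downset_reach[OF X, unfolded snd_conv]
  have "cut_above T X \<in> admissible_cuts T \<and> lower T (cut_above T X) = X"
  proof (cases "troot T \<in> X")
    case True
    hence "X = tverts T" using XV reach rooted_treeD(7)[OF T] by blast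
    thus ?thesis using True by (simp add: cut_above_def admissible_cuts_def)
  next
    case False
    let ?K = "{(u, v) \<in> tedges T. u \<notin> X \<and> v \<in> X}"
    have "Edge_Cut ?K \<in> admissible_cuts T" unfolding admissible_iff using reach by blast
    \<comment> \<open>On the path from the root to a vertex of \<open>X\<close>, the edge by which
      the path enters \<open>X\<close> belongs to the cut.\<close>
    moreover have "w \<in> lower T (Edge_Cut ?K)" if "(troot T, w) \<in> (tedges T)\<^sup>*" "w \<in> X" for w
      using that
    proof induction
      case (step y z)
      show ?case
      proof (cases "y \<in> X")
        case True
        then obtain u v where "(u, v) \<in> ?K" "(v, y) \<in> (tedges T)\<^sup>*" using step.IH by auto
        thus ?thesis using step.hyps(2) unfolding lower_simps by (blast intro: rtrancl.rtrancl_into_rtrancl)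
      qed (use step in auto)
    qed (use False in blast)
    hence "lower T (Edge_Cut ?K) = X" using rooted_treeD(7)[OF T] XV reach by auto
    ultimately show ?thesis using False by (simp add: cut_above_def)
  qed
  thus "cut_above T X \<in> admissible_cuts T" "lower T (cut_above T X) = X" by blast+
qed

end

definition cut_downset :: "'s rtree set \<Rightarrow> ('s rtree \<Rightarrow> 's tree_cut) \<Rightarrow> 's set" where
  "cut_downset F c = (\<Union>T\<in>F. lower T (c T))"

lemma LRF_simps [simp]: "Obj LRF = {F. rooted_forest F}" "iso LRF = forest_iso" "null LRF = {}"
  "disj_union LRF = forest_disj_union" "Subs LRF F = Pi\<^sub>E F admissible_cuts"
  "sub LRF F c = (\<Union>T\<in>F. tree_P T (c T))" "quot LRF F c = (\<Union>T\<in>F. tree_R T (c T))"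
  by (simp_all add: LRF_def)

lemma induced_arborescent: "arborescent G \<Longrightarrow> X \<subseteq> fst G \<Longrightarrow> arborescent (induced G X)"
  unfolding arborescent_def induced_simps
  by (blast intro: finite_subset acyclic_subset single_valued_subset)

context
  fixes F :: "'s rtree set"
  assumes F: "rooted_forest F"
begin

lemma trees_induced_forest:
  assumes X: "X \<subseteq> fst (digraph_of F)"
  shows "trees (induced (digraph_of F) X) = (\<Union>T\<in>F. trees (induced (tree_digraph T) (X \<inter> tverts T)))"
proof -
  let ?E = "snd (digraph_of F)"
  have edge: "(a, b) \<in> ?E \<inter> X \<times> X \<longleftrightarrow> (a, b) \<in> tedges T \<inter> (X \<inter> tverts T) \<times> (X \<inter> tverts T)"
    if "T \<in> F" "a \<in> tverts T \<or> b \<in> tverts T" for T a b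
    using forest_edge[OF F that(1)] that(2) rooted_treeD(3)[OF forestD(2)[OF F that(1)]] by blast
  have br: "branch (?E \<inter> X \<times> X) r = branch (tedges T \<inter> (X \<inter> tverts T) \<times> (X \<inter> tverts T)) r"
    if T: "T \<in> F" and r: "r \<in> tverts T" for T r
    by (rule branch_cong[OF r]) (use edge[OF T] in blast)+
  have rt: "r \<in> roots (induced (digraph_of F) X) \<longleftrightarrow> r \<in> roots (induced (tree_digraph T) (X \<inter> tverts T))"
    if T: "T \<in> F" and r: "r \<in> tverts T" for T r
    using edge[OF T, of _ r] r unfolding roots_def induced_simps fst_conv snd_conv by blast
  show ?thesis
  proof (intro equalityI subsetI)
    fix S assume "S \<in> trees (induced (digraph_of F) X)"
    then obtain r where r: "r \<in> roots (induced (digraph_of F) X)" "S = branch (?E \<inter> X \<times> X) r"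
      by (auto simp: trees_def)
    then obtain T where T: "T \<in> F" "r \<in> tverts T" using X by (auto simp: roots_def)
    have "S \<in> trees (induced (tree_digraph T) (X \<inter> tverts T))"
      using r rt[OF T] br[OF T] by (simp add: trees_def)
    thus "S \<in> (\<Union>T\<in>F. trees (induced (tree_digraph T) (X \<inter> tverts T)))" using T(1) by blast
  next
    fix S assume "S \<in> (\<Union>T\<in>F. trees (induced (tree_digraph T) (X \<inter> tverts T)))"
    then obtain T r where T: "T \<in> F" and r: "r \<in> roots (induced (tree_digraph T) (X \<inter> tverts T))"
        "S = branch (tedges T \<inter> (X \<inter> tverts T) \<times> (X \<inter> tverts T)) r"
      by (auto simp: trees_def)
    hence rT: "r \<in> tverts T" by (simp add: roots_def)
    have "S = branch (?E \<inter> X \<times> X) r" using r(2) br[OF T rT] by (rule trans[OF _ sym])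
    thus "S \<in> trees (induced (digraph_of F) X)"
      using r(1) rt[OF T rT] unfolding trees_def induced_simps by blast
  qed
qed

lemma cut_mem: "c \<in> Pi\<^sub>E F admissible_cuts \<Longrightarrow> T \<in> F \<Longrightarrow> c T \<in> admissible_cuts T"
  by auto

lemma lower_subset: "c \<in> Pi\<^sub>E F admissible_cuts \<Longrightarrow> T \<in> F \<Longrightarrow> lower T (c T) \<subseteq> tverts T"
  using lower_downset[OF forestD(2)[OF F] cut_mem] by (simp add: downsets_def)

lemma cut_downset_tree:
  assumes c: "c \<in> Pi\<^sub>E F admissible_cuts" and T: "T \<in> F"
  shows "cut_downset F c \<inter> tverts T = lower T (c T)"
proof (intro equalityI subsetI)
  fix w assume w: "w \<in> cut_downset F c \<inter> tverts T"
  then obtain S where S: "S \<in> F" "w \<in> lower S (c S)" by (auto simp: cut_downset_def)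
  hence "S = T" using forestD(3)[OF F S(1) T] lower_subset[OF c S(1)] w by blast
  thus "w \<in> lower T (c T)" using S(2) by simp
next
  fix w assume "w \<in> lower T (c T)"
  thus "w \<in> cut_downset F c \<inter> tverts T" using lower_subset[OF c T] T by (auto simp: cut_downset_def)
qed

lemma cut_downset_subset: "c \<in> Pi\<^sub>E F admissible_cuts \<Longrightarrow> cut_downset F c \<subseteq> fst (digraph_of F)"
  using lower_subset by (fastforce simp: cut_downset_def)

lemma sub_eq_trees:
  assumes c: "c \<in> Pi\<^sub>E F admissible_cuts"
  shows "(\<Union>T\<in>F. tree_P T (c T)) = trees (induced (digraph_of F) (cut_downset F c))"
  unfolding trees_induced_forest[OF cut_downset_subset[OF c]]
  using tree_P_trees[OF forestD(2)[OF F] cut_mem[OF c]] cut_downset_tree[OF c] by simp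

lemma quot_eq_trees:
  assumes c: "c \<in> Pi\<^sub>E F admissible_cuts"
  shows "(\<Union>T\<in>F. tree_R T (c T)) = trees (induced (digraph_of F) (fst (digraph_of F) - cut_downset F c))"
proof -
  have "(fst (digraph_of F) - cut_downset F c) \<inter> tverts T = tverts T - lower T (c T)" if T: "T \<in> F" for T
    using cut_downset_tree[OF c T] T by auto
  thus ?thesis
    unfolding trees_induced_forest[OF Diff_subset]
    using tree_R_trees[OF forestD(2)[OF F] cut_mem[OF c]] by simp
qed

text \<open>Trees of a forest have disjoint vertex sets, so a downset decomposes into downsets of
  the trees; extensionality of the cuts makes them determined by their values on
  \<open>F\<close>.\<close>

lemma bij_cut_downset: "bij_betw (cut_downset F) (Pi\<^sub>E F admissible_cuts) (downsets (digraph_of F))"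
proof (rule bij_betw_byWitness[where f' = "\<lambda>X. \<lambda>T\<in>F. cut_above T (X \<inter> tverts T)"])
  have tree: "X \<inter> tverts T \<in> downsets (tree_digraph T)" if X: "X \<in> downsets (digraph_of F)" and T: "T \<in> F" for X T
    using X T rooted_treeD(3)[OF forestD(2)[OF F T]] by (fastforce simp: downsets_def)
  have mem: "(\<lambda>T\<in>F. cut_above T (X \<inter> tverts T)) \<in> Pi\<^sub>E F admissible_cuts" if X: "X \<in> downsets (digraph_of F)" for X
    using cut_above(1)[OF forestD(2)[OF F] tree[OF X]] by (intro PiE_I) auto
  show "\<forall>c\<in>Pi\<^sub>E F admissible_cuts. (\<lambda>T\<in>F. cut_above T (cut_downset F c \<inter> tverts T)) = c"
  proof
    fix c assume c: "c \<in> Pi\<^sub>E F admissible_cuts"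
    have "cut_above T (cut_downset F c \<inter> tverts T) = c T" if "T \<in> F" for T
      using cut_downset_tree[OF c that] cut_above_lower[OF forestD(2)[OF F that] cut_mem[OF c that]] by simp
    thus "(\<lambda>T\<in>F. cut_above T (cut_downset F c \<inter> tverts T)) = c"
      using c by (intro ext) (auto simp: restrict_def PiE_def extensional_def)
  qed
  show "\<forall>X\<in>downsets (digraph_of F). cut_downset F (\<lambda>T\<in>F. cut_above T (X \<inter> tverts T)) = X"
  proof
    fix X assume X: "X \<in> downsets (digraph_of F)"
    have "cut_downset F (\<lambda>T\<in>F. cut_above T (X \<inter> tverts T)) = (\<Union>T\<in>F. X \<inter> tverts T)"
      using cut_above(2)[OF forestD(2)[OF F] tree[OF X]] by (simp add: cut_downset_def)
    also have "\<dots> = X" using X by (auto simp: downsets_def)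
    finally show "cut_downset F (\<lambda>T\<in>F. cut_above T (X \<inter> tverts T)) = X" .
  qed
  show "cut_downset F ` Pi\<^sub>E F admissible_cuts \<subseteq> downsets (digraph_of F)"
  proof
    fix X assume "X \<in> cut_downset F ` Pi\<^sub>E F admissible_cuts"
    then obtain c where c: "c \<in> Pi\<^sub>E F admissible_cuts" and X: "X = cut_downset F c" by blast
    have "v \<in> X" if uv: "(u, v) \<in> tedges T" "T \<in> F" "u \<in> X" for u v T
    proof -
      have "u \<in> tverts T" using uv(1) rooted_treeD(3)[OF forestD(2)[OF F uv(2)]] by blast
      hence "u \<in> lower T (c T)" using cut_downset_tree[OF c uv(2)] uv(3) X by blast
      hence "v \<in> lower T (c T)"
        using lower_downset[OF forestD(2)[OF F uv(2)] cut_mem[OF c uv(2)]] uv(1) by (auto simp: downsets_def)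
      thus ?thesis using uv(2) X by (auto simp: cut_downset_def)
    qed
    thus "X \<in> downsets (digraph_of F)" using cut_downset_subset[OF c] X by (auto simp: downsets_def)
  qed
  show "(\<lambda>X. \<lambda>T\<in>F. cut_above T (X \<inter> tverts T)) ` downsets (digraph_of F) \<subseteq> Pi\<^sub>E F admissible_cuts"
    using mem by blast
qed

lemma cut_forests:
  assumes c: "c \<in> Pi\<^sub>E F admissible_cuts"
  shows "rooted_forest (\<Union>T\<in>F. tree_P T (c T))" "rooted_forest (\<Union>T\<in>F. tree_R T (c T))"
    "digraph_of (\<Union>T\<in>F. tree_P T (c T)) = induced (digraph_of F) (cut_downset F c)"
    "digraph_of (\<Union>T\<in>F. tree_R T (c T)) = induced (digraph_of F) (fst (digraph_of F) - cut_downset F c)"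
  unfolding sub_eq_trees[OF c] quot_eq_trees[OF c]
  using trees_forest[OF induced_arborescent[OF forest_arborescent[OF F] cut_downset_subset[OF c]]]
    trees_forest[OF induced_arborescent[OF forest_arborescent[OF F] Diff_subset]] by blast+

end

section \<open>Isomorphism of forests through their digraphs\<close>

lemma diso_refl: "diso G G"
  unfolding diso_def by (intro exI[of _ id]) (simp add: dmap_def prod.map_id0)

lemma diso_trans: "diso G H \<Longrightarrow> diso H K \<Longrightarrow> diso G K"
proof -
  assume "diso G H" "diso H K"
  then obtain f g where fg: "inj_on f (fst G)" "H = dmap f G" "inj_on g (f ` fst G)" "K = dmap g H"
    by (auto simp: diso_def)
  moreover have "dmap g (dmap f G) = dmap (g \<circ> f) G"
    by (simp add: dmap_def image_comp map_prod_compose)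
  ultimately show ?thesis unfolding diso_def by (intro exI[of _ "g \<circ> f"]) (simp add: comp_inj_on)
qed

lemma diso_sym:
  assumes G: "snd G \<subseteq> fst G \<times> fst G" and iso: "diso G H"
  shows "diso H G"
proof -
  obtain f where f: "inj_on f (fst G)" "H = dmap f G" using iso by (auto simp: diso_def)
  let ?g = "inv_into (fst G) f"
  have "map_prod ?g ?g ` map_prod f f ` snd G = id ` snd G"
    unfolding image_image using G f(1) by (intro image_cong) auto
  hence "G = dmap ?g H" using f inv_into_image_cancel[OF f(1), of "fst G"] by (simp add: dmap_def prod_eq_iff)
  moreover have "inj_on ?g (fst H)" using f by (simp add: inj_on_inv_into)
  ultimately show ?thesis unfolding diso_def by blast
qed

definition tree_map :: "('s \<Rightarrow> 't) \<Rightarrow> 's rtree \<Rightarrow> 't rtree" where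
  "tree_map f T = \<lparr>tverts = f ` tverts T, troot = f (troot T), tedges = map_prod f f ` tedges T\<rparr>"

lemma inj_edge_iff:
  assumes "inj_on f V" "E \<subseteq> V \<times> V" "u \<in> V" "v \<in> V"
  shows "(f u, f v) \<in> map_prod f f ` E \<longleftrightarrow> (u, v) \<in> E"
  using assms by (auto dest: inj_onD)

lemma rtrancl_map_iff:
  assumes f: "inj_on f V" and E: "E \<subseteq> V \<times> V" and r: "r \<in> V"
  shows "(f r, x) \<in> (map_prod f f ` E)\<^sup>* \<longleftrightarrow> (\<exists>w. x = f w \<and> (r, w) \<in> E\<^sup>*)"
proof
  assume "(f r, x) \<in> (map_prod f f ` E)\<^sup>*"
  thus "\<exists>w. x = f w \<and> (r, w) \<in> E\<^sup>*"
  proof induction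
    case (step y z)
    then obtain w where w: "y = f w" "(r, w) \<in> E\<^sup>*" by blast
    obtain a b where ab: "(a, b) \<in> E" "y = f a" "z = f b" using step.hyps(2) by auto
    have "a = w" using inj_onD[OF f, of a w] w ab E rtrancl_mem[OF E w(2) r] by auto
    hence "(r, b) \<in> E\<^sup>*" using rtrancl_into_rtrancl[OF w(2)] ab(1) by simp
    thus ?case using ab(3) by blast
  qed blast
next
  assume "\<exists>w. x = f w \<and> (r, w) \<in> E\<^sup>*"
  then obtain w where w: "x = f w" "(r, w) \<in> E\<^sup>*" by blast
  have "(f r, f w) \<in> (map_prod f f ` E)\<^sup>*" using w(2)
  proof induction
    case (step y z)
    have "(f y, f z) \<in> map_prod f f ` E" using step.hyps(2) by force
    thus ?case by (rule rtrancl_into_rtrancl[OF step.IH])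
  qed simp
  thus "(f r, x) \<in> (map_prod f f ` E)\<^sup>*" using w(1) by simp
qed

lemma arborescent_dmap:
  assumes f: "inj_on f (fst G)" and G: "arborescent G"
  shows "arborescent (dmap f G)"
proof -
  have E: "snd G \<subseteq> fst G \<times> fst G" and sv: "single_valued ((snd G)\<inverse>)" using G by (simp_all add: arborescent_def)
  have "(x, x) \<notin> (map_prod f f ` snd G)\<^sup>+" for x
  proof
    assume "(x, x) \<in> (map_prod f f ` snd G)\<^sup>+"
    then obtain y where y: "(x, y) \<in> map_prod f f ` snd G" "(y, x) \<in> (map_prod f f ` snd G)\<^sup>*" by (meson tranclD)
    then obtain a b where ab: "(a, b) \<in> snd G" "x = f a" "y = f b" by auto
    have aV: "a \<in> fst G" and bV: "b \<in> fst G" using ab(1) E by blast+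
    obtain w where w: "x = f w" "(b, w) \<in> (snd G)\<^sup>*" using rtrancl_map_iff[OF f E bV] y(2) ab(3) by blast
    have "f w = f a" using w(1) ab(2) by simp
    hence "w = a" by (rule inj_onD[OF f]) (use rtrancl_mem[OF E w(2) bV] aV in blast)+
    hence "(a, a) \<in> (snd G)\<^sup>+" using w(2) ab(1) by (meson rtrancl_into_trancl2)
    thus False using G by (simp add: arborescent_def acyclic_def)
  qed
  moreover have "single_valued ((map_prod f f ` snd G)\<inverse>)"
  proof (rule single_valuedI)
    fix z x y assume "(z, x) \<in> (map_prod f f ` snd G)\<inverse>" "(z, y) \<in> (map_prod f f ` snd G)\<inverse>"
    then obtain a b c d where ab: "(a, b) \<in> snd G" "(c, d) \<in> snd G" "x = f a" "y = f c" "f b = f d" by auto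
    have "b = d" by (rule inj_onD[OF f ab(5)]) (use ab(1,2) E in blast)+
    thus "x = y" using ab sv by (auto dest: single_valuedD)
  qed
  moreover have "map_prod f f ` snd G \<subseteq> f ` fst G \<times> f ` fst G" using E by auto
  ultimately show ?thesis using G by (simp add: arborescent_def acyclic_def)
qed

lemma trees_dmap:
  assumes f: "inj_on f (fst G)" and G: "snd G \<subseteq> fst G \<times> fst G"
  shows "trees (dmap f G) = tree_map f ` trees G"
proof -
  have br: "branch (map_prod f f ` snd G) (f r) = tree_map f (branch (snd G) r)" if r: "r \<in> fst G" for r
  proof -
    note iff = rtrancl_map_iff[OF f G r]
    have "{w. (f r, w) \<in> (map_prod f f ` snd G)\<^sup>*} = f ` {w. (r, w) \<in> (snd G)\<^sup>*}"
      unfolding iff by blast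
    moreover have "{(a, b) \<in> map_prod f f ` snd G. (f r, a) \<in> (map_prod f f ` snd G)\<^sup>*} =
        map_prod f f ` {(a, b) \<in> snd G. (r, a) \<in> (snd G)\<^sup>*}"
    proof (intro equalityI subrelI)
      fix x y assume "(x, y) \<in> {(a, b) \<in> map_prod f f ` snd G. (f r, a) \<in> (map_prod f f ` snd G)\<^sup>*}"
      then obtain a b w where ab: "(a, b) \<in> snd G" "x = f a" "y = f b" "x = f w" "(r, w) \<in> (snd G)\<^sup>*"
        unfolding iff by auto
      have "a = w" using inj_onD[OF f, of a w] ab G rtrancl_mem[OF G ab(5) r] by auto
      thus "(x, y) \<in> map_prod f f ` {(a, b) \<in> snd G. (r, a) \<in> (snd G)\<^sup>*}" using ab by force
    qed (auto simp: iff)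
    ultimately show ?thesis by (simp add: branch_def tree_map_def)
  qed
  have mem: "f v \<in> Range (map_prod f f ` snd G) \<longleftrightarrow> v \<in> Range (snd G)" if v: "v \<in> fst G" for v
  proof
    assume "f v \<in> Range (map_prod f f ` snd G)"
    then obtain a b where ab: "(a, b) \<in> snd G" "f v = f b" by auto
    hence "v = b" using inj_onD[OF f, of v b] v G by blast
    thus "v \<in> Range (snd G)" using ab(1) by blast
  qed force
  have "f ` V - R = f ` (V - S)" if "\<And>v. v \<in> V \<Longrightarrow> f v \<in> R \<longleftrightarrow> v \<in> S" for V R S
    using that by blast
  from this[of "fst G", OF mem] have "roots (dmap f G) = f ` roots G" by (simp only: roots_def dmap_simps)
  hence "trees (dmap f G) = (\<lambda>r. branch (map_prod f f ` snd G) (f r)) ` roots G"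
    by (simp add: trees_def image_image)
  also have "\<dots> = (\<lambda>r. tree_map f (branch (snd G) r)) ` roots G"
    using br by (intro image_cong) (auto simp: roots_def)
  finally show ?thesis by (simp add: trees_def image_image)
qed

lemma tree_isoD:
  assumes T: "rooted_tree T" and T': "rooted_tree T'" and iso: "tree_iso T T'"
  shows "\<exists>f. bij_betw f (tverts T) (tverts T') \<and> tedges T' = map_prod f f ` tedges T"
proof -
  obtain f where f: "bij_betw f (tverts T) (tverts T')"
    "\<forall>u \<in> tverts T. \<forall>v \<in> tverts T. (u, v) \<in> tedges T \<longleftrightarrow> (f u, f v) \<in> tedges T'"
    using iso unfolding tree_iso_def by blast
  have "tedges T' = map_prod f f ` tedges T"
  proof (intro equalityI subrelI)
    fix a b assume ab: "(a, b) \<in> tedges T'"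
    hence "a \<in> f ` tverts T" "b \<in> f ` tverts T"
      using rooted_treeD(3)[OF T'] bij_betw_imp_surj_on[OF f(1)] by blast+
    then obtain u v where uv: "u \<in> tverts T" "v \<in> tverts T" "a = f u" "b = f v" by blast
    hence "(u, v) \<in> tedges T" using f(2) ab by blast
    thus "(a, b) \<in> map_prod f f ` tedges T" using uv by force
  next
    fix a b assume "(a, b) \<in> map_prod f f ` tedges T"
    then obtain u v where uv: "(u, v) \<in> tedges T" "a = f u" "b = f v" by auto
    moreover from this have "u \<in> tverts T" "v \<in> tverts T" using rooted_treeD(3)[OF T] by blast+
    ultimately show "(a, b) \<in> tedges T'" using f(2) by blast
  qed
  thus ?thesis using f(1) by blast
qed

lemma diso_of_forest_iso:
  assumes F: "rooted_forest F" and F': "rooted_forest F'" and iso: "forest_iso F F'"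
  shows "diso (digraph_of F) (digraph_of F')"
proof -
  obtain p where p: "bij_betw p F F'" "\<forall>T\<in>F. tree_iso T (p T)" using iso by (auto simp: forest_iso_def)
  have p': "p T \<in> F'" if "T \<in> F" for T using bij_betwE[OF p(1)] that by blast
  have "\<forall>T\<in>F. \<exists>g. bij_betw g (tverts T) (tverts (p T)) \<and> tedges (p T) = map_prod g g ` tedges T"
    using tree_isoD[OF forestD(2)[OF F] forestD(2)[OF F' p']] p(2) by blast
  from bchoice[OF this] obtain g where g: "\<forall>T\<in>F. bij_betw (g T) (tverts T) (tverts (p T)) \<and>
      tedges (p T) = map_prod (g T) (g T) ` tedges T" ..
  \<comment> \<open>The vertex maps of the individual trees are glued; disjointness of the trees
    makes the choice of \<open>T\<close> unique.\<close>
  define f where "f v = g (SOME T. T \<in> F \<and> v \<in> tverts T) v" for v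
  have f: "f v = g T v" if T: "T \<in> F" and v: "v \<in> tverts T" for T v
  proof -
    have "(SOME T. T \<in> F \<and> v \<in> tverts T) = T"
      by (rule some_equality) (use T v forestD(3)[OF F] in blast)+
    thus ?thesis by (simp add: f_def)
  qed
  have V: "tverts (p T) = f ` tverts T" if T: "T \<in> F" for T
    using bspec[OF g T] f[OF T] by (auto simp: bij_betw_def)
  have E: "tedges (p T) = map_prod f f ` tedges T" if T: "T \<in> F" for T
  proof -
    have "map_prod f f ` tedges T = map_prod (g T) (g T) ` tedges T"
      using f[OF T] rooted_treeD(3)[OF forestD(2)[OF F T]] by (intro image_cong) auto
    thus ?thesis using g T by simp
  qed
  have "inj_on f (fst (digraph_of F))"
  proof (rule inj_onI)
    fix v w assume "v \<in> fst (digraph_of F)" "w \<in> fst (digraph_of F)" and eq: "f v = f w"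
    then obtain S T where S: "S \<in> F" "v \<in> tverts S" and T: "T \<in> F" "w \<in> tverts T" by auto
    have "f v \<in> tverts (p S)" using V[OF S(1)] S(2) by simp
    moreover have "f v \<in> tverts (p T)" unfolding eq using V[OF T(1)] T(2) by simp
    ultimately have "p S = p T" by (rule forestD(3)[OF F' p'[OF S(1)] p'[OF T(1)]])
    hence "S = T" using inj_onD[OF bij_betw_imp_inj_on[OF p(1)]] S(1) T(1) by blast
    moreover have "inj_on (g T) (tverts T)" using g T(1) by (simp add: bij_betw_def)
    ultimately show "v = w" using S T eq f by (auto dest: inj_onD)
  qed
  moreover have "digraph_of F' = dmap f (digraph_of F)"
  proof (rule prod_eqI)
    have F'p: "F' = p ` F" using bij_betw_imp_surj_on[OF p(1)] by simp
    show "fst (digraph_of F') = fst (dmap f (digraph_of F))" using V by (simp add: F'p image_UN)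
    show "snd (digraph_of F') = snd (dmap f (digraph_of F))" using E by (simp add: F'p image_UN)
  qed
  ultimately show ?thesis unfolding diso_def by blast
qed

text \<open>Trees and their roots are recovered from the edge relation by \<open>trees\<close>, so
  an injective relabeling of the digraph carries trees to trees and roots to roots.\<close>

lemma forest_iso_of_diso:
  assumes F: "rooted_forest F" and F': "rooted_forest F'" and iso: "diso (digraph_of F) (digraph_of F')"
  shows "forest_iso F F'"
proof -
  obtain f where f: "inj_on f (fst (digraph_of F))" "digraph_of F' = dmap f (digraph_of F)"
    using iso by (auto simp: diso_def)
  have sub: "snd (digraph_of F) \<subseteq> fst (digraph_of F) \<times> fst (digraph_of F)"
    using forest_arborescent[OF F] by (simp add: arborescent_def)
  have F'f: "F' = tree_map f ` F"
    using trees_digraph_of[OF F'] trees_digraph_of[OF F] trees_dmap[OF f(1) sub] f(2) by simp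
  have TV: "tverts T \<subseteq> fst (digraph_of F)" if "T \<in> F" for T using that by auto
  have "inj_on (tree_map f) F"
  proof (rule inj_onI)
    fix S T assume ST: "S \<in> F" "T \<in> F" and "tree_map f S = tree_map f T"
    hence "f ` tverts S = f ` tverts T" by (simp add: tree_map_def)
    hence "tverts S = tverts T" using inj_on_image_eq_iff[OF f(1) TV[OF ST(1)] TV[OF ST(2)]] by blast
    thus "S = T" using forestD(3)[OF F ST] rooted_treeD(2)[OF forestD(2)[OF F ST(1)]] by blast
  qed
  moreover have "tree_iso T (tree_map f T)" if T: "T \<in> F" for T
  proof -
    have inj: "inj_on f (tverts T)" using f(1) TV[OF T] by (rule inj_on_subset)
    show ?thesis
      unfolding tree_iso_def using inj inj_edge_iff[OF inj rooted_treeD(3)[OF forestD(2)[OF F T]]]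
      by (intro exI[of _ f]) (simp add: tree_map_def bij_betw_def)
  qed
  ultimately show ?thesis unfolding forest_iso_def F'f by (intro exI[of _ "tree_map f"]) (simp add: bij_betw_def)
qed

lemma forest_iso_iff:
  "rooted_forest F \<Longrightarrow> rooted_forest F' \<Longrightarrow> forest_iso F F' \<longleftrightarrow> diso (digraph_of F) (digraph_of F')"
  using diso_of_forest_iso forest_iso_of_diso by blast

definition induced_compl :: "'s digraph \<Rightarrow> 's set \<Rightarrow> 's digraph" where
  "induced_compl G X = induced G (fst G - X)"

lemma induced_compl_simps [simp]: "fst (induced_compl G X) = fst G - X"
    "snd (induced_compl G X) = snd G \<inter> (fst G - X) \<times> (fst G - X)"
  by (simp_all add: induced_compl_def)

lemma induced_dmap:
  assumes f: "inj_on f (fst G)" and G: "snd G \<subseteq> fst G \<times> fst G" and X: "X \<subseteq> fst G"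
  shows "induced (dmap f G) (f ` X) = dmap f (induced G X)"
    "induced_compl (dmap f G) (f ` X) = dmap f (induced_compl G X)"
proof -
  have 1: "induced (dmap f G) (f ` X) = dmap f (induced G X)" if X: "X \<subseteq> fst G" for X
  proof (rule prod_eqI)
    have mem: "f a \<in> f ` X \<longleftrightarrow> a \<in> X" if "a \<in> fst G" for a
      using inj_on_image_mem_iff[OF f that X] .
    show "snd (induced (dmap f G) (f ` X)) = snd (dmap f (induced G X))"
    proof (intro equalityI subrelI)
      fix x y assume "(x, y) \<in> snd (induced (dmap f G) (f ` X))"
      hence xy: "(x, y) \<in> map_prod f f ` snd G" "x \<in> f ` X" "y \<in> f ` X" by auto
      then obtain a b where ab: "(a, b) \<in> snd G" "x = f a" "y = f b" by auto
      hence "a \<in> X" "b \<in> X" using mem G xy(2,3) by blast+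
      thus "(x, y) \<in> snd (dmap f (induced G X))" using ab by force
    qed auto
  qed simp
  show "induced (dmap f G) (f ` X) = dmap f (induced G X)" by (rule 1[OF X])
  have "f ` fst G - f ` X = f ` (fst G - X)"
    using inj_on_image_set_diff[OF f Diff_subset X] by simp
  thus "induced_compl (dmap f G) (f ` X) = dmap f (induced_compl G X)"
    using 1[OF Diff_subset] by (simp add: induced_compl_def)
qed

lemma bij_downsets_dmap:
  assumes f: "inj_on f (fst G)" and G: "snd G \<subseteq> fst G \<times> fst G"
  shows "bij_betw ((`) f) (downsets G) (downsets (dmap f G))"
proof (rule bij_betw_imageI)
  have "downsets G \<subseteq> Pow (fst G)" by (auto simp: downsets_def)
  thus "inj_on ((`) f) (downsets G)" using inj_on_image_Pow[OF f] inj_on_subset by blast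
  show "(`) f ` downsets G = downsets (dmap f G)"
  proof (intro equalityI subsetI)
    fix Y assume "Y \<in> (`) f ` downsets G"
    then obtain X where X: "X \<subseteq> fst G" "\<And>u v. (u, v) \<in> snd G \<Longrightarrow> u \<in> X \<Longrightarrow> v \<in> X" "Y = f ` X"
      by (auto simp: downsets_def)
    have "y \<in> Y" if xy: "(x, y) \<in> map_prod f f ` snd G" "x \<in> Y" for x y
    proof -
      obtain a b where ab: "(a, b) \<in> snd G" "x = f a" "y = f b" using xy(1) by auto
      hence "a \<in> X" using inj_on_image_mem_iff[OF f _ X(1), of a] G xy(2) X(3) by blast
      thus ?thesis using X(2,3) ab by blast
    qed
    thus "Y \<in> downsets (dmap f G)" using X(1,3) by (auto simp: downsets_def)
  next
    fix Y assume "Y \<in> downsets (dmap f G)"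
    hence Y: "Y \<subseteq> f ` fst G" "\<And>x y. (x, y) \<in> map_prod f f ` snd G \<Longrightarrow> x \<in> Y \<Longrightarrow> y \<in> Y"
      by (auto simp: downsets_def)
    have "v \<in> fst G \<and> f v \<in> Y" if "(u, v) \<in> snd G" "f u \<in> Y" for u v
    proof -
      have "(f u, f v) \<in> map_prod f f ` snd G" using that(1) by force
      thus ?thesis using Y(2) that G by blast
    qed
    hence "{v \<in> fst G. f v \<in> Y} \<in> downsets G" by (auto simp: downsets_def)
    moreover have "Y = f ` {v \<in> fst G. f v \<in> Y}" using Y(1) by blast
    ultimately show "Y \<in> (`) f ` downsets G" by blast
  qed
qed

definition models_digraph :: "'s rtree set \<Rightarrow> 's digraph \<Rightarrow> bool" where
  "models_digraph F G \<longleftrightarrow> diso (digraph_of F) G"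

lemma forest_edges: "rooted_forest F \<Longrightarrow> snd (digraph_of F) \<subseteq> fst (digraph_of F) \<times> fst (digraph_of F)"
  using forest_arborescent unfolding arborescent_def by blast

lemma models_digraphD:
  assumes F: "rooted_forest F" and m: "models_digraph F G"
  shows "finite (fst G)" "snd G \<subseteq> fst G \<times> fst G"
proof -
  obtain f where f: "G = dmap f (digraph_of F)" using m by (auto simp: models_digraph_def diso_def)
  show "finite (fst G)" using f forest_arborescent[OF F] by (simp add: arborescent_def)
  show "snd G \<subseteq> fst G \<times> fst G" unfolding f dmap_simps using forest_edges[OF F] by (auto simp del: digraph_of_simps)
qed

lemma models_digraph_iso:
  assumes A: "rooted_forest A" and B: "rooted_forest B" and m: "models_digraph A G"
  shows "forest_iso A B \<longleftrightarrow> models_digraph B G"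
  unfolding forest_iso_iff[OF A B] models_digraph_def
  using m diso_trans diso_sym[OF forest_edges[OF A]] diso_sym[OF forest_edges[OF B]]
    diso_sym[OF models_digraphD(2)[OF A m]] unfolding models_digraph_def by blast

lemma models_digraph_subs:
  assumes F: "rooted_forest F" and m: "models_digraph F G"
  shows "\<exists>\<beta>. bij_betw \<beta> (Subs LRF F) (downsets G) \<and>
      (\<forall>c\<in>Subs LRF F. sub LRF F c \<in> Obj LRF \<and> quot LRF F c \<in> Obj LRF \<and>
        models_digraph (sub LRF F c) (induced G (\<beta> c)) \<and>
        models_digraph (quot LRF F c) (induced_compl G (\<beta> c)))"
proof -
  obtain f where f: "inj_on f (fst (digraph_of F))" and G: "G = dmap f (digraph_of F)"
    using m by (auto simp: models_digraph_def diso_def)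
  note E = forest_edges[OF F]
  have "bij_betw ((`) f \<circ> cut_downset F) (Subs LRF F) (downsets G)"
    using bij_betw_trans[OF bij_cut_downset[OF F] bij_downsets_dmap[OF f E]] by (simp add: G)
  moreover have "sub LRF F c \<in> Obj LRF \<and> quot LRF F c \<in> Obj LRF \<and>
        models_digraph (sub LRF F c) (induced G (((`) f \<circ> cut_downset F) c)) \<and>
        models_digraph (quot LRF F c) (induced_compl G (((`) f \<circ> cut_downset F) c))"
    if "c \<in> Subs LRF F" for c
  proof -
    have c: "c \<in> Pi\<^sub>E F admissible_cuts" using that by simp
    note cf = cut_forests[OF F c] and X = cut_downset_subset[OF F c]
    have "inj_on f (cut_downset F c)" "inj_on f (fst (digraph_of F) - cut_downset F c)"
      using inj_on_subset[OF f] X by blast+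
    hence "diso (induced (digraph_of F) (cut_downset F c)) (induced G (f ` cut_downset F c))"
      "diso (induced_compl (digraph_of F) (cut_downset F c)) (induced_compl G (f ` cut_downset F c))"
      unfolding G induced_dmap[OF f E X] diso_def by (simp_all only: induced_simps induced_compl_simps) blast+
    thus ?thesis using cf(1,2) by (simp add: models_digraph_def cf(3,4) induced_compl_def del: digraph_of_simps)
  qed
  ultimately show ?thesis by blast
qed

lemma forest_iso_null_iff [simp]: "forest_iso {} F \<longleftrightarrow> F = {}"
  by (auto simp: forest_iso_def bij_betw_def)

lemma models_null_digraph_iff: "models_digraph {} G \<longleftrightarrow> G = ({}, {})"
  by (auto simp: models_digraph_def diso_def dmap_def digraph_of_def)

lemma digraph_of_Un: "digraph_of (A \<union> B) = (fst (digraph_of A) \<union> fst (digraph_of B), snd (digraph_of A) \<union> snd (digraph_of B))"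
  by (simp add: digraph_of_def)

lemma forest_disj_union_iff:
  "forest_disj_union A B L \<longleftrightarrow> fst (digraph_of A) \<inter> fst (digraph_of B) = {} \<and> L = A \<union> B"
  by (simp add: forest_disj_union_def)

lemma verts_empty_iff: "rooted_forest F \<Longrightarrow> fst (digraph_of F) = {} \<longleftrightarrow> F = {}"
  using rooted_treeD(2)[OF forestD(2)] by fastforce

lemma finite_forest_verts: "rooted_forest F \<Longrightarrow> finite (fst (digraph_of F))"
  using forest_arborescent unfolding arborescent_def by blast

lemma forest_disjoint:
  "rooted_forest A \<Longrightarrow> fst (digraph_of A) \<inter> fst (digraph_of B) = {} \<Longrightarrow> A \<inter> B = {}"
  using rooted_treeD(2)[OF forestD(2)] by fastforce

lemma card_forest_iso:
  assumes "rooted_forest A" "rooted_forest B" "forest_iso A B"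
  shows "card (fst (digraph_of A)) = card (fst (digraph_of B))"
  using diso_of_forest_iso[OF assms] by (auto simp: diso_def card_image simp del: digraph_of_simps)

lemma forest_union:
  assumes A: "rooted_forest A" and B: "rooted_forest B" and disj: "fst (digraph_of A) \<inter> fst (digraph_of B) = {}"
  shows "rooted_forest (A \<union> B)"
proof -
  have "tverts S \<inter> tverts T = {}" if "S \<in> A \<union> B" "T \<in> A \<union> B" "S \<noteq> T" for S T
  proof -
    have "tverts S \<inter> tverts T = {}" if "S \<in> A" "T \<in> B" for S T using disj that by auto
    moreover have "tverts S \<inter> tverts T = {}" if "S \<in> F" "T \<in> F" "S \<noteq> T" "F = A \<or> F = B" for S T F
      using that A B unfolding rooted_forest_def by blast
    ultimately show ?thesis using that by blast
  qed
  thus ?thesis using A B unfolding rooted_forest_def by blast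
qed

lemma forest_iso_union:
  assumes A: "rooted_forest A" and A': "rooted_forest A'"
    and d: "fst (digraph_of A) \<inter> fst (digraph_of B) = {}" "fst (digraph_of A') \<inter> fst (digraph_of B') = {}"
    and iso: "forest_iso A A'" "forest_iso B B'"
  shows "forest_iso (A \<union> B) (A' \<union> B')"
proof -
  note d = forest_disjoint[OF A d(1)] forest_disjoint[OF A' d(2)]
  obtain p q where p: "bij_betw p A A'" "\<forall>T\<in>A. tree_iso T (p T)" and q: "bij_betw q B B'" "\<forall>T\<in>B. tree_iso T (q T)"
    using iso by (auto simp: forest_iso_def)
  let ?r = "\<lambda>T. if T \<in> A then p T else q T"
  have "bij_betw ?r A A'" using p(1) by (simp cong: bij_betw_cong)
  moreover have "bij_betw ?r B B'"
  proof -
    have "?r T = q T" if "T \<in> B" for T using that d(1) by auto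
    thus ?thesis using q(1) bij_betw_cong[of B ?r q] by blast
  qed
  ultimately have "bij_betw ?r (A \<union> B) (A' \<union> B')" using d(2) by (rule bij_betw_combine)
  thus ?thesis unfolding forest_iso_def using p(2) q(2) by (intro exI[of _ ?r]) auto
qed

lemma forest_disjoint_copy:
  fixes A B :: "'s rtree set"
  assumes inf: "infinite (UNIV :: 's set)" and A: "rooted_forest A" and B: "rooted_forest B"
  shows "\<exists>B'. rooted_forest B' \<and> forest_iso B B' \<and> fst (digraph_of A) \<inter> fst (digraph_of B') = {}"
proof -
  obtain f :: "'s \<Rightarrow> 's" where f: "inj_on f (fst (digraph_of B))" "f ` fst (digraph_of B) \<inter> fst (digraph_of A) = {}"
    using disjoint_injection[OF inf finite_forest_verts[OF A] finite_forest_verts[OF B]] by blast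
  let ?G = "dmap f (digraph_of B)"
  have G: "arborescent ?G" using f(1) forest_arborescent[OF B] by (rule arborescent_dmap)
  note t = trees_forest[OF G]
  have "diso (digraph_of B) (digraph_of (trees ?G))" unfolding t(2) diso_def using f(1) by blast
  hence "forest_iso B (trees ?G)" by (rule forest_iso_of_diso[OF B t(1)])
  moreover have "fst (digraph_of A) \<inter> fst (digraph_of (trees ?G)) = {}"
    unfolding t(2) using f(2) by (simp add: Int_commute)
  ultimately show ?thesis using t(1) by blast
qed

lemma finite_forest_classes:
  assumes inf: "infinite (UNIV :: 's set)"
  shows "finite (iso_class LRF ` {F :: 's rtree set. F \<in> Obj LRF \<and> card (fst (digraph_of F)) \<le> k})"
proof -
  obtain Z :: "'s set" where Z: "finite Z" "card Z = k" using infinite_arbitrarily_large[OF inf] by blast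
  have "iso_class LRF ` {F :: 's rtree set. F \<in> Obj LRF \<and> card (fst (digraph_of F)) \<le> k} \<subseteq>
      (\<lambda>G. {B. rooted_forest B \<and> models_digraph B G}) ` (Pow Z \<times> Pow (Z \<times> Z))"
  proof
    fix I assume "I \<in> iso_class LRF ` {F :: 's rtree set. F \<in> Obj LRF \<and> card (fst (digraph_of F)) \<le> k}"
    then obtain F :: "'s rtree set" where F: "rooted_forest F" and c: "card (fst (digraph_of F)) \<le> k"
        and I: "I = iso_class LRF F" by auto
    obtain f where f: "inj_on f (fst (digraph_of F))" "f ` fst (digraph_of F) \<subseteq> Z"
      using card_le_inj[OF finite_forest_verts[OF F] Z(1)] c Z(2) by auto
    have m: "models_digraph F (dmap f (digraph_of F))" using f(1) by (auto simp: models_digraph_def diso_def)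
    hence "I = {B. rooted_forest B \<and> models_digraph B (dmap f (digraph_of F))}"
      using models_digraph_iso[OF F _ m] by (auto simp: I iso_class_def)
    moreover have "dmap f (digraph_of F) \<in> Pow Z \<times> Pow (Z \<times> Z)"
      using f(2) forest_edges[OF F] by (fastforce simp: dmap_def)
    ultimately show "I \<in> (\<lambda>G. {B. rooted_forest B \<and> models_digraph B G}) ` (Pow Z \<times> Pow (Z \<times> Z))"
      by (rule image_eqI)
  qed
  thus ?thesis by (rule finite_subset) (use Z(1) in simp)
qed

text \<open>A cut of a disjoint union is a pair of cuts, and its sub and quotient are literally the
  unions of those of the summands, so the required isomorphisms are identities.\<close>

lemma forest_sum_subs:
  assumes A: "rooted_forest A" and B: "rooted_forest B" and d: "fst (digraph_of A) \<inter> fst (digraph_of B) = {}"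
  shows "\<exists>\<beta>. bij_betw \<beta> (Subs LRF A \<times> Subs LRF B) (Subs LRF (A \<union> B)) \<and>
    (\<forall>S\<in>Subs LRF A. \<forall>T\<in>Subs LRF B.
       (\<exists>P. forest_disj_union (sub LRF A S) (sub LRF B T) P \<and> forest_iso P (sub LRF (A \<union> B) (\<beta> (S, T)))) \<and>
       (\<exists>Q. forest_disj_union (quot LRF A S) (quot LRF B T) Q \<and> forest_iso Q (quot LRF (A \<union> B) (\<beta> (S, T)))))"
proof -
  let ?\<beta> = "\<lambda>(S, T). \<lambda>x. if x \<in> A then S x else T x"
  note AB = forest_disjoint[OF A d]
  have "bij_betw ?\<beta> (Subs LRF A \<times> Subs LRF B) (Subs LRF (A \<union> B))"
  proof (rule bij_betw_byWitness[where f' = "\<lambda>c. (restrict c A, restrict c B)"])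
    show "\<forall>x\<in>Subs LRF A \<times> Subs LRF B. (restrict (?\<beta> x) A, restrict (?\<beta> x) B) = x"
      using AB by (auto simp: fun_eq_iff PiE_def extensional_def restrict_def)
    show "\<forall>c\<in>Subs LRF (A \<union> B). ?\<beta> (restrict c A, restrict c B) = c"
      using AB by (auto simp: fun_eq_iff PiE_def extensional_def restrict_def)
    show "?\<beta> ` (Subs LRF A \<times> Subs LRF B) \<subseteq> Subs LRF (A \<union> B)"
      by (auto simp: PiE_def extensional_def)
    show "(\<lambda>c. (restrict c A, restrict c B)) ` Subs LRF (A \<union> B) \<subseteq> Subs LRF A \<times> Subs LRF B"
      by auto
  qed
  moreover have "(\<exists>P. forest_disj_union (sub LRF A S) (sub LRF B T) P \<and> forest_iso P (sub LRF (A \<union> B) (?\<beta> (S, T)))) \<and>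
       (\<exists>Q. forest_disj_union (quot LRF A S) (quot LRF B T) Q \<and> forest_iso Q (quot LRF (A \<union> B) (?\<beta> (S, T))))"
    if S: "S \<in> Subs LRF A" and T: "T \<in> Subs LRF B" for S T
  proof -
    let ?c = "?\<beta> (S, T)"
    have S': "S \<in> Pi\<^sub>E A admissible_cuts" and T': "T \<in> Pi\<^sub>E B admissible_cuts" using S T by simp_all
    note cS = cut_forests[OF A S'] and cT = cut_forests[OF B T']
    have eq: "(\<Union>x\<in>A \<union> B. g x (?c x)) = (\<Union>x\<in>A. g x (S x)) \<union> (\<Union>x\<in>B. g x (T x))"
      for g :: "'a rtree \<Rightarrow> 'a tree_cut \<Rightarrow> 'a rtree set"
    proof -
      have "?c x = T x" if "x \<in> B" for x using that AB by auto
      thus ?thesis unfolding UN_Un by simp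
    qed
    have ds: "fst (digraph_of (sub LRF A S)) \<inter> fst (digraph_of (sub LRF B T)) = {}"
      unfolding LRF_simps cS(3) cT(3) induced_simps
      using cut_downset_subset[OF A S'] cut_downset_subset[OF B T'] d by blast
    have dq: "fst (digraph_of (quot LRF A S)) \<inter> fst (digraph_of (quot LRF B T)) = {}"
      unfolding LRF_simps cS(4) cT(4) induced_simps using d by blast
    have refl: "forest_iso F F" if "rooted_forest F" for F :: "'a rtree set"
      using forest_iso_of_diso[OF that that diso_refl] .
    have "forest_disj_union (sub LRF A S) (sub LRF B T) (sub LRF (A \<union> B) ?c)"
      unfolding forest_disj_union_iff using ds eq by simp
    moreover have "forest_disj_union (quot LRF A S) (quot LRF B T) (quot LRF (A \<union> B) ?c)"
      unfolding forest_disj_union_iff using dq eq by simp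
    moreover have "rooted_forest (sub LRF (A \<union> B) ?c)" "rooted_forest (quot LRF (A \<union> B) ?c)"
      using forest_union[OF cS(1) cT(1)] forest_union[OF cS(2) cT(2)] ds dq eq by simp_all
    ultimately show ?thesis using refl by blast
  qed
  ultimately show ?thesis by (intro exI[of _ ?\<beta>]) blast
qed

text \<open>For forests the number of vertices serves as both measures, because subobject and
  quotient partition the vertex set.\<close>

theorem hall_model_LRF:
  assumes inf: "infinite (UNIV :: 's set)"
  shows "hall_model (LRF :: 's lrf_data) models_digraph downsets induced induced_compl fst
    (\<lambda>F. card (fst (digraph_of F))) (\<lambda>F. card (fst (digraph_of F)))"
proof
  let ?C = "LRF :: 's lrf_data" and ?V = "\<lambda>F :: 's rtree set. fst (digraph_of F)"
  note [simp del] = digraph_of_simps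
  show "\<exists>G. models_digraph A G" for A :: "'s rtree set" 
    unfolding models_digraph_def by (rule exI, rule diso_refl)
  show "null ?C \<in> Obj ?C" by (simp add: rooted_forest_def)
  show "card (?V (null ?C)) = 0" by (simp add: digraph_of_def)
  show "finite (iso_class ?C ` {A \<in> Obj ?C. card (?V A) \<le> k})" for k
    by (rule finite_forest_classes[OF inf])
  show "disj_union ?C A (null ?C) A" for A by (simp add: forest_disj_union_def)
  show "disj_union ?C A B L \<Longrightarrow> disj_union ?C B A L" for A B L
    by (auto simp: forest_disj_union_def)
  show "\<exists>N. disj_union ?C B D N \<and> disj_union ?C A N K" if "disj_union ?C A B L" "disj_union ?C L D K" for A B D L K
    using that by (auto simp: forest_disj_union_def)
  fix A :: "'s rtree set" assume "A \<in> Obj ?C"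
  hence A: "rooted_forest A" by simp
  {
    fix B assume "B \<in> Obj ?C"
    hence B: "rooted_forest B" by simp
    show "models_digraph A G \<Longrightarrow> iso ?C A B \<longleftrightarrow> models_digraph B G" for G
      using models_digraph_iso[OF A B] by simp
    show "iso ?C A B \<Longrightarrow> card (?V A) = card (?V B)" using card_forest_iso[OF A B] by simp
    show "\<exists>B' L. B' \<in> Obj ?C \<and> iso ?C B B' \<and> disj_union ?C A B' L"
      using forest_disjoint_copy[OF inf A B] by (auto simp: forest_disj_union_iff)
    fix L assume "disj_union ?C A B L"
    hence d: "?V A \<inter> ?V B = {}" and L: "L = A \<union> B" by (simp_all add: forest_disj_union_iff)
    show "L \<in> Obj ?C" using forest_union[OF A B d] L by simp
    show "card (?V L) = card (?V A) + card (?V B)"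
      using d finite_forest_verts[OF A] finite_forest_verts[OF B] by (simp add: L digraph_of_Un card_Un_disjoint)
    show "iso ?C (null ?C) L \<Longrightarrow> iso ?C (null ?C) A" using L by simp
    show "\<exists>\<beta>. bij_betw \<beta> (Subs ?C A \<times> Subs ?C B) (Subs ?C L) \<and>
      (\<forall>S\<in>Subs ?C A. \<forall>T\<in>Subs ?C B.
         (\<exists>P. disj_union ?C (sub ?C A S) (sub ?C B T) P \<and> iso ?C P (sub ?C L (\<beta> (S, T)))) \<and>
         (\<exists>Q. disj_union ?C (quot ?C A S) (quot ?C B T) Q \<and> iso ?C Q (quot ?C L (\<beta> (S, T)))))"
      using forest_sum_subs[OF A B d] unfolding L LRF_simps(2,4) .
    fix A' B' L'
    assume "A' \<in> Obj ?C" "B' \<in> Obj ?C" "disj_union ?C A' B' L'" "iso ?C A A'" "iso ?C B B'"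
    thus "iso ?C L L'"
      using forest_iso_union[OF A _ d] by (simp add: L forest_disj_union_iff)
  }
  {
    fix S assume "S \<in> Subs ?C A"
    hence S: "S \<in> Pi\<^sub>E A admissible_cuts" by simp
    note c = cut_forests[OF A S] and sub = cut_downset_subset[OF A S] and fin = finite_forest_verts[OF A]
    have V: "?V (sub ?C A S) = cut_downset A S" "?V (quot ?C A S) = ?V A - cut_downset A S"
      using c(3,4) by simp_all
    have n: "\<not> iso ?C (null ?C) (sub ?C A S) \<longleftrightarrow> cut_downset A S \<noteq> {}"
      "\<not> iso ?C (null ?C) (quot ?C A S) \<longleftrightarrow> ?V A - cut_downset A S \<noteq> {}"
      using verts_empty_iff[OF c(1)] verts_empty_iff[OF c(2)] V by simp_all
    show "\<not> iso ?C (null ?C) (quot ?C A S) \<Longrightarrow> card (?V (sub ?C A S)) < card (?V A)"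
      unfolding n V using sub fin by (intro psubset_card_mono) auto
    show "\<not> iso ?C (null ?C) (sub ?C A S) \<Longrightarrow> card (?V (quot ?C A S)) < card (?V A)"
      unfolding n V using sub fin by (intro psubset_card_mono) auto
    show "card (?V A) \<le> card (?V (sub ?C A S)) + card (?V (quot ?C A S))"
      unfolding V using card_Un_le[of "cut_downset A S" "?V A - cut_downset A S"] sub by (simp add: Un_absorb1)
  }
  fix G assume G: "models_digraph A G"
  note finG = models_digraphD(1)[OF A G] and E = models_digraphD(2)[OF A G]
  show "\<exists>\<beta>. bij_betw \<beta> (Subs ?C A) (downsets G) \<and>
      (\<forall>S\<in>Subs ?C A. sub ?C A S \<in> Obj ?C \<and> quot ?C A S \<in> Obj ?C \<and>
        models_digraph (sub ?C A S) (induced G (\<beta> S)) \<and> models_digraph (quot ?C A S) (induced_compl G (\<beta> S)))"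
    by (rule models_digraph_subs[OF A G])
  show "finite (downsets G)"
    by (rule finite_subset[of _ "Pow (fst G)"]) (use finG in \<open>auto simp: downsets_def\<close>)
  have restrict: "snd G \<inter> fst G \<times> fst G = snd G" using E by blast
  show "{} \<in> downsets G \<and> induced_compl G {} = G"
    using restrict by (simp add: downsets_def prod_eq_iff)
  show "fst G \<in> downsets G \<and> induced G (fst G) = G"
    using restrict E by (auto simp: downsets_def prod_eq_iff)
  fix U assume U: "U \<in> downsets G"
  hence UG: "U \<subseteq> fst G" by (simp add: downsets_def)
  show "models_digraph (null ?C) (induced G U) \<longleftrightarrow> U = {}"
    by (auto simp: models_null_digraph_iff prod_eq_iff)
  show "models_digraph (null ?C) (induced_compl G U) \<longleftrightarrow> U = fst G"
    using UG by (auto simp: models_null_digraph_iff prod_eq_iff)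
  fix W
  show "W \<in> downsets (induced G U) \<Longrightarrow> W \<subseteq> U \<and> W \<in> downsets G \<and> U - W \<in> downsets (induced_compl G W)"
    using U by (auto simp: downsets_def)
  show "W \<in> downsets (induced G U) \<Longrightarrow> induced (induced G U) W = induced G W \<and>
      induced_compl (induced G U) W = induced (induced_compl G W) (U - W) \<and>
      induced_compl (induced_compl G W) (U - W) = induced_compl G U"
    using UG by (auto simp: downsets_def prod_eq_iff)
  show "W \<in> downsets (induced_compl G U) \<Longrightarrow>
      U \<inter> W = {} \<and> U \<union> W \<in> downsets G \<and> U \<in> downsets (induced G (U \<union> W))"
    using U E by (auto simp: downsets_def)
qed

theorem mainTheorem2:
  assumes "infinite (UNIV :: 's set)"
    and "infinite (UNIV :: 'v set)" and "infinite (UNIV :: 'h set)"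
  shows
    "(modules_isomorphic (prim (LRF :: 's lrf_data)) (Hall LRF) (ins LRF) (Hall LRF) (top_ins LRF) \<and>
      modules_isomorphic (prim (LRF :: 's lrf_data))
        (Hall_dual (LRF :: 's lrf_data)) (elim LRF) (Hall_dual (LRF :: 's lrf_data)) (top_elim LRF)) \<and>
     (modules_isomorphic (prim (LFG :: ('v, 'h) lfg_data)) (Hall LFG) (ins LFG) (Hall LFG) (top_ins LFG) \<and>
      modules_isomorphic (prim (LFG :: ('v, 'h) lfg_data))
        (Hall_dual (LFG :: ('v, 'h) lfg_data)) (elim LFG) (Hall_dual (LFG :: ('v, 'h) lfg_data)) (top_elim LFG))"
proof -
  interpret LRF: hall_model "LRF :: 's lrf_data" models_digraph downsets induced induced_compl fst
    "\<lambda>F. card (fst (digraph_of F))" "\<lambda>F. card (fst (digraph_of F))"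
    by (rule hall_model_LRF[OF assms(1)])
  interpret LFG: hall_model "LFG :: ('v, 'h) lfg_data" models_legs lsubs lsub lquo lnk
    "\<lambda>A. card (adj A)" "\<lambda>A. card (halves A)"
    by (rule hall_model_LFG[OF assms(2,3)])
  show ?thesis
    using LRF.ins_iso_top_ins LRF.elim_iso_top_elim LFG.ins_iso_top_ins LFG.elim_iso_top_elim by blast
qed

end
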